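(* Let $\mu\in\mathbb{C}\setminus\{0\}$ and $p=1\le\frac2d$ (that is, $d\in\{1,2\}$). Let $V$ be a (possibly complex-valued and time-dependent) potential with $V\in L^\infty_t\bigl(\mathbb{R};(L^2\cap L^{2-\varepsilon})(\mathbb{R}^d)\bigr)$ for some sufficiently small $\varepsilon>0$. Suppose that $u$ is a forward-global solution to $$i\partial_t u+\Delta u=Vu+\mu|u|u$$ on $[0,\infty)\times\mathbb{R}^d$ that admits a decomposition of the form $$u(t)=l(t)+e^{it\Delta}v_+ + r(t),\qquad \|r(t)\|_{L^2(\mathbb{R}^d)}\to0\ \text{ as }t\to\infty,$$ with $v_+\in L^2(\mathbb{R}^d)$ and $l\in L^\infty_t\bigl((0,\infty);(L^2\cap L^{2-\varepsilon})(\mathbb{R}^d)\bigr)$ for some sufficiently small $\varepsilon>0$. Assume additionally that there exists a measure $\nu\in\mathcal{M}(\mathbb{R}^d)$ that is singular with respect to Lebesgue measure and obeys $$\langle\nu,\varphi\rangle\ \ge\ \limsup_{t\to\infty}\int_{\mathbb{R}^d}t^d\bigl[|l(t,tx)|^2+|V(t,tx)|^2\bigr]\varphi(x)\,dx$$ for every nonnegative $\varphi\in C_0(\mathbb{R}^d)$. Then $v_+\equiv0$.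
   Context: Functions $u$ are complex-valued on space-time. $\mathcal{M}(\mathbb{R}^d)$ is the Banach space of complex Radon measures on $\mathbb{R}^d$ with finite total variation; $C_0(\mathbb{R}^d)$ is the space of continuous functions $f:\mathbb{R}^d\to\mathbb{C}$ with $f(x)\to0$ as $|x|\to\infty$; $\langle\nu,\varphi\rangle=\int\varphi\,d\nu$ for nonnegative $\varphi\in C_0(\mathbb{R}^d)$. $e^{it\Delta}$ is the free Schrödinger group, $e^{it\Delta}=\mathcal{F}^{-1}e^{-it|\xi|^2}\mathcal{F}$, with $\mathcal{F}f(\xi)=(2\pi)^{-d/2}\int_{\mathbb{R}^d}e^{-ix\cdot\xi}f(x)\,dx$. Notion of solution: the equation is locally well-posed in $L^2(\mathbb{R}^d)$ (by Strichartz estimates and a fixed point argument), and a forward-global solution is an $L^2$-solution in this sense that exists for all $t\ge0$. That is, $u\in C([0,\infty);L^2(\mathbb{R}^d))$, for every $0<T<\infty$ the function $u$ restricted to $(0,T)$ has finite Strichartz norm $$\|u\|_{L^\infty_tL^2_x(0,T)}+\begin{cases}\|u\|_{L^{a}_tL^{b}_x(0,T)}\text{ for any }\tfrac1a+\tfrac1b=\tfrac12,\ a>2&(d=2),\\ \|u\|_{L^4_tC_b(0,T)}&(d=1),\end{cases}$$ where $C_b$ is the space of bounded continuous functions with the sup norm, and $u$ satisfies the equation in the distribution sense: for every Schwartz function $\varphi$ on $\mathbb{R}^d$, $$i\partial_t\langle u(t),\varphi\rangle=\langle-\Delta u(t)+V(t)u(t)+\mu|u(t)|u(t),\varphi\rangle,$$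 with right-hand side locally integrable in $t$, where $\langle f,g\rangle=\int_{\mathbb{R}^d}f\,\overline{g}\,dx$ and its extensions as a duality pairing. *)

theory Defs
  imports "HOL-Probability.Essential_Supremum"
begin

section \<open>Lebesgue norms\<close>

text \<open>Real powers on the extended nonnegative reals; used with positive exponents only, where
  the power of \<open>0\<close> is \<open>0\<close> and the power of \<open>\<infinity>\<close> is \<open>\<infinity>\<close>.\<close>

definition ennpow :: "ennreal \<Rightarrow> real \<Rightarrow> ennreal" where
  "ennpow x p = (if x = top then top else ennreal (enn2real x powr p))"

definition lebesgue_norm :: "real \<Rightarrow> 'b measure \<Rightarrow> ('b \<Rightarrow> ennreal) \<Rightarrow> ennreal" where
  "lebesgue_norm p M F = ennpow (\<integral>\<^sup>+x. ennpow (F x) p \<partial>M) (1 / p)"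

definition Lp_norm :: "real \<Rightarrow> ('a::euclidean_space \<Rightarrow> complex) \<Rightarrow> ennreal" where
  "Lp_norm p f = lebesgue_norm p lborel (\<lambda>x. ennreal (norm (f x)))"

text \<open>Elements of \<open>L\<^sup>p\<close> are represented by Borel functions; equality in \<open>L\<^sup>p\<close> is
  equality almost everywhere and is always written out as such.\<close>

definition Lp :: "real \<Rightarrow> ('a::euclidean_space \<Rightarrow> complex) set" where
  "Lp p = {f \<in> borel_measurable lborel. Lp_norm p f < \<infinity>}"

text \<open>The norm of \<open>C\<^sub>b\<close> on almost-everywhere classes. The continuous representative is unique if it
  exists; otherwise the infimum is over the empty set and the value is \<open>\<infinity>\<close>.\<close>

definition Cb_norm :: "('a::euclidean_space \<Rightarrow> complex) \<Rightarrow> ennreal" where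
  "Cb_norm f = (INF g \<in> {g. continuous_on UNIV g \<and> bounded (range g) \<and> (AE x in lborel. f x = g x)}.
                  SUP x. ennreal (norm (g x)))"

text \<open>The space \<open>L\<^sup>\<infinity>\<^sub>t(I; L\<^sup>p(\<real>\<^sup>d))\<close>. Since \<open>L\<^sup>p\<close> is separable for finite \<open>p\<close>, its elements are
  exactly the classes of jointly measurable functions with essentially bounded norm.\<close>

definition Linf_Lp :: "real set \<Rightarrow> real \<Rightarrow> (real \<Rightarrow> 'a::euclidean_space \<Rightarrow> complex) set" where
  "Linf_Lp I p =
     {f. case_prod f \<in> borel_measurable (restrict_space lborel I \<Otimes>\<^sub>M lborel) \<and>
         esssup (restrict_space lborel I) (\<lambda>t. Lp_norm p (f t)) < \<infinity>}"

definition L2_pairing :: "('a::euclidean_space \<Rightarrow> complex) \<Rightarrow> ('a \<Rightarrow> complex) \<Rightarrow> complex" where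
  "L2_pairing f g = (LINT x|lborel. f x * cnj (g x))"


section \<open>Smooth functions and distributions\<close>

definition partial :: "'a::euclidean_space \<Rightarrow> ('a \<Rightarrow> 'b::real_normed_vector) \<Rightarrow> 'a \<Rightarrow> 'b" where
  "partial b f x = vector_derivative (\<lambda>s::real. f (x + s *\<^sub>R b)) (at 0)"

definition partials :: "'a::euclidean_space list \<Rightarrow> ('a \<Rightarrow> 'b::real_normed_vector) \<Rightarrow> 'a \<Rightarrow> 'b" where
  "partials bs f = foldr partial bs f"

definition smooth :: "('a::euclidean_space \<Rightarrow> 'b::real_normed_vector) \<Rightarrow> bool" where
  "smooth f \<longleftrightarrow> (\<forall>bs \<in> lists Basis. \<forall>x. partials bs f differentiable (at x))"

definition schwartz :: "('a::euclidean_space \<Rightarrow> complex) \<Rightarrow> bool" where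
  "schwartz \<phi> \<longleftrightarrow> smooth \<phi> \<and>
     (\<forall>bs \<in> lists Basis. \<forall>k::nat. bounded (range (\<lambda>x. norm x ^ k *\<^sub>R partials bs \<phi> x)))"

definition laplacian :: "('a::euclidean_space \<Rightarrow> complex) \<Rightarrow> 'a \<Rightarrow> complex" where
  "laplacian \<phi> x = (\<Sum>b\<in>Basis. partial b (partial b \<phi>) x)"

definition test_function :: "real set \<Rightarrow> (real \<Rightarrow> real) \<Rightarrow> bool" where
  "test_function S \<eta> \<longleftrightarrow>
     smooth \<eta> \<and> compact (closure {t. \<eta> t \<noteq> 0}) \<and> closure {t. \<eta> t \<noteq> 0} \<subseteq> S"

text \<open>\<open>g\<close> is the derivative of \<open>f\<close> in the sense of distributions on the open set \<open>S\<close>;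
  both functions are meant to be locally integrable on \<open>S\<close>.\<close>

definition has_distributional_derivative ::
    "real set \<Rightarrow> (real \<Rightarrow> complex) \<Rightarrow> (real \<Rightarrow> complex) \<Rightarrow> bool" where
  "has_distributional_derivative S f g \<longleftrightarrow>
     (\<forall>\<eta>. test_function S \<eta> \<longrightarrow>
        (LINT t|lborel. deriv \<eta> t *\<^sub>R f t) = - (LINT t|lborel. \<eta> t *\<^sub>R g t))"


section \<open>The Fourier transform and the free Schroedinger group\<close>

definition fourier_integral :: "('a::euclidean_space \<Rightarrow> complex) \<Rightarrow> 'a \<Rightarrow> complex" where
  "fourier_integral f \<xi> =
     of_real ((2 * pi) powr (- (real DIM('a) / 2))) * (LINT x|lborel. exp (- \<i> * of_real (x \<bullet> \<xi>)) * f x)"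

text \<open>For square-integrable \<open>f\<close> the Fourier integral need not converge. As in Plancherel's theorem,
  the transform is the \<open>L\<^sup>2\<close> limit of the transforms of the integrable truncations of \<open>f\<close> to
  balls; this determines it up to null sets.\<close>

definition fourier_L2 :: "('a::euclidean_space \<Rightarrow> complex) \<Rightarrow> 'a \<Rightarrow> complex" where
  "fourier_L2 f = (SOME g. g \<in> Lp 2 \<and>
     (\<lambda>n::nat. Lp_norm 2 (\<lambda>\<xi>. fourier_integral (\<lambda>x. indicator (cball 0 (real n)) x *\<^sub>R f x) \<xi> - g \<xi>))
       \<longlonglongrightarrow> 0)"

text \<open>\<open>e\<^sup>i\<^sup>t\<^sup>\<Delta> f\<close>, the inverse image of \<open>exp (-i t |\<xi>|\<^sup>2) (\<F> f) (\<xi>)\<close> under the (unitary)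
  transform on \<open>L\<^sup>2\<close>, again up to null sets.\<close>

definition free_schroedinger :: "real \<Rightarrow> ('a::euclidean_space \<Rightarrow> complex) \<Rightarrow> 'a \<Rightarrow> complex" where
  "free_schroedinger t f = (SOME w. w \<in> Lp 2 \<and>
     (AE \<xi> in lborel. fourier_L2 w \<xi> = exp (- \<i> * of_real (t * (norm \<xi>)\<^sup>2)) * fourier_L2 f \<xi>))"


section \<open>Forward-global solutions\<close>

definition continuous_in_L2 :: "real set \<Rightarrow> (real \<Rightarrow> 'a::euclidean_space \<Rightarrow> complex) \<Rightarrow> bool" where
  "continuous_in_L2 I u \<longleftrightarrow>
     (\<forall>t\<in>I. u t \<in> Lp 2) \<and>
     (\<forall>t\<in>I. ((\<lambda>s. Lp_norm 2 (\<lambda>x. u s x - u t x)) \<longlongrightarrow> 0) (at t within I))"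

text \<open>Only dimensions one and two are considered. In dimension two, the condition concerns all finite
  exponents \<open>a\<close>; the endpoint \<open>(a, b) = (\<infinity>, 2)\<close> is the first conjunct. For \<open>u\<close> continuous in
  \<open>L\<^sup>2\<close> the functions of time whose norms are taken here are measurable.\<close>

definition finite_strichartz_norm :: "real \<Rightarrow> (real \<Rightarrow> 'a::euclidean_space \<Rightarrow> complex) \<Rightarrow> bool" where
  "finite_strichartz_norm T u \<longleftrightarrow>
     (let J = restrict_space lborel {0<..<T} in
       esssup J (\<lambda>t. Lp_norm 2 (u t)) < \<infinity> \<and>
       (DIM('a) = 2 \<longrightarrow>
          (\<forall>a b. a > 2 \<and> 1 / a + 1 / b = 1 / 2 \<longrightarrow> lebesgue_norm a J (\<lambda>t. Lp_norm b (u t)) < \<infinity>)) \<and>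
       (DIM('a) = 1 \<longrightarrow> lebesgue_norm 4 J (\<lambda>t. Cb_norm (u t)) < \<infinity>))"

text \<open>The pairing of \<open>- \<Delta>u(t) + V(t) u(t) + \<mu> |u(t)| u(t)\<close> with \<open>\<phi>\<close>; the distributional Laplacian
  acts by transposition. The three pairings are split because \<open>u(t)\<close> is only in \<open>L\<^sup>2\<close>, while
  the other two factors are in \<open>L\<^sup>1\<close>.\<close>

definition nls_rhs :: "complex \<Rightarrow> (real \<Rightarrow> 'a::euclidean_space \<Rightarrow> complex) \<Rightarrow>
    (real \<Rightarrow> 'a \<Rightarrow> complex) \<Rightarrow> ('a \<Rightarrow> complex) \<Rightarrow> real \<Rightarrow> complex" where
  "nls_rhs \<mu> V u \<phi> t =
     - L2_pairing (u t) (laplacian \<phi>)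
     + L2_pairing (\<lambda>x. V t x * u t x) \<phi>
     + L2_pairing (\<lambda>x. \<mu> * of_real (norm (u t x)) * u t x) \<phi>"

definition forward_global_solution :: "complex \<Rightarrow> (real \<Rightarrow> 'a::euclidean_space \<Rightarrow> complex) \<Rightarrow>
    (real \<Rightarrow> 'a \<Rightarrow> complex) \<Rightarrow> bool" where
  "forward_global_solution \<mu> V u \<longleftrightarrow>
     continuous_in_L2 {0..} u \<and>
     (\<forall>T>0. finite_strichartz_norm T u) \<and>
     (\<forall>\<phi>. schwartz \<phi> \<longrightarrow>
        (\<forall>T>0. set_integrable lborel {0..T} (nls_rhs \<mu> V u \<phi>)) \<and>
        has_distributional_derivative {0<..} (\<lambda>t. \<i> * L2_pairing (u t) \<phi>) (nls_rhs \<mu> V u \<phi>))"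


section \<open>Complex Radon measures\<close>

text \<open>Every finite Borel measure on a Euclidean space is Radon, so no regularity is required.\<close>

definition total_variation :: "('a::topological_space set \<Rightarrow> complex) \<Rightarrow> 'a set \<Rightarrow> ennreal" where
  "total_variation \<nu> A =
     (SUP P \<in> {P. finite P \<and> disjoint P \<and> P \<subseteq> sets borel \<and> \<Union>P \<subseteq> A}. \<Sum>B\<in>P. ennreal (norm (\<nu> B)))"

definition complex_radon_measure :: "('a::euclidean_space set \<Rightarrow> complex) \<Rightarrow> bool" where
  "complex_radon_measure \<nu> \<longleftrightarrow>
     \<nu> {} = 0 \<and>
     (\<forall>A :: nat \<Rightarrow> 'a set. range A \<subseteq> sets borel \<longrightarrow> disjoint_family A \<longrightarrow> (\<lambda>n. \<nu> (A n)) sums \<nu> (\<Union>n. A n)) \<and>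
     total_variation \<nu> UNIV < \<infinity>"

definition lebesgue_singular :: "('a::euclidean_space set \<Rightarrow> complex) \<Rightarrow> bool" where
  "lebesgue_singular \<nu> \<longleftrightarrow> (\<exists>N \<in> null_sets lborel. total_variation \<nu> (- N) = 0)"

text \<open>The positive part in the Jordan decomposition of a real measure \<open>\<sigma>\<close>; the negative part is
  the positive part of \<open>- \<sigma>\<close>.\<close>

definition positive_part :: "('a::topological_space set \<Rightarrow> real) \<Rightarrow> 'a measure" where
  "positive_part \<sigma> = measure_of UNIV (sets borel) (\<lambda>A. SUP B \<in> {B \<in> sets borel. B \<subseteq> A}. ennreal (\<sigma> B))"

definition real_measure_integral :: "('a::topological_space set \<Rightarrow> real) \<Rightarrow> ('a \<Rightarrow> real) \<Rightarrow> real" where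
  "real_measure_integral \<sigma> \<phi> =
     (LINT x|positive_part \<sigma>. \<phi> x) - (LINT x|positive_part (\<lambda>A. - \<sigma> A). \<phi> x)"

definition measure_pairing :: "('a::topological_space set \<Rightarrow> complex) \<Rightarrow> ('a \<Rightarrow> real) \<Rightarrow> complex" where
  "measure_pairing \<nu> \<phi> =
     Complex (real_measure_integral (\<lambda>A. Re (\<nu> A)) \<phi>) (real_measure_integral (\<lambda>A. Im (\<nu> A)) \<phi>)"

definition C0 :: "('a::real_normed_vector \<Rightarrow> 'b::real_normed_vector) set" where
  "C0 = {\<phi>. continuous_on UNIV \<phi> \<and> (\<phi> \<longlongrightarrow> 0) at_infinity}"

end

theory Submission
  imports Defs "HOL-Real_Asymp.Real_Asymp" "HOL-Probability.Distributions"
begin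

text \<open>The reason is a resonance in the slowly decaying nonlinearity. Test the equation with a free wave
  \<open>W\<close> whose Fourier profile is \<open>f\<close>: the linear terms cancel, so
  \<open>\<i> \<langle>u(t), W(t)\<rangle>\<close> has time derivative \<open>\<langle>V u + \<mu>
  |u| u, W\<rangle>\<close>. Let \<open>h\<close> be the Fourier transform of \<open>v\<close>. At
  large times \<open>e\<^sup>i\<^sup>t\<^sup>\<Delta> v\<close> and \<open>W\<close> are chirps
  \<open>t\<^sup>-\<^sup>d\<^sup>/\<^sup>2 h(x/2t)\<close> and
  \<open>t\<^sup>-\<^sup>d\<^sup>/\<^sup>2 f(x/2t)\<close> with a common phase
  (\<open>free_schroedinger_profile\<close>, \<open>gauss_evolution_profile_sup\<close>), and that
  phase cancels in \<open>\<langle>|P| P, W\<rangle>\<close> for \<open>P =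
  e\<^sup>i\<^sup>t\<^sup>\<Delta> v\<close>. This pairing is therefore asymptotic to a constant
  times \<open>t\<^sup>-\<^sup>d\<^sup>/\<^sup>2 \<integral> |h| h cnj f\<close>, which is not
  integrable at infinity when \<open>d \<le> 2\<close>, whereas \<open>\<langle>u(t),
  W(t)\<rangle>\<close> stays bounded. Unless other contributions of the same size compensate it,
  the integral has to vanish (\<open>forcing_limit_le\<close>).

  The other contributions come from \<open>V\<close> and \<open>l\<close>. Young's inequality with a
  parameter \<open>\<delta>\<close> bounds them, after multiplication by
  \<open>t\<^sup>d\<^sup>/\<^sup>2\<close>, by \<open>A \<delta> sup |f| + (C/\<delta>) \<integral>
  (|V|\<^sup>2 + |l|\<^sup>2) |f(x/2t)| dx\<close>. By hypothesis the last integral is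
  asymptotically at most \<open>\<integral> |f(y/2)| dm(y)\<close>, where \<open>m\<close> is the
  positive part of the real part of \<open>\<nu>\<close>. Hence \<open>|\<integral> |h| h cnj f|
  \<le> A \<delta> sup |f| + (C/\<delta>) \<integral> |f(y/2)| dm(y)\<close> for every
  \<open>\<delta> > 0\<close>, up to the constant \<open>|\<mu>|
  2\<^sup>-\<^sup>d\<^sup>/\<^sup>2\<close> (\<open>main_estimate\<close>).

  The measure \<open>m\<close> lives on a Lebesgue null set \<open>N\<close>. Let
  \<open>f(\<cdot>/2)\<close> decrease to the indicator of a compact set \<open>K\<close> disjoint
  from \<open>N\<close>: the \<open>m\<close>-integral tends to \<open>m K = 0\<close>, and then
  \<open>\<delta> \<rightarrow> 0\<close> gives \<open>\<integral> 1\<^sub>K(2\<xi>) |h| h d\<xi> =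
  0\<close> (\<open>integral_zero_on_null_compact\<close>). Since \<open>N\<close> is null, this
  holds for enough sets \<open>K\<close> to force \<open>h = 0\<close> almost everywhere, and
  \<open>v = 0\<close> by Plancherel.

  All test profiles are finite combinations of Gaussians \<open>exp (- a |\<xi>|\<^sup>2 + p \<cdot>
  \<xi>)\<close>. Their free evolutions are explicit, their Schwartz bounds and asymptotics can be
  checked by hand, and they are uniformly dense in \<open>C\<^sub>0\<close> and dense in
  \<open>L\<^sup>2\<close>. The \<open>L\<^sup>2\<close> theory of the Fourier transform is also
  obtained from them: the isometry is an explicit computation on Gaussians, and density carries it
  over to \<open>L\<^sup>2\<close>.\<close>

section \<open>The squared \<open>L\<^sup>2\<close> norm\<close>

text \<open>The square of the \<open>L\<^sup>2\<close> norm, with values in the extended nonnegative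
  reals. Working with the square avoids roots; the price is a factor 2 in each triangle inequality,
  which is harmless because only limits and boundedness are at stake.\<close>

definition N2 :: "('a::euclidean_space \<Rightarrow> complex) \<Rightarrow> ennreal" where
  "N2 f = (\<integral>\<^sup>+x. ennreal ((norm (f x))\<^sup>2) \<partial>lborel)"

lemma Lp_norm_2: "Lp_norm 2 f = ennpow (N2 f) (1/2)"
  unfolding Lp_norm_def lebesgue_norm_def N2_def
  by (simp add: ennpow_def powr_numeral)

lemma ennpow_half_less_top: "ennpow x (1/2) < top \<longleftrightarrow> x < top"
  by (auto simp: ennpow_def less_top)

lemma Lp_2_iff: "f \<in> Lp 2 \<longleftrightarrow> f \<in> borel_measurable borel \<and> N2 f < \<infinity>"
  by (simp add: Lp_def Lp_norm_2 ennpow_half_less_top)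

lemma ennpow_half_le: assumes "ennpow x (1/2) \<le> ennreal c" "c \<ge> 0" shows "x \<le> ennreal (c\<^sup>2)"
proof (cases x)
  case (real r)
  with assms have "sqrt r \<le> c" by (simp add: ennpow_def powr_half_sqrt)
  then have "(sqrt r)\<^sup>2 \<le> c\<^sup>2" using real by (intro power_mono) auto
  then have "r \<le> c\<^sup>2" using real by simp
  with real show ?thesis by (simp add: ennreal_leI)
qed (use assms in \<open>simp add: ennpow_def top_unique\<close>)

lemma Lp_norm_2_eventually_le:
  "ennpow x (1/2) < ennreal c \<longleftrightarrow> x < ennreal (c\<^sup>2)" if "c > 0"
proof (cases x)
  case (real r)
  have "sqrt r < c \<longleftrightarrow> r < c\<^sup>2" using real that
    by (metis abs_of_pos real_sqrt_abs real_sqrt_less_iff)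
  then show ?thesis using real that by (simp add: ennpow_def powr_half_sqrt ennreal_less_iff)
qed (simp add: ennpow_def)

text \<open>Convergence to zero is tested with finite thresholds, so that real arithmetic is
  available for them.\<close>

lemma ennreal_tendsto_0_iff: "((f::_\<Rightarrow>ennreal) \<longlongrightarrow> 0) F \<longleftrightarrow> (\<forall>c>0. eventually (\<lambda>x. f x < ennreal c) F)"
proof
  assume "(f \<longlongrightarrow> 0) F" then show "\<forall>c>0. eventually (\<lambda>x. f x < ennreal c) F"
    by (auto intro: order_tendstoD)
next
  assume *: "\<forall>c>0. eventually (\<lambda>x. f x < ennreal c) F"
  show "(f \<longlongrightarrow> 0) F"
  proof (rule order_tendstoI)
    fix a :: ennreal assume "0 < a"
    then obtain c where "c > 0" "ennreal c \<le> a"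
      by (metis ennreal_ge_1 ennreal_1 ennreal_cases ennreal_less_zero_iff order.refl order.strict_iff_order top_greatest zero_less_one ennreal_0)
    with * have "eventually (\<lambda>x. f x < ennreal c) F" by blast
    then show "eventually (\<lambda>x. f x < a) F" by eventually_elim (use \<open>ennreal c \<le> a\<close> in auto)
  qed auto
qed

lemma Lp_norm_2_tendsto_0_iff:
  "((\<lambda>t. Lp_norm 2 (f t)) \<longlongrightarrow> 0) F \<longleftrightarrow> ((\<lambda>t. N2 (f t)) \<longlongrightarrow> 0) F"
proof -
  have "(\<forall>c>0. eventually (\<lambda>t. N2 (f t) < ennreal (c\<^sup>2)) F) \<longleftrightarrow> (\<forall>c>0. eventually (\<lambda>t. N2 (f t) < ennreal c) F)"
    by (metis real_sqrt_gt_zero real_sqrt_pow2 less_imp_le zero_less_power)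
  then show ?thesis unfolding ennreal_tendsto_0_iff Lp_norm_2 by (simp add: Lp_norm_2_eventually_le)
qed

lemma N2_cong_AE: "AE x in lborel. f x = g x \<Longrightarrow> N2 f = N2 g"
  unfolding N2_def by (rule nn_integral_cong_AE) auto

lemma N2_mono: "(\<And>x. norm (f x) \<le> norm (g x)) \<Longrightarrow> N2 f \<le> N2 g"
  unfolding N2_def by (intro nn_integral_mono ennreal_leI power_mono) auto

lemma N2_norm_cong: "(\<And>x. norm (f x) = norm (g x)) \<Longrightarrow> N2 f = N2 g"
  unfolding N2_def by simp

lemma N2_cnj [simp]: "N2 (\<lambda>x. cnj (f x)) = N2 f"
  by (rule N2_norm_cong) simp

lemma N2_minus_commute: "N2 (\<lambda>x. f x - g x) = N2 (\<lambda>x. g x - f x)"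
  by (rule N2_norm_cong) (simp add: norm_minus_commute)

lemma N2_zero [simp]: "N2 (\<lambda>x. 0) = 0" by (simp add: N2_def)

lemma N2_cmult: "N2 (\<lambda>x. c * f x) = ennreal ((norm c)\<^sup>2) * N2 f" if [measurable]: "f \<in> borel_measurable borel"
  unfolding N2_def by (subst nn_integral_cmult[symmetric]) (auto simp: norm_mult power_mult_distrib ennreal_mult)

lemma norm_add_sq_le: "(norm (a + b::'b::real_normed_vector))\<^sup>2 \<le> 2 * (norm a)\<^sup>2 + 2 * (norm b)\<^sup>2"
proof -
  have "(norm (a + b))\<^sup>2 \<le> (norm a + norm b)\<^sup>2" by (intro power_mono norm_triangle_ineq) auto
  also have "\<dots> \<le> 2 * (norm a)\<^sup>2 + 2 * (norm b)\<^sup>2"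
    using zero_le_power2[of "norm a - norm b"] by (simp add: power2_eq_square algebra_simps)
  finally show ?thesis .
qed

lemma N2_add: 
  assumes [measurable]: "f \<in> borel_measurable borel" "g \<in> borel_measurable borel"
  shows "N2 (\<lambda>x. f x + g x) \<le> 2 * N2 f + 2 * N2 g"
proof -
  have "N2 (\<lambda>x. f x + g x) \<le> (\<integral>\<^sup>+x. 2 * ennreal ((norm (f x))\<^sup>2) + 2 * ennreal ((norm (g x))\<^sup>2) \<partial>lborel)"
    unfolding N2_def
  proof (intro nn_integral_mono)
    fix x
    have "ennreal ((norm (f x + g x))\<^sup>2) \<le> ennreal (2 * (norm (f x))\<^sup>2 + 2 * (norm (g x))\<^sup>2)"
      by (intro ennreal_leI norm_add_sq_le)
    also have "\<dots> = 2 * ennreal ((norm (f x))\<^sup>2) + 2 * ennreal ((norm (g x))\<^sup>2)"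
      by (simp add: ennreal_mult')
    finally show "ennreal ((norm (f x + g x))\<^sup>2) \<le> 2 * ennreal ((norm (f x))\<^sup>2) + 2 * ennreal ((norm (g x))\<^sup>2)" .
  qed
  also have "\<dots> = 2 * N2 f + 2 * N2 g"
    unfolding N2_def by (subst nn_integral_add) (auto simp: nn_integral_cmult)
  finally show ?thesis .
qed

lemma N2_diff: 
  assumes [measurable]: "f \<in> borel_measurable borel" "g \<in> borel_measurable borel"
  shows "N2 (\<lambda>x. f x - g x) \<le> 2 * N2 f + 2 * N2 g"
  using N2_add[of f "\<lambda>x. - g x"] N2_norm_cong[of "\<lambda>x. - g x" g] by simp

lemma N2_diff_trans: 
  assumes [measurable]: "f \<in> borel_measurable borel" "g \<in> borel_measurable borel" "h \<in> borel_measurable borel"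
  shows "N2 (\<lambda>x. f x - h x) \<le> 2 * N2 (\<lambda>x. f x - g x) + 2 * N2 (\<lambda>x. g x - h x)"
  using N2_add[of "\<lambda>x. f x - g x" "\<lambda>x. g x - h x"] by simp

lemma N2_0_iff:
  assumes [measurable]: "f \<in> borel_measurable borel"
  shows "N2 f = 0 \<longleftrightarrow> (AE x in lborel. f x = 0)"
  unfolding N2_def by (subst nn_integral_0_iff_AE) auto

lemma Lp_2_diff: "f \<in> Lp 2 \<Longrightarrow> g \<in> Lp 2 \<Longrightarrow> (\<lambda>x. f x - g x) \<in> Lp 2"
  using N2_diff[of f g] by (auto simp: Lp_2_iff ennreal_mult_less_top intro: le_less_trans)

lemma Lp_2_cmult: "f \<in> Lp 2 \<Longrightarrow> (\<lambda>x. c * f x) \<in> Lp 2"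
  using N2_cmult[of f c] by (auto simp: Lp_2_iff ennreal_mult_less_top)

lemma borel_measurable_cnj [measurable]:
  "f \<in> borel_measurable M \<Longrightarrow> (\<lambda>x. cnj (f x)) \<in> borel_measurable M"
  by (rule measurable_compose[OF _ borel_measurable_continuous_onI]) (auto intro: continuous_intros)

lemma Lp_2_cnj: "f \<in> Lp 2 \<Longrightarrow> (\<lambda>x. cnj (f x)) \<in> Lp 2"
  by (auto simp: Lp_2_iff)

lemma Lp_2_measurable [measurable_dest]: "f \<in> Lp 2 \<Longrightarrow> f \<in> borel_measurable borel"
  by (simp add: Lp_2_iff)

lemma N2_le_liminf:
  assumes [measurable]: "\<And>n. f n \<in> borel_measurable borel"
    and "AE x in lborel. (\<lambda>n. f n x) \<longlonglongrightarrow> g x"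
  shows "N2 g \<le> liminf (\<lambda>n. N2 (f n))"
proof -
  have "N2 g \<le> (\<integral>\<^sup>+x. liminf (\<lambda>n. ennreal ((norm (f n x))\<^sup>2)) \<partial>lborel)"
    unfolding N2_def
  proof (rule nn_integral_mono_AE, use assms(2) in eventually_elim)
    case (elim x)
    then have "(\<lambda>n. ennreal ((norm (f n x))\<^sup>2)) \<longlonglongrightarrow> ennreal ((norm (g x))\<^sup>2)"
      by (intro tendsto_ennrealI tendsto_intros)
    from lim_imp_Liminf[OF _ this] show ?case by simp
  qed
  also have "\<dots> \<le> liminf (\<lambda>n. N2 (f n))"
    unfolding N2_def by (rule nn_integral_liminf) simp
  finally show ?thesis .
qed

text \<open>Completeness of \<open>L\<^sup>2\<close>, in the form needed to pass to the limit in the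
  definition of the Fourier transform. A subsequence with \<open>N2 (f\<^sub>k\<^sub>+\<^sub>1 -
  f\<^sub>k) \<le> 8\<^sup>-\<^sup>k\<close> converges almost everywhere, because
  \<open>\<Sum>\<^sub>k 4\<^sup>k |f\<^sub>k\<^sub>+\<^sub>1 - f\<^sub>k|\<^sup>2\<close> is
  integrable; Fatou's lemma identifies the limit.\<close>

lemma L2_complete:
  fixes f :: "nat \<Rightarrow> 'a::euclidean_space \<Rightarrow> complex"
  assumes f: "\<And>n. f n \<in> Lp 2"
    and cauchy: "\<And>e. e > 0 \<Longrightarrow> \<exists>M. \<forall>m\<ge>M. \<forall>n\<ge>M. N2 (\<lambda>x. f m x - f n x) < ennreal e"
  obtains g where "g \<in> Lp 2" "(\<lambda>n. N2 (\<lambda>x. f n x - g x)) \<longlonglongrightarrow> 0"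
proof -
  have [measurable]: "f n \<in> borel_measurable borel" for n using f by (simp add: Lp_2_iff)
  obtain M where M: "\<And>k::nat. \<forall>m\<ge>M k. \<forall>n\<ge>M k. N2 (\<lambda>x. f m x - f n x) < ennreal ((1/8)^k)"
    using cauchy[of "(1/8)^k" for k] by (metis zero_less_divide_1_iff zero_less_numeral zero_less_power)
  \<comment> \<open>The summand \<open>k\<close> makes the indices tend to infinity; the sum
    dominates each \<open>M j\<close>.\<close>
  define r where "r k = (\<Sum>j\<le>k. M j) + k" for k
  have rM: "r k \<ge> M k" for k using member_le_sum[of k "{..k}" M] by (simp add: r_def)
  have rS: "r (Suc k) \<ge> M k" for k using member_le_sum[of k "{..Suc k}" M] by (simp add: r_def del: sum.atMost_Suc)
  have rk: "r k \<ge> k" for k by (simp add: r_def)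
  define d where "d k x = f (r (Suc k)) x - f (r k) x" for k x
  have [measurable]: "d k \<in> borel_measurable borel" for k unfolding d_def by measurable
  have dN: "N2 (d k) \<le> ennreal ((1/8)^k)" for k
    unfolding d_def using M[of k] rM rS by (simp add: less_imp_le)
  have "(\<integral>\<^sup>+x. (\<Sum>k. ennreal (4^k * (norm (d k x))\<^sup>2)) \<partial>lborel) = (\<Sum>k. ennreal (4^k) * N2 (d k))"
    by (subst nn_integral_suminf) (auto simp: N2_def nn_integral_cmult ennreal_mult)
  also have "\<dots> \<le> (\<Sum>k. ennreal ((1/2)^k))"
  proof (intro suminf_le)
    fix k
    have "ennreal (4^k) * N2 (d k) \<le> ennreal (4^k) * ennreal ((1/8)^k)" by (intro mult_left_mono dN) auto
    also have "\<dots> = ennreal ((4 * (1/8))^k)" by (subst power_mult_distrib) (simp add: ennreal_mult)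
    finally show "ennreal (4^k) * N2 (d k) \<le> ennreal ((1/2)^k)" by simp
  qed auto
  also have "\<dots> = ennreal (\<Sum>k. (1/2)^k)" by (rule suminf_ennreal2) auto
  finally have "(\<integral>\<^sup>+x. (\<Sum>k. ennreal (4^k * (norm (d k x))\<^sup>2)) \<partial>lborel) < \<infinity>"
    by (simp add: le_less_trans)
  then have "AE x in lborel. (\<Sum>k. ennreal (4^k * (norm (d k x))\<^sup>2)) \<noteq> \<infinity>"
    by (intro nn_integral_noteq_infinite) auto
  then have conv: "AE x in lborel. convergent (\<lambda>k. f (r k) x)"
  proof eventually_elim
    case (elim x)
    then have s: "summable (\<lambda>k. 4^k * (norm (d k x))\<^sup>2)"
      by (intro summable_suminf_not_top) auto
    then obtain B where B: "\<And>k. norm (4^k * (norm (d k x))\<^sup>2) \<le> B"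
      using summable_imp_bounded[OF s] by (auto simp: bounded_iff)
    have "summable (\<lambda>k. d k x)"
    proof (rule summable_comparison_test'[where N=0])
      show "summable (\<lambda>k. sqrt B * (1/2)^k)" by (intro summable_mult summable_geometric) simp
      fix k :: nat
      have "(2^k * norm (d k x))\<^sup>2 \<le> B" using B[of k]
        by (simp add: power_mult_distrib power2_eq_square[of "2^k"] flip: power_mult_distrib[of 2 2])
      then have "2^k * norm (d k x) \<le> sqrt B" by (rule real_le_rsqrt)
      then show "norm (d k x) \<le> sqrt B * (1/2)^k" by (simp add: field_simps)
    qed
    then have "convergent (\<lambda>n. \<Sum>k<n. d k x)" by (simp add: summable_iff_convergent)
    moreover have "(\<Sum>k<n. d k x) = f (r n) x - f (r 0) x" for n
      unfolding d_def by (rule sum_lessThan_telescope)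
    ultimately have "convergent (\<lambda>n. (f (r n) x - f (r 0) x) + f (r 0) x)"
      by (intro convergent_add convergent_const) simp
    then show ?case by simp
  qed
  define g where "g x = lim (\<lambda>k. f (r k) x)" for x
  have [measurable]: "g \<in> borel_measurable borel" unfolding g_def by measurable
  have lim: "AE x in lborel. (\<lambda>k. f (r k) x) \<longlonglongrightarrow> g x"
    using conv by eventually_elim (simp add: g_def convergent_LIMSEQ_iff)
  have bound: "\<exists>M. \<forall>n\<ge>M. N2 (\<lambda>x. f n x - g x) \<le> ennreal e" if "e > 0" for e
  proof -
    obtain M where M: "\<And>m n. m \<ge> M \<Longrightarrow> n \<ge> M \<Longrightarrow> N2 (\<lambda>x. f m x - f n x) < ennreal e"
      using cauchy[OF \<open>e > 0\<close>] by blast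
    have "N2 (\<lambda>x. f n x - g x) \<le> ennreal e" if n: "n \<ge> M" for n
    proof -
      have "N2 (\<lambda>x. f n x - g x) \<le> liminf (\<lambda>k. N2 (\<lambda>x. f n x - f (r k) x))"
        by (rule N2_le_liminf) (use lim in \<open>auto elim!: eventually_mono intro!: tendsto_intros\<close>)
      also have "\<dots> \<le> ennreal e"
      proof (rule Liminf_le)
        show "\<forall>\<^sub>F k in sequentially. N2 (\<lambda>x. f n x - f (r k) x) \<le> ennreal e"
          using M[OF n order.trans[OF _ rk]]
          by (auto simp: eventually_sequentially intro!: exI[of _ M] less_imp_le)
      qed auto
      finally show ?thesis .
    qed
    then show ?thesis by blast
  qed
  show ?thesis
  proof (rule that[of g])
    obtain M where "N2 (\<lambda>x. f M x - g x) \<le> ennreal 1" using bound[of 1] by auto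
    then have "N2 (\<lambda>x. f M x - g x) < \<infinity>" by (rule le_less_trans) simp
    then have "(\<lambda>x. f M x - g x) \<in> Lp 2" by (simp add: Lp_2_iff)
    from Lp_2_diff[OF f[of M] this] show "g \<in> Lp 2" by simp
    show "(\<lambda>n. N2 (\<lambda>x. f n x - g x)) \<longlonglongrightarrow> 0"
      unfolding ennreal_tendsto_0_iff
    proof safe
      fix c :: real assume "c > 0"
      with bound[of "c/2"] obtain M where "\<forall>n\<ge>M. N2 (\<lambda>x. f n x - g x) \<le> ennreal (c/2)" by auto
      then show "\<forall>\<^sub>F n in sequentially. N2 (\<lambda>x. f n x - g x) < ennreal c"
        using \<open>c > 0\<close> by (auto simp: eventually_sequentially intro!: exI[of _ M] le_less_trans[of _ "ennreal (c/2)"] ennreal_lessI)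
    qed
  qed
qed

lemma N2_integrable: "f \<in> Lp 2 \<Longrightarrow> integrable lborel (\<lambda>x. (norm (f x))\<^sup>2)"
  by (intro integrableI_bounded) (auto simp: Lp_2_iff N2_def)

lemma N2_eq_integral: "f \<in> Lp 2 \<Longrightarrow> N2 f = ennreal (LINT x|lborel. (norm (f x))\<^sup>2)"
  unfolding N2_def by (intro nn_integral_eq_integral N2_integrable) auto

lemma young_ineq: assumes "\<delta> > 0" shows "a * b \<le> (\<delta> * a\<^sup>2 + b\<^sup>2 / \<delta>) / (2::real)"
proof -
  have "0 \<le> (sqrt \<delta> * a - b / sqrt \<delta>)\<^sup>2" by simp
  also have "\<dots> = \<delta> * a\<^sup>2 + b\<^sup>2 / \<delta> - 2 * a * b"
    using assms by (simp add: power2_diff power_mult_distrib power_divide real_sqrt_pow2)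
  finally show ?thesis by simp
qed

lemma L2_mult_integrable:
  fixes f g :: "'a::euclidean_space \<Rightarrow> complex"
  assumes "f \<in> Lp 2" "g \<in> Lp 2"
  shows "integrable lborel (\<lambda>x. f x * g x)"
proof (rule Bochner_Integration.integrable_bound)
  show "integrable lborel (\<lambda>x. (norm (f x))\<^sup>2 + (norm (g x))\<^sup>2)"
    using assms by (intro Bochner_Integration.integrable_add N2_integrable)
  have "norm (f x * g x) \<le> (norm (f x))\<^sup>2 + (norm (g x))\<^sup>2" for x
    using young_ineq[of 1 "norm (f x)" "norm (g x)"] by (simp add: norm_mult) (smt (verit) zero_le_power2)
  then show "AE x in lborel. norm (f x * g x) \<le> norm ((norm (f x))\<^sup>2 + (norm (g x))\<^sup>2)"
    by (intro AE_I2) (simp add: abs_of_nonneg)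
  have [measurable]: "f \<in> borel_measurable borel" "g \<in> borel_measurable borel" using assms by (auto simp: Lp_2_iff)
  show "(\<lambda>x. f x * g x) \<in> borel_measurable lborel" by measurable
qed

lemma L2_pairing_integrable:
  "f \<in> Lp 2 \<Longrightarrow> g \<in> Lp 2 \<Longrightarrow> integrable lborel (\<lambda>x. f x * cnj (g x))"
  by (intro L2_mult_integrable Lp_2_cnj)

text \<open>The Cauchy--Schwarz inequality in additive form; a suitable \<open>\<delta>\<close>
  replaces the product of norms.\<close>

lemma L2_pairing_bound:
  assumes "f \<in> Lp 2" "g \<in> Lp 2" "\<delta> > 0"
  shows "norm (L2_pairing f g) \<le> (\<delta> * enn2real (N2 f) + enn2real (N2 g) / \<delta>) / 2"
proof -
  have "norm (L2_pairing f g) \<le> (LINT x|lborel. norm (f x * cnj (g x)))"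
    unfolding L2_pairing_def by (rule integral_norm_bound)
  also have "\<dots> \<le> (LINT x|lborel. (\<delta> * (norm (f x))\<^sup>2 + (norm (g x))\<^sup>2 / \<delta>) / 2)"
  proof (intro integral_mono integrable_norm L2_pairing_integrable assms)
    show "integrable lborel (\<lambda>x. (\<delta> * (norm (f x))\<^sup>2 + (norm (g x))\<^sup>2 / \<delta>) / 2)"
      by (intro integrable_divide Bochner_Integration.integrable_add integrable_mult_right N2_integrable assms)
    show "norm (f x * cnj (g x)) \<le> (\<delta> * (norm (f x))\<^sup>2 + (norm (g x))\<^sup>2 / \<delta>) / 2" for x
      using young_ineq[OF assms(3)] by (simp add: norm_mult del: times_divide_eq_right)
  qed
  also have "\<dots> = (\<delta> * enn2real (N2 f) + enn2real (N2 g) / \<delta>) / 2"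
    using assms by (simp add: N2_eq_integral N2_integrable)
  finally show ?thesis .
qed

lemma L2_pairing_tendsto:
  assumes f: "\<And>n. f n \<in> Lp 2" "g \<in> Lp 2" "h \<in> Lp 2" and lim: "((\<lambda>n. N2 (\<lambda>x. f n x - g x)) \<longlongrightarrow> 0) F"
  shows "((\<lambda>n. L2_pairing (f n) h) \<longlongrightarrow> L2_pairing g h) F"
proof (rule tendstoI)
  fix e :: real assume e: "e > 0"
  define H where "H = enn2real (N2 h)"
  have H: "H \<ge> 0" by (simp add: H_def)
  define d where "d = (H + 1) / e"
  have d: "d > 0" using H e by (simp add: d_def)
  have "\<forall>\<^sub>F n in F. N2 (\<lambda>x. f n x - g x) < ennreal (e / d)"
    using lim d e by (simp add: ennreal_tendsto_0_iff)
  then show "\<forall>\<^sub>F n in F. dist (L2_pairing (f n) h) (L2_pairing g h) < e"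
  proof eventually_elim
    case (elim n)
    have "L2_pairing (f n) h - L2_pairing g h = L2_pairing (\<lambda>x. f n x - g x) h"
      unfolding L2_pairing_def
      by (simp add: left_diff_distrib Bochner_Integration.integral_diff L2_pairing_integrable f)
    moreover have "norm (L2_pairing (\<lambda>x. f n x - g x) h) \<le> (d * enn2real (N2 (\<lambda>x. f n x - g x)) + H / d) / 2"
      unfolding H_def by (intro L2_pairing_bound Lp_2_diff f d)
    moreover have "enn2real (N2 (\<lambda>x. f n x - g x)) \<le> e / d"
      using elim d e by (intro enn2real_leI) auto
    then have "d * enn2real (N2 (\<lambda>x. f n x - g x)) \<le> e" using d by (simp add: field_simps)
    moreover have "H / d < e" using H e by (simp add: d_def field_simps)
    ultimately show ?case by (simp add: dist_norm)
  qed
qed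

section \<open>Differentiation under the integral and Gaussian integrals\<close>

lemma has_vector_derivative_iff_quotient:
  fixes g :: "real \<Rightarrow> 'b::real_normed_vector"
  shows "(g has_vector_derivative v) (at s) \<longleftrightarrow> ((\<lambda>t. (1 / (t - s)) *\<^sub>R (g t - g s)) \<longlongrightarrow> v) (at s)"
proof -
  have "(g has_vector_derivative v) (at s) \<longleftrightarrow> ((\<lambda>t. norm ((g t - g s) - (t - s) *\<^sub>R v) / norm (t - s)) \<longlongrightarrow> 0) (at s)"
    unfolding has_vector_derivative_def has_derivative_iff_norm by (simp add: bounded_linear_scaleR_left)
  also have "\<dots> \<longleftrightarrow> ((\<lambda>t. norm ((1 / (t - s)) *\<^sub>R (g t - g s) - v)) \<longlongrightarrow> 0) (at s)"
  proof (rule tendsto_cong, unfold eventually_at_filter, intro always_eventually allI impI)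
    fix t assume "t \<noteq> s"
    have "(1 / (t - s)) *\<^sub>R (g t - g s) - v = (1 / (t - s)) *\<^sub>R ((g t - g s) - (t - s) *\<^sub>R v)"
      using \<open>t \<noteq> s\<close> by (simp add: scaleR_diff_right)
    then show "norm ((g t - g s) - (t - s) *\<^sub>R v) / norm (t - s) = norm ((1 / (t - s)) *\<^sub>R (g t - g s) - v)"
      by (simp only: norm_scaleR) (simp add: divide_inverse mult.commute)
  qed
  also have "\<dots> \<longleftrightarrow> ((\<lambda>t. (1 / (t - s)) *\<^sub>R (g t - g s)) \<longlongrightarrow> v) (at s)"
    by (simp add: tendsto_norm_zero_iff LIM_zero_iff)
  finally show ?thesis .
qed

lemma has_vector_derivative_lipschitz:
  fixes g :: "real \<Rightarrow> 'b::real_normed_vector"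
  assumes "convex S" "\<And>s. s \<in> S \<Longrightarrow> (g has_vector_derivative g' s) (at s)"
    "\<And>s. s \<in> S \<Longrightarrow> norm (g' s) \<le> C" "s \<in> S" "t \<in> S"
  shows "norm (g s - g t) \<le> C * \<bar>s - t\<bar>"
proof -
  have "norm (g s - g t) \<le> C * norm (s - t)"
  proof (rule differentiable_bound[OF assms(1) _ _ assms(4,5)])
    show "(g has_derivative (\<lambda>h. h *\<^sub>R g' u)) (at u within S)" if "u \<in> S" for u
      using assms(2)[OF that] by (simp add: has_vector_derivative_def has_derivative_at_withinI)
    show "onorm (\<lambda>h. h *\<^sub>R g' u) \<le> C" if "u \<in> S" for u
      using assms(3)[OF that] order_trans[OF norm_ge_zero assms(3)[OF that]]
      by (intro onorm_le) (simp add: mult.commute[of C] mult_left_mono)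
  qed
  then show ?thesis by simp
qed

text \<open>The difference quotients are dominated by \<open>D\<close> because of the mean value
  inequality, so that dominated convergence applies along sequences.\<close>

lemma has_vector_derivative_integral_dominated:
  fixes f :: "real \<Rightarrow> 'b \<Rightarrow> complex"
  assumes S: "open S" "convex S" "s0 \<in> S"
    and int: "\<And>s. s \<in> S \<Longrightarrow> integrable M (f s)"
    and der: "\<And>s x. s \<in> S \<Longrightarrow> ((\<lambda>s. f s x) has_vector_derivative f' s x) (at s)"
    and dom: "\<And>s x. s \<in> S \<Longrightarrow> norm (f' s x) \<le> D x"
    and D: "integrable M D"
  shows "((\<lambda>s. LINT x|M. f s x) has_vector_derivative (LINT x|M. f' s0 x)) (at s0)"
    and "integrable M (f' s0)"
proof -
  have lip: "norm (f s x - f s0 x) \<le> D x * \<bar>s - s0\<bar>" if "s \<in> S" for s x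
    by (rule has_vector_derivative_lipschitz[OF S(2) der dom that S(3)])
  define q where "q s x = (1 / (s - s0)) *\<^sub>R (f s x - f s0 x)" for s x
  have q_lim: "((\<lambda>s. q s x) \<longlongrightarrow> f' s0 x) (at s0)" for x
    using der[OF S(3), of x] unfolding has_vector_derivative_iff_quotient q_def .
  have q_int: "integrable M (q s)" if "s \<in> S" for s
    unfolding q_def using int that S(3) by (intro integrable_scaleR_right Bochner_Integration.integrable_diff) auto
  have q_bd: "norm (q s x) \<le> D x" if "s \<in> S" "s \<noteq> s0" for s x
    using lip[OF that(1), of x] that(2) by (simp add: q_def divide_simps)
  have inS: "\<forall>\<^sub>F s in at s0. s \<in> S \<and> s \<noteq> s0"
    unfolding eventually_at_filter
    using eventually_nhds_in_open[OF S(1,3)] by eventually_elim simp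
  have main: "integrable M (f' s0) \<and> (\<lambda>n. LINT x|M. q (X n) x) \<longlonglongrightarrow> (LINT x|M. f' s0 x)"
    if X: "\<And>n. X n \<in> S" "\<And>n. X n \<noteq> s0" "X \<longlonglongrightarrow> s0" for X :: "nat \<Rightarrow> real"
  proof
    have X0: "filterlim X (at s0) sequentially" unfolding filterlim_at using X by simp
    have lim: "AE x in M. (\<lambda>n. q (X n) x) \<longlonglongrightarrow> f' s0 x"
      using filterlim_compose[OF q_lim X0] by auto
    have m: "\<And>n. q (X n) \<in> borel_measurable M" by (rule borel_measurable_integrable[OF q_int[OF X(1)]])
    have m': "f' s0 \<in> borel_measurable M"
      by (rule borel_measurable_LIMSEQ_metric[OF m]) (rule filterlim_compose[OF q_lim X0])
    show "integrable M (f' s0)"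
      by (rule integrable_dominated_convergence[OF m' m D lim]) (use q_bd X in auto)
    show "(\<lambda>n. LINT x|M. q (X n) x) \<longlonglongrightarrow> (LINT x|M. f' s0 x)"
      by (rule integral_dominated_convergence[OF m' m D lim]) (use q_bd X in auto)
  qed
  have lim: "((\<lambda>s. LINT x|M. q s x) \<longlongrightarrow> (LINT x|M. f' s0 x)) (at s0)"
    unfolding tendsto_at_iff_sequentially comp_def
  proof (intro allI impI)
    fix X :: "nat \<Rightarrow> real" assume X: "\<forall>i. X i \<in> UNIV - {s0}" "X \<longlonglongrightarrow> s0"
    have "\<forall>\<^sub>F n in sequentially. X n \<in> S" by (rule topological_tendstoD[OF X(2) S(1) S(3)])
    then obtain N where N: "\<And>n. n \<ge> N \<Longrightarrow> X n \<in> S" by (auto simp: eventually_sequentially)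
    have "(\<lambda>n. LINT x|M. q (X (n + N)) x) \<longlonglongrightarrow> (LINT x|M. f' s0 x)"
      using X N by (intro main[THEN conjunct2] LIMSEQ_ignore_initial_segment) auto
    then show "(\<lambda>n. LINT x|M. q (X n) x) \<longlonglongrightarrow> (LINT x|M. f' s0 x)"
      by (rule LIMSEQ_offset)
  qed
  show "((\<lambda>s. LINT x|M. f s x) has_vector_derivative (LINT x|M. f' s0 x)) (at s0)"
    unfolding has_vector_derivative_iff_quotient
  proof (rule Lim_transform_eventually[OF lim], use inS in eventually_elim)
    case (elim s)
    then show ?case unfolding q_def using int S(3) by (simp add: Bochner_Integration.integral_diff)
  qed
  obtain e where e: "e > 0" "\<And>s. dist s s0 < e \<Longrightarrow> s \<in> S" using S unfolding open_dist by blast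
  have "(\<lambda>n. s0 + (e/2) * (1 / real (Suc n))) \<longlonglongrightarrow> s0 + (e/2) * 0"
    using LIMSEQ_inverse_real_of_nat by (intro tendsto_intros) (simp add: inverse_eq_divide)
  then show "integrable M (f' s0)"
  proof (intro main[THEN conjunct1, of "\<lambda>n. s0 + (e/2) * (1 / real (Suc n))"])
    fix n
    have "(e/2) * (1 / real (Suc n)) \<le> (e/2) * 1" using e(1) by (intro mult_left_mono) auto
    then have "(e/2) * (1 / real (Suc n)) < e" using e(1) by linarith
    then show "s0 + (e/2) * (1 / real (Suc n)) \<in> S" using e(1) by (intro e(2)) (simp add: dist_norm)
    show "s0 + (e/2) * (1 / real (Suc n)) \<noteq> s0" using e(1) by simp
  qed simp
qed

lemma integrable_gaussian_moment:
  assumes "c > 0" shows "integrable lborel (\<lambda>x::real. \<bar>x\<bar> ^ k * exp (- c * x\<^sup>2))"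
proof -
  define \<sigma> where "\<sigma> = 1 / sqrt (2 * c)"
  have \<sigma>: "\<sigma> > 0" "\<sigma>\<^sup>2 = 1 / (2 * c)" using assms by (auto simp: \<sigma>_def power_divide)
  have "integrable lborel (\<lambda>x. sqrt (2 * pi * \<sigma>\<^sup>2) * (normal_density 0 \<sigma> x * \<bar>x - 0\<bar>^k))"
    by (intro integrable_mult_right integrable_normal_moment_abs \<sigma>)
  also have "(\<lambda>x. sqrt (2 * pi * \<sigma>\<^sup>2) * (normal_density 0 \<sigma> x * \<bar>x - 0\<bar>^k)) = (\<lambda>x. \<bar>x\<bar> ^ k * exp (- c * x\<^sup>2))"
    using \<sigma> assms by (auto simp: normal_density_def)
  finally show ?thesis .
qed

lemma integral_gaussian_real: "(LINT x|lborel. exp (- x\<^sup>2 :: real)) = sqrt pi"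
proof -
  have "normal_density 0 (1 / sqrt 2) x = exp (- x\<^sup>2) / sqrt pi" for x
    by (simp add: normal_density_def power_divide)
  with integral_normal_density[of "1 / sqrt 2" 0] show ?thesis by simp
qed

text \<open>Integration by parts on the line without boundary terms; it yields the moment identities
  for Gaussians below.\<close>

lemma integral_derivative_eq_0:
  fixes F :: "real \<Rightarrow> complex"
  assumes F: "\<And>x. (F has_vector_derivative f x) (at x)" and f: "continuous_on UNIV f" "integrable lborel f"
    and lim: "(F \<longlongrightarrow> 0) at_top" "(F \<longlongrightarrow> 0) at_bot"
  shows "(LINT x|lborel. f x) = 0"
proof -
  have "(LBINT x=-\<infinity>..\<infinity>. f x) = 0 - 0"
  proof (rule interval_integral_FTC_integrable)
    show "((F \<circ> real_of_ereal) \<longlongrightarrow> 0) (at_right (-\<infinity>))" "((F \<circ> real_of_ereal) \<longlongrightarrow> 0) (at_left \<infinity>)"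
      using lim by (simp_all add: ereal_tendsto_simps)
  qed (use F f in \<open>auto simp: set_integrable_def continuous_on_eq_continuous_at\<close>)
  then show ?thesis by (simp add: interval_lebesgue_integral_def set_lebesgue_integral_def)
qed

lemma gaussian_exponent_le:
  assumes "c > 0" shows "- c * x\<^sup>2 + b * x \<le> b\<^sup>2 / (2 * c) + (- (c / 2) * x\<^sup>2 :: real)"
proof -
  have "0 \<le> (sqrt (c/2) * x - b / sqrt (2 * c))\<^sup>2" by simp
  also have "\<dots> = c / 2 * x\<^sup>2 + b\<^sup>2 / (2 * c) - b * x"
    using assms by (simp add: power2_diff power_mult_distrib power_divide real_sqrt_divide real_sqrt_mult)
  finally show ?thesis by (simp add: algebra_simps)
qed

lemma gaussian_tendsto_0:
  assumes "Re \<alpha> > 0"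
  shows "((\<lambda>x. of_real x ^ k * exp (- \<alpha> * of_real (x\<^sup>2) + \<beta> * of_real x)) \<longlongrightarrow> 0) at_top"
    and "((\<lambda>x. of_real x ^ k * exp (- \<alpha> * of_real (x\<^sup>2) + \<beta> * of_real x)) \<longlongrightarrow> 0) at_bot"
proof -
  define a where "a = Re \<alpha>" 
  define b where "b = Re \<beta>" 
  have a: "a > 0" using assms by (simp add: a_def)
  have n: "norm (of_real x ^ k * exp (- \<alpha> * of_real (x\<^sup>2) + \<beta> * of_real x)) = \<bar>x\<bar>^k * exp (- a * x\<^sup>2 + b * x)" for x
    by (simp add: norm_mult norm_power a_def b_def)
  have "((\<lambda>x. \<bar>x\<bar>^k * exp (- a * x\<^sup>2 + b * x)) \<longlongrightarrow> 0) at_top" 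
    using a by real_asymp
  then show "((\<lambda>x. of_real x ^ k * exp (- \<alpha> * of_real (x\<^sup>2) + \<beta> * of_real x)) \<longlongrightarrow> 0) at_top"
    by (subst tendsto_norm_zero_iff[symmetric], subst n)
  have "((\<lambda>x. \<bar>x\<bar>^k * exp (- a * x\<^sup>2 + b * x)) \<longlongrightarrow> 0) at_bot" 
    using a by real_asymp
  then show "((\<lambda>x. of_real x ^ k * exp (- \<alpha> * of_real (x\<^sup>2) + \<beta> * of_real x)) \<longlongrightarrow> 0) at_bot"
    by (subst tendsto_norm_zero_iff[symmetric], subst n)
qed

lemma integrable_gaussian_complex:
  assumes "Re \<alpha> > 0"
  shows "integrable lborel (\<lambda>x. of_real x ^ k * exp (- \<alpha> * of_real (x\<^sup>2) + \<beta> * of_real x))"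
proof (rule Bochner_Integration.integrable_bound)
  define a where "a = Re \<alpha>" 
  define b where "b = Re \<beta>" 
  have a: "a > 0" using assms by (simp add: a_def)
  show "integrable lborel (\<lambda>x. exp (b\<^sup>2 / (2 * a)) * (\<bar>x\<bar>^k * exp (- (a/2) * x\<^sup>2)))"
    using a by (intro integrable_mult_right integrable_gaussian_moment) auto
  have "\<bar>x\<bar>^k * exp (- a * x\<^sup>2 + b * x) \<le> \<bar>x\<bar>^k * (exp (b\<^sup>2 / (2 * a)) * exp (- (a/2) * x\<^sup>2))" for x
    using gaussian_exponent_le[OF a, of x b] by (intro mult_left_mono) (auto simp flip: exp_add)
  then show "AE x in lborel. norm (of_real x ^ k * exp (- \<alpha> * of_real (x\<^sup>2) + \<beta> * of_real x))
    \<le> norm (exp (b\<^sup>2 / (2 * a)) * (\<bar>x\<bar>^k * exp (- (a/2) * x\<^sup>2)))"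
    by (intro AE_I2) (simp add: norm_mult norm_power a_def b_def mult_ac)
  show "(\<lambda>x. of_real x ^ k * exp (- \<alpha> * of_real (x\<^sup>2) + \<beta> * of_real x)) \<in> borel_measurable lborel" by measurable
qed

text \<open>The Gaussian integral with complex parameters, without contour integration. Join the
  known integral of \<open>exp (- x\<^sup>2)\<close> to the given one by the segment \<open>A s = 1
  + s (\<alpha> - 1)\<close> in the right half plane, with linear coefficient \<open>s
  \<beta>\<close>. Two integrations by parts express the first and second moments through the
  integral \<open>J s\<close>, and so \<open>J s sqrt (A s) exp (- (s \<beta>)\<^sup>2 / (4 A
  s))\<close> has derivative zero.\<close>

lemma gaussian_integral_complex:
  assumes \<alpha>: "Re \<alpha> > 0"
  shows "(LINT x|lborel. exp (- \<alpha> * of_real (x\<^sup>2) + \<beta> * of_real x)) = of_real (sqrt pi) / csqrt \<alpha> * exp (\<beta>\<^sup>2 / (4 * \<alpha>))"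
proof -
  define A where "A s = 1 + of_real s * (\<alpha> - 1)" for s :: real
  define f where "f s x = exp (- A s * of_real (x\<^sup>2) + (of_real s * \<beta>) * of_real x)" for s x :: real
  define f' where "f' s x = (- (\<alpha> - 1) * of_real (x\<^sup>2) + \<beta> * of_real x) * f s x" for s x :: real
  define m where "m = min 1 (Re \<alpha>) / 2"
  have m: "m > 0" using \<alpha> by (simp add: m_def)
  \<comment> \<open>An open convex set around the segment on which the real part of the width stays
    above \<open>m > 0\<close>.\<close>
  define S where "S = {-1<..<2::real} \<inter> {s. Re (A s) > m}"
  have ReA: "Re (A s) = 1 + s * (Re \<alpha> - 1)" for s by (simp add: A_def)
  have S_open: "open S" unfolding S_def ReA by (intro open_Int open_Collect_less continuous_intros open_greaterThanLessThan)
  have "{s. Re (A s) > m} = {s. (Re \<alpha> - 1) \<bullet> s > m - 1}" unfolding ReA by (auto simp: algebra_simps)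
  then have S_convex: "convex S" unfolding S_def
    by (simp only:) (intro convex_Int convex_halfspace_gt convex_real_interval)
  have S01: "{0..1} \<subseteq> S"
  proof
    fix s :: real assume s: "s \<in> {0..1}"
    have "2 * m \<le> (1 - s) * (2 * m) + s * (2 * m)" by (simp add: algebra_simps)
    also have "\<dots> \<le> (1 - s) * 1 + s * Re \<alpha>" using s by (intro add_mono mult_left_mono) (auto simp: m_def)
    finally have "m < Re (A s)" unfolding ReA using m by (simp add: algebra_simps)
    then show "s \<in> S" using s by (simp add: S_def)
  qed
  have RA: "Re (A s) > 0" if "s \<in> S" for s using that m by (auto simp: S_def)
  define J where "J s = (LINT x|lborel. f s x)" for s
  define M1 where "M1 s = (LINT x|lborel. of_real x * f s x)" for s
  define M2 where "M2 s = (LINT x|lborel. of_real (x\<^sup>2) * f s x)" for s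
  have i0: "integrable lborel (f s)" if "s \<in> S" for s
    using integrable_gaussian_complex[OF RA[OF that], of 0] by (simp add: f_def[abs_def])
  have i1: "integrable lborel (\<lambda>x. of_real x * f s x)" if "s \<in> S" for s
    using integrable_gaussian_complex[OF RA[OF that], of 1] by (simp add: f_def[abs_def])
  have i2: "integrable lborel (\<lambda>x. of_real (x\<^sup>2) * f s x)" if "s \<in> S" for s
    using integrable_gaussian_complex[OF RA[OF that], of 2] by (simp add: f_def[abs_def])
  have derJ: "(J has_vector_derivative (LINT x|lborel. f' s x)) (at s)" if "s \<in> S" for s
    unfolding J_def
  proof (rule has_vector_derivative_integral_dominated(1)[OF S_open S_convex that i0])
    define B where "B = 2 * \<bar>Re \<beta>\<bar>"
    define D where "D x = norm (\<alpha> - 1) * exp (B\<^sup>2 / (2 * m)) * (\<bar>x\<bar>^2 * exp (- (m / 2) * x\<^sup>2))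
       + norm \<beta> * exp (B\<^sup>2 / (2 * m)) * (\<bar>x\<bar>^1 * exp (- (m / 2) * x\<^sup>2))" for x :: real
    show "((\<lambda>s. f s x) has_vector_derivative f' s x) (at s)" for s x
    proof -
      have "((\<lambda>z. exp (- (1 + z * (\<alpha> - 1)) * of_real (x\<^sup>2) + (z * \<beta>) * of_real x)) has_field_derivative f' s x) (at (of_real s))"
        unfolding f_def f'_def A_def by (rule derivative_eq_intros refl)+ (simp add: algebra_simps)
      from has_vector_derivative_real_field[OF this] show ?thesis by (simp add: f_def[abs_def] A_def)
    qed
    show "norm (f' s x) \<le> D x" if "s \<in> S" for s x
    proof -
      have "\<bar>s * Re \<beta> * x\<bar> \<le> B * \<bar>x\<bar>"
        using that unfolding abs_mult B_def S_def by (intro mult_right_mono) auto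
      moreover have "m * x\<^sup>2 \<le> Re (A s) * x\<^sup>2" using that unfolding S_def by (intro mult_right_mono) auto
      ultimately have "- Re (A s) * x\<^sup>2 + s * Re \<beta> * x \<le> - m * \<bar>x\<bar>\<^sup>2 + B * \<bar>x\<bar>" by (simp add: abs_le_iff)
      also have "\<dots> \<le> B\<^sup>2 / (2 * m) + (- (m / 2) * \<bar>x\<bar>\<^sup>2)" by (rule gaussian_exponent_le[OF m])
      finally have "norm (f s x) \<le> exp (B\<^sup>2 / (2 * m)) * exp (- (m / 2) * x\<^sup>2)"
        by (simp add: f_def flip: exp_add)
      moreover have "norm (- (\<alpha> - 1) * of_real (x\<^sup>2) + \<beta> * of_real x) \<le> norm (\<alpha> - 1) * \<bar>x\<bar>^2 + norm \<beta> * \<bar>x\<bar>^1"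
        by (rule norm_triangle_le) (simp add: norm_mult norm_power norm_minus_commute del: of_real_power)
      ultimately have "norm (f' s x) \<le> (norm (\<alpha> - 1) * \<bar>x\<bar>^2 + norm \<beta> * \<bar>x\<bar>^1) * (exp (B\<^sup>2 / (2 * m)) * exp (- (m / 2) * x\<^sup>2))"
        unfolding f'_def norm_mult by (intro mult_mono) auto
      also have "\<dots> = D x" unfolding D_def by algebra
      finally show ?thesis .
    qed
    show "integrable lborel D" unfolding D_def[abs_def]
      using m by (intro Bochner_Integration.integrable_add integrable_mult_right integrable_gaussian_moment) auto
  qed
  have derJ': "(LINT x|lborel. f' s x) = - (\<alpha> - 1) * M2 s + \<beta> * M1 s" if "s \<in> S" for s
  proof -
    have "(LINT x|lborel. f' s x) = (LINT x|lborel. - (\<alpha> - 1) * (of_real (x\<^sup>2) * f s x) + \<beta> * (of_real x * f s x))"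
      unfolding f'_def by (simp only: distrib_right mult.assoc)
    then show ?thesis unfolding M1_def M2_def
      using i1[OF that] i2[OF that] by (simp del: of_real_power)
  qed
  have der_f: "((\<lambda>x. f s x) has_vector_derivative (- 2 * A s * of_real x + of_real s * \<beta>) * f s x) (at x)" for s x
  proof -
    have "((\<lambda>z. exp (- A s * z\<^sup>2 + (of_real s * \<beta>) * z)) has_field_derivative (- 2 * A s * of_real x + of_real s * \<beta>) * f s x) (at (of_real x))"
      unfolding f_def by (rule derivative_eq_intros refl)+ (simp add: algebra_simps)
    from has_vector_derivative_real_field[OF this] show ?thesis by (simp add: f_def[abs_def])
  qed
  have cf: "continuous_on UNIV (f s)" for s unfolding f_def by (intro continuous_intros)
  have e1: "- 2 * A s * M1 s + of_real s * \<beta> * J s = 0" if s: "s \<in> S" for s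
  proof -
    have "(LINT x|lborel. - 2 * A s * (of_real x * f s x) + of_real s * \<beta> * f s x) = 0"
    proof (rule integral_derivative_eq_0)
      show "((\<lambda>x. f s x) has_vector_derivative - 2 * A s * (of_real x * f s x) + of_real s * \<beta> * f s x) (at x)" for x
        using der_f[of s x] by (simp add: algebra_simps)
      show "(f s \<longlongrightarrow> 0) at_top" "(f s \<longlongrightarrow> 0) at_bot"
        using gaussian_tendsto_0[OF RA[OF s], of 0] by (simp_all add: f_def[abs_def])
    qed (intro continuous_intros cf Bochner_Integration.integrable_add integrable_mult_right i0 i1 s)+
    then show ?thesis unfolding M1_def J_def using i0[OF s] i1[OF s] by simp
  qed
  have e2: "J s - 2 * A s * M2 s + of_real s * \<beta> * M1 s = 0" if s: "s \<in> S" for s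
  proof -
    have "(LINT x|lborel. f s x + (- 2 * A s * (of_real (x\<^sup>2) * f s x) + of_real s * \<beta> * (of_real x * f s x))) = 0"
    proof (rule integral_derivative_eq_0)
      show "((\<lambda>x. of_real x * f s x) has_vector_derivative f s x + (- 2 * A s * (of_real (x\<^sup>2) * f s x) + of_real s * \<beta> * (of_real x * f s x))) (at x)" for x
        by (rule has_vector_derivative_eq_rhs[OF has_vector_derivative_mult[OF has_vector_derivative_of_real[OF DERIV_ident] der_f]])
           (simp add: algebra_simps power2_eq_square)
      show "((\<lambda>x. of_real x * f s x) \<longlongrightarrow> 0) at_top" "((\<lambda>x. of_real x * f s x) \<longlongrightarrow> 0) at_bot"
        using gaussian_tendsto_0[OF RA[OF s], of 1] by (simp_all add: f_def[abs_def])
    qed (intro continuous_intros cf Bochner_Integration.integrable_add integrable_mult_right i0 i1 i2 s)+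
    then have "J s + (- 2 * A s * M2 s + of_real s * \<beta> * M1 s) = 0"
      unfolding M1_def M2_def J_def using i0[OF s] i1[OF s] i2[OF s] by (simp del: of_real_power)
    then show ?thesis by (simp add: algebra_simps)
  qed
  have An: "A s \<notin> \<real>\<^sub>\<le>\<^sub>0" "A s \<noteq> 0" if "s \<in> S" for s using RA[OF that] by (auto elim!: nonpos_Reals_cases)
  define E where "E s = - (of_real s * \<beta>)\<^sup>2 / (4 * A s)" for s :: real
  define G where "G s = J s * csqrt (A s) * exp (E s)" for s
  have "\<exists>c. \<forall>s\<in>{0..1}. G s = c"
  proof (rule has_vector_derivative_zero_constant)
    fix s :: real assume "s \<in> {0..1}"
    then have s: "s \<in> S" using S01 by auto
    note an = An[OF s]
    have dA: "(A has_vector_derivative (\<alpha> - 1)) (at s)"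
    proof -
      have "((\<lambda>z. 1 + z * (\<alpha> - 1)) has_field_derivative (\<alpha> - 1)) (at (of_real s))"
        by (rule derivative_eq_intros refl)+ simp
      from has_vector_derivative_real_field[OF this] show ?thesis by (simp add: A_def[abs_def])
    qed
    have dC: "((\<lambda>s. csqrt (A s)) has_vector_derivative (\<alpha> - 1) * (inverse (2 * csqrt (A s)))) (at s)"
      using field_vector_diff_chain_at[OF dA has_field_derivative_csqrt[OF an(1)]] by (simp add: o_def)
    have dE: "(E has_vector_derivative (- 2 * of_real s * \<beta>\<^sup>2 * A s + (of_real s * \<beta>)\<^sup>2 * (\<alpha> - 1)) / (4 * (A s)\<^sup>2)) (at s)"
    proof -
      have "((\<lambda>z. - (z * \<beta>)\<^sup>2 / (4 * (1 + z * (\<alpha> - 1)))) has_field_derivative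
          (- 2 * of_real s * \<beta>\<^sup>2 * A s + (of_real s * \<beta>)\<^sup>2 * (\<alpha> - 1)) / (4 * (A s)\<^sup>2)) (at (of_real s))"
        apply (rule derivative_eq_intros refl)+
        subgoal using an(2) unfolding A_def by (metis mult_eq_0_iff zero_neq_numeral)
        using an(2) unfolding A_def[symmetric]
        by (simp add: divide_simps) (simp add: algebra_simps power2_eq_square A_def)
      from has_vector_derivative_real_field[OF this] show ?thesis by (simp add: E_def[abs_def] A_def)
    qed
    have dX: "((\<lambda>s. exp (E s)) has_vector_derivative 
        ((- 2 * of_real s * \<beta>\<^sup>2 * A s + (of_real s * \<beta>)\<^sup>2 * (\<alpha> - 1)) / (4 * (A s)\<^sup>2)) * exp (E s)) (at s)"
      using field_vector_diff_chain_at[OF dE DERIV_exp] by (simp add: o_def)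
    have m1: "M1 s = of_real s * \<beta> * J s / (2 * A s)" using e1[OF s] an by (simp add: field_simps)
    have m2: "M2 s = (J s + of_real s * \<beta> * M1 s) / (2 * A s)" using e2[OF s] an by (simp add: field_simps)
    have c2: "csqrt (A s) \<noteq> 0" "csqrt (A s) * csqrt (A s) = A s" using an(2) by (auto simp flip: power2_eq_square)
    define c where "c = csqrt (A s)"
    have c: "c \<noteq> 0" "A s = c * c" using c2 by (auto simp: c_def)
    have "(G has_vector_derivative 0) (at s)"
      unfolding G_def
      apply (rule has_vector_derivative_eq_rhs)
       apply (rule has_vector_derivative_mult[OF has_vector_derivative_mult[OF derJ[OF s] dC] dX])
      apply (unfold derJ'[OF s] m2 m1 c_def[symmetric])
      using c(1) unfolding c(2)
      by (simp add: divide_simps power2_eq_square) (simp add: algebra_simps)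
    then show "(G has_vector_derivative 0) (at s within {0..1})" by (rule has_vector_derivative_at_within)
  qed auto
  then have "G 1 = G 0" by auto
  moreover have "G 0 = of_real (sqrt pi)"
  proof -
    have "J 0 = (LINT x|lborel. of_real (exp (- x\<^sup>2)))" by (simp add: J_def f_def A_def exp_of_real[symmetric])
    also have "\<dots> = of_real (sqrt pi)" by (simp only: integral_complex_of_real integral_gaussian_real)
    finally show ?thesis by (simp add: G_def A_def E_def)
  qed
  ultimately have "J 1 * csqrt \<alpha> * exp (- \<beta>\<^sup>2 / (4 * \<alpha>)) = of_real (sqrt pi)" by (simp add: G_def A_def E_def)
  moreover have "csqrt \<alpha> \<noteq> 0" using \<alpha> by auto
  ultimately have "J 1 = of_real (sqrt pi) / csqrt \<alpha> * exp (\<beta>\<^sup>2 / (4 * \<alpha>))"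
    by (simp add: field_simps exp_minus)
  then show ?thesis by (simp add: J_def f_def A_def)
qed

lemma
  fixes f :: "'a::euclidean_space \<Rightarrow> real \<Rightarrow> complex"
  assumes f: "\<And>b. b \<in> Basis \<Longrightarrow> integrable lborel (f b)"
  shows integrable_lborel_Prod: "integrable lborel (\<lambda>x::'a. \<Prod>b\<in>Basis. f b (x \<bullet> b))"
    and integral_lborel_Prod: "(LINT x|lborel. (\<Prod>b\<in>(Basis::'a set). f b (x \<bullet> b))) = (\<Prod>b\<in>Basis. (LINT x|lborel. f b x))"
proof -
  interpret P: product_sigma_finite "\<lambda>_::'a. lborel :: real measure" ..
  have [measurable]: "f b \<in> borel_measurable borel" if "b \<in> Basis" for b
    using f[OF that] by (auto dest: borel_measurable_integrable)
  have m: "(\<lambda>f. \<Sum>b\<in>Basis. f b *\<^sub>R b) \<in> measurable (\<Pi>\<^sub>M b\<in>(Basis::'a set). lborel) borel" by measurable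
  have m2: "(\<lambda>x::'a. \<Prod>b\<in>Basis. f b (x \<bullet> b)) \<in> borel_measurable borel" by measurable
  show "integrable lborel (\<lambda>x::'a. \<Prod>b\<in>Basis. f b (x \<bullet> b))"
    by (subst lborel_eq, subst integrable_distr_eq[OF m m2]) (use P.product_integrable_prod[OF finite_Basis f] in simp)
  show "(LINT x|lborel. (\<Prod>b\<in>(Basis::'a set). f b (x \<bullet> b))) = (\<Prod>b\<in>Basis. (LINT x|lborel. f b x))"
    by (subst lborel_eq, subst integral_distr[OF m m2]) (use P.product_integral_prod[OF finite_Basis f] in simp)
qed

text \<open>The linear part of the exponent is complex, but \<open>'a\<close> is a real space;
  \<open>p\<close> and \<open>q\<close> are its real and imaginary parts.\<close>

definition cgauss :: "complex \<Rightarrow> 'a::euclidean_space \<Rightarrow> 'a \<Rightarrow> 'a \<Rightarrow> complex" where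
  "cgauss \<alpha> p q x = exp (- \<alpha> * of_real (x \<bullet> x) + of_real (p \<bullet> x) + \<i> * of_real (q \<bullet> x))"

lemma cgauss_eq_prod:
  "cgauss \<alpha> p q x = (\<Prod>b\<in>Basis. exp (- \<alpha> * of_real ((x \<bullet> b)\<^sup>2) + (of_real (p \<bullet> b) + \<i> * of_real (q \<bullet> b)) * of_real (x \<bullet> b)))"
proof -
  have "- \<alpha> * of_real (x \<bullet> x) + of_real (p \<bullet> x) + \<i> * of_real (q \<bullet> x)
    = (\<Sum>b\<in>Basis. - \<alpha> * of_real ((x \<bullet> b)\<^sup>2) + (of_real (p \<bullet> b) + \<i> * of_real (q \<bullet> b)) * of_real (x \<bullet> b))"
    unfolding euclidean_inner[of x x] euclidean_inner[of p x] euclidean_inner[of q x] of_real_sum sum_distrib_left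
      sum.distrib[symmetric] by (intro sum.cong refl) (simp add: algebra_simps power2_eq_square)
  then show ?thesis unfolding cgauss_def by (simp only: exp_sum[OF finite_Basis])
qed

lemma integrable_cgauss:
  assumes "Re \<alpha> > 0" shows "integrable lborel (cgauss \<alpha> p q)"
  unfolding cgauss_eq_prod[abs_def]
  using integrable_gaussian_complex[OF assms, of 0] by (intro integrable_lborel_Prod) simp

lemma integral_cgauss:
  fixes p q :: "'a::euclidean_space"
  assumes "Re \<alpha> > 0"
  shows "(LINT x|lborel. cgauss \<alpha> p q x) = (of_real (sqrt pi) / csqrt \<alpha>) ^ DIM('a)
    * exp ((of_real (p \<bullet> p - q \<bullet> q) + 2 * \<i> * of_real (p \<bullet> q)) / (4 * \<alpha>))"
proof -
  define \<beta> where "\<beta> b = of_real (p \<bullet> b) + \<i> * of_real (q \<bullet> b)" for b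
  have "(LINT x|lborel. cgauss \<alpha> p q x) = (\<Prod>b\<in>Basis. of_real (sqrt pi) / csqrt \<alpha> * exp ((\<beta> b)\<^sup>2 / (4 * \<alpha>)))"
  proof -
    have "(LINT x|lborel. cgauss \<alpha> p q x)
      = (\<Prod>b\<in>Basis. (LINT x|lborel. exp (- \<alpha> * of_real (x\<^sup>2) + \<beta> b * of_real x)))"
      unfolding cgauss_eq_prod \<beta>_def[symmetric] using integrable_gaussian_complex[OF assms, of 0]
      by (intro integral_lborel_Prod) simp
    then show ?thesis by (simp only: gaussian_integral_complex[OF assms])
  qed
  also have "\<dots> = (of_real (sqrt pi) / csqrt \<alpha>) ^ DIM('a) * exp (\<Sum>b\<in>Basis. (\<beta> b)\<^sup>2 / (4 * \<alpha>))"
    by (simp only: prod.distrib prod_constant exp_sum[OF finite_Basis])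
  also have "(\<Sum>b\<in>Basis. (\<beta> b)\<^sup>2 / (4 * \<alpha>)) = (\<Sum>b\<in>Basis. (\<beta> b)\<^sup>2) / (4 * \<alpha>)"
    by (simp add: sum_divide_distrib)
  also have "(\<Sum>b\<in>Basis. (\<beta> b)\<^sup>2) = of_real (p \<bullet> p - q \<bullet> q) + 2 * \<i> * of_real (p \<bullet> q)"
    unfolding euclidean_inner[of p p] euclidean_inner[of q q] euclidean_inner[of p q] of_real_diff of_real_sum sum_distrib_left
      sum.distrib[symmetric] sum_subtractf[symmetric] \<beta>_def
    by (intro sum.cong refl) (simp add: algebra_simps power2_eq_square)
  finally show ?thesis .
qed

section \<open>Density of Gaussians among continuous functions\<close>

text \<open>An inductive predicate instead of a linear span, so that properties of combinations of
  Gaussians follow by rule induction.\<close>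

inductive gauss_span :: "('a::euclidean_space \<Rightarrow> real) \<Rightarrow> bool" where
  gauss: "a > 0 \<Longrightarrow> gauss_span (\<lambda>x. exp (- a * (x \<bullet> x) + p \<bullet> x))"
| add: "gauss_span f \<Longrightarrow> gauss_span g \<Longrightarrow> gauss_span (\<lambda>x. f x + g x)"
| scale: "gauss_span f \<Longrightarrow> gauss_span (\<lambda>x. c * f x)"

lemma gauss_le:
  assumes "a > 0"
  shows "exp (- a * (x \<bullet> x) + p \<bullet> x) \<le> exp ((norm p)\<^sup>2 / (2 * a)) * exp (- (a / 2) * (x \<bullet> x))"
proof -
  have "p \<bullet> x \<le> norm p * norm x" by (rule norm_cauchy_schwarz)
  with gaussian_exponent_le[OF assms, of "norm x" "norm p"] show ?thesis
    by (simp add: dot_square_norm flip: exp_add)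
qed

lemma gauss_tendsto_0:
  assumes "a > 0"
  shows "((\<lambda>x::'a::euclidean_space. exp (- a * (x \<bullet> x))) \<longlongrightarrow> 0) at_infinity"
proof (rule filterlim_compose[OF exp_at_bot])
  have "filterlim (\<lambda>x::'a. a * (norm x * norm x)) at_top at_infinity"
    using assms by (intro filterlim_tendsto_pos_mult_at_top[OF tendsto_const] filterlim_at_top_mult_at_top filterlim_norm_at_top) auto
  then show "filterlim (\<lambda>x::'a. - a * (x \<bullet> x)) at_bot at_infinity"
    by (simp add: filterlim_uminus_at_bot dot_square_norm power2_eq_square)
qed

lemma gauss_span_continuous: "gauss_span f \<Longrightarrow> continuous_on UNIV f"
  by (induction rule: gauss_span.induct) (auto intro!: continuous_intros)

lemma gauss_span_vanishes: "gauss_span f \<Longrightarrow> (f \<longlongrightarrow> 0) at_infinity"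
proof (induction rule: gauss_span.induct)
  case (gauss a p)
  have "((\<lambda>x::'a. exp ((norm p)\<^sup>2 / (2 * a)) * exp (- (a / 2) * (x \<bullet> x))) \<longlongrightarrow> 0) at_infinity"
    using gauss by (intro tendsto_mult_right_zero gauss_tendsto_0) auto
  then show ?case
    by (rule Lim_null_comparison[rotated], intro always_eventually allI)
      (use gauss_le[OF gauss, of _ p] in \<open>simp add: real_norm_def\<close>)
qed (auto intro!: tendsto_add_zero tendsto_mult_right_zero)

text \<open>A product of two Gaussians is a Gaussian: the span is an algebra, as the
  Stone--Weierstrass theorem demands.\<close>

lemma gauss_span_mult: "gauss_span f \<Longrightarrow> gauss_span g \<Longrightarrow> gauss_span (\<lambda>x. f x * g x)"
proof (induction arbitrary: g rule: gauss_span.induct)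
  case (gauss a p)
  note a = \<open>a > 0\<close>
  from \<open>gauss_span g\<close> show ?case
  proof (induction rule: gauss_span.induct)
    case (gauss b q)
    have "gauss_span (\<lambda>x. exp (- (a + b) * (x \<bullet> x) + (p + q) \<bullet> x))" using a gauss by (intro gauss_span.gauss) auto
    moreover have "exp (- (a + b) * (x \<bullet> x) + (p + q) \<bullet> x) = exp (- a * (x \<bullet> x) + p \<bullet> x) * exp (- b * (x \<bullet> x) + q \<bullet> x)" for x
      unfolding exp_add[symmetric] by (simp add: algebra_simps)
    ultimately show ?case by simp
  next
    case (add f g)
    from gauss_span.add[OF add.IH] show ?case by (simp add: algebra_simps)
  next
    case (scale f c)
    from gauss_span.scale[OF scale.IH, of c] show ?case by (simp add: mult_ac)
  qed
next
  case (add f h)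
  from gauss_span.add[OF add.IH(1)[OF add.prems] add.IH(2)[OF add.prems]] show ?case by (simp add: algebra_simps)
next
  case (scale f c)
  from gauss_span.scale[OF scale.IH[OF scale.prems], of c] show ?case by (simp add: mult_ac)
qed

lemma gauss_span_separates:
  assumes "x \<noteq> y" obtains g where "gauss_span g" "g x > 0" "g x \<noteq> g (y::'a::euclidean_space)"
proof
  \<comment> \<open>A Gaussian centred at \<open>x\<close> takes its maximum only there.\<close>
  show "gauss_span (\<lambda>w. exp (- 1 * (w \<bullet> w) + (2 *\<^sub>R x) \<bullet> w))" by (intro gauss_span.gauss) auto
  have "(x - y) \<bullet> (x - y) > 0" using assms by simp
  then show "exp (- 1 * (x \<bullet> x) + (2 *\<^sub>R x) \<bullet> x) \<noteq> exp (- 1 * (y \<bullet> y) + (2 *\<^sub>R x) \<bullet> y)"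
    by (simp add: inner_diff_left inner_diff_right inner_commute)
qed simp

text \<open>Stereographic projection from the pole \<open>(0, 1)\<close>. It identifies the unit
  sphere of \<open>'a \<times> real\<close> with the one-point compactification of
  \<open>'a\<close>.\<close>

definition stereo :: "'a::euclidean_space \<times> real \<Rightarrow> 'a" where
  "stereo z = (1 / (1 - snd z)) *\<^sub>R fst z"

text \<open>The value at the pole is the limit at infinity.\<close>

definition stereo_extend :: "('a::euclidean_space \<Rightarrow> real) \<Rightarrow> 'a \<times> real \<Rightarrow> real" where
  "stereo_extend g z = (if snd z = 1 then 0 else g (stereo z))"

lemma sphere_prodD: 
  assumes "z \<in> sphere (0::'a::euclidean_space \<times> real) 1" 
  shows "(norm (fst z))\<^sup>2 = 1 - (snd z)\<^sup>2" "\<bar>snd z\<bar> \<le> 1"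
proof -
  have "norm z = 1" using assms by simp
  then have n: "(norm (fst z))\<^sup>2 + (snd z)\<^sup>2 = 1" by (simp add: norm_prod_def)
  then show "(norm (fst z))\<^sup>2 = 1 - (snd z)\<^sup>2" by simp
  have "(snd z)\<^sup>2 \<le> 1" using n zero_le_power2[of "norm (fst z)"] by linarith
  then show "\<bar>snd z\<bar> \<le> 1" by (simp add: abs_square_le_1)
qed

lemma norm_stereo:
  assumes "z \<in> sphere (0::'a::euclidean_space \<times> real) 1" "snd z \<noteq> 1"
  shows "(norm (stereo z))\<^sup>2 = (1 + snd z) / (1 - snd z)"
proof -
  have "(norm (stereo z))\<^sup>2 = (norm (fst z))\<^sup>2 / (1 - snd z)\<^sup>2"
    by (simp add: stereo_def power_divide)
  also have "\<dots> = ((1 + snd z) * (1 - snd z)) / ((1 - snd z) * (1 - snd z))"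
    unfolding sphere_prodD[OF assms(1)] by (simp add: power2_eq_square algebra_simps)
  finally show ?thesis using assms(2) by simp
qed

lemma stereo_inj:
  assumes "z \<in> sphere (0::'a::euclidean_space \<times> real) 1" "snd z \<noteq> 1"
    "w \<in> sphere 0 1" "snd w \<noteq> 1" "stereo z = stereo w"
  shows "z = w"
proof -
  have "(1 + snd z) / (1 - snd z) = (1 + snd w) / (1 - snd w)" using norm_stereo assms by metis
  then have s: "snd z = snd w" using assms(2,4) by (simp add: field_simps)
  moreover have "fst z = fst w" using assms(2,5) s by (simp add: stereo_def)
  ultimately show ?thesis by (simp add: prod_eq_iff)
qed

lemma stereo_surj:
  obtains z where "z \<in> sphere (0::'a::euclidean_space \<times> real) 1" "snd z \<noteq> 1" "stereo z = x"
proof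
  define n where "n = 1 + (norm x)\<^sup>2"
  have n: "n > 0" "(norm x)\<^sup>2 = n - 1" unfolding n_def by (auto simp: add_pos_nonneg)
  \<comment> \<open>The inverse of the stereographic projection.\<close>
  let ?z = "((2 / n) *\<^sub>R x, (n - 2) / n)"
  have n1: "n \<ge> 1" by (simp add: n_def)
  have "(norm ?z)\<^sup>2 = (norm ((2 / n) *\<^sub>R x))\<^sup>2 + (norm ((n - 2) / n))\<^sup>2"
    unfolding norm_Pair by (rule real_sqrt_pow2) simp
  also have "\<dots> = (2 / n)\<^sup>2 * (n - 1) + ((n - 2) / n)\<^sup>2"
    by (simp add: power_mult_distrib power_divide n(2))
  also have "\<dots> = 1" using n by (simp add: field_simps power2_eq_square)
  finally have "norm ?z = 1" by (metis abs_norm_cancel abs_square_eq_1)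
  then show "?z \<in> sphere 0 1" by simp
  show "snd ?z \<noteq> 1" using n by simp
  show "stereo ?z = x" using n by (simp add: stereo_def field_simps)
qed

lemma continuous_stereo_extend:
  fixes g :: "'a::euclidean_space \<Rightarrow> real"
  assumes g: "continuous_on UNIV g" "(g \<longlongrightarrow> 0) at_infinity"
  shows "continuous_on (sphere 0 1) (stereo_extend g)"
  unfolding continuous_on_eq_continuous_within
proof
  fix z :: "'a \<times> real" assume z: "z \<in> sphere 0 1"
  show "continuous (at z within sphere 0 1) (stereo_extend g)"
  proof (cases "snd z = 1")
    case False
    have o: "open {z::'a \<times> real. snd z \<noteq> 1}" by (intro open_Collect_neq continuous_intros)
    have "continuous_on {z::'a \<times> real. snd z \<noteq> 1} (\<lambda>z. g (stereo z))"
      unfolding stereo_def by (intro continuous_on_compose2[OF g(1)] continuous_intros) auto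
    then have "continuous_on {z::'a \<times> real. snd z \<noteq> 1} (stereo_extend g)"
      by (rule continuous_on_eq) (simp add: stereo_extend_def)
    then have "continuous (at z) (stereo_extend g)"
      using continuous_on_eq_continuous_at[OF o, of "stereo_extend g"] False by blast
    then show ?thesis by (rule continuous_at_imp_continuous_at_within)
  next
    case True
    have "\<exists>d>0. \<forall>x'\<in>sphere 0 1. dist x' z < d \<longrightarrow> dist (stereo_extend g x') (stereo_extend g z) < e" if e: "e > 0" for e
    proof -
      obtain B where B: "\<And>x. norm x \<ge> B \<Longrightarrow> \<bar>g x\<bar> < e"
        using tendstoD[OF g(2) e] by (auto simp: eventually_at_infinity)
      define d where "d = 1 / (B\<^sup>2 + 1)"
      have d: "d > 0" "d \<le> 1" by (auto simp: d_def add_nonneg_pos)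
      have "\<bar>stereo_extend g x'\<bar> < e" if x': "x' \<in> sphere 0 1" "dist x' z < d" for x'
      proof (cases "snd x' = 1")
        case f: False
        have "\<bar>snd x' - snd z\<bar> \<le> dist x' z" using dist_snd_le[of x' z] by (simp add: dist_real_def)
        then have s: "1 - snd x' < d" "0 < 1 - snd x'" using x' True f sphere_prodD(2)[OF x'(1)] by auto
        have "B\<^sup>2 + 1 = 1 / d" by (simp add: d_def)
        also have "\<dots> \<le> (1 + snd x') / (1 - snd x')" using s d by (intro frac_le) auto
        also have "\<dots> = (norm (stereo x'))\<^sup>2" using norm_stereo[OF x'(1) f] by simp
        finally have "B\<^sup>2 \<le> (norm (stereo x'))\<^sup>2" by simp
        then have "B \<le> norm (stereo x')" by (rule power2_le_imp_le) simp
        then show ?thesis using B f by (simp add: stereo_extend_def)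
      qed (use e in \<open>simp add: stereo_extend_def\<close>)
      then show ?thesis using d True by (intro exI[of _ d]) (simp add: stereo_extend_def)
    qed
    then show ?thesis unfolding continuous_within_eps_delta by blast
  qed
qed

text \<open>Stone--Weierstrass for \<open>C\<^sub>0\<close>. On the compact sphere the functions
  \<open>c + g\<close>, with \<open>g\<close> the transport of a combination of Gaussians, form a
  point-separating algebra containing the constants. At the pole both \<open>\<phi>\<close> and
  \<open>g\<close> vanish, so the constant of a good approximation is small and may be
  discarded.\<close>

lemma gauss_span_dense_C0:
  fixes \<phi> :: "'a::euclidean_space \<Rightarrow> real"
  assumes \<phi>: "continuous_on UNIV \<phi>" "(\<phi> \<longlongrightarrow> 0) at_infinity" and e: "e > 0"
  obtains g where "gauss_span g" "\<And>x. \<bar>\<phi> x - g x\<bar> < e"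
proof -
  define P where "P F \<longleftrightarrow> (\<exists>c g. gauss_span g \<and> F = (\<lambda>z. c + stereo_extend g z))" for F :: "'a \<times> real \<Rightarrow> real"
  have g0: "gauss_span (\<lambda>x::'a. 0 * exp (- 1 * (x \<bullet> x) + 0 \<bullet> x))" by (intro gauss_span.intros) auto
  have "\<exists>F. P F \<and> (\<forall>z\<in>sphere 0 1. \<bar>stereo_extend \<phi> z - F z\<bar> < e / 2)"
  proof (rule Stone_Weierstrass_HOL[where S = "sphere (0::'a \<times> real) 1" and P = P])
    show "P (\<lambda>x. c)" for c using g0 unfolding P_def by (intro exI conjI) (auto simp: stereo_extend_def)
    show "continuous_on (sphere 0 1) F" if F: "P F" for F
    proof -
      obtain c g where "gauss_span g" "F = (\<lambda>z. c + stereo_extend g z)" using F by (auto simp: P_def)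
      then show ?thesis
        by (auto intro!: continuous_intros continuous_stereo_extend gauss_span_continuous gauss_span_vanishes)
    qed
    show "P (\<lambda>z. F z + G z)" if FG: "P F \<and> P G" for F G
    proof -
      obtain c g where 1: "gauss_span g" "F = (\<lambda>z. c + stereo_extend g z)" using FG by (auto simp: P_def)
      obtain d h where 2: "gauss_span h" "G = (\<lambda>z. d + stereo_extend h z)" using FG by (auto simp: P_def)
      show ?thesis unfolding P_def
        by (rule exI[of _ "c + d"], rule exI[of _ "\<lambda>x. g x + h x"])
           (use 1 2 in \<open>auto simp: stereo_extend_def fun_eq_iff intro: gauss_span.intros\<close>)
    qed
    show "P (\<lambda>z. F z * G z)" if FG: "P F \<and> P G" for F G
    proof -
      obtain c g where 1: "gauss_span g" "F = (\<lambda>z. c + stereo_extend g z)" using FG by (auto simp: P_def)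
      obtain d h where 2: "gauss_span h" "G = (\<lambda>z. d + stereo_extend h z)" using FG by (auto simp: P_def)
      show ?thesis unfolding P_def
        by (rule exI[of _ "c * d"], rule exI[of _ "\<lambda>x. (c * h x + d * g x) + g x * h x"])
           (use 1 2 in \<open>auto simp: stereo_extend_def fun_eq_iff algebra_simps intro!: gauss_span.add gauss_span.scale gauss_span_mult\<close>)
    qed
    show "\<exists>F. P F \<and> F z \<noteq> F w" if zw: "z \<in> sphere 0 1 \<and> w \<in> sphere 0 1 \<and> z \<noteq> w" for z w
    proof -
      have *: "\<exists>g. gauss_span g \<and> stereo_extend g z \<noteq> stereo_extend g w"
        if "z \<in> sphere 0 1" "w \<in> sphere 0 1" "z \<noteq> w" "snd z \<noteq> 1" for z w :: "'a \<times> real"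
      proof (cases "snd w = 1")
        case True
        show ?thesis
          by (rule exI[of _ "\<lambda>x. exp (- 1 * (x \<bullet> x) + 0 \<bullet> x)"]) 
             (use True that in \<open>auto simp: stereo_extend_def intro: gauss_span.gauss[of 1 0, simplified]\<close>)
      next
        case False
        then have "stereo z \<noteq> stereo w" using stereo_inj that by blast
        then obtain g where "gauss_span g" "g (stereo z) \<noteq> g (stereo w)" by (rule gauss_span_separates)
        then show ?thesis using False that by (intro exI[of _ g]) (auto simp: stereo_extend_def)
      qed
      have "snd z \<noteq> 1 \<or> snd w \<noteq> 1"
      proof (rule ccontr)
        assume "\<not> ?thesis"
        then have "fst z = 0" "fst w = 0" "snd z = snd w" using sphere_prodD(1)[of z] sphere_prodD(1)[of w] zw by auto
        then show False using zw by (simp add: prod_eq_iff)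
      qed
      then obtain g where g: "gauss_span g" "stereo_extend g z \<noteq> stereo_extend g w" using *[of z w] *[of w z] zw by fastforce
      then show ?thesis by (intro exI[of _ "\<lambda>z. 0 + stereo_extend g z"]) (unfold P_def, intro conjI exI[of _ 0] exI[of _ g], auto)
    qed
  qed (use e in \<open>auto intro: continuous_stereo_extend \<phi>\<close>)
  then obtain c g where g: "gauss_span g" and ap: "\<And>z. z \<in> sphere 0 1 \<Longrightarrow> \<bar>stereo_extend \<phi> z - (c + stereo_extend g z)\<bar> < e / 2"
    unfolding P_def by blast
  have 1: "\<bar>c\<bar> < e / 2" using ap[of "(0, 1)"] by (simp add: stereo_extend_def norm_prod_def)
  have 2: "\<bar>\<phi> x - (c + g x)\<bar> < e / 2" for x
    by (rule stereo_surj[of x]) (use ap in \<open>fastforce simp: stereo_extend_def\<close>)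
  have "\<bar>\<phi> x - g x\<bar> < e" for x using 1 2[of x] by linarith
  with g show ?thesis by (rule that)
qed

text \<open>For compactly supported functions the error can be made small in every integral norm:
  approximate \<open>\<phi>(x) exp |x|\<^sup>2\<close> uniformly and multiply by \<open>exp (-
  |x|\<^sup>2)\<close>.\<close>

lemma gauss_span_weighted_approx:
  fixes \<phi> :: "'a::euclidean_space \<Rightarrow> real"
  assumes \<phi>: "continuous_on UNIV \<phi>" "\<And>x. norm x > R \<Longrightarrow> \<phi> x = 0" and e: "e > 0"
  obtains g where "gauss_span g" "\<And>x. \<bar>\<phi> x - g x\<bar> \<le> e * exp (- (x \<bullet> x))"
proof -
  have "((\<lambda>x. \<phi> x * exp (x \<bullet> x)) \<longlongrightarrow> 0) at_infinity"
    by (rule tendsto_eventually) (use \<phi>(2) in \<open>auto simp: eventually_at_infinity intro!: exI[of _ "R + 1"]\<close>)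
  moreover have "continuous_on UNIV (\<lambda>x. \<phi> x * exp (x \<bullet> x))" by (intro continuous_intros \<phi>)
  ultimately obtain g where g: "gauss_span g" "\<And>x. \<bar>\<phi> x * exp (x \<bullet> x) - g x\<bar> < e"
    using gauss_span_dense_C0[of "\<lambda>x. \<phi> x * exp (x \<bullet> x)" e] e by blast
  show ?thesis
  proof (rule that)
    show "gauss_span (\<lambda>x. g x * exp (- 1 * (x \<bullet> x) + 0 \<bullet> x))"
      by (intro gauss_span_mult g gauss_span.gauss) simp
    show "\<bar>\<phi> x - g x * exp (- 1 * (x \<bullet> x) + 0 \<bullet> x)\<bar> \<le> e * exp (- (x \<bullet> x))" for x
    proof -
      have "\<phi> x - g x * exp (- (x \<bullet> x)) = (\<phi> x * exp (x \<bullet> x) - g x) * exp (- (x \<bullet> x))"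
        by (simp add: left_diff_distrib mult.assoc flip: exp_add)
      then show ?thesis using g(2)[of x] by (simp add: abs_mult)
    qed
  qed
qed

section \<open>Explicit free evolutions of Gaussians\<close>

definition gauss_profile :: "real \<Rightarrow> 'a::euclidean_space \<Rightarrow> 'a \<Rightarrow> complex" where
  "gauss_profile a p \<xi> = of_real (exp (- a * (\<xi> \<bullet> \<xi>) + p \<bullet> \<xi>))"

text \<open>The free evolution of the function whose Fourier transform is \<open>gauss_profile a
  p\<close>. The phase \<open>exp (- \<i> t |\<xi>|\<^sup>2)\<close> only turns the width
  \<open>a\<close> into the complex width \<open>a + \<i> t\<close>; the inverse transform of the
  result is this Gaussian.\<close>

definition gauss_wave :: "real \<Rightarrow> 'a::euclidean_space \<Rightarrow> real \<Rightarrow> 'a \<Rightarrow> complex" where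
  "gauss_wave a p t x = (1 / csqrt (2 * Complex a t)) ^ DIM('a) *
     exp ((of_real (p \<bullet> p - x \<bullet> x) + 2 * \<i> * of_real (p \<bullet> x)) / (4 * Complex a t))"

text \<open>\<open>gauss_evolution f F\<close> pairs a profile \<open>f\<close> on the Fourier side
  with the free wave \<open>F\<close> it generates. Carrying both functions in one relation makes
  every statement about them an induction over linear combinations.\<close>

inductive gauss_evolution :: "('a::euclidean_space \<Rightarrow> complex) \<Rightarrow> (real \<Rightarrow> 'a \<Rightarrow> complex) \<Rightarrow> bool" where
  gauss: "a > 0 \<Longrightarrow> gauss_evolution (gauss_profile a p) (gauss_wave a p)"
| add: "gauss_evolution f F \<Longrightarrow> gauss_evolution g G \<Longrightarrow> gauss_evolution (\<lambda>x. f x + g x) (\<lambda>t x. F t x + G t x)"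
| scale: "gauss_evolution f F \<Longrightarrow> gauss_evolution (\<lambda>x. c * f x) (\<lambda>t x. c * F t x)"

lemma gauss_evolution_of_span: "gauss_span g \<Longrightarrow> \<exists>G. gauss_evolution (\<lambda>x. of_real (g x)) G"
proof (induction rule: gauss_span.induct)
  case (gauss a p)
  then show ?case using gauss_evolution.gauss[of a p] by (auto simp: gauss_profile_def[abs_def])
next
  case (add f g)
  then show ?case using gauss_evolution.add by fastforce
next
  case (scale f c)
  then show ?case using gauss_evolution.scale[where c = "of_real c"] by fastforce
qed

lemma Re_gauss_wave_exponent:
  assumes "a > 0"
  shows "Re ((of_real (p \<bullet> p - x \<bullet> x) + 2 * \<i> * of_real (p \<bullet> x)) / (4 * Complex a t))
    = (a * (p \<bullet> p) - a * (x \<bullet> x) + 2 * t * (p \<bullet> x)) / (4 * (a\<^sup>2 + t\<^sup>2))"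
proof -
  have "Re (z / (4 * Complex a t)) = (4 * (Re z * a + Im z * t)) / (4 * (4 * (a\<^sup>2 + t\<^sup>2)))" for z
    by (simp add: Re_divide power_mult_distrib)
  then have "Re (z / (4 * Complex a t)) = (Re z * a + Im z * t) / (4 * (a\<^sup>2 + t\<^sup>2))" for z
    by (simp only: mult_divide_mult_cancel_left[of 4] zero_neq_numeral not_False_eq_True)
  then show ?thesis by (simp only:) (simp add: algebra_simps)
qed

lemma gauss_wave_le:
  assumes a: "a > 0" and t: "\<bar>t\<bar> \<le> T"
  shows "norm (gauss_wave a p t (x::'a::euclidean_space))
    \<le> (1 / sqrt (2 * a)) ^ DIM('a) * exp ((p \<bullet> p) / (4 * a) + (p \<bullet> p) * T\<^sup>2 / (2 * a ^ 3)) * exp (- (a / (8 * (a\<^sup>2 + T\<^sup>2))) * (x \<bullet> x))"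
proof -
  have aa: "a \<le> norm (Complex a t)" using abs_Re_le_cmod[of "Complex a t"] a by simp
  have 1: "norm ((1 / csqrt (2 * Complex a t)) ^ DIM('a)) \<le> (1 / sqrt (2 * a)) ^ DIM('a)"
    unfolding norm_power
  proof (rule power_mono)
    have "norm (1 / csqrt (2 * Complex a t)) = 1 / sqrt (2 * norm (Complex a t))" by (simp add: norm_divide norm_mult)
    also have "\<dots> \<le> 1 / sqrt (2 * a)" using a aa by (intro frac_le) auto
    finally show "norm (1 / csqrt (2 * Complex a t)) \<le> 1 / sqrt (2 * a)" .
  qed simp
  let ?r = "4 * (a\<^sup>2 + t\<^sup>2)"
  have r: "?r > 0" "4 * a\<^sup>2 \<le> ?r" "?r \<le> 4 * (a\<^sup>2 + T\<^sup>2)" using a t abs_le_square_iff[of t T] by (auto simp: add_pos_nonneg)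
  have "2 * t * (p \<bullet> x) \<le> 2 * \<bar>t\<bar> * norm p * norm x"
    using Cauchy_Schwarz_ineq2[of p x] mult_left_mono[of "\<bar>p \<bullet> x\<bar>" "norm p * norm x" "2 * \<bar>t\<bar>"] abs_ge_self[of "2 * t * (p \<bullet> x)"]
    by (simp add: abs_mult)
  moreover have "- a * (norm x)\<^sup>2 + (2 * \<bar>t\<bar> * norm p) * norm x \<le> (2 * \<bar>t\<bar> * norm p)\<^sup>2 / (2 * a) + (- (a / 2) * (norm x)\<^sup>2)"
    by (rule gaussian_exponent_le[OF a])
  ultimately have "a * (p \<bullet> p) - a * (x \<bullet> x) + 2 * t * (p \<bullet> x) \<le> a * (p \<bullet> p) + 2 * t\<^sup>2 * (p \<bullet> p) / a - (a / 2) * (x \<bullet> x)"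
    using a by (simp add: dot_square_norm power_mult_distrib)
  also have "\<dots> \<le> a * (p \<bullet> p) + 2 * T\<^sup>2 * (p \<bullet> p) / a - (a / 2) * (x \<bullet> x)"
    using a t abs_le_square_iff[of t T] by (intro diff_mono add_mono divide_right_mono mult_right_mono) auto
  finally have "(a * (p \<bullet> p) - a * (x \<bullet> x) + 2 * t * (p \<bullet> x)) / ?r \<le> (a * (p \<bullet> p) + 2 * T\<^sup>2 * (p \<bullet> p) / a) / ?r - (a / 2) * (x \<bullet> x) / ?r"
    using r(1) by (subst diff_divide_distrib[symmetric]) (intro divide_right_mono, auto)
  also have "\<dots> \<le> (a * (p \<bullet> p) + 2 * T\<^sup>2 * (p \<bullet> p) / a) / (4 * a\<^sup>2) - (a / 2) * (x \<bullet> x) / (4 * (a\<^sup>2 + T\<^sup>2))"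
    using a r by (intro diff_mono divide_left_mono) (auto simp: add_pos_nonneg)
  also have "\<dots> = ((p \<bullet> p) / (4 * a) + (p \<bullet> p) * T\<^sup>2 / (2 * a ^ 3)) + - (a / (8 * (a\<^sup>2 + T\<^sup>2))) * (x \<bullet> x)"
    using a by (simp add: field_simps power2_eq_square power3_eq_cube)
  finally have 2: "norm (exp ((of_real (p \<bullet> p - x \<bullet> x) + 2 * \<i> * of_real (p \<bullet> x)) / (4 * Complex a t)))
    \<le> exp ((p \<bullet> p) / (4 * a) + (p \<bullet> p) * T\<^sup>2 / (2 * a ^ 3)) * exp (- (a / (8 * (a\<^sup>2 + T\<^sup>2))) * (x \<bullet> x))"
    unfolding norm_exp_eq_Re Re_gauss_wave_exponent[OF a] by (simp flip: exp_add)
  have "norm (gauss_wave a p t x) = norm ((1 / csqrt (2 * Complex a t)) ^ DIM('a)) *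
      norm (exp ((of_real (p \<bullet> p - x \<bullet> x) + 2 * \<i> * of_real (p \<bullet> x)) / (4 * Complex a t)))"
    unfolding gauss_wave_def by (rule norm_mult)
  also have "\<dots> \<le> (1 / sqrt (2 * a)) ^ DIM('a) * (exp ((p \<bullet> p) / (4 * a) + (p \<bullet> p) * T\<^sup>2 / (2 * a ^ 3)) * exp (- (a / (8 * (a\<^sup>2 + T\<^sup>2))) * (x \<bullet> x)))"
    using a by (intro mult_mono 1 2) auto
  finally show ?thesis by (simp only: mult.assoc)
qed

text \<open>Gaussian domination uniform in the index; it supplies integrability, boundedness and
  dominating functions at once.\<close>

definition gauss_dominated :: "('i \<Rightarrow> 'a::euclidean_space \<Rightarrow> complex) \<Rightarrow> 'i set \<Rightarrow> bool" where
  "gauss_dominated f I \<longleftrightarrow> (\<exists>C c. 0 \<le> C \<and> 0 < c \<and> (\<forall>i\<in>I. \<forall>x. norm (f i x) \<le> C * exp (- c * (x \<bullet> x))))"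

lemma gauss_dominated_add:
  assumes "gauss_dominated f I" "gauss_dominated g I"
  shows "gauss_dominated (\<lambda>i x. f i x + g i x) I"
proof -
  obtain C c where f: "0 \<le> C" "0 < c" "\<And>i x. i \<in> I \<Longrightarrow> norm (f i x) \<le> C * exp (- c * (x \<bullet> x))"
    using assms(1) by (auto simp: gauss_dominated_def)
  obtain D d where g: "0 \<le> D" "0 < d" "\<And>i x. i \<in> I \<Longrightarrow> norm (g i x) \<le> D * exp (- d * (x \<bullet> x))"
    using assms(2) by (auto simp: gauss_dominated_def)
  have "norm (f i x + g i x) \<le> (C + D) * exp (- min c d * (x \<bullet> x))" if "i \<in> I" for i x
  proof -
    have "norm (f i x + g i x) \<le> C * exp (- c * (x \<bullet> x)) + D * exp (- d * (x \<bullet> x))"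
      using f(3)[OF that, of x] g(3)[OF that, of x] by (intro norm_triangle_le) linarith
    also have "\<dots> \<le> C * exp (- min c d * (x \<bullet> x)) + D * exp (- min c d * (x \<bullet> x))"
      using f g by (intro add_mono mult_left_mono) (auto intro!: mult_right_mono)
    finally show ?thesis by (simp add: distrib_right)
  qed
  then show ?thesis using f g unfolding gauss_dominated_def by (intro exI[of _ "C + D"] exI[of _ "min c d"]) auto
qed

lemma gauss_dominated_cmult:
  assumes "gauss_dominated f I" shows "gauss_dominated (\<lambda>i x. k * f i x) I"
proof -
  obtain C c where f: "0 \<le> C" "0 < c" "\<And>i x. i \<in> I \<Longrightarrow> norm (f i x) \<le> C * exp (- c * (x \<bullet> x))"
    using assms(1) by (auto simp: gauss_dominated_def)
  have "norm (k * f i x) \<le> (norm k * C) * exp (- c * (x \<bullet> x))" if "i \<in> I" for i x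
    using mult_left_mono[OF f(3)[OF that, of x], of "norm k"] by (simp add: norm_mult)
  then show ?thesis using f unfolding gauss_dominated_def by (intro exI[of _ "norm k * C"] exI[of _ c]) auto
qed

lemma integrable_real_gauss: "c > 0 \<Longrightarrow> integrable lborel (\<lambda>x::'a::euclidean_space. exp (- c * (x \<bullet> x)))"
proof -
  assume "c > 0"
  then have "integrable lborel (\<lambda>x::'a. norm (cgauss (of_real c) 0 0 x))" by (intro integrable_norm integrable_cgauss) simp
  then show ?thesis by (simp add: cgauss_def)
qed

lemma gauss_dominatedD:
  fixes f :: "'i \<Rightarrow> 'a::euclidean_space \<Rightarrow> complex"
  assumes "gauss_dominated f I" "i \<in> I" and [measurable]: "f i \<in> borel_measurable borel"
  shows "integrable lborel (f i)" "f i \<in> Lp 2" "bounded (range (f i))"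
proof -
  obtain C c where f: "0 \<le> C" "0 < c" "\<And>x. norm (f i x) \<le> C * exp (- c * (x \<bullet> x))"
    using assms(1,2) by (auto simp: gauss_dominated_def)
  show "integrable lborel (f i)"
    by (rule Bochner_Integration.integrable_bound[OF integrable_mult_right[OF integrable_real_gauss[OF f(2)], of C]])
       (use f in \<open>auto simp: abs_mult\<close>)
  have sq: "(norm (f i x))\<^sup>2 \<le> C\<^sup>2 * exp (- (2 * c) * (x \<bullet> x))" for x
  proof -
    have "(norm (f i x))\<^sup>2 \<le> (C * exp (- c * (x \<bullet> x)))\<^sup>2" using f(3) by (intro power_mono) auto
    also have "\<dots> = C\<^sup>2 * exp (- (2 * c) * (x \<bullet> x))" by (simp add: power_mult_distrib flip: exp_double)
    finally show ?thesis .
  qed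
  have "N2 (f i) \<le> (\<integral>\<^sup>+x. ennreal (C\<^sup>2 * exp (- (2 * c) * (x \<bullet> (x::'a)))) \<partial>lborel)"
    unfolding N2_def by (intro nn_integral_mono ennreal_leI sq)
  also have "\<dots> < \<infinity>"
    using integrable_mult_right[OF integrable_real_gauss[of "2 * c"], of "C\<^sup>2"] f(2)
    by (subst nn_integral_eq_integral) auto
  finally show "f i \<in> Lp 2" by (simp add: Lp_2_iff)
  have "C * exp (- c * (x \<bullet> x)) \<le> C * 1" for x using f by (intro mult_left_mono) auto
  then show "bounded (range (f i))" using f(3) unfolding bounded_iff by (intro exI[of _ C]) (auto intro: order_trans)
qed

lemma gauss_evolution_profile_dominated: 
  "gauss_evolution f F \<Longrightarrow> gauss_dominated (\<lambda>_::unit. f) UNIV"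
proof (induction rule: gauss_evolution.induct)
  case (gauss a p)
  then show ?case using gauss_le[of a _ p] unfolding gauss_dominated_def gauss_profile_def
    by (intro exI[of _ "exp ((norm p)\<^sup>2 / (2 * a))"] exI[of _ "a / 2"]) auto
qed (auto intro: gauss_dominated_add gauss_dominated_cmult)

lemma gauss_evolution_wave_dominated: 
  "gauss_evolution f F \<Longrightarrow> gauss_dominated F {-T..T}"
proof (induction rule: gauss_evolution.induct)
  case (gauss a p)
  have "a\<^sup>2 + T\<^sup>2 > 0" using gauss by (simp add: add_pos_nonneg)
  with gauss show ?case using gauss_wave_le[of a _ T p] unfolding gauss_dominated_def
    by (intro exI[of _ "(1 / sqrt (2 * a)) ^ DIM('a) * exp ((p \<bullet> p) / (4 * a) + (p \<bullet> p) * T\<^sup>2 / (2 * a ^ 3))"] 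
        exI[of _ "a / (8 * (a\<^sup>2 + T\<^sup>2))"]) (auto simp: abs_le_iff)
qed (auto intro: gauss_dominated_add gauss_dominated_cmult)

lemma gauss_evolution_continuous:
  "gauss_evolution f F \<Longrightarrow> continuous_on UNIV f \<and> (\<forall>t. continuous_on UNIV (F t))"
  by (induction rule: gauss_evolution.induct)
     (auto simp: gauss_profile_def[abs_def] gauss_wave_def[abs_def] complex_eq_iff intro!: continuous_intros)

lemma gauss_evolution_measurable [measurable_dest]:
  assumes "gauss_evolution f F"
  shows "f \<in> borel_measurable borel" "F t \<in> borel_measurable borel"
  by (rule borel_measurable_continuous_onI; use gauss_evolution_continuous[OF assms] in simp)+

lemma gauss_evolution_regular:
  assumes "gauss_evolution f F"
  shows "integrable lborel f" "f \<in> Lp 2" "bounded (range f)"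
    "integrable lborel (F t)" "F t \<in> Lp 2" "bounded (range (F t))"
  using gauss_dominatedD[OF gauss_evolution_profile_dominated[OF assms], of "()"]
    gauss_dominatedD[OF gauss_evolution_wave_dominated[OF assms, of "\<bar>t\<bar>"], of t] gauss_evolution_measurable[OF assms]
    abs_le_iff[of t "\<bar>t\<bar>"]
  by auto

lemma csqrt_of_nonneg_mult:
  assumes "r > 0" shows "csqrt (of_real r * z) = of_real (sqrt r) * csqrt z"
proof (rule csqrt_unique)
  show "(of_real (sqrt r) * csqrt z)\<^sup>2 = of_real r * z"
    using assms by (simp add: power_mult_distrib flip: of_real_power)
  show "0 < Re (of_real (sqrt r) * csqrt z) \<or> Re (of_real (sqrt r) * csqrt z) = 0 \<and> 0 \<le> Im (of_real (sqrt r) * csqrt z)"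
    using csqrt_principal[of z] assms by (auto simp: zero_less_mult_iff zero_le_mult_iff simp del: csqrt.sel)
qed

lemma fourier_integral_cgauss:
  fixes p q :: "'a::euclidean_space"
  assumes "Re \<alpha> > 0"
  shows "fourier_integral (cgauss \<alpha> p q) \<xi> = (1 / csqrt (2 * \<alpha>)) ^ DIM('a) *
    exp ((of_real (p \<bullet> p - (q - \<xi>) \<bullet> (q - \<xi>)) + 2 * \<i> * of_real (p \<bullet> (q - \<xi>))) / (4 * \<alpha>))"
proof -
  have 1: "exp (- \<i> * of_real (x \<bullet> \<xi>)) * cgauss \<alpha> p q x = cgauss \<alpha> p (q - \<xi>) x" for x
    unfolding cgauss_def exp_add[symmetric] by (simp add: algebra_simps inner_diff_left inner_commute[of x \<xi>])
  have "(2 * pi) powr (- (real DIM('a) / 2)) = ((2 * pi) powr (- (1 / 2))) powr (real DIM('a))"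
    by (simp add: powr_powr)
  also have "\<dots> = ((2 * pi) powr (- (1 / 2))) ^ DIM('a)" by (simp add: powr_realpow)
  also have "(2 * pi) powr (- (1 / 2)) = 1 / sqrt (2 * pi)" unfolding powr_minus by (subst powr_half_sqrt) (simp_all add: divide_inverse)
  finally have 2: "complex_of_real ((2 * pi) powr (- (real DIM('a) / 2))) = (1 / of_real (sqrt (2 * pi))) ^ DIM('a)" by simp
  have "csqrt (2 * \<alpha>) = of_real (sqrt 2) * csqrt \<alpha>" using csqrt_of_nonneg_mult[of 2 \<alpha>] by simp
  then have 3: "1 / complex_of_real (sqrt (2 * pi)) * (of_real (sqrt pi) / csqrt \<alpha>) = 1 / csqrt (2 * \<alpha>)"
    by (simp add: real_sqrt_mult)
  show ?thesis
    unfolding fourier_integral_def 1 2 integral_cgauss[OF assms] mult.assoc[symmetric] power_mult_distrib[symmetric] 3 ..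
qed

lemma gauss_wave_eq_cgauss:
  fixes p :: "'a::euclidean_space" and t :: real
  assumes a: "a > 0"
  defines "c \<equiv> \<i> / (2 * Complex a t)"
  shows "gauss_wave a p t x = (1 / csqrt (2 * Complex a t)) ^ DIM('a) * exp (of_real (p \<bullet> p) / (4 * Complex a t))
    * cgauss (1 / (4 * Complex a t)) (Re c *\<^sub>R p) (Im c *\<^sub>R p) x"
proof -
  have "of_real (Re c) * w + \<i> * (of_real (Im c) * w) = c * w" for w
    by (metis complex_eq distrib_right mult.assoc)
  then have "of_real ((Re c *\<^sub>R p) \<bullet> x) + \<i> * of_real ((Im c *\<^sub>R p) \<bullet> x) = c * of_real (p \<bullet> x)"
    by simp
  then have "- (1 / (4 * Complex a t)) * of_real (x \<bullet> x) + of_real ((Re c *\<^sub>R p) \<bullet> x) + \<i> * of_real ((Im c *\<^sub>R p) \<bullet> x)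
    = - (1 / (4 * Complex a t)) * of_real (x \<bullet> x) + c * of_real (p \<bullet> x)" by (simp only: add.assoc)
  moreover have "(of_real (p \<bullet> p - x \<bullet> x) + 2 * \<i> * of_real (p \<bullet> x)) / (4 * Complex a t)
    = of_real (p \<bullet> p) / (4 * Complex a t) + (- (1 / (4 * Complex a t)) * of_real (x \<bullet> x) + c * of_real (p \<bullet> x))"
    unfolding c_def by (simp add: add_divide_distrib diff_divide_distrib)
  ultimately show ?thesis unfolding gauss_wave_def cgauss_def by (simp only: exp_add mult.assoc)
qed

lemma fourier_integral_gauss_wave:
  fixes p :: "'a::euclidean_space"
  assumes a: "a > 0"
  shows "fourier_integral (gauss_wave a p t) \<xi> = exp (- \<i> * of_real (t * (norm \<xi>)\<^sup>2)) * gauss_profile a p \<xi>"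
proof -
  define \<alpha> where "\<alpha> = Complex a t"
  define c where "c = \<i> / (2 * \<alpha>)"
  have \<alpha>: "\<alpha> \<noteq> 0" "Re \<alpha> > 0" using a by (auto simp: \<alpha>_def complex_eq_iff)
  then have R: "Re (1 / (4 * \<alpha>)) > 0"
  proof -
    have "Re (1 / (4 * \<alpha>)) = 4 * a / ((4 * a)\<^sup>2 + (4 * t)\<^sup>2)" by (simp add: Re_divide \<alpha>_def)
    also have "\<dots> > 0" using a by (intro divide_pos_pos add_pos_nonneg) auto
    finally show ?thesis .
  qed
  define K where "K = (1 / csqrt (2 * \<alpha>)) ^ DIM('a) * exp (of_real (p \<bullet> p) / (4 * \<alpha>))"
  have gw: "gauss_wave a p t = (\<lambda>x. K * cgauss (1 / (4 * \<alpha>)) (Re c *\<^sub>R p) (Im c *\<^sub>R p) x)"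
    unfolding K_def c_def \<alpha>_def using gauss_wave_eq_cgauss[OF a] by auto
  have "fourier_integral (gauss_wave a p t) \<xi> = K * fourier_integral (cgauss (1 / (4 * \<alpha>)) (Re c *\<^sub>R p) (Im c *\<^sub>R p)) \<xi>"
    unfolding gw fourier_integral_def by (simp add: mult.left_commute[of _ K])
  also have "\<dots> = K * ((1 / csqrt (2 * (1 / (4 * \<alpha>)))) ^ DIM('a) *
    exp ((of_real ((Re c *\<^sub>R p) \<bullet> (Re c *\<^sub>R p) - (Im c *\<^sub>R p - \<xi>) \<bullet> (Im c *\<^sub>R p - \<xi>)) + 2 * \<i> * of_real ((Re c *\<^sub>R p) \<bullet> (Im c *\<^sub>R p - \<xi>))) / (4 * (1 / (4 * \<alpha>)))))"
    by (simp only: fourier_integral_cgauss[OF R])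
  also have "of_real ((Re c *\<^sub>R p) \<bullet> (Re c *\<^sub>R p) - (Im c *\<^sub>R p - \<xi>) \<bullet> (Im c *\<^sub>R p - \<xi>)) + 2 * \<i> * of_real ((Re c *\<^sub>R p) \<bullet> (Im c *\<^sub>R p - \<xi>))
    = c\<^sup>2 * of_real (p \<bullet> p) - 2 * \<i> * c * of_real (p \<bullet> \<xi>) - of_real (\<xi> \<bullet> \<xi>)"
    by (simp add: complex_eq_iff inner_diff_left inner_diff_right inner_commute[of \<xi> p] power2_eq_square algebra_simps)
  also have "(c\<^sup>2 * of_real (p \<bullet> p) - 2 * \<i> * c * of_real (p \<bullet> \<xi>) - of_real (\<xi> \<bullet> \<xi>)) / (4 * (1 / (4 * \<alpha>)))
    = - of_real (p \<bullet> p) / (4 * \<alpha>) + of_real (p \<bullet> \<xi>) - \<alpha> * of_real (\<xi> \<bullet> \<xi>)"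
    unfolding c_def using \<alpha>(1) by (simp add: field_simps power2_eq_square)
  also have "K * ((1 / csqrt (2 * (1 / (4 * \<alpha>)))) ^ DIM('a) * exp (- of_real (p \<bullet> p) / (4 * \<alpha>) + of_real (p \<bullet> \<xi>) - \<alpha> * of_real (\<xi> \<bullet> \<xi>)))
    = (1 / (csqrt (2 * \<alpha>) * csqrt (2 * (1 / (4 * \<alpha>))))) ^ DIM('a)
      * exp (of_real (p \<bullet> p) / (4 * \<alpha>) + (- of_real (p \<bullet> p) / (4 * \<alpha>) + of_real (p \<bullet> \<xi>) - \<alpha> * of_real (\<xi> \<bullet> \<xi>)))"
    unfolding K_def exp_add by (simp add: power_mult_distrib power_divide)
  also have "csqrt (2 * \<alpha>) * csqrt (2 * (1 / (4 * \<alpha>))) = 1"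
  proof -
    have "csqrt (2 * (1 / (4 * \<alpha>))) = inverse (csqrt (2 * \<alpha>))"
      using csqrt_inverse[of "2 * \<alpha>"] \<alpha> by (simp add: inverse_eq_divide complex_nonpos_Reals_iff)
    then show ?thesis using \<alpha>(1) by simp
  qed
  also have "exp (of_real (p \<bullet> p) / (4 * \<alpha>) + (- of_real (p \<bullet> p) / (4 * \<alpha>) + of_real (p \<bullet> \<xi>) - \<alpha> * of_real (\<xi> \<bullet> \<xi>)))
    = exp (- \<i> * of_real (t * (norm \<xi>)\<^sup>2)) * gauss_profile a p \<xi>"
  proof -
    have "\<alpha> = of_real a + \<i> * of_real t" by (simp add: \<alpha>_def complex_eq_iff)
    then show ?thesis
      unfolding gauss_profile_def exp_of_real[symmetric] exp_add[symmetric] 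
      by (simp add: dot_square_norm algebra_simps)
  qed
  finally show ?thesis by simp
qed

lemma fourier_integral_cnj_gauss_profile:
  fixes p :: "'a::euclidean_space"
  assumes a: "a > 0"
  shows "fourier_integral (\<lambda>\<xi>. cnj (exp (- \<i> * of_real (t * (norm \<xi>)\<^sup>2)) * gauss_profile a p \<xi>)) x = cnj (gauss_wave a p t x)"
proof -
  define \<alpha> where "\<alpha> = Complex a t"
  have \<alpha>: "Re \<alpha> > 0" "\<alpha> = of_real a + \<i> * of_real t" using a by (auto simp: \<alpha>_def complex_eq_iff)
  have "(\<lambda>\<xi>. cnj (exp (- \<i> * of_real (t * (norm \<xi>)\<^sup>2)) * gauss_profile a p \<xi>)) = cgauss (cnj \<alpha>) p 0"
    unfolding cgauss_def gauss_profile_def \<alpha>(2) exp_of_real[symmetric] exp_add[symmetric] exp_cnj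
    by (simp add: dot_square_norm algebra_simps fun_eq_iff)
  then have "fourier_integral (\<lambda>\<xi>. cnj (exp (- \<i> * of_real (t * (norm \<xi>)\<^sup>2)) * gauss_profile a p \<xi>)) x
    = (1 / csqrt (2 * cnj \<alpha>)) ^ DIM('a) *
    exp ((of_real (p \<bullet> p - (0 - x) \<bullet> (0 - x)) + 2 * \<i> * of_real (p \<bullet> (0 - x))) / (4 * cnj \<alpha>))"
    using fourier_integral_cgauss[of "cnj \<alpha>" p 0 x] \<alpha> by simp
  also have "csqrt (2 * cnj \<alpha>) = cnj (csqrt (2 * \<alpha>))" using cnj_csqrt[of "2 * \<alpha>"] \<alpha>(1)
    by (simp add: complex_nonpos_Reals_iff)
  finally show ?thesis unfolding gauss_wave_def \<alpha>_def by (simp add: exp_cnj)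
qed

lemma norm_phase [simp]: "norm (exp (- (\<i> * of_real r))) = 1" "norm (exp (\<i> * of_real r)) = 1"
  by (simp_all add: norm_exp_eq_Re)

lemma integrable_phase_mult:
  assumes "integrable lborel f" and [measurable]: "p \<in> borel_measurable borel" and "\<And>x. norm (p x) = 1"
  shows "integrable lborel (\<lambda>x. p x * f x :: complex)"
proof (rule Bochner_Integration.integrable_bound[OF assms(1)])
  have [measurable]: "f \<in> borel_measurable lborel" using assms by auto
  show "(\<lambda>x. p x * f x) \<in> borel_measurable lborel" by measurable
qed (simp add: norm_mult assms)

lemma integrable_fourier_integrand:
  assumes "integrable lborel f"
  shows "integrable lborel (\<lambda>x. exp (- \<i> * of_real (x \<bullet> \<xi>)) * f x)"
  by (rule integrable_phase_mult[OF assms]) auto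

lemma fourier_integral_add:
  assumes "integrable lborel f" "integrable lborel g"
  shows "fourier_integral (\<lambda>x. f x + g x) \<xi> = fourier_integral f \<xi> + fourier_integral g \<xi>"
  using integrable_fourier_integrand[OF assms(1)] integrable_fourier_integrand[OF assms(2)]
  by (simp add: fourier_integral_def distrib_left)

lemma fourier_integral_diff:
  assumes "integrable lborel f" "integrable lborel g"
  shows "fourier_integral (\<lambda>x. f x - g x) \<xi> = fourier_integral f \<xi> - fourier_integral g \<xi>"
  using integrable_fourier_integrand[OF assms(1)] integrable_fourier_integrand[OF assms(2)]
  by (simp add: fourier_integral_def right_diff_distrib)

lemma fourier_integral_cmult: "fourier_integral (\<lambda>x. c * f x) \<xi> = c * fourier_integral f \<xi>"
  by (simp add: fourier_integral_def mult.left_commute[of _ c])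

lemma fourier_gauss_evolution:
  assumes "gauss_evolution f F"
  shows "fourier_integral (F t) \<xi> = exp (- \<i> * of_real (t * (norm \<xi>)\<^sup>2)) * f \<xi>"
  using assms
proof (induction rule: gauss_evolution.induct)
  case (add f F g G)
  then show ?case
    using gauss_evolution_regular(4)[OF add(1), of t] gauss_evolution_regular(4)[OF add(2), of t]
    by (simp add: fourier_integral_add distrib_left)
qed (auto simp: fourier_integral_gauss_wave fourier_integral_cmult)

text \<open>Fourier inversion for Gaussians. Conjugation turns the inverse transform into the
  transform, so that no separate inverse transform has to be introduced.\<close>

lemma fourier_cnj_gauss_evolution:
  assumes "gauss_evolution f F"
  shows "fourier_integral (\<lambda>\<xi>. cnj (exp (- \<i> * of_real (t * (norm \<xi>)\<^sup>2)) * f \<xi>)) x = cnj (F t x)"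
  using assms
proof (induction rule: gauss_evolution.induct)
  case (add f F g G)
  have "integrable lborel (\<lambda>\<xi>. cnj (exp (- \<i> * of_real (t * (norm \<xi>)\<^sup>2)) * f \<xi>))" if "gauss_evolution f F" for f F
    by (intro integrable_cnj integrable_phase_mult gauss_evolution_regular(1)[OF that]) auto
  from fourier_integral_add[OF this[OF add(1)] this[OF add(2)]] add.IH show ?case by (simp add: distrib_left)
next
  case (scale f F c)
  have "fourier_integral (\<lambda>\<xi>. cnj (exp (- \<i> * of_real (t * (norm \<xi>)\<^sup>2)) * (c * f \<xi>))) x
     = cnj c * fourier_integral (\<lambda>\<xi>. cnj (exp (- \<i> * of_real (t * (norm \<xi>)\<^sup>2)) * f \<xi>)) x"
    by (subst fourier_integral_cmult[symmetric]) (simp add: mult_ac)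
  then show ?case unfolding scale.IH by simp
qed (use fourier_integral_cnj_gauss_profile in auto)

text \<open>Fubini; the phase \<open>exp (- \<i> x \<cdot> \<xi>)\<close> is symmetric in the two
  variables.\<close>

lemma fourier_multiplication:
  fixes f g :: "'a::euclidean_space \<Rightarrow> complex"
  assumes f: "integrable lborel f" and g: "integrable lborel g"
  shows "(LINT \<xi>|lborel. fourier_integral f \<xi> * g \<xi>) = (LINT x|lborel. f x * fourier_integral g x)"
proof -
  define K where "K = complex_of_real ((2 * pi) powr (- (real DIM('a) / 2)))"
  define e where "e x \<xi> = exp (- \<i> * of_real (x \<bullet> \<xi>))" for x \<xi> :: 'a
  have [measurable]: "f \<in> borel_measurable borel" "g \<in> borel_measurable borel" using f g by auto
  have [measurable]: "case_prod e \<in> borel_measurable (borel \<Otimes>\<^sub>M borel)" unfolding e_def case_prod_beta' by measurable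
  have e1: "norm (e x \<xi>) = 1" for x \<xi> unfolding e_def by simp
  have "integrable (lborel \<Otimes>\<^sub>M lborel) (\<lambda>(x, \<xi>). e x \<xi> * (f x * g \<xi>))"
  proof (rule lborel_pair.Fubini_integrable)
    show "(\<lambda>(x, \<xi>). e x \<xi> * (f x * g \<xi>)) \<in> borel_measurable (lborel \<Otimes>\<^sub>M lborel)" by measurable
    show "AE x in lborel. integrable lborel (\<lambda>y. case (x, y) of (x, \<xi>) \<Rightarrow> e x \<xi> * (f x * g \<xi>))"
    proof (intro AE_I2)
      fix x
      have "e x \<in> borel_measurable borel" unfolding e_def[abs_def] by measurable
      then show "integrable lborel (\<lambda>y. case (x, y) of (x, \<xi>) \<Rightarrow> e x \<xi> * (f x * g \<xi>))"
        unfolding prod.case by (rule integrable_phase_mult[OF integrable_mult_right[OF g]]) (rule e1)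
    qed
    have "(\<lambda>x. LINT y|lborel. norm (case (x, y) of (x, \<xi>) \<Rightarrow> e x \<xi> * (f x * g \<xi>))) = (\<lambda>x. norm (f x) * (LINT y|lborel. norm (g y)))"
      by (simp add: norm_mult e1)
    then show "integrable lborel (\<lambda>x. LINT y|lborel. norm (case (x, y) of (x, \<xi>) \<Rightarrow> e x \<xi> * (f x * g \<xi>)))"
      using f by simp
  qed
  from lborel_pair.Fubini_integral[OF this]
  have "(LINT \<xi>|lborel. (LINT x|lborel. e x \<xi> * (f x * g \<xi>))) = (LINT x|lborel. (LINT \<xi>|lborel. e x \<xi> * (f x * g \<xi>)))" by simp
  moreover have "(LINT x|lborel. e x \<xi> * (f x * g \<xi>)) = (LINT x|lborel. e x \<xi> * f x) * g \<xi>" for \<xi>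
    by (subst integral_mult_left_zero[symmetric]) (simp add: mult_ac)
  moreover have "(LINT \<xi>|lborel. e x \<xi> * (f x * g \<xi>)) = f x * (LINT \<xi>|lborel. e x \<xi> * g \<xi>)" for x
    by (subst integral_mult_right_zero[symmetric]) (simp add: mult_ac)
  ultimately have "K * (LINT \<xi>|lborel. (LINT x|lborel. e x \<xi> * f x) * g \<xi>) = K * (LINT x|lborel. f x * (LINT \<xi>|lborel. e x \<xi> * g \<xi>))" by simp
  moreover have "e x \<xi> = e \<xi> x" for x \<xi> by (simp add: e_def inner_commute)
  ultimately have "(LINT \<xi>|lborel. K * (LINT x|lborel. e x \<xi> * f x) * g \<xi>) = (LINT x|lborel. f x * (K * (LINT \<xi>|lborel. e \<xi> x * g \<xi>)))"
    by (simp add: mult.assoc mult.left_commute[of _ K])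
  then show ?thesis unfolding fourier_integral_def K_def e_def .
qed

text \<open>Plancherel's identity on Gaussians: move the transform from one factor of
  \<open>\<integral> F cnj F\<close> to the other by the multiplication formula and use the two
  inversion formulas.\<close>

lemma N2_gauss_evolution:
  assumes "gauss_evolution f F" shows "N2 (F t) = N2 f"
proof -
  define h where "h \<xi> = exp (- \<i> * of_real (t * (norm \<xi>)\<^sup>2)) * f \<xi>" for \<xi>
  note R = gauss_evolution_regular[OF assms]
  have h: "integrable lborel h" unfolding h_def[abs_def] by (intro integrable_phase_mult R) auto
  have "complex_of_real (LINT x|lborel. (norm (F t x))\<^sup>2) = (LINT x|lborel. F t x * cnj (F t x))"
    by (simp add: complex_norm_square flip: integral_complex_of_real of_real_power)
  also have "\<dots> = (LINT x|lborel. F t x * fourier_integral (\<lambda>\<xi>. cnj (h \<xi>)) x)"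
    unfolding h_def fourier_cnj_gauss_evolution[OF assms] ..
  also have "\<dots> = (LINT \<xi>|lborel. fourier_integral (F t) \<xi> * cnj (h \<xi>))"
    by (rule fourier_multiplication[symmetric]) (intro R integrable_cnj h)+
  also have "\<dots> = (LINT \<xi>|lborel. h \<xi> * cnj (h \<xi>))"
    unfolding h_def fourier_gauss_evolution[OF assms] ..
  also have "\<dots> = complex_of_real (LINT x|lborel. (norm (h x))\<^sup>2)"
    by (simp add: complex_norm_square flip: integral_complex_of_real of_real_power)
  finally have "(LINT x|lborel. (norm (F t x))\<^sup>2) = (LINT x|lborel. (norm (f x))\<^sup>2)"
    by (simp only: of_real_eq_iff) (simp add: h_def norm_mult)
  then show ?thesis by (simp add: N2_eq_integral R)
qed

section \<open>Density of Gaussians in \<open>L\<^sup>2\<close>\<close>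

lemma ennreal_quarters:
  assumes "e \<ge> 0" shows "2 * ennreal (e / 4) + 2 * ennreal (e / 4) = ennreal e"
proof -
  have "2 * ennreal (e / 4) = ennreal (2 * (e / 4))" by (subst ennreal_mult') simp_all
  then have "2 * ennreal (e / 4) + 2 * ennreal (e / 4) = ennreal (2 * (e / 4) + 2 * (e / 4))"
    using assms by (subst ennreal_plus) simp_all
  then show ?thesis by simp
qed

text \<open>Membership in the \<open>L\<^sup>2\<close> closure of the profiles. It is closed under
  limits and linear combinations, which reduces density to compactly supported continuous
  functions.\<close>

definition gauss_approx :: "('a::euclidean_space \<Rightarrow> complex) \<Rightarrow> bool" where
  "gauss_approx h \<longleftrightarrow> h \<in> borel_measurable borel \<and>
     (\<forall>e>0. \<exists>f F. gauss_evolution f F \<and> N2 (\<lambda>x. h x - f x) < ennreal e)"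

lemma gauss_approxI_limit:
  assumes h: "\<And>n. gauss_approx (h n)" and [measurable]: "g \<in> borel_measurable borel"
    and lim: "(\<lambda>n. N2 (\<lambda>x. h n x - g x)) \<longlonglongrightarrow> 0"
  shows "gauss_approx g"
  unfolding gauss_approx_def
proof (intro conjI allI impI)
  fix e :: real assume e: "e > 0"
  have hm [measurable]: "h n \<in> borel_measurable borel" for n using h by (simp add: gauss_approx_def)
  have "\<forall>\<^sub>F n in sequentially. N2 (\<lambda>x. h n x - g x) < ennreal (e / 4)"
    using lim e by (simp add: ennreal_tendsto_0_iff)
  then obtain n where n: "N2 (\<lambda>x. h n x - g x) < ennreal (e / 4)" by (auto simp: eventually_sequentially)
  obtain f F where f: "gauss_evolution f F" "N2 (\<lambda>x. h n x - f x) < ennreal (e / 4)"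
    using h[of n] e unfolding gauss_approx_def by (meson divide_pos_pos zero_less_numeral)
  have [measurable]: "f \<in> borel_measurable borel" using f(1) by (rule gauss_evolution_measurable)
  have "N2 (\<lambda>x. g x - f x) \<le> 2 * N2 (\<lambda>x. g x - h n x) + 2 * N2 (\<lambda>x. h n x - f x)" by (rule N2_diff_trans) auto
  also have "\<dots> < 2 * ennreal (e / 4) + 2 * ennreal (e / 4)"
    using n f(2) by (intro add_strict_mono ennreal_mult_strict_left_mono) (auto simp: N2_minus_commute[of g])
  also have "\<dots> = ennreal e" using e by (intro ennreal_quarters) simp
  finally show "\<exists>f F. gauss_evolution f F \<and> N2 (\<lambda>x. g x - f x) < ennreal e" using f(1) by blast
qed fact

lemma gauss_approx_add:
  assumes "gauss_approx g" "gauss_approx h" shows "gauss_approx (\<lambda>x. g x + h x)"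
  unfolding gauss_approx_def
proof (intro conjI allI impI)
  have [measurable]: "g \<in> borel_measurable borel" "h \<in> borel_measurable borel" using assms by (auto simp: gauss_approx_def)
  show "(\<lambda>x. g x + h x) \<in> borel_measurable borel" by measurable
  fix e :: real assume e: "e > 0"
  obtain f F where f: "gauss_evolution f F" "N2 (\<lambda>x. g x - f x) < ennreal (e / 4)"
    using assms(1) e unfolding gauss_approx_def by (meson divide_pos_pos zero_less_numeral)
  obtain k K where k: "gauss_evolution k K" "N2 (\<lambda>x. h x - k x) < ennreal (e / 4)"
    using assms(2) e unfolding gauss_approx_def by (meson divide_pos_pos zero_less_numeral)
  have [measurable]: "f \<in> borel_measurable borel" "k \<in> borel_measurable borel"
    using gauss_evolution_measurable f(1) k(1) by auto
  have "N2 (\<lambda>x. (g x + h x) - (f x + k x)) = N2 (\<lambda>x. (g x - f x) + (h x - k x))" by (simp add: algebra_simps)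
  also have "\<dots> \<le> 2 * N2 (\<lambda>x. g x - f x) + 2 * N2 (\<lambda>x. h x - k x)" by (rule N2_add) auto
  also have "\<dots> < 2 * ennreal (e / 4) + 2 * ennreal (e / 4)"
    using k f(2) by (intro add_strict_mono ennreal_mult_strict_left_mono) auto
  also have "\<dots> = ennreal e" using e by (intro ennreal_quarters) simp
  finally show "\<exists>f F. gauss_evolution f F \<and> N2 (\<lambda>x. (g x + h x) - f x) < ennreal e"
    using gauss_evolution.add[OF f(1) k(1)] by blast
qed

lemma gauss_approx_cmult:
  assumes "gauss_approx g" shows "gauss_approx (\<lambda>x. c * g x)"
  unfolding gauss_approx_def
proof (intro conjI allI impI)
  have [measurable]: "g \<in> borel_measurable borel" using assms by (auto simp: gauss_approx_def)
  show "(\<lambda>x. c * g x) \<in> borel_measurable borel" by measurable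
  fix e :: real assume e: "e > 0"
  define d where "d = e / ((norm c)\<^sup>2 + 1)"
  have p: "(norm c)\<^sup>2 + 1 > 0" by (simp add: add_nonneg_pos)
  have d: "d > 0" "(norm c)\<^sup>2 * d < e" unfolding d_def using e p by (simp_all add: pos_divide_less_eq algebra_simps)
  obtain f F where f: "gauss_evolution f F" "N2 (\<lambda>x. g x - f x) < ennreal d"
    using assms(1) d unfolding gauss_approx_def by blast
  have [measurable]: "f \<in> borel_measurable borel" using gauss_evolution_measurable f(1) by auto
  have "N2 (\<lambda>x. c * g x - c * f x) = ennreal ((norm c)\<^sup>2) * N2 (\<lambda>x. g x - f x)"
    unfolding right_diff_distrib[symmetric] by (rule N2_cmult) auto
  also have "\<dots> \<le> ennreal ((norm c)\<^sup>2) * ennreal d" using f(2) by (intro mult_left_mono) auto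
  also have "\<dots> = ennreal ((norm c)\<^sup>2 * d)" using d by (simp add: ennreal_mult)
  also have "\<dots> < ennreal e" using d by (intro ennreal_lessI) (auto intro: le_less_trans[rotated])
  finally show "\<exists>f F. gauss_evolution f F \<and> N2 (\<lambda>x. c * g x - f x) < ennreal e"
    using gauss_evolution.scale[OF f(1)] by blast
qed

lemma gauss_evolution_zero: "\<exists>F. gauss_evolution (\<lambda>x::'a::euclidean_space. 0) F"
  using gauss_evolution.scale[OF gauss_evolution.gauss[of 1 "0::'a"], of 0] by auto

lemma gauss_approx_zero: "gauss_approx (\<lambda>x. 0)"
  unfolding gauss_approx_def using gauss_evolution_zero by (auto intro!: exI[of _ "\<lambda>x. 0"])

lemma gauss_approx_sum: "finite I \<Longrightarrow> (\<And>i. i \<in> I \<Longrightarrow> gauss_approx (h i)) \<Longrightarrow> gauss_approx (\<lambda>x. \<Sum>i\<in>I. h i x)"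
  by (induction I rule: finite_induct) (auto intro: gauss_approx_add gauss_approx_zero)

lemma gauss_approx_Cc:
  fixes \<phi> :: "'a::euclidean_space \<Rightarrow> real"
  assumes \<phi>: "continuous_on UNIV \<phi>" "\<And>x. norm x > R \<Longrightarrow> \<phi> x = 0"
  shows "gauss_approx (\<lambda>x. of_real (\<phi> x))"
  unfolding gauss_approx_def
proof (intro conjI allI impI)
  show "(\<lambda>x. complex_of_real (\<phi> x)) \<in> borel_measurable borel"
    by (intro borel_measurable_continuous_onI continuous_intros \<phi>)
  fix e :: real assume e: "e > 0"
  define k :: "'a \<Rightarrow> complex" where "k = (\<lambda>x. of_real (exp (- (x \<bullet> x))))"
  have [measurable]: "k \<in> borel_measurable borel" unfolding k_def by measurable
  have "gauss_evolution (gauss_profile 1 (0::'a)) (gauss_wave 1 0)" by (rule gauss_evolution.gauss) simp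
  then have "gauss_profile 1 (0::'a) \<in> Lp 2" by (rule gauss_evolution_regular)
  then have k: "N2 k < \<infinity>" by (simp add: Lp_2_iff k_def gauss_profile_def[abs_def])
  define B where "B = enn2real (N2 k)"
  have B: "N2 k = ennreal B" "B \<ge> 0" using k by (auto simp: B_def)
  define d where "d = sqrt (e / (B + 1))"
  have d: "d > 0" "d\<^sup>2 = e / (B + 1)" using B e by (auto simp: d_def)
  obtain g where g: "gauss_span g" "\<And>x. \<bar>\<phi> x - g x\<bar> \<le> d * exp (- (x \<bullet> x))"
    using gauss_span_weighted_approx[OF \<phi> d(1)] by blast
  obtain G where G: "gauss_evolution (\<lambda>x. of_real (g x)) G" using gauss_evolution_of_span[OF g(1)] by blast
  have "N2 (\<lambda>x. of_real (\<phi> x) - of_real (g x)) \<le> N2 (\<lambda>x. of_real d * k x)"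
  proof (rule N2_mono)
    fix x
    have "norm (complex_of_real (\<phi> x) - of_real (g x)) = \<bar>\<phi> x - g x\<bar>" by (metis norm_of_real of_real_diff)
    then show "norm (complex_of_real (\<phi> x) - of_real (g x)) \<le> norm (of_real d * k x)"
      using g(2)[of x] d(1) by (simp add: k_def norm_mult)
  qed
  also have "\<dots> = ennreal (d\<^sup>2 * B)" using B by (subst N2_cmult) (simp_all add: ennreal_mult)
  also have "\<dots> < ennreal e" using B e by (intro ennreal_lessI) (auto simp: d field_simps)
  finally show "\<exists>f F. gauss_evolution f F \<and> N2 (\<lambda>x. of_real (\<phi> x) - f x) < ennreal e" using G by blast
qed

lemma N2_dominated:
  fixes g :: "'a::euclidean_space \<Rightarrow> complex"
  assumes [measurable]: "\<And>n. f n \<in> borel_measurable borel" "g \<in> borel_measurable borel" "w \<in> borel_measurable borel"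
    and bd: "\<And>n x. norm (f n x - g x) \<le> norm (w x)" and w: "N2 w < \<infinity>"
    and lim: "\<And>x. (\<lambda>n. f n x) \<longlonglongrightarrow> g x"
  shows "(\<lambda>n. N2 (\<lambda>x. f n x - g x)) \<longlonglongrightarrow> 0"
proof -
  have "(\<lambda>n. \<integral>\<^sup>+x. ennreal ((norm (f n x - g x))\<^sup>2) \<partial>lborel) \<longlonglongrightarrow> (\<integral>\<^sup>+x. 0 \<partial>(lborel :: 'a measure))"
  proof (rule nn_integral_dominated_convergence[where w="\<lambda>x. ennreal ((norm (w x))\<^sup>2)"])
    show "AE x in lborel. ennreal ((norm (f n x - g x))\<^sup>2) \<le> ennreal ((norm (w x))\<^sup>2)" for n
      using bd by (intro AE_I2 ennreal_leI power_mono) auto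
    show "(\<integral>\<^sup>+x. ennreal ((norm (w x))\<^sup>2) \<partial>lborel) < \<infinity>" using w by (simp add: N2_def)
    show "AE x in lborel. (\<lambda>n. ennreal ((norm (f n x - g x))\<^sup>2)) \<longlonglongrightarrow> 0"
    proof (rule AE_I2)
      fix x
      have "(\<lambda>n. (norm (f n x - g x))\<^sup>2) \<longlonglongrightarrow> 0\<^sup>2"
        by (intro tendsto_intros tendsto_norm_zero LIM_zero lim)
      then show "(\<lambda>n. ennreal ((norm (f n x - g x))\<^sup>2)) \<longlonglongrightarrow> 0"
        by (metis ennreal_0 tendsto_ennrealI zero_power2)
    qed
  qed auto
  then show ?thesis by (simp add: N2_def)
qed

lemma N2_indicator: "A \<in> sets borel \<Longrightarrow> N2 (\<lambda>x. indicator A x) = emeasure lborel A"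
proof -
  assume "A \<in> sets borel"
  have "ennreal ((norm (indicator A x :: complex))\<^sup>2) = indicator A x" for x :: 'a by (simp add: indicator_def)
  then show ?thesis unfolding N2_def using \<open>A \<in> sets borel\<close> by simp
qed

text \<open>Continuous cut-offs that decrease to the indicator of a compact set; used for density
  and for localizing to null sets.\<close>

lemma tent_indicator:
  fixes K :: "'a::euclidean_space set"
  assumes K: "compact K" "K \<noteq> {}"
  defines "\<phi> n x \<equiv> max 0 (1 - real n * infdist x K)"
  obtains R where "\<And>n. continuous_on UNIV (\<phi> n)" "\<And>n x. norm x > R \<Longrightarrow> n > 0 \<Longrightarrow> \<phi> n x = 0"
    "\<And>n x. 0 \<le> \<phi> n x" "\<And>n x. \<phi> n x \<le> 1" "\<And>x. (\<lambda>n. \<phi> n x) \<longlonglongrightarrow> indicator K x"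
proof -
  obtain r where r: "\<And>x. x \<in> K \<Longrightarrow> norm x \<le> r" using compact_imp_bounded[OF K(1)] by (auto simp: bounded_iff)
  show ?thesis
  proof
    show "continuous_on UNIV (\<phi> n)" for n unfolding \<phi>_def by (intro continuous_intros)
    show "\<phi> n x = 0" if x: "norm x > r + 1" "n > 0" for n x
    proof -
      have "1 \<le> dist x a" if "a \<in> K" for a
        using r[OF that] x(1) norm_triangle_ineq2[of x a] by (simp add: dist_norm)
      then have "1 \<le> infdist x K" using K(2) by (auto simp: infdist_def intro: cINF_greatest)
      then have "1 * 1 \<le> real n * infdist x K" using x(2) by (intro mult_mono) auto
      then show ?thesis by (simp add: \<phi>_def)
    qed
    show "0 \<le> \<phi> n x" "\<phi> n x \<le> 1" for n x by (auto simp: \<phi>_def infdist_nonneg)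
    show "(\<lambda>n. \<phi> n x) \<longlonglongrightarrow> indicator K x" for x
    proof (cases "x \<in> K")
      case False
      then have "infdist x K > 0" using K by (metis compact_imp_closed in_closed_iff_infdist_zero infdist_nonneg less_le)
      then obtain N where "1 < real N * infdist x K" using reals_Archimedean3 by blast
      have "\<phi> n x = 0" if "n \<ge> N" for n
      proof -
        have "real N * infdist x K \<le> real n * infdist x K" using that by (intro mult_right_mono infdist_nonneg) simp
        with \<open>1 < real N * infdist x K\<close> show ?thesis by (simp add: \<phi>_def)
      qed
      then have "\<forall>\<^sub>F n in sequentially. \<phi> n x = indicator K x" using False by (auto simp: eventually_sequentially)
      then show ?thesis by (rule tendsto_eventually)
    qed (simp add: \<phi>_def)
  qed
qed

lemma gauss_approx_compact:
  fixes K :: "'a::euclidean_space set"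
  assumes K: "compact K" shows "gauss_approx (\<lambda>x. indicator K x)"
proof (cases "K = {}")
  case False
  define \<phi> where "\<phi> n x = max 0 (1 - real n * infdist x K)" for n x
  obtain R where \<phi>: "\<And>n. continuous_on UNIV (\<phi> n)" "\<And>n x. norm x > R \<Longrightarrow> n > 0 \<Longrightarrow> \<phi> n x = 0"
    "\<And>n x. 0 \<le> \<phi> n x" "\<And>n x. \<phi> n x \<le> 1" "\<And>x. (\<lambda>n. \<phi> n x) \<longlonglongrightarrow> indicator K x"
    using tent_indicator[OF K False] unfolding \<phi>_def by blast
  have Km[measurable]: "K \<in> sets borel" using K by (simp add: borel_compact)
  show ?thesis
  proof (rule gauss_approxI_limit)
    show "gauss_approx (\<lambda>x. complex_of_real (\<phi> (Suc n) x))" for n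
      by (rule gauss_approx_Cc[OF \<phi>(1)]) (use \<phi>(2) in auto)
    show "(\<lambda>n. N2 (\<lambda>x. complex_of_real (\<phi> (Suc n) x) - indicator K x)) \<longlonglongrightarrow> 0"
    proof (rule N2_dominated)
      let ?S = "cball 0 R \<union> K"
      have c: "compact ?S" using K by auto
      show "(\<lambda>x. indicator ?S x :: complex) \<in> borel_measurable borel"
        by (intro borel_measurable_indicator) (simp add: borel_compact c)
      show "N2 (\<lambda>x. indicator ?S x :: complex) < \<infinity>"
        using emeasure_compact_finite[OF c] by (subst N2_indicator) (auto simp: borel_compact c)
      show "norm (complex_of_real (\<phi> (Suc n) x) - indicator K x) \<le> norm (indicator ?S x :: complex)" for n x
      proof -
        have "complex_of_real (\<phi> (Suc n) x) - indicator K x = of_real (\<phi> (Suc n) x - indicator K x)"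
          by (simp add: indicator_def)
        moreover have "\<bar>\<phi> (Suc n) x - indicator K x\<bar> \<le> 1"
          using \<phi>(3,4)[of "Suc n" x] by (cases "x \<in> K") simp_all
        moreover have "\<phi> (Suc n) x = 0 \<and> x \<notin> K" if "x \<notin> ?S"
          using \<phi>(2)[of x "Suc n"] that by simp
        ultimately show ?thesis by (cases "x \<in> ?S") (simp_all only: norm_of_real, simp_all)
      qed
      show "(\<lambda>n. complex_of_real (\<phi> (Suc n) x)) \<longlonglongrightarrow> indicator K x" for x
      proof -
        have "(\<lambda>n. complex_of_real (\<phi> (Suc n) x)) \<longlonglongrightarrow> of_real (indicator K x)"
          by (rule tendsto_of_real[OF LIMSEQ_Suc[OF \<phi>(5)]])
        then show ?thesis by (cases "x \<in> K") simp_all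
      qed
      show "(\<lambda>x. complex_of_real (\<phi> (Suc n) x)) \<in> borel_measurable borel" for n
        by (intro borel_measurable_continuous_onI continuous_intros \<phi>)
    qed auto
  qed auto
qed (simp add: gauss_approx_zero)

text \<open>By inner regularity of Lebesgue measure, indicators of compact subsets approximate the
  indicator in \<open>L\<^sup>2\<close>.\<close>

lemma gauss_approx_bounded_set:
  fixes A :: "'a::euclidean_space set"
  assumes A[measurable]: "A \<in> sets borel" and b: "bounded A" shows "gauss_approx (\<lambda>x. indicator A x)"
proof -
  have "\<exists>K. closed K \<and> K \<subseteq> A \<and> emeasure lborel (A - K) < ennreal (1 / Suc n)" for n
  proof -
    have "A \<in> sets lebesgue" using A by simp
    then obtain T where T: "closed T" "T \<subseteq> A" "emeasure lebesgue (A - T) < ennreal (1 / Suc n)"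
      by (rule sets_lebesgue_inner_closed[of A "1 / Suc n"]) auto
    have "A - T \<in> sets lborel" using T(1) A by auto
    then have "emeasure lebesgue (A - T) = emeasure lborel (A - T)" by simp
    then show ?thesis using T by (intro exI[of _ T]) simp
  qed
  then obtain K where K: "\<And>n. closed (K n)" "\<And>n. K n \<subseteq> A" "\<And>n. emeasure lborel (A - K n) < ennreal (1 / Suc n)" by metis
  show ?thesis
  proof (rule gauss_approxI_limit)
    show "gauss_approx (\<lambda>x. indicator (K n) x)" for n
      using K b by (intro gauss_approx_compact) (meson bounded_subset compact_eq_bounded_closed)
    have b: "N2 (\<lambda>x. indicator (K n) x - indicator A x :: complex) \<le> ennreal (1 / Suc n)" for n
    proof -
      have "N2 (\<lambda>x. indicator (K n) x - indicator A x :: complex) = N2 (\<lambda>x. indicator (A - K n) x)"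
        using K(2)[of n] by (intro N2_norm_cong) (auto simp: indicator_def)
      then show ?thesis using K(3)[of n] K(1)[of n] A by (subst (asm) N2_indicator) auto
    qed
    have l: "(\<lambda>n. ennreal (1 / Suc n)) \<longlonglongrightarrow> 0"
      using tendsto_ennrealI[OF LIMSEQ_inverse_real_of_nat] by (simp add: inverse_eq_divide)
    show "(\<lambda>n. N2 (\<lambda>x. indicator (K n) x - indicator A x :: complex)) \<longlonglongrightarrow> 0"
      by (rule tendsto_sandwich[OF _ always_eventually[OF allI[OF b]] tendsto_const l]) simp
    show "(\<lambda>x. indicator A x :: complex) \<in> borel_measurable borel" by simp
  qed
qed

text \<open>Simple functions truncated to balls converge to \<open>h\<close> and are dominated by a
  multiple of \<open>|h|\<close>.\<close>

lemma gauss_approx_L2: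
  fixes h :: "'a::euclidean_space \<Rightarrow> complex"
  assumes h: "h \<in> Lp 2" shows "gauss_approx h"
proof -
  have [measurable]: "h \<in> borel_measurable borel" using h by (simp add: Lp_2_iff)
  obtain s where s: "\<And>i. simple_function borel (s i)" "\<And>x. (\<lambda>i. s i x) \<longlonglongrightarrow> h x" "\<And>i x. norm (s i x) \<le> 2 * norm (h x)"
    using borel_measurable_implies_sequence_metric[of h borel 0] by (auto simp: dist_norm)
  define t where "t i x = indicator (cball 0 (real i)) x * s i x" for i x
  have [measurable]: "s i \<in> borel_measurable borel" for i using s(1) by (rule borel_measurable_simple_function)
  have t: "t i x = (\<Sum>y\<in>range (s i). y * indicator (s i -` {y} \<inter> cball 0 (real i)) x)" for i x
  proof -
    have f: "finite (range (s i))" using simple_functionD(1)[OF s(1)] by simp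
    have "(\<Sum>y\<in>range (s i). y * indicator (s i -` {y} \<inter> cball 0 (real i)) x)
      = (\<Sum>y\<in>range (s i). if y = s i x then s i x * indicator (cball 0 (real i)) x else 0)"
      by (intro sum.cong) (auto simp: indicator_def)
    then show ?thesis using f by (simp add: t_def mult.commute)
  qed
  show ?thesis
  proof (rule gauss_approxI_limit)
    show "gauss_approx (t i)" for i
      unfolding t[abs_def]
    proof (intro gauss_approx_sum gauss_approx_cmult gauss_approx_bounded_set)
      show "finite (range (s i))" using simple_functionD(1)[OF s(1)] by simp
      show "s i -` {y} \<inter> cball 0 (real i) \<in> sets borel" for y
        using simple_functionD(2)[OF s(1), of i "{y}"] by auto
    qed (auto intro: bounded_subset[OF bounded_cball])
    show "(\<lambda>n. N2 (\<lambda>x. t n x - h x)) \<longlonglongrightarrow> 0"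
    proof (rule N2_dominated)
      show "t n \<in> borel_measurable borel" for n unfolding t_def
        by (intro borel_measurable_times borel_measurable_indicator borel_measurable_simple_function s) simp
      show "norm (t n x - h x) \<le> norm (3 * h x)" for n x
        using s(3)[of n x] norm_triangle_ineq4[of "s n x" "h x"] by (auto simp: t_def indicator_def norm_mult)
      show "N2 (\<lambda>x. 3 * h x) < \<infinity>" using Lp_2_cmult[OF h, of 3] by (simp add: Lp_2_iff)
      show "(\<lambda>n. t n x) \<longlonglongrightarrow> h x" for x
      proof (rule Lim_transform_eventually[OF s(2)])
        obtain N :: nat where "norm x \<le> N" using real_arch_simple by blast
        then show "\<forall>\<^sub>F n in sequentially. s n x = t n x"
          by (auto simp: eventually_sequentially t_def indicator_def intro!: exI[of _ N])
      qed
    qed auto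
  qed auto
qed

lemma gauss_dense_L2:
  assumes "h \<in> Lp 2" "e > 0"
  obtains f F where "gauss_evolution f F" "N2 (\<lambda>x. h x - f x) < ennreal e"
  using gauss_approx_L2[OF assms(1)] assms(2) unfolding gauss_approx_def by blast

section \<open>The Fourier transform and the free group on \<open>L\<^sup>2\<close>\<close>

lemma fourier_integral_bounded_continuous:
  fixes f :: "'a::euclidean_space \<Rightarrow> complex"
  assumes f: "integrable lborel f"
  shows "continuous_on UNIV (fourier_integral f)"
    and "norm (fourier_integral f \<xi>) \<le> (2 * pi) powr (- (real DIM('a) / 2)) * (LINT x|lborel. norm (f x))"
proof -
  have [measurable]: "f \<in> borel_measurable borel" using f by auto
  show "continuous_on UNIV (fourier_integral f)"
    unfolding continuous_on_sequentially fourier_integral_def comp_def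
  proof (intro ballI allI impI tendsto_mult tendsto_const)
    fix X :: "nat \<Rightarrow> 'a" and a assume X: "(\<forall>n. X n \<in> UNIV) \<and> X \<longlonglongrightarrow> a"
    show "(\<lambda>n. LINT x|lborel. exp (- \<i> * of_real (x \<bullet> X n)) * f x) \<longlonglongrightarrow> (LINT x|lborel. exp (- \<i> * of_real (x \<bullet> a)) * f x)"
    proof (rule integral_dominated_convergence[where w="\<lambda>x. norm (f x)"])
      show "AE x in lborel. (\<lambda>n. exp (- \<i> * of_real (x \<bullet> X n)) * f x) \<longlonglongrightarrow> exp (- \<i> * of_real (x \<bullet> a)) * f x"
        using X by (intro AE_I2 tendsto_intros) auto
    qed (use f in \<open>auto simp: norm_mult\<close>)
  qed
  have "norm (LINT x|lborel. exp (- \<i> * of_real (x \<bullet> \<xi>)) * f x) \<le> (LINT x|lborel. norm (exp (- \<i> * of_real (x \<bullet> \<xi>)) * f x))"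
    by (rule integral_norm_bound)
  also have "\<dots> = (LINT x|lborel. norm (f x))" by (simp add: norm_mult)
  finally show "norm (fourier_integral f \<xi>) \<le> (2 * pi) powr (- (real DIM('a) / 2)) * (LINT x|lborel. norm (f x))"
    unfolding fourier_integral_def norm_mult by (intro mult_mono) auto
qed

text \<open>Bessel's inequality for the Fourier integral, by duality with Gaussians: approximate the
  truncation \<open>\<psi>\<^sub>n h\<close> of \<open>h = \<F> f\<close> by a profile
  \<open>\<gamma>\<close> with wave \<open>W\<close>. Then \<open>\<integral> |h|\<^sup>2
  \<psi>\<^sub>n \<approx> Re \<integral> h cnj \<gamma> = Re \<langle>f, W 0\<rangle> \<le> (N2 f +
  N2 \<gamma>) / 2\<close>, and \<open>N2 \<gamma>\<close> is at most about \<open>\<integral>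
  |h|\<^sup>2 \<psi>\<^sub>n\<close> again, which can be absorbed.\<close>

lemma N2_fourier_integral_le:
  fixes f :: "'a::euclidean_space \<Rightarrow> complex"
  assumes f: "integrable lborel f" "f \<in> Lp 2"
  shows "N2 (fourier_integral f) \<le> N2 f"
proof -
  define h where "h = fourier_integral f"
  have hc: "continuous_on UNIV h" unfolding h_def by (rule fourier_integral_bounded_continuous[OF f(1)])
  have hm [measurable]: "h \<in> borel_measurable borel" by (intro borel_measurable_continuous_onI hc)
  define B where "B = (2 * pi) powr (- (real DIM('a) / 2)) * (LINT x|lborel. norm (f x)) + 1"
  have B: "norm (h \<xi>) \<le> B" "B > 0" for \<xi>
  proof -
    show "norm (h \<xi>) \<le> B" using fourier_integral_bounded_continuous(2)[OF f(1), of \<xi>] by (simp add: B_def h_def)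
    show "B > 0" unfolding B_def by (intro add_nonneg_pos mult_nonneg_nonneg integral_nonneg_AE) auto
  qed
  define G :: "'a \<Rightarrow> real" where "G x = exp (- (x \<bullet> x))" for x
  have G: "integrable lborel G" unfolding G_def using integrable_real_gauss[of 1] by simp
  have [measurable]: "G \<in> borel_measurable borel" unfolding G_def by measurable
  have G01: "0 < G x" "G x \<le> 1" for x by (auto simp: G_def)
  define K where "K = (LINT x|lborel. G x)"
  have K: "K \<ge> 0" unfolding K_def using G01 by (intro integral_nonneg_AE) (auto intro: less_imp_le)
  define A where "A = enn2real (N2 f)"
  have A: "N2 f = ennreal A" "A \<ge> 0" using f(2) by (auto simp: A_def Lp_2_iff)
  \<comment> \<open>Continuous cut-offs, equal to one on the ball of radius \<open>n\<close>; they
    make the truncation of \<open>h\<close> compactly supported, as the weighted approximation by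
    Gaussians demands.\<close>
  define \<psi> :: "nat \<Rightarrow> 'a \<Rightarrow> real" where "\<psi> n x = max 0 (min 1 (real n + 1 - norm x))" for n x
  have \<psi>: "0 \<le> \<psi> n x" "\<psi> n x \<le> 1" for n x by (auto simp: \<psi>_def)
  have \<psi>c: "continuous_on UNIV (\<psi> n)" for n unfolding \<psi>_def by (intro continuous_intros)
  have \<psi>m [measurable]: "\<psi> n \<in> borel_measurable borel" for n by (intro borel_measurable_continuous_onI \<psi>c)
  have main: "(\<integral>\<^sup>+x. ennreal ((norm (h x))\<^sup>2 * \<psi> n x) \<partial>lborel) \<le> N2 f" for n
  proof -
    define X where "X = (LINT x|lborel. (norm (h x))\<^sup>2 * \<psi> n x)"
    have Xint: "integrable lborel (\<lambda>x. (norm (h x))\<^sup>2 * \<psi> n x)"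
    proof (rule Bochner_Integration.integrable_bound)
      show "integrable lborel (\<lambda>x::'a. B\<^sup>2 * indicator (cball 0 (real n + 1)) x :: real)"
        using emeasure_compact_finite[OF compact_cball, of "0::'a" "real n + 1"]
        by (intro integrable_mult_right integrable_real_indicator) auto
      have "(norm (h x))\<^sup>2 * \<psi> n x \<le> B\<^sup>2 * indicator (cball 0 (real n + 1)) x" for x
      proof (cases "x \<in> cball 0 (real n + 1)")
        case True
        have "(norm (h x))\<^sup>2 * \<psi> n x \<le> B\<^sup>2 * 1" using B \<psi> by (intro mult_mono power_mono) auto
        then show ?thesis using True by simp
      qed (simp add: \<psi>_def)
      then show "AE x in lborel. norm ((norm (h x))\<^sup>2 * \<psi> n x) \<le> norm (B\<^sup>2 * indicator (cball 0 (real n + 1)) x :: real)"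
        using \<psi> by (intro AE_I2) (simp add: abs_mult)
    qed measurable
    have bound: "X \<le> A + e * ((4 * B + e) * K)" if e: "e > 0" for e
    proof -
      have cR: "continuous_on UNIV (\<lambda>x. Re (h x) * \<psi> n x)" "continuous_on UNIV (\<lambda>x. Im (h x) * \<psi> n x)"
        by (intro continuous_intros hc \<psi>c)+
      have sR: "Re (h x) * \<psi> n x = 0" "Im (h x) * \<psi> n x = 0" if "norm x > real n + 1" for x using that by (auto simp: \<psi>_def)
      have e2: "e / 2 > 0" using e by simp
      obtain g1 where g1: "gauss_span g1" "\<And>x. \<bar>Re (h x) * \<psi> n x - g1 x\<bar> \<le> e / 2 * exp (- (x \<bullet> x))"
        using gauss_span_weighted_approx[OF cR(1) sR(1) e2] by blast
      obtain g2 where g2: "gauss_span g2" "\<And>x. \<bar>Im (h x) * \<psi> n x - g2 x\<bar> \<le> e / 2 * exp (- (x \<bullet> x))"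
        using gauss_span_weighted_approx[OF cR(2) sR(2) e2] by blast
      obtain G1 where G1: "gauss_evolution (\<lambda>x. of_real (g1 x)) G1" using gauss_evolution_of_span[OF g1(1)] by blast
      obtain G2 where G2: "gauss_evolution (\<lambda>x. of_real (g2 x)) G2" using gauss_evolution_of_span[OF g2(1)] by blast
      define \<gamma> where "\<gamma> x = of_real (g1 x) + \<i> * of_real (g2 x)" for x
      define W where "W t x = G1 t x + \<i> * G2 t x" for t x
      have ev: "gauss_evolution \<gamma> W" unfolding \<gamma>_def W_def
        by (intro gauss_evolution.add gauss_evolution.scale G1 G2)
      note R = gauss_evolution_regular[OF ev]
      have [measurable]: "\<gamma> \<in> borel_measurable borel" by (rule gauss_evolution_measurable[OF ev])
      have close: "norm (of_real (\<psi> n x) * h x - \<gamma> x) \<le> e * G x" for x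
      proof -
        have "of_real (\<psi> n x) * h x - \<gamma> x = Complex (Re (h x) * \<psi> n x - g1 x) (Im (h x) * \<psi> n x - g2 x)"
          by (simp add: complex_eq_iff \<gamma>_def mult.commute)
        also have "norm \<dots> \<le> \<bar>Re (h x) * \<psi> n x - g1 x\<bar> + \<bar>Im (h x) * \<psi> n x - g2 x\<bar>"
          by (rule order_trans[OF cmod_le]) simp
        also have "\<dots> \<le> e * G x" using g1(2)[of x] g2(2)[of x] by (simp add: G_def)
        finally show ?thesis .
      qed
      have hchi: "norm (of_real (\<psi> n x) * h x) \<le> B" for x
      proof -
        have "norm (of_real (\<psi> n x) * h x) \<le> 1 * B" unfolding norm_mult using \<psi>[of n x] B by (intro mult_mono) auto
        then show ?thesis by simp
      qed
      have int1: "integrable lborel (\<lambda>x. h x * cnj (\<gamma> x))"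
      proof (rule Bochner_Integration.integrable_bound[OF integrable_mult_right[OF R(1), of "of_real B"]])
        show "AE x in lborel. norm (h x * cnj (\<gamma> x)) \<le> norm (complex_of_real B * \<gamma> x)"
          using B by (intro AE_I2) (auto simp: norm_mult intro!: mult_right_mono)
      qed measurable
      have "\<bar>(norm (h x))\<^sup>2 * \<psi> n x - Re (h x * cnj (\<gamma> x))\<bar> \<le> B * (e * G x)" for x
      proof -
        have "of_real ((norm (h x))\<^sup>2 * \<psi> n x) - h x * cnj (\<gamma> x) = h x * cnj (of_real (\<psi> n x) * h x - \<gamma> x)"
          using complex_norm_square[of "h x"] by (simp add: algebra_simps)
        then have "\<bar>(norm (h x))\<^sup>2 * \<psi> n x - Re (h x * cnj (\<gamma> x))\<bar> \<le> norm (h x * cnj (of_real (\<psi> n x) * h x - \<gamma> x))"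
          by (metis Re_complex_of_real abs_Re_le_cmod minus_complex.simps(1))
        also have "\<dots> \<le> B * (e * G x)" unfolding norm_mult complex_mod_cnj using B close by (intro mult_mono) auto
        finally show ?thesis .
      qed
      then have "X \<le> (LINT x|lborel. Re (h x * cnj (\<gamma> x)) + B * e * G x)"
        unfolding X_def by (intro integral_mono Xint Bochner_Integration.integrable_add integrable_mult_right G integrable_Re int1)
          (smt (verit) mult.assoc)
      also have "\<dots> = (LINT x|lborel. Re (h x * cnj (\<gamma> x))) + B * e * K"
        unfolding K_def
        by (simp only: Bochner_Integration.integral_add[OF integrable_Re[OF int1] integrable_mult_right[OF G]] integral_mult_right_zero)
      also have "(LINT x|lborel. Re (h x * cnj (\<gamma> x))) = Re (LINT x|lborel. h x * cnj (\<gamma> x))"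
        by (rule integral_Re[OF int1])
      also have "(LINT x|lborel. h x * cnj (\<gamma> x)) = (LINT x|lborel. f x * fourier_integral (\<lambda>x. cnj (\<gamma> x)) x)"
        unfolding h_def by (rule fourier_multiplication[OF f(1)]) (intro integrable_cnj R)
      also have "\<dots> = L2_pairing f (W 0)"
        using fourier_cnj_gauss_evolution[OF ev, of 0] by (simp add: L2_pairing_def)
      also have "Re \<dots> \<le> norm (L2_pairing f (W 0))" by (rule complex_Re_le_cmod)
      also have "\<dots> \<le> (1 * enn2real (N2 f) + enn2real (N2 (W 0)) / 1) / 2"
        by (rule L2_pairing_bound) (use f R in auto)
      also have "N2 (W 0) = N2 \<gamma>" by (rule N2_gauss_evolution[OF ev])
      also have "enn2real (N2 \<gamma>) = (LINT x|lborel. (norm (\<gamma> x))\<^sup>2)"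
        using R(2) by (simp add: N2_eq_integral)
      also have "\<dots> \<le> (LINT x|lborel. (norm (h x))\<^sup>2 * \<psi> n x + (2 * e * B + e\<^sup>2) * G x)"
      proof (intro integral_mono N2_integrable R Bochner_Integration.integrable_add Xint integrable_mult_right G)
        fix x
        have "norm (\<gamma> x) \<le> norm (of_real (\<psi> n x) * h x) + e * G x"
          using close[of x] norm_triangle_ineq2[of "\<gamma> x" "of_real (\<psi> n x) * h x"] by (simp add: norm_minus_commute)
        then have "(norm (\<gamma> x))\<^sup>2 \<le> (norm (of_real (\<psi> n x) * h x) + e * G x)\<^sup>2" by (intro power_mono) auto
        also have "\<dots> = (norm (of_real (\<psi> n x) * h x))\<^sup>2 + 2 * e * G x * norm (of_real (\<psi> n x) * h x) + e\<^sup>2 * (G x * G x)"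
          by (simp add: power2_eq_square algebra_simps)
        also have "\<dots> \<le> (norm (h x))\<^sup>2 * \<psi> n x + 2 * e * G x * B + e\<^sup>2 * (G x * 1)"
        proof (intro add_mono mult_left_mono)
          have "(norm (of_real (\<psi> n x) * h x))\<^sup>2 = (norm (h x))\<^sup>2 * (\<psi> n x * \<psi> n x)"
            by (simp add: norm_mult power2_eq_square)
          also have "\<dots> \<le> (norm (h x))\<^sup>2 * (\<psi> n x * 1)" using \<psi> by (intro mult_left_mono) auto
          finally show "(norm (of_real (\<psi> n x) * h x))\<^sup>2 \<le> (norm (h x))\<^sup>2 * \<psi> n x" by simp
        qed (use hchi e G01 in \<open>auto intro: less_imp_le\<close>)
        finally show "(norm (\<gamma> x))\<^sup>2 \<le> (norm (h x))\<^sup>2 * \<psi> n x + (2 * e * B + e\<^sup>2) * G x" by (simp add: algebra_simps)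
      qed
      also have "\<dots> = X + (2 * e * B + e\<^sup>2) * K" unfolding X_def K_def using Xint G by simp
      finally have "X \<le> (A + (X + (2 * e * B + e\<^sup>2) * K)) / 2 + B * e * K" by (simp add: A_def)
      then show ?thesis by (simp add: field_simps power2_eq_square)
    qed
    have "X \<le> A"
    proof (rule tendsto_lowerbound)
      show "((\<lambda>e. A + e * ((4 * B + e) * K)) \<longlongrightarrow> A) (at_right 0)"
        by (rule tendsto_eq_intros refl | simp)+
      show "\<forall>\<^sub>F e in at_right 0. X \<le> A + e * ((4 * B + e) * K)"
        using bound by (auto simp: eventually_at_filter)
    qed simp
    moreover have "(\<integral>\<^sup>+x. ennreal ((norm (h x))\<^sup>2 * \<psi> n x) \<partial>lborel) = ennreal X"
      unfolding X_def using Xint \<psi> by (intro nn_integral_eq_integral) auto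
    ultimately show ?thesis by (simp add: A ennreal_leI)
  qed
  have "N2 h \<le> (\<integral>\<^sup>+x. liminf (\<lambda>n. ennreal ((norm (h x))\<^sup>2 * \<psi> n x)) \<partial>lborel)"
    unfolding N2_def
  proof (intro nn_integral_mono)
    fix x :: 'a
    obtain N :: nat where N: "norm x \<le> N" using real_arch_simple by blast
    have "\<forall>\<^sub>F n in sequentially. ennreal ((norm (h x))\<^sup>2 * \<psi> n x) = ennreal ((norm (h x))\<^sup>2)"
      unfolding eventually_sequentially
    proof (intro exI[of _ N] allI impI)
      fix n assume "N \<le> n"
      then have "\<psi> n x = 1" using N by (simp add: \<psi>_def)
      then show "ennreal ((norm (h x))\<^sup>2 * \<psi> n x) = ennreal ((norm (h x))\<^sup>2)" by simp
    qed
    from lim_imp_Liminf[OF _ tendsto_eventually[OF this]]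
    show "ennreal ((norm (h x))\<^sup>2) \<le> liminf (\<lambda>n. ennreal ((norm (h x))\<^sup>2 * \<psi> n x))" by simp
  qed
  also have "\<dots> \<le> liminf (\<lambda>n. \<integral>\<^sup>+x. ennreal ((norm (h x))\<^sup>2 * \<psi> n x) \<partial>lborel)"
    by (rule nn_integral_liminf) simp
  also have "\<dots> \<le> N2 f" by (rule Liminf_le) (use main in auto)
  finally show ?thesis by (simp add: h_def)
qed

abbreviation truncate_ball :: "nat \<Rightarrow> ('a::euclidean_space \<Rightarrow> complex) \<Rightarrow> 'a \<Rightarrow> complex" where
  "truncate_ball n f \<equiv> (\<lambda>x. indicator (cball 0 (real n)) x *\<^sub>R f x)"

lemma truncate_ball_regular:
  fixes f :: "'a::euclidean_space \<Rightarrow> complex"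
  assumes f: "f \<in> Lp 2"
  shows "truncate_ball n f \<in> Lp 2" "integrable lborel (truncate_ball n f)" "N2 (truncate_ball n f) \<le> N2 f"
proof -
  have [measurable]: "f \<in> borel_measurable borel" using f by (simp add: Lp_2_iff)
  show le: "N2 (truncate_ball n f) \<le> N2 f" by (rule N2_mono) (simp add: indicator_def)
  have m: "truncate_ball n f \<in> borel_measurable borel" 
    by (intro borel_measurable_scaleR borel_measurable_indicator) auto
  show L: "truncate_ball n f \<in> Lp 2" using le f m by (auto simp: Lp_2_iff intro: le_less_trans)
  have "(\<lambda>x::'a. indicator (cball 0 (real n)) x :: complex) \<in> Lp 2"
    using emeasure_compact_finite[OF compact_cball, of "0::'a" "real n"]
    unfolding Lp_2_iff by (intro conjI borel_measurable_indicator, simp) (subst N2_indicator, auto)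
  from L2_mult_integrable[OF this f] have "integrable lborel (\<lambda>x. indicator (cball 0 (real n)) x * f x)" .
  moreover have "(\<lambda>x. indicator (cball 0 (real n)) x * f x) = truncate_ball n f"
    by (auto simp: indicator_def fun_eq_iff)
  ultimately show "integrable lborel (truncate_ball n f)" by simp
qed

lemma N2_truncate_ball:
  fixes f :: "'a::euclidean_space \<Rightarrow> complex"
  assumes f: "f \<in> Lp 2"
  shows "(\<lambda>n. N2 (\<lambda>x. truncate_ball n f x - f x)) \<longlonglongrightarrow> 0"
proof (rule N2_dominated)
  show "truncate_ball n f \<in> borel_measurable borel" for n using truncate_ball_regular(1)[OF f] by (simp add: Lp_2_iff)
  show "f \<in> borel_measurable borel" using f by (simp add: Lp_2_iff)
  then show "f \<in> borel_measurable borel" .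
  show "N2 f < \<infinity>" using f by (simp add: Lp_2_iff)
  show "norm (truncate_ball n f x - f x) \<le> norm (f x)" for n x by (simp add: indicator_def)
  fix x :: 'a
  obtain N :: nat where N: "norm x \<le> N" using real_arch_simple by blast
  have "\<forall>\<^sub>F n in sequentially. truncate_ball n f x = f x"
    unfolding eventually_sequentially by (rule exI[of _ N]) (use N in \<open>auto simp: indicator_def\<close>)
  then show "(\<lambda>n. truncate_ball n f x) \<longlonglongrightarrow> f x" by (rule tendsto_eventually)
qed

lemma fourier_integral_measurable [measurable]:
  "integrable lborel f \<Longrightarrow> fourier_integral f \<in> borel_measurable borel"
  by (intro borel_measurable_continuous_onI fourier_integral_bounded_continuous)

lemma fourier_integral_Lp_2:
  "integrable lborel f \<Longrightarrow> f \<in> Lp 2 \<Longrightarrow> fourier_integral f \<in> Lp 2"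
  using N2_fourier_integral_le[of f] fourier_integral_measurable[of f] by (auto simp: Lp_2_iff intro: le_less_trans)

text \<open>The choice in the definition of \<open>fourier_L2\<close> succeeds: by Bessel's
  inequality the transforms of the truncations form a Cauchy sequence.\<close>

lemma fourier_L2_props:
  fixes f :: "'a::euclidean_space \<Rightarrow> complex"
  assumes f: "f \<in> Lp 2"
  shows "fourier_L2 f \<in> Lp 2"
    and "(\<lambda>n. N2 (\<lambda>\<xi>. fourier_integral (truncate_ball n f) \<xi> - fourier_L2 f \<xi>)) \<longlonglongrightarrow> 0"
proof -
  note T = truncate_ball_regular[OF f]
  have [measurable]: "f \<in> borel_measurable borel" "truncate_ball n f \<in> borel_measurable borel" for n
    using f T(1) by (auto simp: Lp_2_iff)
  obtain g where "g \<in> Lp 2" "(\<lambda>n. N2 (\<lambda>\<xi>. fourier_integral (truncate_ball n f) \<xi> - g \<xi>)) \<longlonglongrightarrow> 0"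
  proof (rule L2_complete[of "\<lambda>n. fourier_integral (truncate_ball n f)"])
    show "fourier_integral (truncate_ball n f) \<in> Lp 2" for n by (intro fourier_integral_Lp_2 T)
    fix e :: real assume e: "e > 0"
    have "\<forall>\<^sub>F n in sequentially. N2 (\<lambda>x. truncate_ball n f x - f x) < ennreal (e / 4)"
      using N2_truncate_ball[OF f] e by (simp add: ennreal_tendsto_0_iff)
    then obtain M where M: "\<And>n. n \<ge> M \<Longrightarrow> N2 (\<lambda>x. truncate_ball n f x - f x) < ennreal (e / 4)"
      by (auto simp: eventually_sequentially)
    have "N2 (\<lambda>x. fourier_integral (truncate_ball m f) x - fourier_integral (truncate_ball n f) x) < ennreal e"
      if "m \<ge> M" "n \<ge> M" for m n
    proof -
      have "N2 (\<lambda>x. fourier_integral (truncate_ball m f) x - fourier_integral (truncate_ball n f) x)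
        = N2 (fourier_integral (\<lambda>x. truncate_ball m f x - truncate_ball n f x))"
        using T by (intro N2_norm_cong) (simp add: fourier_integral_diff)
      also have "\<dots> \<le> N2 (\<lambda>x. truncate_ball m f x - truncate_ball n f x)"
        by (intro N2_fourier_integral_le Bochner_Integration.integrable_diff Lp_2_diff T)
      also have "\<dots> \<le> 2 * N2 (\<lambda>x. truncate_ball m f x - f x) + 2 * N2 (\<lambda>x. f x - truncate_ball n f x)"
        by (rule N2_diff_trans) measurable
      also have "\<dots> < 2 * ennreal (e / 4) + 2 * ennreal (e / 4)"
        using M[OF that(1)] M[OF that(2)]
        by (intro add_strict_mono ennreal_mult_strict_left_mono) (auto simp: N2_minus_commute[of f])
      also have "\<dots> = ennreal e" using e by (intro ennreal_quarters) simp
      finally show ?thesis .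
    qed
    then show "\<exists>M. \<forall>m\<ge>M. \<forall>n\<ge>M. N2 (\<lambda>x. fourier_integral (truncate_ball m f) x - fourier_integral (truncate_ball n f) x) < ennreal e"
      by blast
  qed blast
  then have "\<exists>g. g \<in> Lp 2 \<and> (\<lambda>n. Lp_norm 2 (\<lambda>\<xi>. fourier_integral (truncate_ball n f) \<xi> - g \<xi>)) \<longlonglongrightarrow> 0"
    unfolding Lp_norm_2_tendsto_0_iff by blast
  from someI_ex[OF this]
  have "fourier_L2 f \<in> Lp 2 \<and> (\<lambda>n. Lp_norm 2 (\<lambda>\<xi>. fourier_integral (truncate_ball n f) \<xi> - fourier_L2 f \<xi>)) \<longlonglongrightarrow> 0"
    unfolding fourier_L2_def[symmetric] .
  then show "fourier_L2 f \<in> Lp 2"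
    "(\<lambda>n. N2 (\<lambda>\<xi>. fourier_integral (truncate_ball n f) \<xi> - fourier_L2 f \<xi>)) \<longlonglongrightarrow> 0"
    unfolding Lp_norm_2_tendsto_0_iff by auto
qed

lemma N2_fourier_L2_diff_le:
  assumes f: "f \<in> Lp 2" and g: "g \<in> Lp 2"
  shows "N2 (\<lambda>\<xi>. fourier_L2 f \<xi> - fourier_L2 g \<xi>) \<le> 4 * N2 (\<lambda>x. f x - g x)"
proof (rule LIMSEQ_le_const)
  note F = fourier_L2_props[OF f] and G = fourier_L2_props[OF g]
  note Tf = truncate_ball_regular[OF f] and Tg = truncate_ball_regular[OF g]
  let ?a = "\<lambda>n. N2 (\<lambda>\<xi>. fourier_integral (truncate_ball n f) \<xi> - fourier_L2 f \<xi>)"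
  let ?b = "\<lambda>n. N2 (\<lambda>\<xi>. fourier_integral (truncate_ball n g) \<xi> - fourier_L2 g \<xi>)"
  have "(\<lambda>n. 2 * ?a n + 2 * (2 * N2 (\<lambda>x. f x - g x) + 2 * ?b n)) \<longlonglongrightarrow> 2 * 0 + 2 * (2 * N2 (\<lambda>x. f x - g x) + 2 * 0)"
    by (intro tendsto_add ennreal_tendsto_cmult tendsto_const F G) auto
  also have "2 * 0 + 2 * (2 * N2 (\<lambda>x. f x - g x) + 2 * 0) = 4 * N2 (\<lambda>x. f x - g x)"
    by (simp add: mult.assoc[symmetric])
  finally show "(\<lambda>n. 2 * ?a n + 2 * (2 * N2 (\<lambda>x. f x - g x) + 2 * ?b n)) \<longlonglongrightarrow> 4 * N2 (\<lambda>x. f x - g x)" .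
  have [measurable]: "fourier_L2 f \<in> borel_measurable borel" "fourier_L2 g \<in> borel_measurable borel"
    "fourier_integral (truncate_ball n f) \<in> borel_measurable borel" "fourier_integral (truncate_ball n g) \<in> borel_measurable borel" for n
    using F(1) G(1) fourier_integral_measurable[OF Tf(2)] fourier_integral_measurable[OF Tg(2)] by (auto simp: Lp_2_iff)
  have "N2 (\<lambda>\<xi>. fourier_L2 f \<xi> - fourier_L2 g \<xi>) \<le> 2 * ?a n + 2 * (2 * N2 (\<lambda>x. f x - g x) + 2 * ?b n)" for n
  proof -
    have "N2 (\<lambda>\<xi>. fourier_L2 f \<xi> - fourier_L2 g \<xi>)
      \<le> 2 * N2 (\<lambda>\<xi>. fourier_L2 f \<xi> - fourier_integral (truncate_ball n f) \<xi>)
        + 2 * N2 (\<lambda>\<xi>. fourier_integral (truncate_ball n f) \<xi> - fourier_L2 g \<xi>)"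
      by (rule N2_diff_trans) measurable
    also have "N2 (\<lambda>\<xi>. fourier_integral (truncate_ball n f) \<xi> - fourier_L2 g \<xi>)
      \<le> 2 * N2 (\<lambda>\<xi>. fourier_integral (truncate_ball n f) \<xi> - fourier_integral (truncate_ball n g) \<xi>) + 2 * ?b n"
      by (rule N2_diff_trans) measurable
    also have "N2 (\<lambda>\<xi>. fourier_integral (truncate_ball n f) \<xi> - fourier_integral (truncate_ball n g) \<xi>)
        = N2 (fourier_integral (\<lambda>x. truncate_ball n f x - truncate_ball n g x))"
      using Tf Tg by (intro N2_norm_cong) (simp add: fourier_integral_diff)
    also have "\<dots> \<le> N2 (\<lambda>x. truncate_ball n f x - truncate_ball n g x)"
      by (intro N2_fourier_integral_le Bochner_Integration.integrable_diff Lp_2_diff Tf Tg)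
    also have "\<dots> \<le> N2 (\<lambda>x. f x - g x)" by (rule N2_mono) (simp add: indicator_def)
    finally show ?thesis
      by (simp add: N2_minus_commute[of "fourier_L2 f"] add_left_mono mult_left_mono add_mono)
  qed
  then show "\<exists>N. \<forall>n\<ge>N. N2 (\<lambda>\<xi>. fourier_L2 f \<xi> - fourier_L2 g \<xi>) \<le> 2 * ?a n + 2 * (2 * N2 (\<lambda>x. f x - g x) + 2 * ?b n)"
    by blast
qed

lemma N2_diff_0_imp_AE:
  assumes "f \<in> borel_measurable borel" "g \<in> borel_measurable borel" "N2 (\<lambda>x. f x - g x) = 0"
  shows "AE x in lborel. f x = g x"
proof -
  have "(\<lambda>x. f x - g x) \<in> borel_measurable borel" using assms by measurable
  from N2_0_iff[OF this] assms(3) show ?thesis by auto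
qed

text \<open>For functions in both \<open>L\<^sup>1\<close> and \<open>L\<^sup>2\<close> the
  transforms of the truncations converge pointwise to the Fourier integral, and Fatou's lemma
  compares the two limits.\<close>

lemma fourier_L2_eq_integral:
  fixes f :: "'a::euclidean_space \<Rightarrow> complex"
  assumes f: "f \<in> Lp 2" "integrable lborel f"
  shows "AE \<xi> in lborel. fourier_L2 f \<xi> = fourier_integral f \<xi>"
proof -
  note F = fourier_L2_props[OF f(1)] and T = truncate_ball_regular[OF f(1)]
  have [measurable]: "fourier_L2 f \<in> borel_measurable borel" using F(1) by (simp add: Lp_2_iff)
  have m[measurable]: "fourier_integral (truncate_ball n f) \<in> borel_measurable borel" "fourier_integral f \<in> borel_measurable borel" for n
    using fourier_integral_measurable T(2) f(2) by auto
  have fm: "f \<in> borel_measurable borel" using f by (simp add: Lp_2_iff)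
  have lim: "(\<lambda>n. fourier_integral (truncate_ball n f) \<xi>) \<longlonglongrightarrow> fourier_integral f \<xi>" for \<xi>
    unfolding fourier_integral_def
  proof (intro tendsto_mult tendsto_const integral_dominated_convergence[where w="\<lambda>x. norm (f x)"])
    show "AE x in lborel. (\<lambda>n. exp (- \<i> * of_real (x \<bullet> \<xi>)) * truncate_ball n f x) \<longlonglongrightarrow> exp (- \<i> * of_real (x \<bullet> \<xi>)) * f x"
    proof (intro AE_I2 tendsto_mult tendsto_const)
      fix x :: 'a
      obtain N :: nat where N: "norm x \<le> N" using real_arch_simple by blast
      have "\<forall>\<^sub>F n in sequentially. truncate_ball n f x = f x"
        unfolding eventually_sequentially by (rule exI[of _ N]) (use N in \<open>auto simp: indicator_def\<close>)
      then show "(\<lambda>n. truncate_ball n f x) \<longlonglongrightarrow> f x" by (rule tendsto_eventually)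
    qed
    show "AE x in lborel. norm (exp (- \<i> * of_real (x \<bullet> \<xi>)) * truncate_ball n f x) \<le> norm (f x)" for n
      by (simp add: norm_mult indicator_def)
    show "(\<lambda>x. exp (- \<i> * of_real (x \<bullet> \<xi>)) * truncate_ball n f x) \<in> borel_measurable lborel" for n
      using integrable_fourier_integrand[OF T(2)] by (rule borel_measurable_integrable)
    show "(\<lambda>x. exp (- \<i> * of_real (x \<bullet> \<xi>)) * f x) \<in> borel_measurable lborel"
      using integrable_fourier_integrand[OF f(2)] by (rule borel_measurable_integrable)
  qed (use f in auto)
  have "N2 (\<lambda>\<xi>. fourier_integral f \<xi> - fourier_L2 f \<xi>) \<le> liminf (\<lambda>n. N2 (\<lambda>\<xi>. fourier_integral (truncate_ball n f) \<xi> - fourier_L2 f \<xi>))"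
    by (rule N2_le_liminf) (auto intro!: AE_I2 tendsto_diff lim)
  also have "\<dots> = 0" using lim_imp_Liminf[OF _ F(2)] by simp
  finally have "N2 (\<lambda>\<xi>. fourier_L2 f \<xi> - fourier_integral f \<xi>) = 0"
    by (simp add: N2_minus_commute[of "fourier_L2 f" "fourier_integral f"])
  then show ?thesis by (intro N2_diff_0_imp_AE) auto
qed

lemma fourier_L2_gauss_evolution:
  assumes ev: "gauss_evolution f F"
  shows "AE \<xi> in lborel. fourier_L2 (F t) \<xi> = exp (- \<i> * of_real (t * (norm \<xi>)\<^sup>2)) * f \<xi>"
    and "AE x in lborel. fourier_L2 (\<lambda>\<xi>. cnj (f \<xi>)) x = cnj (F 0 x)"
proof -
  note R = gauss_evolution_regular[OF ev]
  show "AE \<xi> in lborel. fourier_L2 (F t) \<xi> = exp (- \<i> * of_real (t * (norm \<xi>)\<^sup>2)) * f \<xi>"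
    using fourier_L2_eq_integral[OF R(5,4)] by (simp only: fourier_gauss_evolution[OF ev])
  show "AE x in lborel. fourier_L2 (\<lambda>\<xi>. cnj (f \<xi>)) x = cnj (F 0 x)"
    using fourier_L2_eq_integral[OF Lp_2_cnj[OF R(2)] integrable_cnj[OF R(1)]] fourier_cnj_gauss_evolution[OF ev, of 0] by simp
qed

text \<open>Fourier inversion on \<open>L\<^sup>2\<close>. It holds for Gaussians and both sides are
  continuous in \<open>L\<^sup>2\<close>.\<close>

lemma fourier_L2_cnj_fourier_L2:
  assumes k: "k \<in> Lp 2"
  shows "AE x in lborel. fourier_L2 (\<lambda>\<xi>. cnj (fourier_L2 k \<xi>)) x = cnj (k x)"
proof -
  let ?g = "\<lambda>\<xi>. cnj (fourier_L2 k \<xi>)"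
  have g: "?g \<in> Lp 2" by (intro Lp_2_cnj fourier_L2_props k)
  have ck: "(\<lambda>x. cnj (k x)) \<in> Lp 2" by (intro Lp_2_cnj k)
  have Fg: "fourier_L2 ?g \<in> Lp 2" by (rule fourier_L2_props(1)[OF g])
  have [measurable]: "k \<in> borel_measurable borel" "fourier_L2 ?g \<in> borel_measurable borel" using k Fg by (auto simp: Lp_2_iff)
  have "N2 (\<lambda>x. fourier_L2 ?g x - cnj (k x)) \<le> ennreal e" if e: "e > 0" for e
  proof -
    \<comment> \<open>The constant 34 = 2 * 16 + 2 collects two applications of the transform
      bound.\<close>
    have "e / 34 > 0" using e by simp
    then obtain f F where ev: "gauss_evolution f F" and ap: "N2 (\<lambda>x. cnj (k x) - f x) < ennreal (e / 34)"
      using gauss_dense_L2[OF ck] by blast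
    note R = gauss_evolution_regular[OF ev]
    have F0: "fourier_L2 (F 0) \<in> Lp 2" by (rule fourier_L2_props(1)[OF R(5)])
    have [measurable]: "f \<in> borel_measurable borel" "fourier_L2 (F 0) \<in> borel_measurable borel"
      using R F0 by (auto simp: Lp_2_iff)
    have a: "N2 (\<lambda>x. fourier_L2 (F 0) x - cnj (k x)) = N2 (\<lambda>x. cnj (k x) - f x)"
      using fourier_L2_gauss_evolution(1)[OF ev, of 0]
      by (subst N2_minus_commute) (intro N2_cong_AE, auto)
    have "N2 (\<lambda>x. ?g x - F 0 x) = N2 (\<lambda>x. fourier_L2 k x - cnj (F 0 x))"
      by (rule N2_norm_cong) (metis complex_cnj_cnj complex_cnj_diff complex_mod_cnj)
    also have "\<dots> = N2 (\<lambda>x. fourier_L2 k x - fourier_L2 (\<lambda>\<xi>. cnj (f \<xi>)) x)"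
      using fourier_L2_gauss_evolution(2)[OF ev] by (intro N2_cong_AE) auto
    also have "\<dots> \<le> 4 * N2 (\<lambda>x. k x - cnj (f x))"
      by (intro N2_fourier_L2_diff_le k Lp_2_cnj R)
    also have "N2 (\<lambda>x. k x - cnj (f x)) = N2 (\<lambda>x. cnj (k x) - f x)"
      by (rule N2_norm_cong) (metis complex_cnj_cnj complex_cnj_diff complex_mod_cnj)
    finally have b: "N2 (\<lambda>x. ?g x - F 0 x) \<le> 4 * N2 (\<lambda>x. cnj (k x) - f x)" .
    have "N2 (\<lambda>x. fourier_L2 ?g x - cnj (k x))
      \<le> 2 * N2 (\<lambda>x. fourier_L2 ?g x - fourier_L2 (F 0) x) + 2 * N2 (\<lambda>x. fourier_L2 (F 0) x - cnj (k x))"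
      by (rule N2_diff_trans) measurable
    also have "\<dots> \<le> 2 * (4 * (4 * N2 (\<lambda>x. cnj (k x) - f x))) + 2 * N2 (\<lambda>x. cnj (k x) - f x)"
      unfolding a using N2_fourier_L2_diff_le[OF g R(5)[of 0]] b
      by (intro add_mono mult_left_mono order_refl order_trans[OF N2_fourier_L2_diff_le[OF g R(5)[of 0]]]) auto
    also have "\<dots> = 34 * N2 (\<lambda>x. cnj (k x) - f x)" by (simp add: mult.assoc[symmetric] distrib_right[symmetric])
    also have "\<dots> \<le> 34 * ennreal (e / 34)" using ap by (intro mult_left_mono) auto
    also have "\<dots> = ennreal (34 * (e / 34))" by (subst ennreal_mult') simp_all
    finally show ?thesis by simp
  qed
  then have "N2 (\<lambda>x. fourier_L2 ?g x - cnj (k x)) = 0"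
    by (intro antisym[OF ennreal_le_epsilon]) auto
  then show ?thesis by (intro N2_diff_0_imp_AE) auto
qed

text \<open>The transform is bounded below, because by inversion the function is recovered from its
  transform by another (conjugated) transform.\<close>

lemma N2_diff_le_fourier_L2:
  assumes f: "f \<in> Lp 2" and g: "g \<in> Lp 2"
  shows "N2 (\<lambda>x. f x - g x) \<le> 4 * N2 (\<lambda>\<xi>. fourier_L2 f \<xi> - fourier_L2 g \<xi>)"
proof -
  have "N2 (\<lambda>x. f x - g x) = N2 (\<lambda>x. cnj (f x) - cnj (g x))"
    by (rule N2_norm_cong) (metis complex_cnj_diff complex_mod_cnj)
  also have "\<dots> = N2 (\<lambda>x. fourier_L2 (\<lambda>\<xi>. cnj (fourier_L2 f \<xi>)) x - fourier_L2 (\<lambda>\<xi>. cnj (fourier_L2 g \<xi>)) x)"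
    using fourier_L2_cnj_fourier_L2[OF f] fourier_L2_cnj_fourier_L2[OF g] by (intro N2_cong_AE) auto
  also have "\<dots> \<le> 4 * N2 (\<lambda>\<xi>. cnj (fourier_L2 f \<xi>) - cnj (fourier_L2 g \<xi>))"
    by (intro N2_fourier_L2_diff_le Lp_2_cnj fourier_L2_props f g)
  also have "N2 (\<lambda>\<xi>. cnj (fourier_L2 f \<xi>) - cnj (fourier_L2 g \<xi>)) = N2 (\<lambda>\<xi>. fourier_L2 f \<xi> - fourier_L2 g \<xi>)"
    by (rule N2_norm_cong) (metis complex_cnj_diff complex_mod_cnj)
  finally show ?thesis .
qed

lemma Lp_2_phase_mult:
  assumes "f \<in> Lp 2" shows "(\<lambda>\<xi>. exp (- \<i> * of_real (t * (norm \<xi>)\<^sup>2)) * f \<xi>) \<in> Lp 2"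
proof -
  have [measurable]: "f \<in> borel_measurable borel" using assms by (simp add: Lp_2_iff)
  have "N2 (\<lambda>\<xi>. exp (- \<i> * of_real (t * (norm \<xi>)\<^sup>2)) * f \<xi>) = N2 f"
    using norm_phase(1)[of "t * _"] by (intro N2_norm_cong) (simp add: norm_mult)
  then show ?thesis using assms by (simp add: Lp_2_iff)
qed

text \<open>The choice in the definition of \<open>free_schroedinger\<close> succeeds: a witness is
  the conjugated transform of the conjugate of \<open>exp (- \<i> t |\<xi>|\<^sup>2) \<F>
  v\<close>.\<close>

lemma free_schroedinger_props:
  assumes v: "v \<in> Lp 2"
  shows "free_schroedinger t v \<in> Lp 2"
    and "AE \<xi> in lborel. fourier_L2 (free_schroedinger t v) \<xi> = exp (- \<i> * of_real (t * (norm \<xi>)\<^sup>2)) * fourier_L2 v \<xi>"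
proof -
  define h where "h \<xi> = exp (- \<i> * of_real (t * (norm \<xi>)\<^sup>2)) * fourier_L2 v \<xi>" for \<xi>
  define w where "w \<xi> = cnj (fourier_L2 (\<lambda>\<xi>. cnj (h \<xi>)) \<xi>)" for \<xi>
  have h: "(\<lambda>\<xi>. cnj (h \<xi>)) \<in> Lp 2" unfolding h_def[abs_def] by (intro Lp_2_cnj Lp_2_phase_mult fourier_L2_props v)
  have "w \<in> Lp 2" unfolding w_def[abs_def] by (intro Lp_2_cnj fourier_L2_props h)
  moreover have "AE \<xi> in lborel. fourier_L2 w \<xi> = h \<xi>"
    using fourier_L2_cnj_fourier_L2[OF h] by (simp add: w_def[abs_def])
  ultimately have "\<exists>w. w \<in> Lp 2 \<and> (AE \<xi> in lborel. fourier_L2 w \<xi> = exp (- \<i> * of_real (t * (norm \<xi>)\<^sup>2)) * fourier_L2 v \<xi>)"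
    unfolding h_def by blast
  from someI_ex[OF this]
  have "free_schroedinger t v \<in> Lp 2 \<and> (AE \<xi> in lborel. fourier_L2 (free_schroedinger t v) \<xi> = exp (- \<i> * of_real (t * (norm \<xi>)\<^sup>2)) * fourier_L2 v \<xi>)"
    unfolding free_schroedinger_def[symmetric] .
  then show "free_schroedinger t v \<in> Lp 2"
    "AE \<xi> in lborel. fourier_L2 (free_schroedinger t v) \<xi> = exp (- \<i> * of_real (t * (norm \<xi>)\<^sup>2)) * fourier_L2 v \<xi>" by auto
qed

lemma N2_free_schroedinger_diff_le:
  assumes v: "v \<in> Lp 2" and ev: "gauss_evolution f F"
  shows "N2 (\<lambda>x. free_schroedinger t v x - F t x) \<le> 4 * N2 (\<lambda>\<xi>. fourier_L2 v \<xi> - f \<xi>)"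
proof -
  note R = gauss_evolution_regular[OF ev] and P = free_schroedinger_props[OF v, of t]
  have "N2 (\<lambda>x. free_schroedinger t v x - F t x) \<le> 4 * N2 (\<lambda>\<xi>. fourier_L2 (free_schroedinger t v) \<xi> - fourier_L2 (F t) \<xi>)"
    by (intro N2_diff_le_fourier_L2 P R)
  also have "N2 (\<lambda>\<xi>. fourier_L2 (free_schroedinger t v) \<xi> - fourier_L2 (F t) \<xi>)
    = N2 (\<lambda>\<xi>. exp (- \<i> * of_real (t * (norm \<xi>)\<^sup>2)) * fourier_L2 v \<xi> - exp (- \<i> * of_real (t * (norm \<xi>)\<^sup>2)) * f \<xi>)"
    using P(2) fourier_L2_gauss_evolution(1)[OF ev, of t] by (intro N2_cong_AE) auto
  also have "\<dots> = N2 (\<lambda>\<xi>. fourier_L2 v \<xi> - f \<xi>)"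
    using norm_phase(1)[of "t * _"] by (intro N2_norm_cong) (simp add: norm_mult flip: right_diff_distrib)
  finally show ?thesis .
qed

lemma fourier_L2_eq_0_imp:
  assumes v: "v \<in> Lp 2" and 0: "AE \<xi> in lborel. fourier_L2 v \<xi> = 0"
  shows "AE x in lborel. v x = 0"
proof -
  have z: "(\<lambda>x::'a. 0::complex) \<in> Lp 2" by (simp add: Lp_2_iff)
  have "AE \<xi> in lborel. fourier_L2 (\<lambda>x::'a. 0) \<xi> = 0"
    using fourier_L2_eq_integral[OF z] by (simp add: fourier_integral_def)
  with 0 have "N2 (\<lambda>\<xi>. fourier_L2 v \<xi> - fourier_L2 (\<lambda>x. 0) \<xi>) = N2 (\<lambda>x::'a. 0)"
    by (intro N2_cong_AE) auto
  with N2_diff_le_fourier_L2[OF v z] have "N2 v = 0" by simp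
  then show ?thesis using N2_0_iff[of v] v by (simp add: Lp_2_iff)
qed

section \<open>Large-time asymptotics of the free evolution\<close>

lemma nn_integral_lborel_scale:
  fixes f :: "'a::euclidean_space \<Rightarrow> ennreal"
  assumes "c > 0" and [measurable]: "f \<in> borel_measurable borel"
  shows "(\<integral>\<^sup>+x. f ((1 / c) *\<^sub>R x) \<partial>lborel) = ennreal (c ^ DIM('a)) * (\<integral>\<^sup>+x. f x \<partial>lborel)"
proof -
  have "(\<integral>\<^sup>+x. f ((1 / c) *\<^sub>R x) \<partial>lborel)
    = (\<integral>\<^sup>+x. f ((1 / c) *\<^sub>R x) \<partial>density (distr lborel borel (\<lambda>x. 0 + c *\<^sub>R x)) (\<lambda>_. ennreal (\<bar>c\<bar> ^ DIM('a))))"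
    using lborel_affine[of c "0::'a"] assms(1) by simp
  also have "\<dots> = (\<integral>\<^sup>+x. ennreal (c ^ DIM('a)) * f x \<partial>lborel)"
    using assms(1) by (simp add: nn_integral_density nn_integral_distr)
  also have "\<dots> = ennreal (c ^ DIM('a)) * (\<integral>\<^sup>+x. f x \<partial>lborel)" by (rule nn_integral_cmult) simp
  finally show ?thesis .
qed

lemma integral_lborel_scale:
  fixes f :: "'a::euclidean_space \<Rightarrow> complex"
  assumes "c > 0" and [measurable]: "f \<in> borel_measurable borel"
  shows "(LINT x|lborel. f ((1 / c) *\<^sub>R x)) = of_real (c ^ DIM('a)) * (LINT x|lborel. f x)"
proof -
  have "(LINT x|lborel. f ((1 / c) *\<^sub>R x))
    = (LINT x|density (distr lborel borel (\<lambda>x. 0 + c *\<^sub>R x)) (\<lambda>_. ennreal (\<bar>c\<bar> ^ DIM('a))). f ((1 / c) *\<^sub>R x))"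
    using lborel_affine[of c "0::'a"] assms(1) by simp
  also have "\<dots> = (LINT x|lborel. (c ^ DIM('a)) *\<^sub>R f x)"
    using assms(1) by (subst integral_density) (simp_all add: integral_distr)
  finally show ?thesis by (simp add: scaleR_conv_of_real)
qed

text \<open>The large-time approximation \<open>(2 \<i> t)\<^sup>-\<^sup>d\<^sup>/\<^sup>2 exp (\<i>
  |x|\<^sup>2 / 4t) h (x / 2t)\<close> of the free wave with Fourier transform \<open>h\<close> (the
  Dollard decomposition of the propagator).\<close>

definition dollard :: "real \<Rightarrow> ('a::euclidean_space \<Rightarrow> complex) \<Rightarrow> 'a \<Rightarrow> complex" where
  "dollard t h x = of_real ((1 / sqrt t) ^ DIM('a)) * (1 / csqrt (2 * \<i>)) ^ DIM('a)
     * exp (\<i> * of_real ((norm x)\<^sup>2 / (4 * t))) * h ((1 / (2 * t)) *\<^sub>R x)"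

lemma norm_dollard:
  assumes "t > 0"
  shows "norm (dollard t h x) = (1 / sqrt (2 * t)) ^ DIM('a) * norm (h ((1 / (2 * t)) *\<^sub>R (x::'a::euclidean_space)))"
proof -
  have "norm (csqrt (2 * \<i>)) = sqrt 2" by (simp add: norm_mult)
  then show ?thesis using assms
    by (simp add: dollard_def norm_mult norm_power norm_divide real_sqrt_mult power_divide power_mult_distrib)
qed

lemma borel_measurable_scaled:
  fixes h :: "'a::euclidean_space \<Rightarrow> 'b::topological_space"
  assumes "h \<in> borel_measurable borel"
  shows "(\<lambda>x. h (c *\<^sub>R x)) \<in> borel_measurable borel"
  by (rule measurable_compose[OF _ assms]) simp

lemma dollard_measurable [measurable]:
  assumes "h \<in> borel_measurable borel" shows "dollard t h \<in> borel_measurable borel"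
  unfolding dollard_def[abs_def]
  by (intro borel_measurable_times borel_measurable_scaled[OF assms]) (auto intro!: borel_measurable_continuous_onI continuous_intros)

text \<open>The map \<open>h \<mapsto> dollard t h\<close> is an isometry, which lets the
  asymptotics be extended from Gaussians by density.\<close>

lemma N2_dollard:
  fixes h :: "'a::euclidean_space \<Rightarrow> complex"
  assumes t: "t > 0" and [measurable]: "h \<in> borel_measurable borel"
  shows "N2 (dollard t h) = N2 h"
proof -
  have p: "((1 / sqrt (2 * t)) ^ DIM('a))\<^sup>2 * (2 * t) ^ DIM('a) = 1"
  proof -
    have "((1 / sqrt (2 * t)) ^ DIM('a))\<^sup>2 = ((1 / sqrt (2 * t))\<^sup>2) ^ DIM('a)"
      by (simp only: power_mult[symmetric] mult.commute)
    also have "(1 / sqrt (2 * t))\<^sup>2 = 1 / (2 * t)" using t by (simp add: power_divide)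
    finally show ?thesis using t by (simp only: power_mult_distrib[symmetric]) simp
  qed
  have "N2 (dollard t h) = (\<integral>\<^sup>+x. ennreal (((1 / sqrt (2 * t)) ^ DIM('a))\<^sup>2) * ennreal ((norm (h ((1 / (2 * t)) *\<^sub>R x)))\<^sup>2) \<partial>lborel)"
    unfolding N2_def norm_dollard[OF t] power_mult_distrib by (simp add: ennreal_mult)
  also have "\<dots> = ennreal (((1 / sqrt (2 * t)) ^ DIM('a))\<^sup>2) * (\<integral>\<^sup>+x. ennreal ((norm (h ((1 / (2 * t)) *\<^sub>R x)))\<^sup>2) \<partial>lborel)"
    by (rule nn_integral_cmult) (use borel_measurable_scaled[OF assms(2)] in measurable)
  also have "(\<integral>\<^sup>+x. ennreal ((norm (h ((1 / (2 * t)) *\<^sub>R x)))\<^sup>2) \<partial>lborel) = ennreal ((2 * t) ^ DIM('a)) * N2 h"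
    unfolding N2_def using t by (subst nn_integral_lborel_scale) auto
  also have "ennreal (((1 / sqrt (2 * t)) ^ DIM('a))\<^sup>2) * (ennreal ((2 * t) ^ DIM('a)) * N2 h)
    = ennreal (((1 / sqrt (2 * t)) ^ DIM('a))\<^sup>2 * (2 * t) ^ DIM('a)) * N2 h"
  proof -
    have "0 \<le> ((1 / sqrt (2 * t)) ^ DIM('a))\<^sup>2" "0 \<le> (2 * t) ^ DIM('a)" using t by auto
    from ennreal_mult[OF this] show ?thesis by (simp only: mult.assoc)
  qed
  finally show ?thesis by (simp only: p) simp
qed

lemma dollard_diff: "dollard t (\<lambda>x. f x - g x) x = dollard t f x - dollard t g x"
  by (simp add: dollard_def right_diff_distrib)

text \<open>Uniform smallness at the scale \<open>t\<^sup>-\<^sup>d\<^sup>/\<^sup>2\<close> of the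
  wave itself, with Gaussian decay in the rescaled variable. The decay makes the same estimate
  usable in \<open>L\<^sup>2\<close>.\<close>

definition asymptotic_profile :: "('a::euclidean_space \<Rightarrow> complex) \<Rightarrow> (real \<Rightarrow> 'a \<Rightarrow> complex) \<Rightarrow> bool" where
  "asymptotic_profile f F \<longleftrightarrow> (\<exists>c \<omega>. c > 0 \<and> (\<omega> \<longlongrightarrow> 0) at_top \<and> (\<forall>\<^sub>F t in at_top. \<forall>x.
     norm (F t x - dollard t f x) \<le> (1 / sqrt t) ^ DIM('a) * \<omega> t * exp (- c * (((1 / (2 * t)) *\<^sub>R x) \<bullet> ((1 / (2 * t)) *\<^sub>R x)))))"

text \<open>An exponential with \<open>Re \<rho> \<in> [1/2, 1]\<close> is controlled by the two end
  points, whatever the sign of \<open>q\<close>.\<close>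

lemma norm_exp_mult_le:
  assumes "1 / 2 \<le> Re \<rho>" "Re \<rho> \<le> 1"
  shows "norm (exp (\<rho> * of_real q)) \<le> exp (q / 2) + exp q"
proof -
  have n: "norm (exp (\<rho> * of_real q)) = exp (Re \<rho> * q)" by (simp add: norm_exp_eq_Re)
  show ?thesis
proof (cases "q \<ge> 0")
  case True
  have "Re \<rho> * q \<le> 1 * q" using True assms by (intro mult_right_mono) auto
  then have "exp (Re \<rho> * q) \<le> exp q" by simp
  then show ?thesis using exp_ge_zero[of "q / 2"] unfolding n by linarith
next
  case False
  have "Re \<rho> * q \<le> 1 / 2 * q" using False assms by (intro mult_right_mono_neg) auto
  then have "exp (Re \<rho> * q) \<le> exp (q / 2)" by simp
  then show ?thesis using exp_ge_zero[of q] unfolding n by linarith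
qed
qed

lemma norm_exp_mult_diff_le:
  assumes "1 / 2 \<le> Re \<rho>" "Re \<rho> \<le> 1"
  shows "norm (exp (\<rho> * of_real q) - exp (of_real q)) \<le> norm (\<rho> - 1) * (\<bar>q\<bar> * (exp (q / 2) + exp q))"
proof -
  define g where "g s = exp ((1 + of_real s * (\<rho> - 1)) * of_real q)" for s :: real
  have "norm (g 1 - g 0) \<le> (norm (\<rho> - 1) * (\<bar>q\<bar> * (exp (q / 2) + exp q))) * \<bar>1 - 0\<bar>"
  proof (rule has_vector_derivative_lipschitz[where S="{0..1}" and g'="\<lambda>s. (\<rho> - 1) * of_real q * g s"])
    show "(g has_vector_derivative (\<rho> - 1) * of_real q * g s) (at s)" for s
    proof -
      have "((\<lambda>z. exp ((1 + z * (\<rho> - 1)) * of_real q)) has_field_derivative (\<rho> - 1) * of_real q * g s) (at (of_real s))"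
        unfolding g_def by (rule derivative_eq_intros refl)+ (simp add: algebra_simps)
      from has_vector_derivative_real_field[OF this] show ?thesis by (simp add: g_def[abs_def])
    qed
    show "norm ((\<rho> - 1) * of_real q * g s) \<le> norm (\<rho> - 1) * (\<bar>q\<bar> * (exp (q / 2) + exp q))" if s: "s \<in> {0..1}" for s
    proof -
      have "Re (1 + of_real s * (\<rho> - 1)) = 1 - s * (1 - Re \<rho>)" by (simp add: algebra_simps)
      moreover have "s * (1 - Re \<rho>) \<le> 1 * (1 - Re \<rho>)" by (rule mult_right_mono) (use s assms in auto)
      moreover have "0 \<le> s * (1 - Re \<rho>)" by (rule mult_nonneg_nonneg) (use s assms in auto)
      ultimately have "norm (g s) \<le> exp (q / 2) + exp q"
        unfolding g_def using assms by (intro norm_exp_mult_le) auto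
      then show ?thesis unfolding norm_mult mult.assoc by (auto intro!: mult_left_mono)
    qed
  qed auto
  then show ?thesis by (simp add: g_def)
qed

text \<open>Part of the decay of \<open>exp q\<close> as \<open>q \<rightarrow> -\<infinity>\<close>
  is spent on the factor \<open>|q|\<close>; \<open>exp (q/4)\<close> remains.\<close>

lemma exp_quarter_bound:
  fixes q M :: real
  assumes "q \<le> M" "M \<ge> 0"
  shows "exp (q / 2) + exp q \<le> (2 * exp M) * exp (q / 4)" "\<bar>q\<bar> * (exp (q / 2) + exp q) \<le> (8 + 2 * M * exp M) * exp (q / 4)"
proof -
  have 1: "exp (q / 2) \<le> exp M * exp (q / 4)" "exp q \<le> exp M * exp (q / 4)"
    using assms unfolding exp_add[symmetric] by (auto simp: field_simps)
  then show "exp (q / 2) + exp q \<le> (2 * exp M) * exp (q / 4)" by linarith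
  show "\<bar>q\<bar> * (exp (q / 2) + exp q) \<le> (8 + 2 * M * exp M) * exp (q / 4)"
  proof (cases "q \<ge> 0")
    case True
    have "q * (exp (q / 2) + exp q) \<le> M * (2 * exp M * exp (q / 4))"
      using True assms 1 by (intro mult_mono) auto
    also have "\<dots> \<le> (8 + 2 * M * exp M) * exp (q / 4)" by (simp add: algebra_simps)
    finally show ?thesis using True by simp
  next
    case False
    have "- q / 4 \<le> exp (- q / 4)" using exp_ge_add_one_self[of "- q / 4"] by linarith
    then have "\<bar>q\<bar> \<le> 4 * exp (- q / 4)" using False by simp
    moreover have "exp (q / 2) + exp q \<le> 2 * exp (q / 2)" using False by simp
    ultimately have "\<bar>q\<bar> * (exp (q / 2) + exp q) \<le> (4 * exp (- q / 4)) * (2 * exp (q / 2))" by (intro mult_mono) auto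
    also have "\<dots> = 8 * (exp (- q / 4) * exp (q / 2))" by simp
    also have "exp (- q / 4) * exp (q / 2) = exp (q / 4)" unfolding exp_add[symmetric] by simp
    also have "8 * exp (q / 4) \<le> (8 + 2 * M * exp M) * exp (q / 4)" using assms by (intro mult_right_mono) auto
    finally show ?thesis .
  qed
qed

text \<open>With \<open>\<xi> = x / 2t\<close> the explicit Gaussian factors exactly into the chirp
  of \<open>dollard\<close> and corrections that tend to \<open>1\<close>, since \<open>\<i> t / (a
  + \<i> t) \<rightarrow> 1\<close>.\<close>

lemma gauss_wave_factor:
  fixes p x :: "'a::euclidean_space"
  assumes a: "a > 0" and t: "t > 0"
  defines "\<xi> \<equiv> (1 / (2 * t)) *\<^sub>R x" and "\<alpha> \<equiv> Complex a t"
  shows "gauss_wave a p t x = of_real ((1 / sqrt t) ^ DIM('a)) * (1 / csqrt (2 * Complex (a / t) 1)) ^ DIM('a)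
     * exp (\<i> * of_real ((norm x)\<^sup>2 / (4 * t))) * (exp (of_real (p \<bullet> p) / (4 * \<alpha>))
     * exp ((\<i> * of_real t / \<alpha>) * of_real (- a * (\<xi> \<bullet> \<xi>) + p \<bullet> \<xi>)))"
proof -
  have \<alpha>: "\<alpha> \<noteq> 0" "\<alpha> = of_real a + \<i> * of_real t" using a by (auto simp: \<alpha>_def complex_eq_iff)
  have x: "x = (2 * t) *\<^sub>R \<xi>" using t by (simp add: \<xi>_def)
  have n: "(norm x)\<^sup>2 / (4 * t) = t * (\<xi> \<bullet> \<xi>)"
    using t unfolding x by (simp add: power_mult_distrib dot_square_norm) (simp add: power2_eq_square)
  have xx: "x \<bullet> x = 4 * t\<^sup>2 * (\<xi> \<bullet> \<xi>)" "p \<bullet> x = 2 * t * (p \<bullet> \<xi>)" unfolding x by (auto simp: power2_eq_square)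
  have "2 * \<alpha> = of_real t * (2 * Complex (a / t) 1)" using t by (simp add: \<alpha>_def complex_eq_iff)
  then have c: "csqrt (2 * \<alpha>) = of_real (sqrt t) * csqrt (2 * Complex (a / t) 1)"
    by (simp only: csqrt_of_nonneg_mult[OF t])
  have "(of_real (p \<bullet> p - x \<bullet> x) + 2 * \<i> * of_real (p \<bullet> x)) / (4 * \<alpha>)
    = \<i> * of_real ((norm x)\<^sup>2 / (4 * t)) + (of_real (p \<bullet> p) / (4 * \<alpha>) + (\<i> * of_real t / \<alpha>) * of_real (- a * (\<xi> \<bullet> \<xi>) + p \<bullet> \<xi>))"
    unfolding n xx using \<alpha>(1) by (simp add: field_simps) (simp add: \<alpha>(2) algebra_simps power2_eq_square)
  then show ?thesis
    unfolding gauss_wave_def \<alpha>_def[symmetric] c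
    by (simp add: exp_add power_mult_distrib power_divide mult.assoc)
qed

lemma asymptotic_profile_gauss:
  fixes p :: "'a::euclidean_space"
  assumes a: "a > 0"
  shows "asymptotic_profile (gauss_profile a p) (gauss_wave a p)"
proof -
  define \<kappa> where "\<kappa> = (1 / csqrt (2 * \<i>)) ^ DIM('a)"
  define k where "k t = (1 / csqrt (2 * Complex (a / t) 1)) ^ DIM('a) * exp (of_real (p \<bullet> p) / (4 * Complex a t))" for t
  define \<rho> where "\<rho> t = \<i> * of_real t / Complex a t" for t
  define M where "M = (norm p)\<^sup>2 / (2 * a)"
  have M: "M \<ge> 0" using a by (simp add: M_def)
  define q where "q \<xi> = - a * (\<xi> \<bullet> \<xi>) + p \<bullet> \<xi>" for \<xi> :: 'a
  have qM: "q \<xi> \<le> M + - (a / 2) * (\<xi> \<bullet> \<xi>)" for \<xi>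
    using gauss_le[OF a, of \<xi> p] unfolding q_def M_def by (simp flip: exp_add)
  have qM': "q \<xi> \<le> M" for \<xi>
  proof -
    have "- (a / 2) * (\<xi> \<bullet> \<xi>) \<le> 0" using a by (simp add: mult_nonneg_nonneg)
    then show ?thesis using qM[of \<xi>] by linarith
  qed
  define \<omega> where "\<omega> t = (norm (k t - \<kappa>) * (2 * exp M) + norm \<kappa> * (norm (\<rho> t - 1) * (8 + 2 * M * exp M))) * exp (M / 4)" for t
  have lim0: "((\<lambda>t. a / t) \<longlongrightarrow> 0) at_top" by real_asymp
  have \<rho>_eq: "\<rho> t = \<i> / (of_real (a / t) + \<i>)" "of_real (p \<bullet> p) / (4 * Complex a t) = (of_real (1 / t)) * of_real (p \<bullet> p) / (4 * (of_real (a / t) + \<i>))" if "t > 0" for t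
  proof -
    have "Complex a t = of_real t * (of_real (a / t) + \<i>)" using that by (simp add: complex_eq_iff)
    then show "\<rho> t = \<i> / (of_real (a / t) + \<i>)"
      "of_real (p \<bullet> p) / (4 * Complex a t) = (of_real (1 / t)) * of_real (p \<bullet> p) / (4 * (of_real (a / t) + \<i>))"
      using that by (auto simp: \<rho>_def)
  qed
  have "((\<lambda>t. \<i> / (of_real (a / t) + \<i>)) \<longlongrightarrow> \<i> / (of_real 0 + \<i>)) at_top"
    by (intro tendsto_intros lim0) auto
  then have l1: "((\<lambda>t. \<i> / (of_real (a / t) + \<i>)) \<longlongrightarrow> 1) at_top" by simp
  have \<rho>lim: "(\<rho> \<longlongrightarrow> 1) at_top"
    by (rule Lim_transform_eventually[OF l1], use eventually_gt_at_top[of 0] in eventually_elim) (simp add: \<rho>_eq)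
  have klim: "(k \<longlongrightarrow> \<kappa>) at_top"
  proof -
    have "isCont csqrt (2 * (of_real 0 + \<i>))" by (intro continuous_at_csqrt) (auto simp: complex_nonpos_Reals_iff)
    then have "((\<lambda>t. csqrt (2 * (of_real (a / t) + \<i>))) \<longlongrightarrow> csqrt (2 * (of_real 0 + \<i>))) at_top"
      by (rule isCont_tendsto_compose) (intro tendsto_intros lim0)
    moreover have "((\<lambda>t. 1 / t :: real) \<longlongrightarrow> 0) at_top" by real_asymp
    ultimately have "((\<lambda>t. (1 / csqrt (2 * (of_real (a / t) + \<i>))) ^ DIM('a) * exp ((of_real (1 / t)) * of_real (p \<bullet> p) / (4 * (of_real (a / t) + \<i>))))
      \<longlongrightarrow> (1 / csqrt (2 * (of_real 0 + \<i>))) ^ DIM('a) * exp (of_real 0 * of_real (p \<bullet> p) / (4 * (of_real 0 + \<i>)))) at_top"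
      by (intro tendsto_intros lim0) auto
    then have l: "((\<lambda>t. (1 / csqrt (2 * (of_real (a / t) + \<i>))) ^ DIM('a) * exp ((of_real (1 / t)) * of_real (p \<bullet> p) / (4 * (of_real (a / t) + \<i>)))) \<longlongrightarrow> \<kappa>) at_top"
      by (simp add: \<kappa>_def)
    show ?thesis
    proof (rule Lim_transform_eventually[OF l], use eventually_gt_at_top[of 0] in eventually_elim)
      case (elim t)
      have "Complex (a / t) 1 = of_real (a / t) + \<i>" by (simp add: complex_eq_iff)
      then show ?case unfolding k_def \<rho>_eq(2)[OF elim] by simp
    qed
  qed
  have "(\<omega> \<longlongrightarrow> (norm (\<kappa> - \<kappa>) * (2 * exp M) + norm \<kappa> * (norm (1 - 1 :: complex) * (8 + 2 * M * exp M))) * exp (M / 4)) at_top"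
    unfolding \<omega>_def by (intro tendsto_intros klim \<rho>lim)
  then have \<omega>lim: "(\<omega> \<longlongrightarrow> 0) at_top" by simp
  have bound: "norm (gauss_wave a p t x - dollard t (gauss_profile a p) x)
      \<le> (1 / sqrt t) ^ DIM('a) * \<omega> t * exp (- (a / 8) * (((1 / (2 * t)) *\<^sub>R x) \<bullet> ((1 / (2 * t)) *\<^sub>R x)))"
    if t: "t \<ge> a" "t > 0" for t x
  proof -
    define \<xi> where "\<xi> = (1 / (2 * t)) *\<^sub>R x"
    have Re\<rho>: "Re (\<rho> t) = t\<^sup>2 / (a\<^sup>2 + t\<^sup>2)" using a t by (simp add: \<rho>_def Re_divide power2_eq_square)
    have pos: "a\<^sup>2 + t\<^sup>2 > 0" using a by (simp add: add_pos_nonneg)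
    have "a\<^sup>2 \<le> t\<^sup>2" using a t by (intro power_mono) auto
    then have R: "1 / 2 \<le> Re (\<rho> t)" "Re (\<rho> t) \<le> 1" unfolding Re\<rho> using pos by (auto simp: field_simps)
    have "gauss_wave a p t x - dollard t (gauss_profile a p) x
      = of_real ((1 / sqrt t) ^ DIM('a)) * exp (\<i> * of_real ((norm x)\<^sup>2 / (4 * t)))
        * ((k t - \<kappa>) * exp (\<rho> t * of_real (q \<xi>)) + \<kappa> * (exp (\<rho> t * of_real (q \<xi>)) - exp (of_real (q \<xi>))))"
      unfolding gauss_wave_factor[OF a t(2)] dollard_def gauss_profile_def q_def \<xi>_def k_def \<kappa>_def \<rho>_def exp_of_real[symmetric]
      by (simp only: algebra_simps)
    also have "norm \<dots> = (1 / sqrt t) ^ DIM('a)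
        * norm ((k t - \<kappa>) * exp (\<rho> t * of_real (q \<xi>)) + \<kappa> * (exp (\<rho> t * of_real (q \<xi>)) - exp (of_real (q \<xi>))))"
      using t by (simp add: norm_mult norm_power norm_divide del: of_real_divide of_real_power)
    also have "\<dots> \<le> (1 / sqrt t) ^ DIM('a) * (norm (k t - \<kappa>) * norm (exp (\<rho> t * of_real (q \<xi>))) + norm \<kappa> * norm (exp (\<rho> t * of_real (q \<xi>)) - exp (of_real (q \<xi>))))"
      using t by (intro mult_left_mono norm_triangle_le) (auto simp: norm_mult)
    also have "\<dots> \<le> (1 / sqrt t) ^ DIM('a) * (norm (k t - \<kappa>) * ((2 * exp M) * exp (q \<xi> / 4)) + norm \<kappa> * (norm (\<rho> t - 1) * ((8 + 2 * M * exp M) * exp (q \<xi> / 4))))"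
      using t order_trans[OF norm_exp_mult_le[OF R, of "q \<xi>"] exp_quarter_bound(1)[OF qM' M, of \<xi>]]
        order_trans[OF norm_exp_mult_diff_le[OF R, of "q \<xi>"] mult_left_mono[OF exp_quarter_bound(2)[OF qM' M, of \<xi>] norm_ge_zero[of "\<rho> t - 1"]]]
      by (intro mult_left_mono add_mono) auto
    also have "\<dots> = (1 / sqrt t) ^ DIM('a) * (norm (k t - \<kappa>) * (2 * exp M) + norm \<kappa> * (norm (\<rho> t - 1) * (8 + 2 * M * exp M))) * exp (q \<xi> / 4)"
      by (simp add: algebra_simps)
    also have "\<dots> \<le> (1 / sqrt t) ^ DIM('a) * (norm (k t - \<kappa>) * (2 * exp M) + norm \<kappa> * (norm (\<rho> t - 1) * (8 + 2 * M * exp M))) * (exp (M / 4) * exp (- (a / 8) * (\<xi> \<bullet> \<xi>)))"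
      using t M qM[of \<xi>] by (intro mult_left_mono mult_nonneg_nonneg add_nonneg_nonneg) (auto simp flip: exp_add)
    finally show ?thesis unfolding \<xi>_def \<omega>_def by (simp only: mult.assoc)
  qed
  have "\<forall>\<^sub>F t in at_top. \<forall>x. norm (gauss_wave a p t x - dollard t (gauss_profile a p) x)
      \<le> (1 / sqrt t) ^ DIM('a) * \<omega> t * exp (- (a / 8) * (((1 / (2 * t)) *\<^sub>R x) \<bullet> ((1 / (2 * t)) *\<^sub>R x)))"
    using eventually_ge_at_top[of a] eventually_gt_at_top[of 0] by eventually_elim (use bound in blast)
  with \<omega>lim a show ?thesis unfolding asymptotic_profile_def by (intro exI[of _ "a / 8"] exI[of _ \<omega>]) auto
qed

lemma asymptotic_profile_gauss_evolution:
  "gauss_evolution f F \<Longrightarrow> asymptotic_profile f F"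
proof (induction rule: gauss_evolution.induct)
  case (add f F g G)
  obtain c u where 1: "c > 0" "(u \<longlongrightarrow> 0) at_top" "\<forall>\<^sub>F t in at_top. \<forall>x.
     norm (F t x - dollard t f x) \<le> (1 / sqrt t) ^ DIM('a) * u t * exp (- c * (((1 / (2 * t)) *\<^sub>R x) \<bullet> ((1 / (2 * t)) *\<^sub>R x)))"
    using add.IH(1) unfolding asymptotic_profile_def by blast
  obtain d w where 2: "d > 0" "(w \<longlongrightarrow> 0) at_top" "\<forall>\<^sub>F t in at_top. \<forall>x.
     norm (G t x - dollard t g x) \<le> (1 / sqrt t) ^ DIM('a) * w t * exp (- d * (((1 / (2 * t)) *\<^sub>R x) \<bullet> ((1 / (2 * t)) *\<^sub>R x)))"
    using add.IH(2) unfolding asymptotic_profile_def by blast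
  show ?case unfolding asymptotic_profile_def
  proof (intro exI[of _ "min c d"] exI[of _ "\<lambda>t. \<bar>u t\<bar> + \<bar>w t\<bar>"] conjI)
    show "((\<lambda>t. \<bar>u t\<bar> + \<bar>w t\<bar>) \<longlongrightarrow> 0) at_top" using 1 2 by (intro tendsto_add_zero tendsto_rabs_zero)
    show "\<forall>\<^sub>F t in at_top. \<forall>x. norm (F t x + G t x - dollard t (\<lambda>x. f x + g x) x)
      \<le> (1 / sqrt t) ^ DIM('a) * (\<bar>u t\<bar> + \<bar>w t\<bar>) * exp (- min c d * (((1 / (2 * t)) *\<^sub>R x) \<bullet> ((1 / (2 * t)) *\<^sub>R x)))"
      using 1(3) 2(3) eventually_gt_at_top[of 0]
    proof eventually_elim
      case (elim t)
      show ?case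
      proof
        fix x :: 'a
        define X where "X = ((1 / (2 * t)) *\<^sub>R x) \<bullet> ((1 / (2 * t)) *\<^sub>R x)"
        have X: "X \<ge> 0" by (simp add: X_def)
        define s where "s = (1 / sqrt t) ^ DIM('a)"
        have s: "s \<ge> 0" using elim by (simp add: s_def)
        have "F t x + G t x - dollard t (\<lambda>x. f x + g x) x = (F t x - dollard t f x) + (G t x - dollard t g x)"
          by (simp add: dollard_def distrib_left)
        also have "norm \<dots> \<le> s * u t * exp (- c * X) + s * w t * exp (- d * X)"
          using elim unfolding X_def s_def by (intro norm_triangle_le add_mono) auto
        also have "\<dots> \<le> s * \<bar>u t\<bar> * exp (- min c d * X) + s * \<bar>w t\<bar> * exp (- min c d * X)"
        proof (rule add_mono)
          have "exp (- c * X) \<le> exp (- min c d * X)" "exp (- d * X) \<le> exp (- min c d * X)"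
            using X by (auto intro!: mult_right_mono)
          moreover have "s * u t \<le> s * \<bar>u t\<bar>" "s * w t \<le> s * \<bar>w t\<bar>" using s by (auto intro!: mult_left_mono)
          ultimately show "s * u t * exp (- c * X) \<le> s * \<bar>u t\<bar> * exp (- min c d * X)"
            "s * w t * exp (- d * X) \<le> s * \<bar>w t\<bar> * exp (- min c d * X)"
            using s by (auto intro!: mult_mono)
        qed
        finally show "norm (F t x + G t x - dollard t (\<lambda>x. f x + g x) x) \<le> s * (\<bar>u t\<bar> + \<bar>w t\<bar>) * exp (- min c d * X)"
          by (simp add: algebra_simps)
      qed
    qed
  qed (use 1 2 in auto)
next
  case (scale f F k)
  obtain c u where 1: "c > 0" "(u \<longlongrightarrow> 0) at_top" "\<forall>\<^sub>F t in at_top. \<forall>x.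
     norm (F t x - dollard t f x) \<le> (1 / sqrt t) ^ DIM('a) * u t * exp (- c * (((1 / (2 * t)) *\<^sub>R x) \<bullet> ((1 / (2 * t)) *\<^sub>R x)))"
    using scale.IH unfolding asymptotic_profile_def by blast
  show ?case unfolding asymptotic_profile_def
  proof (intro exI[of _ c] exI[of _ "\<lambda>t. norm k * u t"] conjI)
    show "((\<lambda>t. norm k * u t) \<longlongrightarrow> 0) at_top" using 1 by (intro tendsto_mult_right_zero)
    show "\<forall>\<^sub>F t in at_top. \<forall>x. norm (k * F t x - dollard t (\<lambda>x. k * f x) x)
      \<le> (1 / sqrt t) ^ DIM('a) * (norm k * u t) * exp (- c * (((1 / (2 * t)) *\<^sub>R x) \<bullet> ((1 / (2 * t)) *\<^sub>R x)))"
      using 1(3)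
    proof eventually_elim
      case (elim t)
      show ?case
      proof
        fix x :: 'a
        have "k * F t x - dollard t (\<lambda>x. k * f x) x = k * (F t x - dollard t f x)" by (simp add: dollard_def algebra_simps)
        then show "norm (k * F t x - dollard t (\<lambda>x. k * f x) x)
          \<le> (1 / sqrt t) ^ DIM('a) * (norm k * u t) * exp (- c * (((1 / (2 * t)) *\<^sub>R x) \<bullet> ((1 / (2 * t)) *\<^sub>R x)))"
          using mult_left_mono[OF elim[rule_format, of x] norm_ge_zero[of k]] by (simp add: norm_mult mult_ac)
      qed
    qed
  qed (use 1 in auto)
qed (rule asymptotic_profile_gauss)

lemma gauss_evolution_profile_sup:
  fixes f :: "'a::euclidean_space \<Rightarrow> complex"
  assumes "gauss_evolution f F"
  obtains \<omega> where "(\<omega> \<longlongrightarrow> 0) at_top" "\<And>t. \<omega> t \<ge> 0"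
    "\<forall>\<^sub>F t in at_top. \<forall>x. norm (F t x - dollard t f x) \<le> (1 / sqrt t) ^ DIM('a) * \<omega> t"
proof -
  obtain c \<omega> where 1: "c > 0" "(\<omega> \<longlongrightarrow> 0) at_top" "\<forall>\<^sub>F t in at_top. \<forall>x.
     norm (F t x - dollard t f x) \<le> (1 / sqrt t) ^ DIM('a) * \<omega> t * exp (- c * (((1 / (2 * t)) *\<^sub>R x) \<bullet> ((1 / (2 * t)) *\<^sub>R x)))"
    using asymptotic_profile_gauss_evolution[OF assms] unfolding asymptotic_profile_def by blast
  show ?thesis
  proof
    show "((\<lambda>t. \<bar>\<omega> t\<bar>) \<longlongrightarrow> 0) at_top" using 1 by (intro tendsto_rabs_zero)
    show "\<forall>\<^sub>F t in at_top. \<forall>x. norm (F t x - dollard t f x) \<le> (1 / sqrt t) ^ DIM('a) * \<bar>\<omega> t\<bar>"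
      using 1(3) eventually_gt_at_top[of 0]
    proof eventually_elim
      case (elim t)
      show ?case
      proof
        fix x :: 'a
        define y where "y = (1 / (2 * t)) *\<^sub>R x"
        have "norm (F t x - dollard t f x) \<le> (1 / sqrt t) ^ DIM('a) * \<omega> t * exp (- c * (y \<bullet> y))"
          using elim(1) unfolding y_def by blast
        also have "\<dots> \<le> (1 / sqrt t) ^ DIM('a) * \<bar>\<omega> t\<bar> * 1"
          using elim(2) 1(1) by - (rule mult_mono, auto intro!: mult_left_mono)
        finally show "norm (F t x - dollard t f x) \<le> (1 / sqrt t) ^ DIM('a) * \<bar>\<omega> t\<bar>" by simp
      qed
    qed
  qed auto
qed

lemma gauss_evolution_profile_L2:
  fixes f :: "'a::euclidean_space \<Rightarrow> complex"
  assumes "gauss_evolution f F"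
  shows "((\<lambda>t. N2 (\<lambda>x. F t x - dollard t f x)) \<longlongrightarrow> 0) at_top"
proof -
  obtain c \<omega> where 1: "c > 0" "(\<omega> \<longlongrightarrow> 0) at_top" "\<forall>\<^sub>F t in at_top. \<forall>x.
     norm (F t x - dollard t f x) \<le> (1 / sqrt t) ^ DIM('a) * \<omega> t * exp (- c * (((1 / (2 * t)) *\<^sub>R x) \<bullet> ((1 / (2 * t)) *\<^sub>R x)))"
    using asymptotic_profile_gauss_evolution[OF assms] unfolding asymptotic_profile_def by blast
  define k :: "'a \<Rightarrow> complex" where "k x = of_real (exp (- c * (x \<bullet> x)))" for x
  have k [measurable]: "k \<in> borel_measurable borel" unfolding k_def by measurable
  have "N2 k < \<infinity>"
    using gauss_evolution_regular(2)[OF gauss_evolution.gauss[OF 1(1), of "0::'a"]]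
    by (simp add: Lp_2_iff k_def[abs_def] gauss_profile_def[abs_def])
  then obtain K where K: "K \<ge> 0" "N2 k = ennreal K" by (cases "N2 k") auto
  have "((\<lambda>t. (sqrt 2 ^ DIM('a))\<^sup>2 * (\<omega> t)\<^sup>2 * K) \<longlongrightarrow> (sqrt 2 ^ DIM('a))\<^sup>2 * 0\<^sup>2 * K) at_top"
    by (intro tendsto_intros 1)
  then have lim: "((\<lambda>t. ennreal ((sqrt 2 ^ DIM('a))\<^sup>2 * (\<omega> t)\<^sup>2 * K)) \<longlongrightarrow> 0) at_top"
    using tendsto_ennrealI by fastforce
  have bound: "\<forall>\<^sub>F t in at_top. N2 (\<lambda>x. F t x - dollard t f x) \<le> ennreal ((sqrt 2 ^ DIM('a))\<^sup>2 * (\<omega> t)\<^sup>2 * K)"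
    using 1(3) eventually_gt_at_top[of 0]
  proof eventually_elim
    case (elim t)
    have t: "t > 0" by fact
    have "N2 (\<lambda>x. F t x - dollard t f x) \<le> N2 (\<lambda>x. of_real (sqrt 2 ^ DIM('a) * \<omega> t) * dollard t k x)"
    proof (rule N2_mono)
      fix x :: 'a
      define y where "y = (1 / (2 * t)) *\<^sub>R x"
      have "norm (F t x - dollard t f x) \<le> (1 / sqrt t) ^ DIM('a) * \<omega> t * exp (- c * (y \<bullet> y))"
        using elim(1) unfolding y_def by blast
      also have "\<dots> \<le> (1 / sqrt t) ^ DIM('a) * \<bar>\<omega> t\<bar> * exp (- c * (y \<bullet> y))"
        using t by (intro mult_right_mono mult_left_mono) auto
      also have "(1 / sqrt t) ^ DIM('a) = sqrt 2 ^ DIM('a) * (1 / sqrt (2 * t)) ^ DIM('a)"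
        using t by (simp add: real_sqrt_mult flip: power_mult_distrib)
      also have "\<dots> * \<bar>\<omega> t\<bar> * exp (- c * (y \<bullet> y)) = norm (of_real (sqrt 2 ^ DIM('a) * \<omega> t) * dollard t k x)"
        unfolding norm_mult norm_dollard[OF t] y_def[symmetric] by (simp add: k_def abs_mult norm_mult norm_power)
      finally show "norm (F t x - dollard t f x) \<le> norm (of_real (sqrt 2 ^ DIM('a) * \<omega> t) * dollard t k x)" .
    qed
    also have "\<dots> = ennreal ((sqrt 2 ^ DIM('a))\<^sup>2 * (\<omega> t)\<^sup>2) * N2 k"
      by (subst N2_cmult) (simp_all add: N2_dollard[OF t] norm_mult power_mult_distrib del: of_real_mult of_real_power)
    finally show ?case using K by (simp add: ennreal_mult)
  qed
  show ?thesis by (rule tendsto_sandwich[OF _ bound tendsto_const lim]) simp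
qed

text \<open>Both sides are Lipschitz in the profile uniformly in \<open>t\<close>, so the
  asymptotics for Gaussians extend by density.\<close>

lemma free_schroedinger_profile:
  fixes v :: "'a::euclidean_space \<Rightarrow> complex"
  assumes v: "v \<in> Lp 2"
  shows "((\<lambda>t. N2 (\<lambda>x. free_schroedinger t v x - dollard t (fourier_L2 v) x)) \<longlongrightarrow> 0) at_top"
  unfolding ennreal_tendsto_0_iff
proof (intro allI impI)
  fix e :: real assume e: "e > 0"
  have Fv: "fourier_L2 v \<in> Lp 2" by (rule fourier_L2_props(1)[OF v])
  \<comment> \<open>Sixteen copies of the threshold add up below: eight from the free group and
    eight from the two profile errors; the factor 32 makes the inequality strict.\<close>
  have e32: "e / 32 > 0" using e by simp
  obtain f F where ev: "gauss_evolution f F" and ap: "N2 (\<lambda>x. fourier_L2 v x - f x) < ennreal (e / 32)"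
    using gauss_dense_L2[OF Fv e32] by blast
  note R = gauss_evolution_regular[OF ev]
  have "\<forall>\<^sub>F t in at_top. N2 (\<lambda>x. F t x - dollard t f x) < ennreal (e / 32)"
    using gauss_evolution_profile_L2[OF ev] e32 unfolding ennreal_tendsto_0_iff by blast
  then show "\<forall>\<^sub>F t in at_top. N2 (\<lambda>x. free_schroedinger t v x - dollard t (fourier_L2 v) x) < ennreal e"
    using eventually_gt_at_top[of 0]
  proof eventually_elim
    case (elim t)
    have m [measurable]: "f \<in> borel_measurable borel" "F t \<in> borel_measurable borel" "fourier_L2 v \<in> borel_measurable borel"
      "free_schroedinger t v \<in> borel_measurable borel"
      using R Fv free_schroedinger_props(1)[OF v] by (auto simp: Lp_2_iff)
    have d [measurable]: "dollard t f \<in> borel_measurable borel" "dollard t (fourier_L2 v) \<in> borel_measurable borel"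
      by (intro dollard_measurable m)+
    have "N2 (\<lambda>x. dollard t f x - dollard t (fourier_L2 v) x) = N2 (dollard t (\<lambda>x. f x - fourier_L2 v x))"
      by (simp only: dollard_diff[symmetric])
    also have "\<dots> = N2 (\<lambda>x. fourier_L2 v x - f x)"
      using elim(2) by (subst N2_dollard) (auto simp: N2_minus_commute[of f])
    finally have 3: "N2 (\<lambda>x. dollard t f x - dollard t (fourier_L2 v) x) \<le> ennreal (e / 32)" using ap by simp
    have "N2 (\<lambda>x. free_schroedinger t v x - F t x) \<le> 4 * N2 (\<lambda>\<xi>. fourier_L2 v \<xi> - f \<xi>)"
      by (rule N2_free_schroedinger_diff_le[OF v ev])
    also have "\<dots> \<le> 4 * ennreal (e / 32)" using ap by (intro mult_left_mono) auto
    finally have 1: "N2 (\<lambda>x. free_schroedinger t v x - F t x) \<le> 4 * ennreal (e / 32)" .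
    have "N2 (\<lambda>x. free_schroedinger t v x - dollard t (fourier_L2 v) x)
      \<le> 2 * N2 (\<lambda>x. free_schroedinger t v x - F t x) + 2 * N2 (\<lambda>x. F t x - dollard t (fourier_L2 v) x)"
      by (rule N2_diff_trans) measurable
    also have "\<dots> \<le> 2 * (4 * ennreal (e / 32)) + 2 * (2 * N2 (\<lambda>x. F t x - dollard t f x) + 2 * N2 (\<lambda>x. dollard t f x - dollard t (fourier_L2 v) x))"
      by (intro add_mono mult_left_mono 1 N2_diff_trans m d) auto
    also have "\<dots> \<le> 2 * (4 * ennreal (e / 32)) + 2 * (2 * ennreal (e / 32) + 2 * ennreal (e / 32))"
      using elim(1) 3 by (intro add_mono mult_left_mono) auto
    also have "\<dots> = ennreal (16 * (e / 32))"
    proof -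
      have "ennreal (16 * (e / 32)) = 16 * ennreal (e / 32)" using e by (subst ennreal_mult') auto
      then show ?thesis by (simp add: mult.assoc[symmetric] distrib_left distrib_right[symmetric])
    qed
    also have "\<dots> < ennreal e" using e by (intro ennreal_lessI) auto
    finally show ?case .
  qed
qed

section \<open>Distributional derivatives in time\<close>

lemma partials_in_class:
  assumes X: "\<And>f b. f \<in> X \<Longrightarrow> b \<in> Basis \<Longrightarrow> partial b f \<in> X" and "f \<in> X" "bs \<in> lists Basis"
  shows "partials bs f \<in> X"
  using assms(3,2) unfolding partials_def by (induction bs) (auto intro: X)

text \<open>A class of differentiable functions that is closed under partial derivatives consists of
  smooth functions.\<close>

lemma smooth_of_class:
  assumes "\<And>f b. f \<in> X \<Longrightarrow> b \<in> Basis \<Longrightarrow> partial b f \<in> X"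
    and "\<And>f x. f \<in> X \<Longrightarrow> f differentiable (at x)" and "f \<in> X"
  shows "smooth f"
  unfolding smooth_def using partials_in_class[OF assms(1) assms(3)] assms(2) by blast

text \<open>The functions \<open>exp (- 1 / x) / x\<^sup>k\<close>, extended by zero;
  differentiation maps each into the span of the others, so that smoothness of \<open>exp (- 1 /
  x)\<close> at the origin needs no formula for higher derivatives.\<close>

definition flat :: "nat \<Rightarrow> real \<Rightarrow> real" where
  "flat k x = (if x > 0 then exp (- 1 / x) / x ^ k else 0)"

lemma flat_has_derivative: "(flat k has_real_derivative flat (k + 2) x + (- real k) * flat (k + 1) x) (at x)"
proof -
  consider "x > 0" | "x < 0" | "x = 0" by linarith
  then show ?thesis
  proof cases
    case 1
    have "((\<lambda>x. exp (- 1 / x) / x ^ k) has_real_derivative flat (k + 2) x + (- real k) * flat (k + 1) x) (at x)"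
    proof (cases k)
      case 0
      then show ?thesis using 1 unfolding flat_def
        by (auto intro!: derivative_eq_intros simp: divide_simps power2_eq_square)
    next
      case (Suc j)
      show ?thesis using 1 unfolding flat_def Suc
        apply (auto intro!: derivative_eq_intros simp del: power_Suc of_nat_Suc)
        apply (simp add: divide_simps power2_eq_square power_add del: of_nat_Suc)
        apply (simp add: algebra_simps del: of_nat_Suc)
        done
    qed
    then show ?thesis
      by (rule DERIV_cong_ev[THEN iffD1, rotated -1])
         (use 1 in \<open>auto simp: flat_def intro: eventually_mono[OF eventually_nhds_in_open[of "{0<..}"]]\<close>)
  next
    case 2
    have "((\<lambda>x. 0) has_real_derivative 0) (at x)" by simp
    then have "(flat k has_real_derivative 0) (at x)"
      by (rule DERIV_cong_ev[THEN iffD1, rotated -1])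
         (use 2 in \<open>auto simp: flat_def intro: eventually_mono[OF eventually_nhds_in_open[of "{..<0}"]]\<close>)
    then show ?thesis using 2 by (simp add: flat_def)
  next
    case 3
    \<comment> \<open>At the origin the exponential beats every power.\<close>
    have r: "((\<lambda>h::real. exp (- 1 / h) / h ^ k / h) \<longlongrightarrow> 0) (at_right 0)"
    proof -
      have "((\<lambda>h::real. (inverse h) ^ Suc k / exp (inverse h)) \<longlongrightarrow> 0) (at_right 0)"
        by (rule filterlim_compose[OF tendsto_power_div_exp_0 filterlim_inverse_at_top_right])
      moreover have "(inverse h) ^ Suc k / exp (inverse h) = exp (- 1 / h) / h ^ k / h" for h :: real
        by (simp add: exp_minus power_inverse field_simps)
      ultimately show ?thesis by (simp only:)
    qed
    have "((\<lambda>h. flat k h / h) \<longlongrightarrow> 0) (at_right 0)"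
      by (rule Lim_transform_eventually[OF r]) (auto simp: flat_def eventually_at_filter)
    moreover have "((\<lambda>h. flat k h / h) \<longlongrightarrow> 0) (at_left 0)"
      by (rule tendsto_eventually) (auto simp: flat_def eventually_at_filter)
    ultimately have "((\<lambda>h. flat k h / h) \<longlongrightarrow> 0) (at 0)"
      by (simp add: filterlim_split_at)
    then have "(flat k has_real_derivative 0) (at 0)"
      unfolding DERIV_def by (simp add: flat_def)
    then show ?thesis using 3 by (simp add: flat_def)
  qed
qed

text \<open>A syntactic class of smooth functions closed under differentiation; it contains the
  smooth step below.\<close>

inductive smooth_fun :: "(real \<Rightarrow> real) \<Rightarrow> bool" where
  const: "smooth_fun (\<lambda>x. c)"
| flat: "smooth_fun (flat k)"
| affine: "smooth_fun f \<Longrightarrow> smooth_fun (\<lambda>x. f (c * x + d))"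
| add: "smooth_fun f \<Longrightarrow> smooth_fun g \<Longrightarrow> smooth_fun (\<lambda>x. f x + g x)"
| mult: "smooth_fun f \<Longrightarrow> smooth_fun g \<Longrightarrow> smooth_fun (\<lambda>x. f x * g x)"
| inverse: "smooth_fun f \<Longrightarrow> (\<And>x. f x \<noteq> 0) \<Longrightarrow> smooth_fun (\<lambda>x. inverse (f x))"

lemma smooth_fun_derivative:
  "smooth_fun f \<Longrightarrow> \<exists>f'. smooth_fun f' \<and> (\<forall>x. (f has_real_derivative f' x) (at x))"
proof (induction rule: smooth_fun.induct)
  case (const c)
  show ?case using smooth_fun.const[of 0] by (auto intro!: exI[of _ "\<lambda>x. 0"])
next
  case (flat k)
  have "smooth_fun (\<lambda>x. flat (k + 2) x + (- real k) * flat (k + 1) x)" by (intro smooth_fun.intros)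
  then show ?case using flat_has_derivative[of k] by blast
next
  case (affine f c d)
  then obtain f' where f': "smooth_fun f'" "\<And>x. (f has_real_derivative f' x) (at x)" by blast
  have "((\<lambda>x. f (c * x + d)) has_real_derivative c * f' (c * x + d)) (at x)" for x
    by (rule DERIV_cong[OF DERIV_chain2[OF f'(2)]]) (auto intro!: derivative_eq_intros)
  moreover have "smooth_fun (\<lambda>x. c * f' (c * x + d))" by (intro smooth_fun.intros f')
  ultimately show ?case by (intro exI[of _ "\<lambda>x. c * f' (c * x + d)"]) auto
next
  case (add f g)
  then obtain f' g' where f': "smooth_fun f'" "\<And>x. (f has_real_derivative f' x) (at x)"
    and g': "smooth_fun g'" "\<And>x. (g has_real_derivative g' x) (at x)" by blast
  show ?case by (intro exI[of _ "\<lambda>x. f' x + g' x"] conjI allI smooth_fun.intros f' g' DERIV_add)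
next
  case (mult f g)
  then obtain f' g' where f': "smooth_fun f'" "\<And>x. (f has_real_derivative f' x) (at x)"
    and g': "smooth_fun g'" "\<And>x. (g has_real_derivative g' x) (at x)" by blast
  have "((\<lambda>x. f x * g x) has_real_derivative f' x * g x + f x * g' x) (at x)" for x
    by (rule DERIV_cong[OF DERIV_mult[OF f'(2) g'(2)]]) (simp add: algebra_simps)
  moreover have "smooth_fun (\<lambda>x. f' x * g x + f x * g' x)" by (intro smooth_fun.intros mult.hyps f' g')
  ultimately show ?case by (intro exI[of _ "\<lambda>x. f' x * g x + f x * g' x"]) auto
next
  case (inverse f)
  then obtain f' where f': "smooth_fun f'" "\<And>x. (f has_real_derivative f' x) (at x)" by blast
  have "((\<lambda>x. inverse (f x)) has_real_derivative (- 1) * (inverse (f x) * f' x * inverse (f x))) (at x)" for x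
    by (rule DERIV_cong[OF DERIV_inverse'[OF f'(2)]]) (auto simp: inverse.hyps)
  moreover have "smooth_fun (\<lambda>x. (- 1) * (inverse (f x) * f' x * inverse (f x)))"
    by (intro smooth_fun.const smooth_fun.mult smooth_fun.inverse f' inverse.hyps)
  ultimately show ?case by (intro exI[of _ "\<lambda>x. (- 1) * (inverse (f x) * f' x * inverse (f x))"]) auto
qed

lemma partial_real:
  assumes "(f has_real_derivative f') (at x)" shows "partial 1 f x = f'"
proof -
  have "((\<lambda>s. f (x + s *\<^sub>R 1)) has_real_derivative f' * 1) (at 0)"
    by (rule DERIV_chain2[where g="\<lambda>s. x + s *\<^sub>R 1"]) (use assms in \<open>auto intro!: derivative_eq_intros\<close>)
  then show ?thesis unfolding partial_def
    by (intro vector_derivative_at) (simp add: has_real_derivative_iff_has_vector_derivative)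
qed

lemma smooth_fun_imp_smooth: "smooth_fun f \<Longrightarrow> smooth f"
proof (rule smooth_of_class[of "Collect smooth_fun"])
  fix f :: "real \<Rightarrow> real" and b :: real assume f: "f \<in> Collect smooth_fun" and b: "b \<in> Basis"
  obtain f' where f': "smooth_fun f'" "\<And>x. (f has_real_derivative f' x) (at x)"
    using smooth_fun_derivative f by blast
  then have "partial b f = f'" using b partial_real by auto
  then show "partial b f \<in> Collect smooth_fun" using f' by simp
next
  fix f :: "real \<Rightarrow> real" and x assume "f \<in> Collect smooth_fun"
  then show "f differentiable (at x)"
    using smooth_fun_derivative[of f] by (auto simp: real_differentiable_def)
qed simp

text \<open>A smooth step from \<open>0\<close> to \<open>1\<close> on the unit interval.\<close>

definition step :: "real \<Rightarrow> real" where
  "step x = flat 0 x * inverse (flat 0 x + flat 0 ((- 1) * x + 1))"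

lemma step_denominator: "flat 0 x + flat 0 ((- 1) * x + 1) > 0"
  by (auto simp: flat_def add_pos_pos add_pos_nonneg add_nonneg_pos)

lemma smooth_fun_step: "smooth_fun step"
  unfolding step_def using step_denominator by (intro smooth_fun.intros) (metis less_irrefl)

lemma step_0: "x \<le> 0 \<Longrightarrow> step x = 0" and step_1: "x \<ge> 1 \<Longrightarrow> step x = 1"
  by (auto simp: step_def flat_def)

lemma step_range: "0 \<le> step x" "step x \<le> 1"
proof -
  have "flat 0 x \<ge> 0" "flat 0 ((- 1) * x + 1) \<ge> 0" by (auto simp: flat_def)
  then show "0 \<le> step x" "step x \<le> 1"
    using step_denominator[of x] unfolding step_def by (auto simp: field_simps)
qed

lemma step_derivative:
  obtains \<theta> where "\<And>x. (step has_real_derivative \<theta> x) (at x)" "continuous_on UNIV \<theta>"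
    "\<And>x. x \<notin> {0..1} \<Longrightarrow> \<theta> x = 0" "integrable lborel \<theta>" "(LINT x|lborel. \<theta> x) = 1"
proof -
  obtain \<theta> where \<theta>: "smooth_fun \<theta>" "\<And>x. (step has_real_derivative \<theta> x) (at x)"
    using smooth_fun_derivative[OF smooth_fun_step] by blast
  obtain \<theta>' where "\<And>x. (\<theta> has_real_derivative \<theta>' x) (at x)" using smooth_fun_derivative[OF \<theta>(1)] by blast
  then have c: "continuous_on UNIV \<theta>" by (meson DERIV_isCont continuous_at_imp_continuous_on)
  have 0: "\<theta> x = 0" if "x \<notin> {0..1}" for x
  proof -
    define S :: "real set" where "S = (if x < 0 then {..<0} else {1<..})"
    have S: "open S" "x \<in> S" using that by (auto simp: S_def)
    have "((\<lambda>y. if x < 0 then 0 else 1 :: real) has_real_derivative 0) (at x)" by simp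
    then have "(step has_real_derivative 0) (at x)"
      by (rule has_field_derivative_transform_within_open[OF _ S]) (auto simp: S_def step_0 step_1 split: if_splits)
    then show ?thesis using \<theta>(2) DERIV_unique by blast
  qed
  have e: "(\<lambda>x. \<theta> x * indicator {0..1} x) = \<theta>" using 0 by (auto simp: indicator_def fun_eq_iff)
  have "has_bochner_integral lborel (\<lambda>x. \<theta> x * indicator {0..1} x) (step 1 - step 0)"
    by (rule has_bochner_integral_FTC_Icc_real) (use \<theta> c in \<open>auto simp: continuous_on_eq_continuous_at\<close>)
  then have "has_bochner_integral lborel \<theta> 1"
    by (simp add: step_0 step_1 e)
  then show ?thesis using that \<theta>(2) c 0 by (auto simp: has_bochner_integral_iff)
qed

text \<open>A distributional derivative integrates to the increment. Test with the difference
  \<open>\<eta>\<^sub>n\<close> of two steps of width \<open>1/n\<close> at \<open>a\<close> and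
  \<open>b\<close>: its derivative concentrates at the two points, where \<open>f\<close> is
  continuous, and \<open>\<eta>\<^sub>n\<close> converges boundedly to the indicator of
  \<open>{a<..b}\<close>.\<close>

lemma distributional_FTC:
  fixes f g :: "real \<Rightarrow> complex"
  assumes fg: "has_distributional_derivative {0<..} f g"
    and f: "continuous_on {0<..} f" and g: "\<And>T. T > 0 \<Longrightarrow> set_integrable lborel {0..T} g"
    and ab: "0 < a" "a \<le> b"
  shows "f b - f a = (LINT t:{a..b}|lborel. g t)"
proof -
  obtain \<theta> where \<theta>: "\<And>x. (step has_real_derivative \<theta> x) (at x)" "continuous_on UNIV \<theta>"
    "\<And>x. x \<notin> {0..1} \<Longrightarrow> \<theta> x = 0" "integrable lborel \<theta>" "(LINT x|lborel. \<theta> x) = 1"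
    using step_derivative by blast
  define N where "N n = real (Suc n)" for n
  have N: "N n > 0" "1 / N n \<le> 1" for n by (auto simp: N_def)
  \<comment> \<open>The affine maps are written with sums so that they match the closure rules of
    \<open>smooth_fun\<close>.\<close>
  define \<eta> where "\<eta> n t = step (N n * t + (- N n * a)) + (- 1) * step (N n * t + (- N n * b))" for n t
  have \<eta>': "(\<eta> n has_real_derivative N n * \<theta> (N n * (t - a)) - N n * \<theta> (N n * (t - b))) (at t)" for n t
  proof -
    have "((\<lambda>t. step (N n * t + (- N n * c))) has_real_derivative \<theta> (N n * t + (- N n * c)) * N n) (at t)" for c
      by (rule DERIV_chain2[OF \<theta>(1)]) (auto intro!: derivative_eq_intros)
    from DERIV_diff[OF this[of a] this[of b]] show ?thesis by (simp add: \<eta>_def[abs_def] algebra_simps)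
  qed
  have \<eta>0: "\<eta> n t = 0" if "t \<notin> {a..b + 1 / N n}" for n t
  proof (cases "t < a")
    case True
    then have "N n * (t - a) \<le> 0" "N n * (t - b) \<le> 0" using N[of n] ab by (auto intro!: mult_nonneg_nonpos)
    then show ?thesis unfolding \<eta>_def by (simp add: step_0 algebra_simps)
  next
    case False
    then have "t - b \<ge> 1 / N n" "t - a \<ge> 1 / N n" using that ab by auto
    then have "N n * (t - b) \<ge> 1" "N n * (t - a) \<ge> 1" using N[of n] by (auto simp: field_simps)
    then show ?thesis unfolding \<eta>_def by (simp add: step_1 algebra_simps)
  qed
  have "test_function {0<..} (\<eta> n)" for n
    unfolding test_function_def
  proof (intro conjI)
    show "smooth (\<eta> n)" unfolding \<eta>_def by (intro smooth_fun_imp_smooth smooth_fun.intros smooth_fun_step)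
    have "{t. \<eta> n t \<noteq> 0} \<subseteq> {a..b + 1 / N n}" using \<eta>0 by blast
    then have cl: "closure {t. \<eta> n t \<noteq> 0} \<subseteq> {a..b + 1 / N n}" by (intro closure_minimal) auto
    then show "compact (closure {t. \<eta> n t \<noteq> 0})" using bounded_subset[OF bounded_closed_interval cl] by (simp add: compact_eq_bounded_closed)
    show "closure {t. \<eta> n t \<noteq> 0} \<subseteq> {0<..}" using cl ab by auto
  qed
  then have eq: "(LINT t|lborel. deriv (\<eta> n) t *\<^sub>R f t) = - (LINT t|lborel. \<eta> n t *\<^sub>R g t)" for n
    using fg unfolding has_distributional_derivative_def by blast
  \<comment> \<open>The rescaled derivative of the step is an approximate identity concentrated to
    the right of \<open>c\<close>.\<close>
  have point: "integrable lborel (\<lambda>t. (N n * \<theta> (N n * (t - c))) *\<^sub>R f t) \<and>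
    (\<lambda>n. LINT t|lborel. (N n * \<theta> (N n * (t - c))) *\<^sub>R f t) \<longlonglongrightarrow> f c" if c: "c > 0" for c n
  proof
    have sub: "{c..c+1} \<subseteq> {0<..}" using c by auto
    have cf: "continuous_on {c..c+1} f" using f sub by (rule continuous_on_subset)
    obtain B where "\<forall>z\<in>f ` {c..c+1}. norm z \<le> B"
      using compact_imp_bounded[OF compact_continuous_image[OF cf compact_Icc]] unfolding bounded_iff by blast
    then have B: "norm (f t) \<le> B" if "t \<in> {c..c+1}" for t using that by blast
    have inI: "c + s / N n \<in> {c..c+1}" if "s \<in> {0..1}" for s n
    proof -
      have "s / N n \<le> 1 / N n" "0 \<le> s / N n" using that N[of n] by (auto intro!: divide_right_mono)
      then show ?thesis using N(2)[of n] by simp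
    qed
    have cf2: "continuous_on {0..1} (\<lambda>s. f (c + s / N n))" for n
      by (rule continuous_on_compose2[OF cf]) (use N[of n] inI in \<open>auto intro!: continuous_intros\<close>)
    have rw: "\<theta> s *\<^sub>R f (c + s / N n) = indicator {0..1} s *\<^sub>R (\<theta> s *\<^sub>R f (c + s / N n))" for s n
      using \<theta>(3)[of s] by (auto simp: indicator_def)
    have int2: "integrable lborel (\<lambda>s. \<theta> s *\<^sub>R f (c + s / N n))" for n
      by (subst rw) (intro borel_integrable_compact compact_Icc continuous_intros cf2 continuous_on_subset[OF \<theta>(2)], auto)
    have cov: "(\<lambda>s. (N n * \<theta> (N n * ((c + (1 / N n) * s) - c))) *\<^sub>R f (c + (1 / N n) * s)) = (\<lambda>s. N n *\<^sub>R (\<theta> s *\<^sub>R f (c + s / N n)))" for n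
      using N[of n] by (auto simp: fun_eq_iff)
    have "integrable lborel (\<lambda>s. (N n * \<theta> (N n * ((c + (1 / N n) * s) - c))) *\<^sub>R f (c + (1 / N n) * s))"
      unfolding cov by (intro integrable_scaleR_right int2)
    then show "integrable lborel (\<lambda>t. (N n * \<theta> (N n * (t - c))) *\<^sub>R f t)"
      using N[of n] by (subst (asm) lborel_integrable_real_affine_iff) auto
    have e: "(LINT t|lborel. (N n * \<theta> (N n * (t - c))) *\<^sub>R f t) = (LINT s|lborel. \<theta> s *\<^sub>R f (c + s / N n))" for n
    proof -
      have "(LINT t|lborel. (N n * \<theta> (N n * (t - c))) *\<^sub>R f t)
        = \<bar>1 / N n\<bar> *\<^sub>R (LINT s|lborel. (N n * \<theta> (N n * ((c + (1 / N n) * s) - c))) *\<^sub>R f (c + (1 / N n) * s))"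
        using N[of n] by (intro lborel_integral_real_affine) auto
      also have "\<dots> = (\<bar>1 / N n\<bar> * N n) *\<^sub>R (LINT s|lborel. \<theta> s *\<^sub>R f (c + s / N n))"
        unfolding cov by (subst integral_scaleR_right) (rule scaleR_scaleR)
      finally show ?thesis using N[of n] by simp
    qed
    have "(\<lambda>n. LINT s|lborel. \<theta> s *\<^sub>R f (c + s / N n)) \<longlonglongrightarrow> (LINT s|lborel. \<theta> s *\<^sub>R f c)"
    proof (rule integral_dominated_convergence[where w="\<lambda>s. norm (\<theta> s) * B"])
      show "integrable lborel (\<lambda>s. norm (\<theta> s) * B)" using \<theta>(4) by simp
      show "(\<lambda>s. \<theta> s *\<^sub>R f (c + s / N n)) \<in> borel_measurable lborel" for n using int2 by (rule borel_measurable_integrable)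
      show "(\<lambda>s. \<theta> s *\<^sub>R f c) \<in> borel_measurable lborel" using \<theta>(4) by auto
      show "AE s in lborel. norm (\<theta> s *\<^sub>R f (c + s / N n)) \<le> norm (\<theta> s) * B" for n
      proof (rule AE_I2)
        fix s
        show "norm (\<theta> s *\<^sub>R f (c + s / N n)) \<le> norm (\<theta> s) * B"
        proof (cases "s \<in> {0..1}")
          case True
          from B[OF inI[OF this, of n]] show ?thesis by (simp add: mult_left_mono)
        qed (simp add: \<theta>(3))
      qed
      have Ninf: "(\<lambda>n. s / N n) \<longlonglongrightarrow> 0" for s
        using tendsto_mult[OF tendsto_const[of s] LIMSEQ_inverse_real_of_nat] by (simp add: N_def divide_inverse)
      have "isCont f c" using f c by (simp add: continuous_on_eq_continuous_at)
      then have "(\<lambda>n. f (c + s / N n)) \<longlonglongrightarrow> f c" for s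
        by (rule isCont_tendsto_compose) (use tendsto_add[OF tendsto_const[of c] Ninf[of s]] in simp)
      then show "AE s in lborel. (\<lambda>n. \<theta> s *\<^sub>R f (c + s / N n)) \<longlonglongrightarrow> \<theta> s *\<^sub>R f c"
        by (intro AE_I2 tendsto_intros)
    qed
    also have "(LINT s|lborel. \<theta> s *\<^sub>R f c) = f c" using \<theta>(4,5) by simp
    finally show "(\<lambda>n. LINT t|lborel. (N n * \<theta> (N n * (t - c))) *\<^sub>R f t) \<longlonglongrightarrow> f c" unfolding e .
  qed
  have "(LINT t|lborel. deriv (\<eta> n) t *\<^sub>R f t) = (LINT t|lborel. (N n * \<theta> (N n * (t - a))) *\<^sub>R f t) - (LINT t|lborel. (N n * \<theta> (N n * (t - b))) *\<^sub>R f t)" for n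
    unfolding DERIV_imp_deriv[OF \<eta>'] scaleR_diff_left
    using point[of a n] point[of b n] ab by (intro Bochner_Integration.integral_diff) auto
  moreover have "(\<lambda>n. (LINT t|lborel. (N n * \<theta> (N n * (t - a))) *\<^sub>R f t) - (LINT t|lborel. (N n * \<theta> (N n * (t - b))) *\<^sub>R f t)) \<longlonglongrightarrow> f a - f b"
    using point[of a] point[of b] ab by (intro tendsto_diff) auto
  ultimately have L: "(\<lambda>n. - (LINT t|lborel. \<eta> n t *\<^sub>R g t)) \<longlonglongrightarrow> f a - f b" by (simp add: eq)
  define G where "G t = indicator {0..b+1} t *\<^sub>R g t" for t
  have G: "integrable lborel G" using g[of "b + 1"] ab by (simp add: set_integrable_def G_def[abs_def])
  have \<eta>G: "\<eta> n t *\<^sub>R g t = \<eta> n t *\<^sub>R G t" for n t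
  proof (cases "t \<in> {a..b + 1 / N n}")
    case True
    then have "t \<in> {0..b+1}" using N(2)[of n] ab by auto
    then show ?thesis by (simp add: G_def)
  qed (simp add: \<eta>0)
  have \<eta>m: "\<eta> n \<in> borel_measurable borel" for n
    using \<eta>' by (intro borel_measurable_continuous_onI) (meson DERIV_isCont continuous_at_imp_continuous_on)
  have "(\<lambda>n. LINT t|lborel. \<eta> n t *\<^sub>R G t) \<longlonglongrightarrow> (LINT t|lborel. indicator {a<..b} t *\<^sub>R G t)"
  proof (rule integral_dominated_convergence[where w="\<lambda>t. norm (G t)"])
    show "AE t in lborel. norm (\<eta> n t *\<^sub>R G t) \<le> norm (G t)" for n
    proof (rule AE_I2)
      fix t
      have "\<bar>\<eta> n t\<bar> \<le> 1" unfolding \<eta>_def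
        using step_range[of "N n * t + (- N n * a)"] step_range[of "N n * t + (- N n * b)"] by (simp add: abs_le_iff)
      then show "norm (\<eta> n t *\<^sub>R G t) \<le> norm (G t)" by (simp add: mult_left_le_one_le)
    qed
    have *: "(\<lambda>n. step (N n * t + (- N n * c))) \<longlonglongrightarrow> (if t > c then 1 else 0)" for t c
    proof (cases "t > c")
      case True
      obtain M where M: "1 < real M * (t - c)" using reals_Archimedean3[of "t - c"] True by auto
      have "step (N n * t + (- N n * c)) = 1" if "n \<ge> M" for n
      proof -
        have "real M * (t - c) \<le> N n * (t - c)" using that True by (intro mult_right_mono) (auto simp: N_def)
        then show ?thesis using M by (intro step_1) (simp add: algebra_simps)
      qed
      then show ?thesis using True by (intro tendsto_eventually) (auto simp: eventually_sequentially)
    next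
      case False
      have "step (N n * t + (- N n * c)) = 0" for n
      proof -
        have "N n * (t - c) \<le> 0" using False N[of n] by (intro mult_nonneg_nonpos) auto
        then show ?thesis by (intro step_0) (simp add: algebra_simps)
      qed
      then show ?thesis using False by simp
    qed
    have "(\<lambda>n. \<eta> n t) \<longlonglongrightarrow> indicator {a<..b} t" for t
    proof -
      have "(\<lambda>n. \<eta> n t) \<longlonglongrightarrow> (if t > a then 1 else 0) + (- 1) * (if t > b then 1 else 0)"
        unfolding \<eta>_def by (intro tendsto_add tendsto_mult tendsto_const *)
      then show ?thesis using ab by (auto simp: indicator_def split: if_splits)
    qed
    then show "AE t in lborel. (\<lambda>n. \<eta> n t *\<^sub>R G t) \<longlonglongrightarrow> indicator {a<..b} t *\<^sub>R G t"
      by (intro AE_I2 tendsto_intros)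
    show "(\<lambda>t. \<eta> n t *\<^sub>R G t) \<in> borel_measurable lborel" for n using \<eta>m[of n] G by measurable
    show "(\<lambda>t. indicator {a<..b} t *\<^sub>R G t) \<in> borel_measurable lborel" using G by measurable
  qed (use G in auto)
  then have "(\<lambda>n. - (LINT t|lborel. \<eta> n t *\<^sub>R g t)) \<longlonglongrightarrow> - (LINT t|lborel. indicator {a<..b} t *\<^sub>R G t)"
    unfolding \<eta>G by (rule tendsto_minus)
  from LIMSEQ_unique[OF L this] have "f b - f a = (LINT t|lborel. indicator {a<..b} t *\<^sub>R G t)"
    by (simp add: algebra_simps)
  also have "\<dots> = (LINT t|lborel. indicator {a..b} t *\<^sub>R g t)"
  proof (rule integral_cong_AE)
    show "(\<lambda>t. indicator {a<..b} t *\<^sub>R G t) \<in> borel_measurable lborel" using G by measurable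
    have "(\<lambda>t. indicator {a..b} t *\<^sub>R G t) \<in> borel_measurable lborel" using G by measurable
    moreover have "indicator {a..b} t *\<^sub>R G t = indicator {a..b} t *\<^sub>R g t" for t
      using ab by (auto simp: G_def indicator_def)
    ultimately show "(\<lambda>t. indicator {a..b} t *\<^sub>R g t) \<in> borel_measurable lborel" by simp
    show "AE t in lborel. indicator {a<..b} t *\<^sub>R G t = indicator {a..b} t *\<^sub>R g t"
      using AE_lborel_singleton[of a] by eventually_elim (use ab in \<open>auto simp: G_def indicator_def\<close>)
  qed
  finally show ?thesis by (simp add: set_lebesgue_integral_def)
qed

section \<open>Gaussian wave packets as test functions\<close>

text \<open>Polynomials times a fixed Gaussian, generated by multiplication with linear forms; the
  class is closed under partial derivatives, which gives the Schwartz bounds.\<close>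

inductive poly_gauss :: "complex \<Rightarrow> 'a::euclidean_space \<Rightarrow> 'a \<Rightarrow> ('a \<Rightarrow> complex) \<Rightarrow> bool" for \<alpha> p q where
  gauss: "poly_gauss \<alpha> p q (cgauss \<alpha> p q)"
| add: "poly_gauss \<alpha> p q f \<Longrightarrow> poly_gauss \<alpha> p q g \<Longrightarrow> poly_gauss \<alpha> p q (\<lambda>x. f x + g x)"
| scale: "poly_gauss \<alpha> p q f \<Longrightarrow> poly_gauss \<alpha> p q (\<lambda>x. c * f x)"
| coord: "poly_gauss \<alpha> p q f \<Longrightarrow> poly_gauss \<alpha> p q (\<lambda>x. of_real (x \<bullet> b) * f x)"

lemma cgauss_directional_derivative:
  "((\<lambda>s. cgauss \<alpha> p q (x + s *\<^sub>R b)) has_vector_derivative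
     (- 2 * \<alpha> * of_real (x \<bullet> b) + (of_real (p \<bullet> b) + \<i> * of_real (q \<bullet> b))) * cgauss \<alpha> p q x) (at 0)"
proof -
  have "((\<lambda>z. exp (- \<alpha> * (of_real (x \<bullet> x) + 2 * z * of_real (x \<bullet> b) + z\<^sup>2 * of_real (b \<bullet> b))
      + (of_real (p \<bullet> x) + z * of_real (p \<bullet> b)) + \<i> * (of_real (q \<bullet> x) + z * of_real (q \<bullet> b)))) has_field_derivative
     (- 2 * \<alpha> * of_real (x \<bullet> b) + (of_real (p \<bullet> b) + \<i> * of_real (q \<bullet> b))) * cgauss \<alpha> p q x) (at (of_real 0))"
    unfolding cgauss_def by (rule derivative_eq_intros refl)+ (simp add: algebra_simps)
  from has_vector_derivative_real_field[OF this] show ?thesis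
    unfolding cgauss_def by (simp add: inner_add_left inner_add_right inner_commute[of b x] algebra_simps power2_eq_square)
qed

lemma cgauss_differentiable: "cgauss \<alpha> p q differentiable (at x)"
proof -
  have "(\<lambda>x. - \<alpha> * of_real (x \<bullet> x) + of_real (p \<bullet> x) + \<i> * of_real (q \<bullet> x)) differentiable (at x)"
    unfolding differentiable_def by (rule exI) (rule derivative_eq_intros refl)+
  moreover have "(exp :: complex \<Rightarrow> complex) differentiable (at z)" for z
    by (intro field_differentiable_imp_differentiable) (auto simp: field_differentiable_def intro: DERIV_exp)
  ultimately have "(exp \<circ> (\<lambda>x. - \<alpha> * of_real (x \<bullet> x) + of_real (p \<bullet> x) + \<i> * of_real (q \<bullet> x))) differentiable (at x)"
    by (intro differentiable_chain_at)
  then show ?thesis by (simp add: cgauss_def[abs_def] o_def)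
qed

lemma poly_gauss_differentiable: "poly_gauss \<alpha> p q f \<Longrightarrow> f differentiable (at x)"
proof (induction rule: poly_gauss.induct)
  case (coord f b)
  have "(\<lambda>x. complex_of_real (x \<bullet> b)) differentiable (at x)"
    unfolding differentiable_def by (rule exI) (rule derivative_eq_intros refl)+
  then show ?case using coord.IH by (intro differentiable_mult)
qed (auto intro: cgauss_differentiable)

lemma poly_gauss_directional_derivative:
  "poly_gauss \<alpha> p q f \<Longrightarrow> \<exists>g. poly_gauss \<alpha> p q g \<and> (\<forall>x. ((\<lambda>s. f (x + s *\<^sub>R b)) has_vector_derivative g x) (at 0))"
proof (induction rule: poly_gauss.induct)
  case gauss
  let ?g = "\<lambda>x. - 2 * \<alpha> * (of_real (x \<bullet> b) * cgauss \<alpha> p q x) + (of_real (p \<bullet> b) + \<i> * of_real (q \<bullet> b)) * cgauss \<alpha> p q x"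
  have "poly_gauss \<alpha> p q ?g" by (intro poly_gauss.intros)
  then show ?case using cgauss_directional_derivative[of \<alpha> p q _ b] by (intro exI[of _ ?g]) (simp add: algebra_simps)
next
  case (add f g)
  then obtain f' g' where f': "poly_gauss \<alpha> p q f'" "\<And>x. ((\<lambda>s. f (x + s *\<^sub>R b)) has_vector_derivative f' x) (at 0)"
    and g': "poly_gauss \<alpha> p q g'" "\<And>x. ((\<lambda>s. g (x + s *\<^sub>R b)) has_vector_derivative g' x) (at 0)" by blast
  show ?case by (intro exI[of _ "\<lambda>x. f' x + g' x"] conjI allI has_vector_derivative_add poly_gauss.intros f' g')
next
  case (scale f c)
  then obtain f' where f': "poly_gauss \<alpha> p q f'" "\<And>x. ((\<lambda>s. f (x + s *\<^sub>R b)) has_vector_derivative f' x) (at 0)" by blast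
  show ?case by (intro exI[of _ "\<lambda>x. c * f' x"] conjI allI has_vector_derivative_mult_right poly_gauss.intros f')
next
  case (coord f c)
  then obtain f' where f': "poly_gauss \<alpha> p q f'" "\<And>x. ((\<lambda>s. f (x + s *\<^sub>R b)) has_vector_derivative f' x) (at 0)" by blast
  let ?g = "\<lambda>x. of_real (x \<bullet> c) * f' x + of_real (b \<bullet> c) * f x"
  have "((\<lambda>s. of_real ((x + s *\<^sub>R b) \<bullet> c) * f (x + s *\<^sub>R b)) has_vector_derivative ?g x) (at 0)" for x
  proof -
    have "((\<lambda>s. (x + s *\<^sub>R b) \<bullet> c) has_real_derivative b \<bullet> c) (at 0)"
      by (auto intro!: derivative_eq_intros simp: inner_add_left)
    from has_vector_derivative_mult[OF has_vector_derivative_of_real[OF this] f'(2)[of x]] show ?thesis by simp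
  qed
  moreover have "poly_gauss \<alpha> p q ?g" by (intro poly_gauss.intros f' coord.hyps)
  ultimately show ?case by (intro exI[of _ ?g]) blast
qed

lemma poly_gauss_partial: "poly_gauss \<alpha> p q f \<Longrightarrow> poly_gauss \<alpha> p q (partial b f)"
proof -
  assume "poly_gauss \<alpha> p q f"
  then obtain g where g: "poly_gauss \<alpha> p q g" "\<And>x. ((\<lambda>s. f (x + s *\<^sub>R b)) has_vector_derivative g x) (at 0)"
    using poly_gauss_directional_derivative by blast
  then have "partial b f = g" unfolding partial_def by (intro ext vector_derivative_at)
  with g show ?thesis by simp
qed

lemma poly_gauss_bound:
  "poly_gauss \<alpha> p q f \<Longrightarrow> \<exists>C k. C \<ge> 0 \<and> (\<forall>x. norm (f x) \<le> C * (1 + norm x) ^ k * norm (cgauss \<alpha> p q x))"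
proof (induction rule: poly_gauss.induct)
  case gauss
  show ?case by (intro exI[of _ 1] exI[of _ 0]) simp
next
  case (add f g)
  then obtain C k D l where 1: "C \<ge> 0" "\<And>x. norm (f x) \<le> C * (1 + norm x) ^ k * norm (cgauss \<alpha> p q x)"
    and 2: "D \<ge> 0" "\<And>x. norm (g x) \<le> D * (1 + norm x) ^ l * norm (cgauss \<alpha> p q x)" by blast
  have "norm (f x + g x) \<le> (C + D) * (1 + norm x) ^ (k + l) * norm (cgauss \<alpha> p q x)" for x
  proof -
    have "norm (f x + g x) \<le> C * (1 + norm x) ^ k * norm (cgauss \<alpha> p q x) + D * (1 + norm x) ^ l * norm (cgauss \<alpha> p q x)"
      by (intro norm_triangle_le add_mono 1 2)
    also have "\<dots> \<le> C * (1 + norm x) ^ (k + l) * norm (cgauss \<alpha> p q x) + D * (1 + norm x) ^ (k + l) * norm (cgauss \<alpha> p q x)"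
      using 1 2 by (intro add_mono mult_right_mono mult_left_mono power_increasing) auto
    finally show ?thesis by (simp add: algebra_simps)
  qed
  then show ?case using 1 2 by (intro exI[of _ "C + D"] exI[of _ "k + l"]) auto
next
  case (scale f c)
  then obtain C k where 1: "C \<ge> 0" "\<And>x. norm (f x) \<le> C * (1 + norm x) ^ k * norm (cgauss \<alpha> p q x)" by blast
  then show ?case using mult_left_mono[OF 1(2) norm_ge_zero[of c]]
    by (intro exI[of _ "norm c * C"] exI[of _ k]) (auto simp: norm_mult mult.assoc)
next
  case (coord f b)
  then obtain C k where 1: "C \<ge> 0" "\<And>x. norm (f x) \<le> C * (1 + norm x) ^ k * norm (cgauss \<alpha> p q x)" by blast
  have "norm (of_real (x \<bullet> b) * f x) \<le> (norm b * C) * (1 + norm x) ^ Suc k * norm (cgauss \<alpha> p q x)" for x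
  proof -
    have "\<bar>x \<bullet> b\<bar> \<le> (1 + norm x) * norm b"
      using Cauchy_Schwarz_ineq2[of x b] mult_right_mono[of "norm x" "1 + norm x" "norm b"] by simp
    then have "\<bar>x \<bullet> b\<bar> * norm (f x) \<le> ((1 + norm x) * norm b) * (C * (1 + norm x) ^ k * norm (cgauss \<alpha> p q x))"
      using 1 by (intro mult_mono) auto
    then show ?thesis by (simp add: norm_mult mult_ac)
  qed
  then show ?case using 1 by (intro exI[of _ "norm b * C"] exI[of _ "Suc k"]) auto
qed

lemma poly_times_gauss_bounded:
  fixes a b :: real
  assumes a: "a > 0"
  obtains B where "\<And>y. y \<ge> 0 \<Longrightarrow> (1 + y) ^ m * exp (- a * y\<^sup>2 + b * y) \<le> B"
proof -
  let ?h = "\<lambda>y::real. (1 + y) ^ m * exp (- a * y\<^sup>2 + b * y)"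
  have "(?h \<longlongrightarrow> 0) at_top" using a by real_asymp
  then have "\<forall>\<^sub>F y in at_top. ?h y < 1" by (rule order_tendstoD) simp
  then obtain Y where Y: "\<And>y. y \<ge> Y \<Longrightarrow> ?h y < 1" by (auto simp: eventually_at_top_linorder)
  have "continuous_on {0..max 0 Y} ?h" by (intro continuous_intros)
  from compact_imp_bounded[OF compact_continuous_image[OF this compact_Icc]]
  obtain C where "\<forall>z\<in>?h ` {0..max 0 Y}. norm z \<le> C" unfolding bounded_iff by blast
  then have C: "?h y \<le> C" if "0 \<le> y" "y \<le> max 0 Y" for y 
  proof -
    have "?h y \<in> ?h ` {0..max 0 Y}" using that by (intro imageI) simp
    then have "norm (?h y) \<le> C" using \<open>\<forall>z\<in>?h ` {0..max 0 Y}. norm z \<le> C\<close> by blast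
    then show ?thesis unfolding real_norm_def by linarith
  qed
  have "?h y \<le> max 1 C" if "y \<ge> 0" for y
    using Y[of y] C[of y] that by (cases "y \<le> Y") (auto simp: le_max_iff_disj)
  then show ?thesis by (rule that)
qed

lemma poly_gauss_schwartz:
  fixes p q :: "'a::euclidean_space"
  assumes \<alpha>: "Re \<alpha> > 0" and f: "poly_gauss \<alpha> p q f"
  shows "schwartz f"
  unfolding schwartz_def
proof (intro conjI ballI allI)
  have X: "partial b g \<in> Collect (poly_gauss \<alpha> p q)" if "g \<in> Collect (poly_gauss \<alpha> p q)" for g b
    using that poly_gauss_partial by auto
  show "smooth f" by (rule smooth_of_class[OF X]) (use f poly_gauss_differentiable in auto)
  fix bs :: "'a list" and k :: nat assume bs: "bs \<in> lists Basis"
  have "partials bs f \<in> Collect (poly_gauss \<alpha> p q)" by (rule partials_in_class[OF X _ bs]) (use f in auto)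
  then obtain C l where C: "C \<ge> 0" "\<And>x. norm (partials bs f x) \<le> C * (1 + norm x) ^ l * norm (cgauss \<alpha> p q x)"
    using poly_gauss_bound by blast
  obtain B where B: "\<And>y. y \<ge> 0 \<Longrightarrow> (1 + y) ^ (k + l) * exp (- Re \<alpha> * y\<^sup>2 + norm p * y) \<le> B"
    using poly_times_gauss_bounded[OF \<alpha>] by blast
  have "norm (norm x ^ k *\<^sub>R partials bs f x) \<le> C * B" for x
  proof -
    have "norm (cgauss \<alpha> p q x) = exp (- Re \<alpha> * (norm x)\<^sup>2 + p \<bullet> x)"
      by (simp add: cgauss_def norm_exp_eq_Re dot_square_norm)
    also have "\<dots> \<le> exp (- Re \<alpha> * (norm x)\<^sup>2 + norm p * norm x)" using norm_cauchy_schwarz[of p x] by simp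
    finally have g: "norm (cgauss \<alpha> p q x) \<le> exp (- Re \<alpha> * (norm x)\<^sup>2 + norm p * norm x)" .
    have "norm (norm x ^ k *\<^sub>R partials bs f x) \<le> (1 + norm x) ^ k * (C * (1 + norm x) ^ l * norm (cgauss \<alpha> p q x))"
      using C by (auto intro!: mult_mono power_mono)
    also have "\<dots> \<le> (1 + norm x) ^ k * (C * (1 + norm x) ^ l * exp (- Re \<alpha> * (norm x)\<^sup>2 + norm p * norm x))"
      using C g by (intro mult_left_mono) auto
    also have "\<dots> = C * ((1 + norm x) ^ (k + l) * exp (- Re \<alpha> * (norm x)\<^sup>2 + norm p * norm x))"
      by (simp add: power_add mult_ac)
    also have "\<dots> \<le> C * B" using C B[of "norm x"] by (intro mult_left_mono) auto
    finally show ?thesis .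
  qed
  then show "bounded (range (\<lambda>x. norm x ^ k *\<^sub>R partials bs f x))" unfolding bounded_iff by blast
qed

lemma gauss_wave_schwartz:
  assumes a: "a > 0" shows "schwartz (gauss_wave a p t)"
proof -
  define c where "c = \<i> / (2 * Complex a t)"
  have R: "Re (1 / (4 * Complex a t)) > 0"
  proof -
    have "Re (1 / (4 * Complex a t)) = 4 * a / ((4 * a)\<^sup>2 + (4 * t)\<^sup>2)" by (simp add: Re_divide)
    also have "\<dots> > 0" using a by (intro divide_pos_pos add_pos_nonneg) auto
    finally show ?thesis .
  qed
  have "gauss_wave a p t = (\<lambda>x. ((1 / csqrt (2 * Complex a t)) ^ DIM('a) * exp (of_real (p \<bullet> p) / (4 * Complex a t)))
    * cgauss (1 / (4 * Complex a t)) (Re c *\<^sub>R p) (Im c *\<^sub>R p) x)"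
    unfolding c_def using gauss_wave_eq_cgauss[OF a] by (intro ext)
  then show ?thesis by (simp only:) (rule poly_gauss_schwartz[OF R poly_gauss.scale[OF poly_gauss.gauss]])
qed

text \<open>The numerator of the exponent of \<open>gauss_wave\<close>.\<close>

definition gauss_wave_quad :: "'a::euclidean_space \<Rightarrow> 'a \<Rightarrow> complex" where
  "gauss_wave_quad p x = of_real (p \<bullet> p - x \<bullet> x) + 2 * \<i> * of_real (p \<bullet> x)"

definition gauss_wave_dt :: "real \<Rightarrow> 'a::euclidean_space \<Rightarrow> real \<Rightarrow> 'a \<Rightarrow> complex" where
  "gauss_wave_dt a p t x = (- of_real (real DIM('a)) * \<i> / (2 * Complex a t) - \<i> * gauss_wave_quad p x / (4 * (Complex a t)\<^sup>2)) * gauss_wave a p t x"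

lemma gauss_wave_has_derivative:
  fixes p x :: "'a::euclidean_space"
  assumes a: "a > 0"
  shows "((\<lambda>t. gauss_wave a p t x) has_vector_derivative gauss_wave_dt a p t x) (at t)"
proof -
  define Q where "Q = gauss_wave_quad p x"
  define A where "A z = of_real a + \<i> * z" for z :: complex
  have AC: "A (of_real t) = Complex a t" for t by (simp add: A_def complex_eq_iff)
  have A0: "A (of_real t) \<noteq> 0" "2 * A (of_real t) \<notin> \<real>\<^sub>\<le>\<^sub>0" unfolding AC using a by (auto simp: complex_eq_iff complex_nonpos_Reals_iff)
  define c where "c = csqrt (2 * A (of_real t))"
  have c: "c \<noteq> 0" "c\<^sup>2 = 2 * A (of_real t)" using A0 by (auto simp: c_def)
  have d1: "((\<lambda>z. csqrt (2 * A z)) has_field_derivative \<i> / c) (at (of_real t))"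
  proof -
    have "((\<lambda>z. 2 * A z) has_field_derivative 2 * \<i>) (at (of_real t))"
      unfolding A_def by (rule derivative_eq_intros refl)+ simp
    from DERIV_chain2[OF has_field_derivative_csqrt[OF A0(2)] this] show ?thesis
      by (simp add: c_def field_simps)
  qed
  have d2: "((\<lambda>z. (1 / csqrt (2 * A z)) ^ DIM('a)) has_field_derivative
      - of_real (real DIM('a)) * \<i> / (2 * A (of_real t)) * (1 / c) ^ DIM('a)) (at (of_real t))"
  proof -
    have "((\<lambda>z. (inverse (csqrt (2 * A z))) ^ DIM('a)) has_field_derivative
       of_nat DIM('a) * (- (inverse c * (\<i> / c) * inverse c) * (inverse c) ^ (DIM('a) - 1))) (at (of_real t))"
      unfolding c_def
      by (rule DERIV_power[OF DERIV_inverse'[OF d1[unfolded c_def]], of "DIM('a)", THEN DERIV_cong]) (use c(1) in \<open>auto simp: c_def\<close>)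
    moreover have "of_nat DIM('a) * (- (inverse c * (\<i> / c) * inverse c) * (inverse c) ^ (DIM('a) - 1))
      = - of_real (real DIM('a)) * \<i> / (c\<^sup>2) * (1 / c) ^ DIM('a)"
    proof -
      have "(inverse c) ^ DIM('a) = inverse c * (inverse c) ^ (DIM('a) - 1)"
        using DIM_positive[where 'a='a] by (metis Suc_pred' power_Suc)
      then show ?thesis using c(1) by (simp add: field_simps power2_eq_square)
    qed
    ultimately show ?thesis by (simp add: c(2) inverse_eq_divide)
  qed
  have d3: "((\<lambda>z. exp (Q / (4 * A z))) has_field_derivative - \<i> * Q / (4 * (A (of_real t))\<^sup>2) * exp (Q / (4 * A (of_real t)))) (at (of_real t))"
  proof -
    have "((\<lambda>z. Q / (4 * A z)) has_field_derivative - \<i> * Q / (4 * (A (of_real t))\<^sup>2)) (at (of_real t))"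
      unfolding A_def
      apply (rule derivative_eq_intros refl)+
      subgoal using A0(1) unfolding A_def by (metis mult_eq_0_iff zero_neq_numeral)
      using A0(1) unfolding A_def[symmetric] by (simp add: power2_eq_square field_simps)
    from DERIV_chain2[OF DERIV_exp this] show ?thesis by (simp add: mult.commute)
  qed
  have gw: "gauss_wave a p t x = (1 / c) ^ DIM('a) * exp (Q / (4 * A (of_real t)))"
    by (simp only: gauss_wave_def AC c_def Q_def gauss_wave_quad_def)
  have "((\<lambda>z. (1 / csqrt (2 * A z)) ^ DIM('a) * exp (Q / (4 * A z))) has_field_derivative gauss_wave_dt a p t x) (at (of_real t))"
    unfolding gauss_wave_dt_def gw AC[symmetric] Q_def[symmetric]
    by (rule DERIV_cong[OF DERIV_mult[OF d2 d3]]) (simp only: c_def[symmetric], simp add: algebra_simps)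
  from has_vector_derivative_real_field[OF this] show ?thesis
    by (simp add: gauss_wave_def[abs_def] AC Q_def gauss_wave_quad_def)
qed

text \<open>The explicit Gaussian solves \<open>\<i> \<partial>\<^sub>t W + \<Delta> W =
  0\<close>.\<close>

lemma gauss_wave_laplacian:
  fixes p x :: "'a::euclidean_space"
  assumes a: "a > 0"
  shows "laplacian (gauss_wave a p t) x = - \<i> * gauss_wave_dt a p t x"
proof -
  define \<alpha> where "\<alpha> = Complex a t"
  have \<alpha>: "\<alpha> \<noteq> 0" using a by (simp add: \<alpha>_def complex_eq_iff)
  define m where "m b x = of_real (p \<bullet> b) + \<i> * of_real (x \<bullet> b)" for b x :: 'a
  define W where "W = gauss_wave a p t"
  have W': "((\<lambda>s. W (x + s *\<^sub>R b)) has_vector_derivative \<i> / (2 * \<alpha>) * m b x * W x) (at 0)" for b x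
  proof -
    define K k where "K = (1 / csqrt (2 * \<alpha>)) ^ DIM('a)" and "k = 1 / (4 * \<alpha>)"
    have Wk: "W y = K * exp (k * (of_real (p \<bullet> p) - of_real (y \<bullet> y) + 2 * \<i> * of_real (p \<bullet> y)))" for y
      by (simp add: W_def gauss_wave_def \<alpha>_def[symmetric] K_def k_def)
    have "((\<lambda>z. K * exp (k * (of_real (p \<bullet> p) - (of_real (x \<bullet> x) + 2 * z * of_real (x \<bullet> b) + z\<^sup>2 * of_real (b \<bullet> b))
        + 2 * \<i> * (of_real (p \<bullet> x) + z * of_real (p \<bullet> b))))) has_field_derivative (2 * k * (\<i> * m b x)) * W x) (at (of_real 0))"
      unfolding Wk m_def by (rule derivative_eq_intros refl)+ (simp add: algebra_simps)
    from has_vector_derivative_real_field[OF this]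
    have "((\<lambda>s. W (x + s *\<^sub>R b)) has_vector_derivative (2 * k * (\<i> * m b x)) * W x) (at 0)"
      unfolding Wk by (simp add: inner_add_left inner_add_right inner_commute[of b x] algebra_simps power2_eq_square)
    also have "2 * k * (\<i> * m b x) = \<i> / (2 * \<alpha>) * m b x" using \<alpha> by (simp add: k_def)
    finally show ?thesis .
  qed
  have pW: "partial b W = (\<lambda>x. \<i> / (2 * \<alpha>) * m b x * W x)" for b
    unfolding partial_def by (intro ext vector_derivative_at W')
  have ppW: "partial b (partial b W) x = (- 1 / (2 * \<alpha>) - (m b x)\<^sup>2 / (4 * \<alpha>\<^sup>2)) * W x" if b: "b \<in> Basis" for b
  proof -
    have "((\<lambda>s. \<i> / (2 * \<alpha>) * m b (x + s *\<^sub>R b)) has_vector_derivative \<i> / (2 * \<alpha>) * \<i>) (at 0)"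
    proof -
      have "((\<lambda>z. \<i> / (2 * \<alpha>) * (of_real (p \<bullet> b) + \<i> * (of_real (x \<bullet> b) + z))) has_field_derivative \<i> / (2 * \<alpha>) * \<i>) (at (of_real 0))"
        by (rule derivative_eq_intros refl)+ simp
      from has_vector_derivative_real_field[OF this] show ?thesis using b by (simp add: m_def inner_add_left)
    qed
    from has_vector_derivative_mult[OF this W'[of x b]]
    have "((\<lambda>s. \<i> / (2 * \<alpha>) * m b (x + s *\<^sub>R b) * W (x + s *\<^sub>R b)) has_vector_derivative
      (\<i> / (2 * \<alpha>) * m b x * (\<i> / (2 * \<alpha>) * m b x * W x) + \<i> / (2 * \<alpha>) * \<i> * W x)) (at 0)" by simp
    then have "partial b (\<lambda>x. \<i> / (2 * \<alpha>) * m b x * W x) x = \<i> / (2 * \<alpha>) * m b x * (\<i> / (2 * \<alpha>) * m b x * W x) + \<i> / (2 * \<alpha>) * \<i> * W x"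
      unfolding partial_def by (rule vector_derivative_at)
    then show ?thesis unfolding pW using \<alpha> by (simp add: power2_eq_square field_simps)
  qed
  have Q: "(\<Sum>b\<in>Basis. (m b x)\<^sup>2) = gauss_wave_quad p x"
    unfolding gauss_wave_quad_def m_def euclidean_inner[of p p] euclidean_inner[of x x] euclidean_inner[of p x] of_real_diff of_real_sum sum_distrib_left
      sum.distrib[symmetric] sum_subtractf[symmetric]
    by (intro sum.cong refl) (simp add: algebra_simps power2_eq_square)
  have "laplacian W x = (\<Sum>b\<in>Basis. (- 1 / (2 * \<alpha>) - (m b x)\<^sup>2 / (4 * \<alpha>\<^sup>2)) * W x)"
    unfolding laplacian_def by (intro sum.cong refl ppW)
  also have "\<dots> = (- of_real (real DIM('a)) / (2 * \<alpha>) - gauss_wave_quad p x / (4 * \<alpha>\<^sup>2)) * W x"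
    by (simp add: sum_distrib_right[symmetric] sum_subtractf Q flip: sum_divide_distrib)
  also have "\<dots> = - \<i> * gauss_wave_dt a p t x"
    unfolding gauss_wave_dt_def W_def \<alpha>_def[symmetric] by (simp add: algebra_simps)
  finally show ?thesis by (simp add: W_def)
qed

text \<open>The quadratic factor of the time derivative costs half of the Gaussian decay.\<close>

lemma gauss_wave_dt_dominated:
  fixes p :: "'a::euclidean_space"
  assumes a: "a > 0"
  shows "gauss_dominated (gauss_wave_dt a p) {-T..T}"
proof -
  obtain C c where C: "0 \<le> C" "0 < c" "\<And>t x. t \<in> {-T..T} \<Longrightarrow> norm (gauss_wave a p t x) \<le> C * exp (- c * (x \<bullet> x))"
    using gauss_evolution_wave_dominated[OF gauss_evolution.gauss[OF a, of p], of T] unfolding gauss_dominated_def by blast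
  define A where "A = real DIM('a) / (2 * a)"
  define B where "B = 1 / (4 * a\<^sup>2)"
  have AB: "A \<ge> 0" "B \<ge> 0" using a by (auto simp: A_def B_def)
  define D where "D = A + B * (2 * (p \<bullet> p)) + B * (2 * (2 / c))"
  have "norm (gauss_wave_dt a p t x) \<le> (D * C) * exp (- (c / 2) * (x \<bullet> x))" if t: "t \<in> {-T..T}" for t x
  proof -
    have aa: "a \<le> norm (Complex a t)" using abs_Re_le_cmod[of "Complex a t"] a by simp
    have Q: "norm (gauss_wave_quad p x) \<le> 2 * (p \<bullet> p) + 2 * (x \<bullet> x)"
    proof -
      have "norm (gauss_wave_quad p x) \<le> \<bar>p \<bullet> p - x \<bullet> x\<bar> + 2 * \<bar>p \<bullet> x\<bar>"
        unfolding gauss_wave_quad_def by (rule norm_triangle_le) (simp add: norm_mult del: of_real_diff)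
      also have "\<bar>p \<bullet> p - x \<bullet> x\<bar> \<le> p \<bullet> p + x \<bullet> x" using inner_ge_zero[of p] inner_ge_zero[of x] by linarith
      also have "2 * \<bar>p \<bullet> x\<bar> \<le> p \<bullet> p + x \<bullet> x"
      proof -
        have "0 \<le> (norm p - norm x)\<^sup>2" by simp
        then have "2 * (norm p * norm x) \<le> p \<bullet> p + x \<bullet> x" by (simp add: power2_diff dot_square_norm)
        then show ?thesis using Cauchy_Schwarz_ineq2[of p x] by linarith
      qed
      finally show ?thesis by simp
    qed
    have 1: "norm (of_real (real DIM('a)) * \<i> / (2 * Complex a t)) \<le> A"
      unfolding A_def using a aa by (simp add: norm_divide norm_mult) (intro divide_left_mono mult_pos_pos, auto)
    have 2: "norm (\<i> * gauss_wave_quad p x / (4 * (Complex a t)\<^sup>2)) \<le> B * (2 * (p \<bullet> p) + 2 * (x \<bullet> x))"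
    proof -
      have "norm (\<i> * gauss_wave_quad p x / (4 * (Complex a t)\<^sup>2)) = norm (gauss_wave_quad p x) / (4 * (norm (Complex a t))\<^sup>2)"
        by (simp add: norm_divide norm_mult norm_power)
      also have "\<dots> \<le> (2 * (p \<bullet> p) + 2 * (x \<bullet> x)) / (4 * a\<^sup>2)"
        using Q a aa by (intro frac_le mult_left_mono power_mono) auto
      finally show ?thesis by (simp add: B_def)
    qed
    have "norm (gauss_wave_dt a p t x) \<le> (A + B * (2 * (p \<bullet> p) + 2 * (x \<bullet> x))) * (C * exp (- c * (x \<bullet> x)))"
      unfolding gauss_wave_dt_def norm_mult
    proof (rule mult_mono)
      show "norm (- of_real (real DIM('a)) * \<i> / (2 * Complex a t) - \<i> * gauss_wave_quad p x / (4 * (Complex a t)\<^sup>2)) \<le> A + B * (2 * (p \<bullet> p) + 2 * (x \<bullet> x))"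
        by (rule order_trans[OF norm_triangle_ineq4 add_mono[OF _ 2]]) (use 1 in simp)
      show "0 \<le> A + B * (2 * (p \<bullet> p) + 2 * (x \<bullet> x))" using AB by simp
    qed (use C t in auto)
    also have "\<dots> = C * ((A + B * (2 * (p \<bullet> p) + 2 * (x \<bullet> x))) * exp (- (c / 2) * (x \<bullet> x)) * exp (- (c / 2) * (x \<bullet> x)))"
      by (simp flip: exp_add add: mult.assoc)
    also have "(A + B * (2 * (p \<bullet> p) + 2 * (x \<bullet> x))) * exp (- (c / 2) * (x \<bullet> x)) \<le> D"
    proof -
      have e1: "exp (- (c / 2) * (x \<bullet> x)) \<le> 1" using C by simp
      have "c / 2 * (x \<bullet> x) \<le> exp (c / 2 * (x \<bullet> x))" using exp_ge_add_one_self[of "c / 2 * (x \<bullet> x)"] by linarith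
      then have "(x \<bullet> x) * exp (- (c / 2) * (x \<bullet> x)) \<le> 2 / c" using C by (simp add: exp_minus field_simps)
      then have "B * (2 * ((x \<bullet> x) * exp (- (c / 2) * (x \<bullet> x)))) \<le> B * (2 * (2 / c))" using AB by (intro mult_left_mono) auto
      moreover have "(A + B * (2 * (p \<bullet> p))) * exp (- (c / 2) * (x \<bullet> x)) \<le> (A + B * (2 * (p \<bullet> p))) * 1"
        using AB e1 by (intro mult_left_mono) auto
      ultimately show ?thesis unfolding D_def by (simp add: algebra_simps)
    qed
    finally show ?thesis using C by (simp add: mult_left_mono mult_right_mono mult_ac)
  qed
  moreover have "0 \<le> D * C" using AB C unfolding D_def by (intro mult_nonneg_nonneg add_nonneg_nonneg) auto
  ultimately show ?thesis unfolding gauss_dominated_def using C by (intro exI[of _ "D * C"] exI[of _ "c / 2"]) auto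
qed

section \<open>Pairings with \<open>L\<^sup>2\<close> functions and the forcing term\<close>

lemma L2_pairing_cnj: "L2_pairing g f = cnj (L2_pairing f g)"
proof -
  have "cnj (L2_pairing f g) = (LINT x|lborel. cnj (f x * cnj (g x)))"
    unfolding L2_pairing_def by (rule Bochner_Integration.integral_cnj[symmetric])
  then show ?thesis by (simp add: L2_pairing_def mult.commute)
qed

lemma L2_pairing_diff_left:
  "f \<in> Lp 2 \<Longrightarrow> g \<in> Lp 2 \<Longrightarrow> h \<in> Lp 2 \<Longrightarrow> L2_pairing (\<lambda>x. f x - g x) h = L2_pairing f h - L2_pairing g h"
  unfolding L2_pairing_def by (simp add: left_diff_distrib Bochner_Integration.integral_diff L2_pairing_integrable)

lemma L2_pairing_diff_right:
  "f \<in> Lp 2 \<Longrightarrow> g \<in> Lp 2 \<Longrightarrow> h \<in> Lp 2 \<Longrightarrow> L2_pairing f (\<lambda>x. g x - h x) = L2_pairing f g - L2_pairing f h"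
  unfolding L2_pairing_def by (simp add: right_diff_distrib Bochner_Integration.integral_diff L2_pairing_integrable)

lemma L2_pairing_add_right:
  "f \<in> Lp 2 \<Longrightarrow> g \<in> Lp 2 \<Longrightarrow> h \<in> Lp 2 \<Longrightarrow> L2_pairing f (\<lambda>x. g x + h x) = L2_pairing f g + L2_pairing f h"
  unfolding L2_pairing_def by (simp add: distrib_left Bochner_Integration.integral_add L2_pairing_integrable)

lemma L2_pairing_cmult_right: "L2_pairing f (\<lambda>x. c * g x) = cnj c * L2_pairing f g"
  unfolding L2_pairing_def by (simp add: mult.left_commute[of _ "cnj c"])

lemma enn2real_tendsto_0: 
  assumes "((f :: _ \<Rightarrow> ennreal) \<longlongrightarrow> 0) F" shows "((\<lambda>x. enn2real (f x)) \<longlongrightarrow> 0) F"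
proof (rule tendstoI)
  fix e :: real assume e: "e > 0"
  have "\<forall>\<^sub>F x in F. f x < ennreal (e / 2)" using assms e by (simp add: ennreal_tendsto_0_iff)
  then show "\<forall>\<^sub>F x in F. dist (enn2real (f x)) 0 < e"
  proof eventually_elim
    case (elim x)
    then have "enn2real (f x) \<le> e / 2" using e by (intro enn2real_leI) auto
    then show ?case using e by (simp add: dist_real_def)
  qed
qed

text \<open>Expand the difference into one term that is small in both factors and two terms with a
  fixed factor.\<close>

lemma L2_pairing_tendsto2:
  assumes L: "\<And>n. f n \<in> Lp 2" "g \<in> Lp 2" "\<And>n. h n \<in> Lp 2" "k \<in> Lp 2"
    and lim: "((\<lambda>n. N2 (\<lambda>x. f n x - g x)) \<longlongrightarrow> 0) F" "((\<lambda>n. N2 (\<lambda>x. h n x - k x)) \<longlongrightarrow> 0) F"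
  shows "((\<lambda>n. L2_pairing (f n) (h n)) \<longlongrightarrow> L2_pairing g k) F"
proof -
  have 1: "((\<lambda>n. L2_pairing (f n) k) \<longlongrightarrow> L2_pairing g k) F" by (rule L2_pairing_tendsto[OF L(1,2,4) lim(1)])
  have "((\<lambda>n. cnj (L2_pairing (h n) g)) \<longlongrightarrow> cnj (L2_pairing k g)) F"
    by (intro tendsto_cnj L2_pairing_tendsto[OF L(3,4,2) lim(2)])
  then have 2: "((\<lambda>n. L2_pairing g (h n)) \<longlongrightarrow> L2_pairing g k) F" by (simp flip: L2_pairing_cnj)
  have 3: "((\<lambda>n. L2_pairing (\<lambda>x. f n x - g x) (\<lambda>x. h n x - k x)) \<longlongrightarrow> 0) F"
  proof (rule Lim_null_comparison)
    show "\<forall>\<^sub>F n in F. norm (L2_pairing (\<lambda>x. f n x - g x) (\<lambda>x. h n x - k x))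
       \<le> (1 * enn2real (N2 (\<lambda>x. f n x - g x)) + enn2real (N2 (\<lambda>x. h n x - k x)) / 1) / 2"
      by (intro always_eventually allI L2_pairing_bound Lp_2_diff L) simp
    have "((\<lambda>n. (1 * enn2real (N2 (\<lambda>x. f n x - g x)) + enn2real (N2 (\<lambda>x. h n x - k x)) / 1) / 2) \<longlongrightarrow> (1 * 0 + 0 / 1) / 2) F"
      by (intro tendsto_intros enn2real_tendsto_0 lim) auto
    then show "((\<lambda>n. (1 * enn2real (N2 (\<lambda>x. f n x - g x)) + enn2real (N2 (\<lambda>x. h n x - k x)) / 1) / 2) \<longlongrightarrow> 0) F" by simp
  qed
  have "L2_pairing (f n) (h n) = L2_pairing (\<lambda>x. f n x - g x) (\<lambda>x. h n x - k x) + L2_pairing (f n) k + L2_pairing g (h n) - L2_pairing g k" for n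
    by (simp add: L2_pairing_diff_left L2_pairing_diff_right Lp_2_diff L)
  moreover have "((\<lambda>n. L2_pairing (\<lambda>x. f n x - g x) (\<lambda>x. h n x - k x) + L2_pairing (f n) k + L2_pairing g (h n) - L2_pairing g k)
     \<longlongrightarrow> 0 + L2_pairing g k + L2_pairing g k - L2_pairing g k) F" by (intro tendsto_intros 1 2 3)
  ultimately show ?thesis by simp
qed

text \<open>A version of the fundamental theorem for integrands that are known almost everywhere
  only: if the integrand is essentially close to \<open>c\<close> near \<open>t0\<close>, its
  primitive has derivative \<open>c\<close> there.\<close>

lemma has_vector_derivative_LINT_AE:
  fixes h :: "real \<Rightarrow> complex"
  assumes int: "set_integrable lborel {a..b} h" and t0: "t0 \<in> {a..b}"
    and lim: "\<And>e. e > 0 \<Longrightarrow> \<exists>d>0. AE s in lborel. s \<in> {a..b} \<and> \<bar>s - t0\<bar> < d \<longrightarrow> norm (h s - c) \<le> e"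
  shows "((\<lambda>t. LINT s:{a..t}|lborel. h s) has_vector_derivative c) (at t0 within {a..b})"
  unfolding has_vector_derivative_def has_derivative_within_alt
proof (intro conjI allI impI bounded_linear_scaleR_left)
  fix e :: real assume e: "e > 0"
  obtain d where d: "d > 0" "AE s in lborel. s \<in> {a..b} \<and> \<bar>s - t0\<bar> < d \<longrightarrow> norm (h s - c) \<le> e" using lim[OF e] by blast
  show "\<exists>d>0. \<forall>t\<in>{a..b}. norm (t - t0) < d \<longrightarrow> norm ((LINT s:{a..t}|lborel. h s) - (LINT s:{a..t0}|lborel. h s) - (t - t0) *\<^sub>R c) \<le> e * norm (t - t0)"
  proof (intro exI[of _ d] conjI ballI impI d(1))
    fix t assume t: "t \<in> {a..b}" "norm (t - t0) < d"
    have ih: "integrable lborel (\<lambda>s. indicator {a..t} s *\<^sub>R h s)" if "t \<in> {a..b}" for t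
      using set_integrable_subset[OF int, of "{a..t}"] that by (auto simp: set_integrable_def)
    have ic: "integrable lborel (\<lambda>s. indicator {a..t} s *\<^sub>R c)" for t :: real
      by (intro integrable_scaleR_left integrable_real_indicator) (auto simp: emeasure_lborel_Icc_eq)
    have cc: "(LINT s|lborel. indicator {a..t} s *\<^sub>R c) = (t - a) *\<^sub>R c" if "t \<ge> a" for t using that by simp
    have "(LINT s:{a..t}|lborel. h s) - (LINT s:{a..t0}|lborel. h s) - (t - t0) *\<^sub>R c
      = ((LINT s|lborel. indicator {a..t} s *\<^sub>R h s) - (LINT s|lborel. indicator {a..t} s *\<^sub>R c))
        - ((LINT s|lborel. indicator {a..t0} s *\<^sub>R h s) - (LINT s|lborel. indicator {a..t0} s *\<^sub>R c))"
      using t t0 by (subst (1 2) cc) (auto simp: set_lebesgue_integral_def algebra_simps)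
    also have "\<dots> = (LINT s|lborel. (indicator {a..t} s *\<^sub>R h s - indicator {a..t} s *\<^sub>R c) - (indicator {a..t0} s *\<^sub>R h s - indicator {a..t0} s *\<^sub>R c))"
      using ih[OF t(1)] ih[OF t0] ic by simp
    finally have e1: "(LINT s:{a..t}|lborel. h s) - (LINT s:{a..t0}|lborel. h s) - (t - t0) *\<^sub>R c
      = (LINT s|lborel. (indicator {a..t} s *\<^sub>R h s - indicator {a..t} s *\<^sub>R c) - (indicator {a..t0} s *\<^sub>R h s - indicator {a..t0} s *\<^sub>R c))" .
    have "norm ((LINT s:{a..t}|lborel. h s) - (LINT s:{a..t0}|lborel. h s) - (t - t0) *\<^sub>R c) \<le> (LINT s|lborel. norm ((indicator {a..t} s *\<^sub>R h s - indicator {a..t} s *\<^sub>R c) - (indicator {a..t0} s *\<^sub>R h s - indicator {a..t0} s *\<^sub>R c)))"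
      unfolding e1 by (rule integral_norm_bound)
    also have "\<dots> \<le> (LINT s|lborel. e * indicator {min t t0..max t t0} s)"
    proof (rule integral_mono_AE)
      show "integrable lborel (\<lambda>s. norm ((indicator {a..t} s *\<^sub>R h s - indicator {a..t} s *\<^sub>R c) - (indicator {a..t0} s *\<^sub>R h s - indicator {a..t0} s *\<^sub>R c)))"
        by (rule integrable_norm[OF Bochner_Integration.integrable_diff[OF Bochner_Integration.integrable_diff[OF ih[OF t(1)] ic]
          Bochner_Integration.integrable_diff[OF ih[OF t0] ic]]])
      show "integrable lborel (\<lambda>s. e * indicator {min t t0..max t t0} s :: real)"
        by (intro integrable_mult_right integrable_real_indicator) (auto simp: emeasure_lborel_Icc_eq)
      show "AE s in lborel. norm ((indicator {a..t} s *\<^sub>R h s - indicator {a..t} s *\<^sub>R c) - (indicator {a..t0} s *\<^sub>R h s - indicator {a..t0} s *\<^sub>R c))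
         \<le> e * indicator {min t t0..max t t0} s"
        using d(2)
      proof eventually_elim
        case (elim s)
        have "(indicator {a..t} s *\<^sub>R h s - indicator {a..t} s *\<^sub>R c) - (indicator {a..t0} s *\<^sub>R h s - indicator {a..t0} s *\<^sub>R c)
          = (indicator {a..t} s - indicator {a..t0} s) *\<^sub>R (h s - c)" by (simp add: algebra_simps)
        also have "norm \<dots> = \<bar>indicator {a..t} s - indicator {a..t0} s\<bar> * norm (h s - c)" by simp
        also have "\<dots> \<le> e * indicator {min t t0..max t t0} s"
        proof (cases "s \<in> {min t t0..max t t0}")
          case True
          then have "s \<in> {a..b}" "\<bar>s - t0\<bar> < d" using t t0 by (auto simp: min_def max_def split: if_splits)
          then have "norm (h s - c) \<le> e" using elim by blast
          moreover have "\<bar>indicator {a..t} s - indicator {a..t0} s\<bar> \<le> (1::real)" by (simp add: indicator_def)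
          ultimately have "\<bar>indicator {a..t} s - indicator {a..t0} s\<bar> * norm (h s - c) \<le> 1 * e" by (intro mult_mono) auto
          then show ?thesis using True by simp
        next
          case False
          then have "indicator {a..t} s = (indicator {a..t0} s :: real)"
            using t t0 by (cases "s < a") (auto simp: indicator_def min_def max_def split: if_splits)
          then show ?thesis using False by simp
        qed
        finally show ?case .
      qed
    qed
    also have "\<dots> = e * norm (t - t0)" by (simp add: min_def max_def abs_if)
    finally show "norm ((LINT s:{a..t}|lborel. h s) - (LINT s:{a..t0}|lborel. h s) - (t - t0) *\<^sub>R c) \<le> e * norm (t - t0)" .
  qed
qed

text \<open>The pairing of \<open>V u + \<mu> |u| u\<close> with a test function: the part of the
  right-hand side of the equation that does not cancel against a free wave.\<close>

definition forcing_pairing :: "complex \<Rightarrow> (real \<Rightarrow> 'a::euclidean_space \<Rightarrow> complex) \<Rightarrow> (real \<Rightarrow> 'a \<Rightarrow> complex) \<Rightarrow> ('a \<Rightarrow> complex) \<Rightarrow> real \<Rightarrow> complex" where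
  "forcing_pairing \<mu> V u \<phi> t = L2_pairing (\<lambda>x. V t x * u t x) \<phi> + L2_pairing (\<lambda>x. \<mu> * of_real (norm (u t x)) * u t x) \<phi>"

lemma integrable_mult_bounded:
  fixes f \<phi> :: "'a::euclidean_space \<Rightarrow> complex"
  assumes "integrable lborel f" "\<phi> \<in> borel_measurable borel" "bounded (range \<phi>)"
  shows "integrable lborel (\<lambda>x. f x * cnj (\<phi> x))"
proof -
  obtain B where B: "\<And>x. norm (\<phi> x) \<le> B" using assms(3) by (auto simp: bounded_iff)
  show ?thesis
  proof (rule Bochner_Integration.integrable_bound[OF integrable_mult_right[OF assms(1), of "of_real B"]])
    show "AE x in lborel. norm (f x * cnj (\<phi> x)) \<le> norm (complex_of_real B * f x)"
    proof (rule AE_I2)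
      fix x
      have "norm (\<phi> x) * norm (f x) \<le> \<bar>B\<bar> * norm (f x)" using B[of x] by (intro mult_right_mono) auto
      then show "norm (f x * cnj (\<phi> x)) \<le> norm (complex_of_real B * f x)" by (simp add: norm_mult mult.commute)
    qed
    have "f \<in> borel_measurable borel" using assms(1) by auto
    then show "(\<lambda>x. f x * cnj (\<phi> x)) \<in> borel_measurable lborel" using assms(2) by measurable
  qed
qed

lemma norm_mult_le_squares: "norm (a * b :: complex) \<le> ((norm a)\<^sup>2 + (norm b)\<^sup>2) / 2"
  using young_ineq[of 1 "norm a" "norm b"] by (simp add: norm_mult)

lemma forcing_integrable:
  assumes V: "v \<in> Lp 2" and u: "w \<in> Lp 2"
  shows "integrable lborel (\<lambda>x. v x * w x)" "integrable lborel (\<lambda>x. \<mu> * of_real (norm (w x)) * w x)"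
proof -
  show "integrable lborel (\<lambda>x. v x * w x)" by (rule L2_mult_integrable[OF V u])
  have "(\<lambda>x. complex_of_real (norm (w x))) \<in> Lp 2" using u by (auto simp: Lp_2_iff N2_def)
  from L2_mult_integrable[OF this u] show "integrable lborel (\<lambda>x. \<mu> * of_real (norm (w x)) * w x)"
    by (simp add: mult.assoc)
qed

lemma norm_mult_cnj_diff: "norm (X * cnj a - X * cnj b) = norm (a - b) * norm (X :: complex)"
proof -
  have "X * cnj a - X * cnj b = X * cnj (a - b)" by (simp add: right_diff_distrib)
  then show ?thesis by (simp only: norm_mult complex_mod_cnj mult.commute)
qed

text \<open>The factors \<open>V u\<close> and \<open>|u| u\<close> are in \<open>L\<^sup>1\<close>,
  so the pairing is Lipschitz in the test function in the uniform norm.\<close>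

lemma forcing_pairing_diff_bound:
  assumes V: "V t \<in> Lp 2" and u: "u t \<in> Lp 2"
    and \<phi>: "\<phi> \<in> borel_measurable borel" "bounded (range \<phi>)" and \<psi>: "\<psi> \<in> borel_measurable borel" "bounded (range \<psi>)"
    and B: "\<And>x. norm (\<phi> x - \<psi> x) \<le> B"
  shows "norm (forcing_pairing \<mu> V u \<phi> t - forcing_pairing \<mu> V u \<psi> t)
    \<le> B * (enn2real (N2 (V t)) + (1 + norm \<mu>) * enn2real (N2 (u t)))"
proof -
  note I = forcing_integrable[OF V u]
  have B0: "B \<ge> 0" using norm_ge_zero B by (rule order_trans)
  have eV: "enn2real (N2 (V t)) = (LINT x|lborel. (norm (V t x))\<^sup>2)" by (simp add: N2_eq_integral V)
  have eu: "enn2real (N2 (u t)) = (LINT x|lborel. (norm (u t x))\<^sup>2)" by (simp add: N2_eq_integral u)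
  have split: "forcing_pairing \<mu> V u \<phi> t - forcing_pairing \<mu> V u \<psi> t =
     (LINT x|lborel. V t x * u t x * cnj (\<phi> x) - V t x * u t x * cnj (\<psi> x))
     + (LINT x|lborel. \<mu> * of_real (norm (u t x)) * u t x * cnj (\<phi> x) - \<mu> * of_real (norm (u t x)) * u t x * cnj (\<psi> x))"
    unfolding forcing_pairing_def L2_pairing_def
    by (simp only: Bochner_Integration.integral_diff[OF integrable_mult_bounded[OF I(1) \<phi>] integrable_mult_bounded[OF I(1) \<psi>]]
        Bochner_Integration.integral_diff[OF integrable_mult_bounded[OF I(2) \<phi>] integrable_mult_bounded[OF I(2) \<psi>]]) simp
  have "norm (forcing_pairing \<mu> V u \<phi> t - forcing_pairing \<mu> V u \<psi> t) \<le> (LINT x|lborel. B * (((norm (V t x))\<^sup>2 + (norm (u t x))\<^sup>2) / 2)) + (LINT x|lborel. B * (norm \<mu> * (norm (u t x))\<^sup>2))"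
    unfolding split
  proof (rule order_trans[OF norm_triangle_ineq add_mono])
    show "norm (LINT x|lborel. V t x * u t x * cnj (\<phi> x) - V t x * u t x * cnj (\<psi> x)) \<le> (LINT x|lborel. B * (((norm (V t x))\<^sup>2 + (norm (u t x))\<^sup>2) / 2))"
    proof (rule order_trans[OF integral_norm_bound integral_mono])
      show "integrable lborel (\<lambda>x. norm (V t x * u t x * cnj (\<phi> x) - V t x * u t x * cnj (\<psi> x)))"
        by (intro integrable_norm Bochner_Integration.integrable_diff integrable_mult_bounded I \<phi> \<psi>)
      show "integrable lborel (\<lambda>x. B * (((norm (V t x))\<^sup>2 + (norm (u t x))\<^sup>2) / 2))"
        by (intro integrable_mult_right integrable_divide Bochner_Integration.integrable_add N2_integrable V u)
      fix x
      have "norm (V t x * u t x * cnj (\<phi> x) - V t x * u t x * cnj (\<psi> x)) = norm (\<phi> x - \<psi> x) * norm (V t x * u t x)"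
        by (rule norm_mult_cnj_diff)
      also have "\<dots> \<le> B * (((norm (V t x))\<^sup>2 + (norm (u t x))\<^sup>2) / 2)"
        using B0 by (intro mult_mono B norm_mult_le_squares) auto
      finally show "norm (V t x * u t x * cnj (\<phi> x) - V t x * u t x * cnj (\<psi> x)) \<le> B * (((norm (V t x))\<^sup>2 + (norm (u t x))\<^sup>2) / 2)" .
    qed
    show "norm (LINT x|lborel. \<mu> * of_real (norm (u t x)) * u t x * cnj (\<phi> x) - \<mu> * of_real (norm (u t x)) * u t x * cnj (\<psi> x)) \<le> (LINT x|lborel. B * (norm \<mu> * (norm (u t x))\<^sup>2))"
    proof (rule order_trans[OF integral_norm_bound integral_mono])
      show "integrable lborel (\<lambda>x. norm (\<mu> * of_real (norm (u t x)) * u t x * cnj (\<phi> x) - \<mu> * of_real (norm (u t x)) * u t x * cnj (\<psi> x)))"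
        by (intro integrable_norm Bochner_Integration.integrable_diff integrable_mult_bounded I \<phi> \<psi>)
      show "integrable lborel (\<lambda>x. B * (norm \<mu> * (norm (u t x))\<^sup>2))"
        by (intro integrable_mult_right N2_integrable u)
      fix x
      have "norm (\<mu> * of_real (norm (u t x)) * u t x * cnj (\<phi> x) - \<mu> * of_real (norm (u t x)) * u t x * cnj (\<psi> x))
        = norm (\<phi> x - \<psi> x) * norm (\<mu> * of_real (norm (u t x)) * u t x)"
        by (rule norm_mult_cnj_diff)
      also have "\<dots> = norm (\<phi> x - \<psi> x) * (norm \<mu> * (norm (u t x))\<^sup>2)" by (simp add: norm_mult power2_eq_square)
      also have "\<dots> \<le> B * (norm \<mu> * (norm (u t x))\<^sup>2)" by (intro mult_right_mono B) auto
      finally show "norm (\<mu> * of_real (norm (u t x)) * u t x * cnj (\<phi> x) - \<mu> * of_real (norm (u t x)) * u t x * cnj (\<psi> x)) \<le> B * (norm \<mu> * (norm (u t x))\<^sup>2)" .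
    qed
  qed
  also have "\<dots> = B * (((LINT x|lborel. (norm (V t x))\<^sup>2) + (LINT x|lborel. (norm (u t x))\<^sup>2)) / 2) + B * (norm \<mu> * (LINT x|lborel. (norm (u t x))\<^sup>2))"
    by (simp only: integral_mult_right_zero integral_divide_zero Bochner_Integration.integral_add[OF N2_integrable[OF V] N2_integrable[OF u]])
  also have "\<dots> = B * ((enn2real (N2 (V t)) + enn2real (N2 (u t))) / 2 + norm \<mu> * enn2real (N2 (u t)))"
    unfolding eV eu distrib_left by (rule refl)
  also have "\<dots> \<le> B * (enn2real (N2 (V t)) + (1 + norm \<mu>) * enn2real (N2 (u t)))"
  proof (rule mult_left_mono[OF _ B0])
    have "(x + y) / 2 + m * y \<le> x + (1 + m) * y" if "x \<ge> 0" "y \<ge> 0" for x y m :: real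
      using that by (simp add: algebra_simps)
    then show "(enn2real (N2 (V t)) + enn2real (N2 (u t))) / 2 + norm \<mu> * enn2real (N2 (u t)) \<le> enn2real (N2 (V t)) + (1 + norm \<mu>) * enn2real (N2 (u t))"
      using enn2real_nonneg by blast
  qed
  finally show ?thesis .
qed

lemma continuous_in_L2_pairing:
  assumes u: "continuous_in_L2 {0..} u" and \<phi>: "\<phi> \<in> Lp 2"
  shows "continuous_on {0..} (\<lambda>t. L2_pairing (u t) \<phi>)"
  unfolding continuous_on_def
proof
  fix t :: real assume t: "t \<in> {0..}"
  have uL: "u s \<in> Lp 2" if "s \<in> {0..}" for s using u that unfolding continuous_in_L2_def by blast
  \<comment> \<open>The solution is only known for nonnegative times; the extension is constant at
    \<open>u t\<close>.\<close>
  define u' where "u' s = (if s \<ge> 0 then u s else u t)" for s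
  have "((\<lambda>s. N2 (\<lambda>x. u s x - u t x)) \<longlongrightarrow> 0) (at t within {0..})"
    using u t unfolding continuous_in_L2_def Lp_norm_2_tendsto_0_iff by blast
  then have "((\<lambda>s. N2 (\<lambda>x. u' s x - u t x)) \<longlongrightarrow> 0) (at t within {0..})"
    by (rule Lim_transform_eventually) (auto simp: u'_def eventually_at_filter)
  then have "((\<lambda>s. L2_pairing (u' s) \<phi>) \<longlongrightarrow> L2_pairing (u t) \<phi>) (at t within {0..})"
    by (intro L2_pairing_tendsto \<phi>) (use uL t in \<open>auto simp: u'_def\<close>)
  then show "((\<lambda>s. L2_pairing (u s) \<phi>) \<longlongrightarrow> L2_pairing (u t) \<phi>) (at t within {0..})"
    by (rule Lim_transform_eventually) (auto simp: u'_def eventually_at_filter)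
qed

lemma N2_eq_norm_pairing: "f \<in> Lp 2 \<Longrightarrow> enn2real (N2 f) = norm (L2_pairing f f)"
proof -
  assume f: "f \<in> Lp 2"
  have "L2_pairing f f = (LINT x|lborel. complex_of_real ((norm (f x))\<^sup>2))"
    unfolding L2_pairing_def using complex_norm_square by simp
  also have "\<dots> = of_real (LINT x|lborel. (norm (f x))\<^sup>2)" by (rule integral_complex_of_real)
  finally show ?thesis using f by (simp add: N2_eq_integral)
qed

lemma continuous_in_L2_bounded:
  assumes u: "continuous_in_L2 {0..} u"
  obtains M where "M \<ge> 0" "\<And>t. t \<in> {0..T} \<Longrightarrow> enn2real (N2 (u t)) \<le> M"
proof -
  have uL: "u s \<in> Lp 2" if "s \<in> {0..}" for s using u that unfolding continuous_in_L2_def by blast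
  have "continuous_on {0..} (\<lambda>t. L2_pairing (u t) (u t))"
    unfolding continuous_on_def
  proof
    fix t :: real assume t: "t \<in> {0..}"
    define u' where "u' s = (if s \<ge> 0 then u s else u t)" for s
    have "((\<lambda>s. N2 (\<lambda>x. u s x - u t x)) \<longlongrightarrow> 0) (at t within {0..})"
      using u t unfolding continuous_in_L2_def Lp_norm_2_tendsto_0_iff by blast
    then have "((\<lambda>s. N2 (\<lambda>x. u' s x - u t x)) \<longlongrightarrow> 0) (at t within {0..})"
      by (rule Lim_transform_eventually) (auto simp: u'_def eventually_at_filter)
    then have "((\<lambda>s. L2_pairing (u' s) (u' s)) \<longlongrightarrow> L2_pairing (u t) (u t)) (at t within {0..})"
      by (intro L2_pairing_tendsto2) (use uL t in \<open>auto simp: u'_def\<close>)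
    then show "((\<lambda>s. L2_pairing (u s) (u s)) \<longlongrightarrow> L2_pairing (u t) (u t)) (at t within {0..})"
      by (rule Lim_transform_eventually) (auto simp: u'_def eventually_at_filter)
  qed
  then have "continuous_on {0..T} (\<lambda>t. L2_pairing (u t) (u t))" by (rule continuous_on_subset) auto
  from compact_imp_bounded[OF compact_continuous_image[OF this compact_Icc]]
  obtain B where "\<forall>z\<in>(\<lambda>t. L2_pairing (u t) (u t)) ` {0..T}. norm z \<le> B" unfolding bounded_iff by blast
  then have B: "norm (L2_pairing (u t) (u t)) \<le> B" if "t \<in> {0..T}" for t using that by blast
  show ?thesis
  proof (rule that[of "max 0 B"])
    fix t assume t: "t \<in> {0..T}"
    then have "enn2real (N2 (u t)) = norm (L2_pairing (u t) (u t))" by (intro N2_eq_norm_pairing uL) simp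
    then show "enn2real (N2 (u t)) \<le> max 0 B" using B[OF t] by simp
  qed simp
qed

section \<open>The Duhamel identity\<close>

lemma forcing_pairing_zero [simp]: "forcing_pairing \<mu> V u (\<lambda>x. 0) t = 0"
  by (simp add: forcing_pairing_def L2_pairing_def)

lemma gauss_wave_dt_measurable [measurable]: "gauss_wave_dt a p t \<in> borel_measurable borel"
  unfolding gauss_wave_dt_def[abs_def] gauss_wave_def[abs_def] gauss_wave_quad_def[abs_def] by measurable

text \<open>Differentiability in time as an \<open>L\<^sup>2\<close>-valued map, which is what the
  pairing with \<open>u(t)\<close> sees.\<close>

lemma gauss_wave_quotient_tendsto:
  fixes p :: "'a::euclidean_space"
  assumes a: "a > 0"
  shows "((\<lambda>t. N2 (\<lambda>x. (1 / (t - t0)) *\<^sub>R (gauss_wave a p t x - gauss_wave a p t0 x) - gauss_wave_dt a p t0 x)) \<longlongrightarrow> 0) (at t0)"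
proof -
  define T where "T = \<bar>t0\<bar> + 1"
  obtain C c where C: "0 \<le> C" "0 < c" "\<And>t x. t \<in> {-T..T} \<Longrightarrow> norm (gauss_wave_dt a p t x) \<le> C * exp (- c * (x \<bullet> x))"
    using gauss_wave_dt_dominated[OF a, of p T] unfolding gauss_dominated_def by blast
  have t0: "t0 \<in> {-T..T}" by (auto simp: T_def)
  have [measurable]: "gauss_wave a p t \<in> borel_measurable borel" for t
    by (rule gauss_evolution_measurable[OF gauss_evolution.gauss[OF a]])
  let ?q = "\<lambda>t x. (1 / (t - t0)) *\<^sub>R (gauss_wave a p t x - gauss_wave a p t0 x)"
  let ?w = "\<lambda>x::'a. of_real (2 * C) * complex_of_real (exp (- c * (x \<bullet> x)))"
  have w: "N2 ?w < \<infinity>"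
  proof -
    have "gauss_profile c (0::'a) \<in> Lp 2" by (rule gauss_evolution_regular(2)[OF gauss_evolution.gauss[OF C(2)]])
    then have "(\<lambda>x::'a. of_real (2 * C) * gauss_profile c 0 x) \<in> Lp 2" by (rule Lp_2_cmult)
    then show ?thesis by (simp add: Lp_2_iff gauss_profile_def)
  qed
  have bd: "norm (?q t x - gauss_wave_dt a p t0 x) \<le> norm (?w x)" if t: "t \<in> {-T..T}" "t \<noteq> t0" for t x
  proof -
    have "norm (gauss_wave a p t x - gauss_wave a p t0 x) \<le> (C * exp (- c * (x \<bullet> x))) * \<bar>t - t0\<bar>"
      by (rule has_vector_derivative_lipschitz[of "{-T..T}", OF _ gauss_wave_has_derivative[OF a]]) (use C(3) t t0 in auto)
    then have "norm (?q t x) \<le> C * exp (- c * (x \<bullet> x))" using t(2) by (simp add: divide_simps)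
    then have "norm (?q t x - gauss_wave_dt a p t0 x) \<le> C * exp (- c * (x \<bullet> x)) + C * exp (- c * (x \<bullet> x))"
      by (intro norm_triangle_le_diff add_mono C(3) t0)
    then show ?thesis using C(1) by (simp add: norm_mult)
  qed
  have pt: "((\<lambda>t. ?q t x) \<longlongrightarrow> gauss_wave_dt a p t0 x) (at t0)" for x
    using gauss_wave_has_derivative[OF a, of p x t0] unfolding has_vector_derivative_iff_quotient .
  show ?thesis
    unfolding tendsto_at_iff_sequentially comp_def
  proof (intro allI impI)
    fix X :: "nat \<Rightarrow> real" assume X: "\<forall>i. X i \<in> UNIV - {t0}" "X \<longlonglongrightarrow> t0"
    have "\<forall>\<^sub>F n in sequentially. dist (X n) t0 < 1" using tendstoD[OF X(2)] by auto
    then obtain N where N: "\<And>n. n \<ge> N \<Longrightarrow> dist (X n) t0 < 1" by (auto simp: eventually_sequentially)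
    have XT: "X (n + N) \<in> {-T..T}" for n using N[of "n + N"] by (auto simp: T_def dist_real_def)
    have "(\<lambda>n. N2 (\<lambda>x. ?q (X (n + N)) x - gauss_wave_dt a p t0 x)) \<longlonglongrightarrow> 0"
    proof (rule N2_dominated[where w="?w"])
      show "norm (?q (X (n + N)) x - gauss_wave_dt a p t0 x) \<le> norm (?w x)" for n x
        using X(1) by (intro bd XT) auto
      have "filterlim (\<lambda>n. X (n + N)) (at t0) sequentially"
        unfolding filterlim_at using X LIMSEQ_ignore_initial_segment[OF X(2), of N] by simp
      then show "(\<lambda>n. ?q (X (n + N)) x) \<longlonglongrightarrow> gauss_wave_dt a p t0 x" for x by (rule filterlim_compose[OF pt])
      show "(\<lambda>x. ?q (X (n + N)) x) \<in> borel_measurable borel" for n by measurable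
      show "?w \<in> borel_measurable borel" by measurable
    qed (use w in auto)
    then show "(\<lambda>n. N2 (\<lambda>x. ?q (X n) x - gauss_wave_dt a p t0 x)) \<longlonglongrightarrow> 0"
      by (rule LIMSEQ_offset)
  qed
qed

text \<open>The weak formulation allows only test functions that are constant in time. Freezing
  \<open>W\<close> at time \<open>t0\<close> and integrating the distributional derivative gives the
  increments of \<open>\<langle>u(t), W(t0)\<rangle>\<close>. The derivative of \<open>\<i>
  \<langle>u(t), W(t)\<rangle> - \<integral> Q\<close> at \<open>t0\<close> is the sum of three
  terms: one from the motion of \<open>W\<close>, one from the Laplacian in the frozen equation, and
  one from replacing \<open>W(t0)\<close> by \<open>W(r)\<close> in the forcing. The first two
  cancel because \<open>W\<close> solves the free equation, the third is zero by continuity. The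
  function \<open>Q\<close> is a measurable representative of the forcing, which is a priori known
  for each frozen test function separately.\<close>

lemma duhamel_gauss_wave:
  fixes p :: "'a::euclidean_space" and u V :: "real \<Rightarrow> 'a \<Rightarrow> complex"
  assumes a: "a > 0" and u: "continuous_in_L2 {0..} u"
    and int: "\<And>\<phi> T. schwartz \<phi> \<Longrightarrow> T > 0 \<Longrightarrow> set_integrable lborel {0..T} (nls_rhs \<mu> V u \<phi>)"
    and dist: "\<And>\<phi>. schwartz \<phi> \<Longrightarrow> has_distributional_derivative {0<..} (\<lambda>t. \<i> * L2_pairing (u t) \<phi>) (nls_rhs \<mu> V u \<phi>)"
    and V: "AE t in lborel. t > 0 \<longrightarrow> V t \<in> Lp 2 \<and> enn2real (N2 (V t)) \<le> M"
    and sb: "0 < s" "s \<le> b"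
  defines "W \<equiv> gauss_wave a p"
  shows "\<exists>Q. set_integrable lborel {s..b} Q \<and> (AE t in lborel. t \<in> {s..b} \<longrightarrow> Q t = forcing_pairing \<mu> V u (W t) t) \<and>
    \<i> * L2_pairing (u b) (W b) - \<i> * L2_pairing (u s) (W s) = (LINT t:{s..b}|lborel. Q t)"
proof -
  define T where "T = b + 1"
  have ev: "gauss_evolution (gauss_profile a p) W" unfolding W_def by (rule gauss_evolution.gauss[OF a])
  note R = gauss_evolution_regular[OF ev]
  have Wm [measurable]: "W t \<in> borel_measurable borel" for t by (rule gauss_evolution_measurable[OF ev])
  have sw: "schwartz (W t)" for t unfolding W_def by (rule gauss_wave_schwartz[OF a])
  have lap: "laplacian (W t) = (\<lambda>x. - \<i> * gauss_wave_dt a p t x)" for t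
    unfolding W_def by (intro ext gauss_wave_laplacian a)
  have dtL: "gauss_wave_dt a p t \<in> Lp 2" for t
    by (rule gauss_dominatedD(2)[OF gauss_wave_dt_dominated[OF a, of p "\<bar>t\<bar>"]]) (auto simp: abs_le_iff)
  have lapL: "laplacian (W t) \<in> Lp 2" for t unfolding lap by (intro Lp_2_cmult dtL)
  obtain C c where C: "0 \<le> C" "0 < c" "\<And>t x. t \<in> {-T..T} \<Longrightarrow> norm (gauss_wave_dt a p t x) \<le> C * exp (- c * (x \<bullet> x))"
    using gauss_wave_dt_dominated[OF a, of p T] unfolding gauss_dominated_def by blast
  have C': "norm (gauss_wave_dt a p t x) \<le> C" if "t \<in> {-T..T}" for t x
  proof -
    have "C * exp (- c * (x \<bullet> x)) \<le> C * 1" using C by (intro mult_left_mono) auto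
    then show ?thesis using C(3)[OF that, of x] by simp
  qed
  obtain CW cW where CW: "0 \<le> CW" "0 < cW" "\<And>t x. t \<in> {-T..T} \<Longrightarrow> norm (W t x) \<le> CW * exp (- cW * (x \<bullet> x))"
    using gauss_evolution_wave_dominated[OF ev, of T] unfolding gauss_dominated_def by blast
  have CW': "norm (W t x) \<le> CW" if "t \<in> {-T..T}" for t x
  proof -
    have "CW * exp (- cW * (x \<bullet> x)) \<le> CW * 1" using CW by (intro mult_left_mono) auto
    then show ?thesis using CW(3)[OF that, of x] by simp
  qed
  have lip: "norm (W r x - W r' x) \<le> C * \<bar>r - r'\<bar>" if "r \<in> {-T..T}" "r' \<in> {-T..T}" for r r' x
    unfolding W_def
    by (rule has_vector_derivative_lipschitz[of "{-T..T}", OF _ gauss_wave_has_derivative[OF a]]) (use C' that in auto)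
  have uL: "u t \<in> Lp 2" if "t \<ge> 0" for t using u that unfolding continuous_in_L2_def by auto
  obtain Mu where Mu: "Mu \<ge> 0" "\<And>t. t \<in> {0..b} \<Longrightarrow> enn2real (N2 (u t)) \<le> Mu"
    using continuous_in_L2_bounded[OF u] by blast
  obtain N0 where N0: "{t \<in> space lborel. \<not> (t > 0 \<longrightarrow> V t \<in> Lp 2 \<and> enn2real (N2 (V t)) \<le> M)} \<subseteq> N0"
    "emeasure lborel N0 = 0" "N0 \<in> sets lborel" using AE_E[OF V] by blast
  have Vg: "V t \<in> Lp 2" "enn2real (N2 (V t)) \<le> M" if "t > 0" "t \<notin> N0" for t using N0(1) that by auto
  have N0AE: "AE t in lborel. t \<notin> N0" by (rule AE_not_in) (use N0 in \<open>auto simp: null_sets_def\<close>)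
  define K0 where "K0 = \<bar>M\<bar> + (1 + norm \<mu>) * Mu"
  have K0: "K0 \<ge> 0" using Mu by (simp add: K0_def)
  have K0b: "enn2real (N2 (V t)) + (1 + norm \<mu>) * enn2real (N2 (u t)) \<le> K0" if "t \<in> {s..b} - N0" for t
    unfolding K0_def using that Vg(2)[of t] Mu(2)[of t] sb by (intro add_mono mult_left_mono) auto
  define q where "q r t = forcing_pairing \<mu> V u (W r) t" for r t
  have qdiff: "norm (q r t - q r' t) \<le> C * \<bar>r - r'\<bar> * K0" if "t \<in> {s..b} - N0" "r \<in> {-T..T}" "r' \<in> {-T..T}" for r r' t
  proof -
    have "norm (q r t - q r' t) \<le> (C * \<bar>r - r'\<bar>) * (enn2real (N2 (V t)) + (1 + norm \<mu>) * enn2real (N2 (u t)))"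
      unfolding q_def using that sb by (intro forcing_pairing_diff_bound Vg uL Wm R lip) auto
    also have "\<dots> \<le> (C * \<bar>r - r'\<bar>) * K0" using K0b[OF that(1)] C by (intro mult_left_mono) auto
    finally show ?thesis .
  qed
  have qbound: "norm (q r t) \<le> CW * K0" if "t \<in> {s..b} - N0" "r \<in> {-T..T}" for r t
  proof -
    have "norm (forcing_pairing \<mu> V u (W r) t - forcing_pairing \<mu> V u (\<lambda>x. 0) t) \<le> CW * (enn2real (N2 (V t)) + (1 + norm \<mu>) * enn2real (N2 (u t)))"
      using that sb CW'[OF that(2)] by (intro forcing_pairing_diff_bound Vg uL Wm R) auto
    also have "\<dots> \<le> CW * K0" using K0b[OF that(1)] CW by (intro mult_left_mono) auto
    finally show ?thesis by (simp add: q_def)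
  qed
  have b0: "b > 0" using sb by simp
  have qint: "integrable lborel (\<lambda>t. indicator {0..b} t *\<^sub>R q r t)" for r
  proof -
    have "integrable lborel (\<lambda>t. indicator {0..b} t *\<^sub>R nls_rhs \<mu> V u (W r) t)"
      using int[OF sw b0] by (simp add: set_integrable_def)
    moreover have "integrable lborel (\<lambda>t. indicator {0..b} t *\<^sub>R L2_pairing (u t) (laplacian (W r)))"
      by (intro borel_integrable_compact compact_Icc continuous_on_subset[OF continuous_in_L2_pairing[OF u lapL]]) auto
    ultimately have "integrable lborel (\<lambda>t. indicator {0..b} t *\<^sub>R nls_rhs \<mu> V u (W r) t + indicator {0..b} t *\<^sub>R L2_pairing (u t) (laplacian (W r)))"
      by (rule Bochner_Integration.integrable_add)
    moreover have "indicator {0..b} t *\<^sub>R nls_rhs \<mu> V u (W r) t + indicator {0..b} t *\<^sub>R L2_pairing (u t) (laplacian (W r)) = indicator {0..b} t *\<^sub>R q r t" for t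
      by (simp add: nls_rhs_def q_def forcing_pairing_def flip: scaleR_add_right)
    ultimately show ?thesis by simp
  qed
  define S where "S = {s..b} - N0"
  have S[measurable]: "S \<in> sets borel" using N0(3) by (auto simp: S_def)
  have qm: "(\<lambda>t. indicator S t *\<^sub>R q r t) \<in> borel_measurable borel" for r
  proof -
    have "(\<lambda>t. indicator {0..b} t *\<^sub>R q r t) \<in> borel_measurable borel" using qint[of r] by auto
    then have "(\<lambda>t. indicator S t *\<^sub>R (indicator {0..b} t *\<^sub>R q r t)) \<in> borel_measurable borel"
      by (rule borel_measurable_scaleR[OF borel_measurable_indicator[OF S]])
    moreover have "indicator S t *\<^sub>R (indicator {0..b} t *\<^sub>R q r t) = indicator S t *\<^sub>R q r t" for t
      using sb by (auto simp: S_def indicator_def)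
    ultimately show ?thesis by (simp only:)
  qed
  \<comment> \<open>Outside an exceptional null set of times the forcing is Lipschitz in the frozen
    time \<open>r\<close>, so its diagonal is the limit of the measurable functions
    \<open>Qn\<close> in which \<open>r\<close> runs through a grid of mesh \<open>1 / Suc
    n\<close>.\<close>
  define Q where "Q t = indicator S t *\<^sub>R q t t" for t
  define Qn where "Qn n t = indicator S t *\<^sub>R q (real_of_int \<lfloor>real (Suc n) * t\<rfloor> / real (Suc n)) t" for n t
  have Qnm: "Qn n \<in> borel_measurable borel" for n
    unfolding Qn_def[abs_def]
  proof (rule measurable_compose_countable[where f="\<lambda>i t. indicator S t *\<^sub>R q (real_of_int i / real (Suc n)) t"])
    show "(\<lambda>t. \<lfloor>real (Suc n) * t\<rfloor>) \<in> borel \<rightarrow>\<^sub>M count_space UNIV" by measurable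
  qed (rule qm)
  have Qlim: "(\<lambda>n. Qn n t) \<longlonglongrightarrow> Q t" for t
  proof (cases "t \<in> S")
    case True
    have tT: "t \<in> {s..b}" using True by (simp add: S_def)
    have "(\<lambda>n. q (real_of_int \<lfloor>real (Suc n) * t\<rfloor> / real (Suc n)) t - q t t) \<longlonglongrightarrow> 0"
    proof (rule Lim_null_comparison)
      show "\<forall>\<^sub>F n in sequentially. norm (q (real_of_int \<lfloor>real (Suc n) * t\<rfloor> / real (Suc n)) t - q t t) \<le> C * (1 / real (Suc n)) * K0"
      proof (intro always_eventually allI)
        fix n
        define r where "r = real_of_int \<lfloor>real (Suc n) * t\<rfloor> / real (Suc n)"
        have "real_of_int \<lfloor>real (Suc n) * t\<rfloor> \<le> real (Suc n) * t" "real (Suc n) * t - 1 \<le> real_of_int \<lfloor>real (Suc n) * t\<rfloor>" by linarith+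
        moreover have "real_of_int \<lfloor>real (Suc n) * t\<rfloor> = real (Suc n) * r" by (simp add: r_def)
        ultimately have "real (Suc n) * r \<le> real (Suc n) * t" "real (Suc n) * t \<le> real (Suc n) * (r + 1 / real (Suc n))"
          by (simp_all only: distrib_left) simp_all
        then have r: "r \<le> t" "t - 1 / real (Suc n) \<le> r" by (simp_all only: mult_le_cancel_left_pos of_nat_0_less_iff zero_less_Suc diff_le_eq)
        have "1 / real (Suc n) \<le> 1" by simp
        then have "t - 1 \<le> r" using r by linarith
        then have rT: "r \<in> {-T..T}" using r tT sb by (auto simp: T_def)
        have "norm (q r t - q t t) \<le> C * \<bar>r - t\<bar> * K0" using True rT tT sb by (intro qdiff) (auto simp: S_def T_def)
        also have "\<dots> \<le> C * (1 / real (Suc n)) * K0" using r K0 C by (intro mult_right_mono mult_left_mono) auto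
        finally show "norm (q (real_of_int \<lfloor>real (Suc n) * t\<rfloor> / real (Suc n)) t - q t t) \<le> C * (1 / real (Suc n)) * K0" by (simp add: r_def)
      qed
      have "(\<lambda>n. C * (inverse (real (Suc n))) * K0) \<longlonglongrightarrow> C * 0 * K0" by (intro tendsto_intros LIMSEQ_inverse_real_of_nat)
      then show "(\<lambda>n. C * (1 / real (Suc n)) * K0) \<longlonglongrightarrow> 0" by (simp add: inverse_eq_divide)
    qed
    then show ?thesis using True by (simp add: Qn_def Q_def LIM_zero_iff del: of_nat_Suc)
  qed (simp add: Qn_def Q_def)
  have Qm: "Q \<in> borel_measurable borel" by (rule borel_measurable_LIMSEQ_metric[OF Qnm Qlim])
  have Qint: "set_integrable lborel {s..b} Q"
    unfolding set_integrable_def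
  proof (rule Bochner_Integration.integrable_bound)
    show "integrable lborel (\<lambda>t. (CW * K0) * indicator {s..b} t :: real)"
      by (intro integrable_mult_right integrable_real_indicator) (auto simp: emeasure_lborel_Icc_eq)
    have "norm (indicator {s..b} t *\<^sub>R Q t) \<le> (CW * K0) * indicator {s..b} t" for t
    proof (cases "t \<in> S")
      case True
      then have "norm (q t t) \<le> CW * K0" using sb by (intro qbound) (auto simp: S_def T_def)
      then show ?thesis using True by (simp add: Q_def S_def)
    qed (use CW K0 in \<open>simp add: Q_def\<close>)
    then show "AE t in lborel. norm (indicator {s..b} t *\<^sub>R Q t) \<le> norm ((CW * K0) * indicator {s..b} t :: real)"
      using CW K0 by (intro AE_I2) (simp add: abs_mult)
    show "(\<lambda>t. indicator {s..b} t *\<^sub>R Q t) \<in> borel_measurable lborel" using Qm by measurable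
  qed
  have QAE: "AE t in lborel. t \<in> {s..b} \<longrightarrow> Q t = forcing_pairing \<mu> V u (W t) t"
    using N0AE by eventually_elim (auto simp: Q_def S_def q_def)
  define K where "K t = \<i> * L2_pairing (u t) (W t) - (LINT r:{s..t}|lborel. Q r)" for t
  have "\<exists>c. \<forall>t\<in>{s..b}. K t = c"
  proof (rule has_vector_derivative_zero_constant)
    fix t0 assume t0: "t0 \<in> {s..b}"
    then have t0pos: "t0 > 0" using sb by simp
    define A where "A t = \<i> * (L2_pairing (u t) (W t) - L2_pairing (u t) (W t0))" for t
    have dA: "(A has_vector_derivative \<i> * L2_pairing (u t0) (gauss_wave_dt a p t0)) (at t0)"
      unfolding has_vector_derivative_iff_quotient
    proof -
      let ?q = "\<lambda>t x. (1 / (t - t0)) *\<^sub>R (W t x - W t0 x)"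
      define u' where "u' t = (if t \<ge> 0 then u t else u t0)" for t
      have u'L: "u' t \<in> Lp 2" for t using uL t0pos by (auto simp: u'_def)
      have qL: "(\<lambda>x. ?q t x) \<in> Lp 2" for t
      proof -
        have "(\<lambda>x. of_real (1 / (t - t0)) * (W t x - W t0 x)) \<in> Lp 2" by (intro Lp_2_cmult Lp_2_diff R)
        then show ?thesis by (simp add: scaleR_conv_of_real)
      qed
      have ev0: "\<forall>\<^sub>F t in at t0. t \<ge> 0"
        using eventually_nhds_in_open[of "{0<..}" t0] t0pos by (auto simp: eventually_at_filter elim: eventually_mono)
      have "((\<lambda>t. N2 (\<lambda>x. u t x - u t0 x)) \<longlongrightarrow> 0) (at t0 within {0..})"
        using u t0pos unfolding continuous_in_L2_def Lp_norm_2_tendsto_0_iff by auto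
      moreover have "at t0 within {0..} = at t0" using t0pos by (intro at_within_interior) (simp add: interior_real_atLeast)
      ultimately have "((\<lambda>t. N2 (\<lambda>x. u t x - u t0 x)) \<longlongrightarrow> 0) (at t0)" by simp
      then have ul: "((\<lambda>t. N2 (\<lambda>x. u' t x - u t0 x)) \<longlongrightarrow> 0) (at t0)"
        by (rule Lim_transform_eventually) (use ev0 in \<open>eventually_elim, simp add: u'_def\<close>)
      have "((\<lambda>t. L2_pairing (u' t) (\<lambda>x. ?q t x)) \<longlongrightarrow> L2_pairing (u t0) (gauss_wave_dt a p t0)) (at t0)"
        by (rule L2_pairing_tendsto2[OF u'L _ qL dtL ul])
           (use uL t0pos gauss_wave_quotient_tendsto[OF a, of t0 p] in \<open>auto simp: W_def\<close>)
      then have lim: "((\<lambda>t. \<i> * L2_pairing (u' t) (\<lambda>x. ?q t x)) \<longlongrightarrow> \<i> * L2_pairing (u t0) (gauss_wave_dt a p t0)) (at t0)"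
        by (intro tendsto_intros)
      show "((\<lambda>t. (1 / (t - t0)) *\<^sub>R (A t - A t0)) \<longlongrightarrow> \<i> * L2_pairing (u t0) (gauss_wave_dt a p t0)) (at t0)"
      proof (rule Lim_transform_eventually[OF lim], use ev0 in eventually_elim)
        case (elim t)
        have "L2_pairing (u t) (\<lambda>x. ?q t x) = L2_pairing (u t) (\<lambda>x. of_real (1 / (t - t0)) * (W t x - W t0 x))"
          by (simp add: scaleR_conv_of_real)
        also have "\<dots> = of_real (1 / (t - t0)) * (L2_pairing (u t) (W t) - L2_pairing (u t) (W t0))"
          unfolding L2_pairing_cmult_right L2_pairing_diff_right[OF uL[OF elim] R(5) R(5)] complex_cnj_complex_of_real by (rule refl)
        finally have "\<i> * L2_pairing (u t) (\<lambda>x. ?q t x) = (1 / (t - t0)) *\<^sub>R (A t - A t0)"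
          by (simp add: A_def scaleR_conv_of_real)
        then show ?case using elim by (simp add: u'_def)
      qed
    qed
    let ?n = "nls_rhs \<mu> V u (W t0)"
    have nint: "set_integrable lborel {s..b} ?n"
      using set_integrable_subset[OF int[OF sw[of t0] b0], of "{s..b}"] sb by auto
    have hint: "set_integrable lborel {s..b} (\<lambda>r. ?n r - Q r)" by (intro set_integral_diff(1) nint Qint)
    have FTC: "\<i> * L2_pairing (u t) (W t0) - \<i> * L2_pairing (u s) (W t0) = (LINT r:{s..t}|lborel. ?n r)" if "t \<in> {s..b}" for t
      using that sb
      by (intro distributional_FTC[OF dist[OF sw]] int sw continuous_intros continuous_on_subset[OF continuous_in_L2_pairing[OF u R(5)]]) auto
    define c where "c = - L2_pairing (u t0) (laplacian (W t0))"
    have dC: "((\<lambda>t. LINT r:{s..t}|lborel. ?n r - Q r) has_vector_derivative c) (at t0 within {s..b})"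
    proof (rule has_vector_derivative_LINT_AE[OF hint t0])
      fix e :: real assume e: "e > 0"
      have "isCont (\<lambda>t. L2_pairing (u t) (laplacian (W t0))) t0"
      proof -
        have "continuous_on {0<..} (\<lambda>t. L2_pairing (u t) (laplacian (W t0)))"
          by (rule continuous_on_subset[OF continuous_in_L2_pairing[OF u lapL]]) auto
        then show ?thesis using t0pos by (simp add: continuous_on_eq_continuous_at)
      qed
      then obtain d1 where d1: "d1 > 0" "\<And>t. \<bar>t - t0\<bar> < d1 \<Longrightarrow> norm (L2_pairing (u t) (laplacian (W t0)) - L2_pairing (u t0) (laplacian (W t0))) < e / 2"
        using e unfolding continuous_at_eps_delta by (metis dist_norm dist_real_def half_gt_zero)
      define d2 where "d2 = e / (2 * (C * K0 + 1))"
      have CK: "C * K0 \<ge> 0" using C K0 by simp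
      have d2: "d2 > 0" "C * d2 * K0 \<le> e / 2" using e CK by (auto simp: d2_def field_simps)
      show "\<exists>d>0. AE r in lborel. r \<in> {s..b} \<and> \<bar>r - t0\<bar> < d \<longrightarrow> norm (?n r - Q r - c) \<le> e"
      proof (intro exI[of _ "min d1 d2"] conjI)
        show "AE r in lborel. r \<in> {s..b} \<and> \<bar>r - t0\<bar> < min d1 d2 \<longrightarrow> norm (?n r - Q r - c) \<le> e"
          using N0AE
        proof eventually_elim
          case (elim r)
          show ?case
          proof
            assume r: "r \<in> {s..b} \<and> \<bar>r - t0\<bar> < min d1 d2"
            then have rS: "r \<in> S" using elim by (simp add: S_def)
            have "?n r - Q r - c = (q t0 r - q r r) - (L2_pairing (u r) (laplacian (W t0)) - L2_pairing (u t0) (laplacian (W t0)))"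
              using rS by (simp add: nls_rhs_def q_def Q_def forcing_pairing_def c_def)
            also have "norm \<dots> \<le> norm (q t0 r - q r r) + norm (L2_pairing (u r) (laplacian (W t0)) - L2_pairing (u t0) (laplacian (W t0)))"
              by (rule norm_triangle_ineq4)
            also have "norm (q t0 r - q r r) \<le> C * \<bar>t0 - r\<bar> * K0"
              using r t0 rS sb by (intro qdiff) (auto simp: S_def T_def)
            also have "\<dots> \<le> C * d2 * K0" using r C K0 by (intro mult_right_mono mult_left_mono) auto
            also have "\<dots> \<le> e / 2" by (rule d2)
            finally show "norm (?n r - Q r - c) \<le> e" using d1(2)[of r] r by simp
          qed
        qed
      qed (use d1 d2 in auto)
    qed
    have Keq: "K t = A t + \<i> * L2_pairing (u s) (W t0) + (LINT r:{s..t}|lborel. ?n r - Q r)" if t: "t \<in> {s..b}" for t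
    proof -
      have "set_integrable lborel {s..t} ?n" "set_integrable lborel {s..t} Q"
        using set_integrable_subset[OF nint, of "{s..t}"] set_integrable_subset[OF Qint, of "{s..t}"] t by auto
      then have "(LINT r:{s..t}|lborel. ?n r - Q r) = (LINT r:{s..t}|lborel. ?n r) - (LINT r:{s..t}|lborel. Q r)"
        by (rule set_integral_diff(2))
      then show ?thesis using FTC[OF t] by (simp add: K_def A_def algebra_simps)
    qed
    have "\<i> * L2_pairing (u t0) (gauss_wave_dt a p t0) + 0 + c = 0"
      unfolding c_def lap L2_pairing_cmult_right by simp
    then have "((\<lambda>t. A t + \<i> * L2_pairing (u s) (W t0) + (LINT r:{s..t}|lborel. ?n r - Q r)) has_vector_derivative 0) (at t0 within {s..b})"
      using has_vector_derivative_add[OF has_vector_derivative_add[OF has_vector_derivative_at_within[OF dA] has_vector_derivative_const] dC] by metis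
    then show "(K has_vector_derivative 0) (at t0 within {s..b})"
      by (rule has_vector_derivative_transform[rotated -1]) (use t0 Keq in auto)
  qed auto
  then have "K b = K s" using sb by auto
  moreover have "(LINT r:{s..s}|lborel. Q r) = 0"
  proof -
    have "AE r in lborel. indicator {s..s} r *\<^sub>R Q r = 0" using AE_lborel_singleton[of s] by eventually_elim (simp add: indicator_def)
    then show ?thesis unfolding set_lebesgue_integral_def by (rule integral_eq_zero_AE)
  qed
  ultimately have "\<i> * L2_pairing (u b) (W b) - \<i> * L2_pairing (u s) (W s) = (LINT t:{s..b}|lborel. Q t)"
    by (simp add: K_def algebra_simps)
  with Qint QAE show ?thesis by blast
qed

lemma forcing_pairing_add:
  assumes V: "V t \<in> Lp 2" and u: "u t \<in> Lp 2"
    and \<phi>: "\<phi> \<in> borel_measurable borel" "bounded (range \<phi>)" and \<psi>: "\<psi> \<in> borel_measurable borel" "bounded (range \<psi>)"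
  shows "forcing_pairing \<mu> V u (\<lambda>x. \<phi> x + \<psi> x) t = forcing_pairing \<mu> V u \<phi> t + forcing_pairing \<mu> V u \<psi> t"
proof -
  note I = forcing_integrable[OF V u]
  show ?thesis
    unfolding forcing_pairing_def L2_pairing_def complex_cnj_add distrib_left
    by (simp only: Bochner_Integration.integral_add[OF integrable_mult_bounded[OF I(1) \<phi>] integrable_mult_bounded[OF I(1) \<psi>]]
        Bochner_Integration.integral_add[OF integrable_mult_bounded[OF I(2) \<phi>] integrable_mult_bounded[OF I(2) \<psi>]]) simp
qed

lemma forcing_pairing_cmult: "forcing_pairing \<mu> V u (\<lambda>x. c * \<phi> x) t = cnj c * forcing_pairing \<mu> V u \<phi> t"
  by (simp add: forcing_pairing_def L2_pairing_cmult_right distrib_left)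

text \<open>Linear combinations; the identity is conjugate linear in the test wave.\<close>

lemma duhamel:
  fixes f :: "'a::euclidean_space \<Rightarrow> complex" and u V :: "real \<Rightarrow> 'a \<Rightarrow> complex"
  assumes ev: "gauss_evolution f F" and sol: "forward_global_solution \<mu> V u"
    and V: "AE t in lborel. t > 0 \<longrightarrow> V t \<in> Lp 2 \<and> enn2real (N2 (V t)) \<le> M"
    and sb: "0 < s" "s \<le> b"
  shows "\<exists>Q. set_integrable lborel {s..b} Q \<and> (AE t in lborel. t \<in> {s..b} \<longrightarrow> Q t = forcing_pairing \<mu> V u (F t) t) \<and>
    \<i> * L2_pairing (u b) (F b) - \<i> * L2_pairing (u s) (F s) = (LINT t:{s..b}|lborel. Q t)"
  using ev
proof (induction rule: gauss_evolution.induct)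
  case (gauss a p)
  show ?case
    by (rule duhamel_gauss_wave[OF gauss _ _ _ V sb]) (use sol in \<open>auto simp: forward_global_solution_def\<close>)
next
  case (add f F g G)
  have uL: "u t \<in> Lp 2" if "t \<ge> 0" for t using sol that unfolding forward_global_solution_def continuous_in_L2_def by auto
  obtain P where P: "set_integrable lborel {s..b} P" "AE t in lborel. t \<in> {s..b} \<longrightarrow> P t = forcing_pairing \<mu> V u (F t) t"
    "\<i> * L2_pairing (u b) (F b) - \<i> * L2_pairing (u s) (F s) = (LINT t:{s..b}|lborel. P t)" using add.IH(1) by blast
  obtain Q where Q: "set_integrable lborel {s..b} Q" "AE t in lborel. t \<in> {s..b} \<longrightarrow> Q t = forcing_pairing \<mu> V u (G t) t"
    "\<i> * L2_pairing (u b) (G b) - \<i> * L2_pairing (u s) (G s) = (LINT t:{s..b}|lborel. Q t)" using add.IH(2) by blast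
  note RF = gauss_evolution_regular[OF add.hyps(1)] and RG = gauss_evolution_regular[OF add.hyps(2)]
  show ?case
  proof (intro exI[of _ "\<lambda>t. P t + Q t"] conjI)
    show "set_integrable lborel {s..b} (\<lambda>t. P t + Q t)" by (intro set_integral_add(1) P Q)
    show "AE t in lborel. t \<in> {s..b} \<longrightarrow> P t + Q t = forcing_pairing \<mu> V u (\<lambda>x. F t x + G t x) t"
      using P(2) Q(2) V
    proof eventually_elim
      case (elim t)
      then show ?case
        using sb forcing_pairing_add[of V t u "F t" "G t" \<mu>] uL[of t] RF(5,6)[of t] RG(5,6)[of t] by (auto simp: Lp_2_iff)
    qed
    have "\<i> * L2_pairing (u t) (\<lambda>x. F t x + G t x) = \<i> * L2_pairing (u t) (F t) + \<i> * L2_pairing (u t) (G t)" if "t \<ge> 0" for t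
      using uL[OF that] RF RG by (simp add: L2_pairing_add_right distrib_left)
    then show "\<i> * L2_pairing (u b) (\<lambda>x. F b x + G b x) - \<i> * L2_pairing (u s) (\<lambda>x. F s x + G s x) = (LINT t:{s..b}|lborel. P t + Q t)"
      using sb set_integral_add(2)[OF P(1) Q(1)] by (simp add: algebra_simps flip: P(3) Q(3))
  qed
next
  case (scale f F c)
  then obtain P where P: "set_integrable lborel {s..b} P" "AE t in lborel. t \<in> {s..b} \<longrightarrow> P t = forcing_pairing \<mu> V u (F t) t"
    "\<i> * L2_pairing (u b) (F b) - \<i> * L2_pairing (u s) (F s) = (LINT t:{s..b}|lborel. P t)" by blast
  show ?case
  proof (intro exI[of _ "\<lambda>t. cnj c * P t"] conjI)
    show "set_integrable lborel {s..b} (\<lambda>t. cnj c * P t)" using P(1) by simp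
    show "AE t in lborel. t \<in> {s..b} \<longrightarrow> cnj c * P t = forcing_pairing \<mu> V u (\<lambda>x. c * F t x) t"
      using P(2) by eventually_elim (simp add: forcing_pairing_cmult)
    have "\<i> * (cnj c * L2_pairing (u b) (F b)) - \<i> * (cnj c * L2_pairing (u s) (F s)) = cnj c * (LINT t:{s..b}|lborel. P t)"
      unfolding P(3)[symmetric] by (simp add: algebra_simps)
    then show "\<i> * L2_pairing (u b) (\<lambda>x. c * F b x) - \<i> * L2_pairing (u s) (\<lambda>x. c * F s x) = (LINT t:{s..b}|lborel. cnj c * P t)"
      by (simp add: L2_pairing_cmult_right)
  qed
qed

section \<open>Singular measures and null sets\<close>

text \<open>The essential bound on the norms yields a bound for almost every time, and joint
  measurability makes the time slices measurable.\<close>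

lemma Linf_Lp_2_D:
  fixes f :: "real \<Rightarrow> 'a::euclidean_space \<Rightarrow> complex"
  assumes f: "f \<in> Linf_Lp I 2" and I: "I \<in> sets borel"
  obtains M where "M \<ge> 0" "AE t in lborel. t \<in> I \<longrightarrow> f t \<in> Lp 2 \<and> enn2real (N2 (f t)) \<le> M"
proof -
  let ?J = "restrict_space lborel I"
  define m where "m = esssup ?J (\<lambda>t. Lp_norm 2 (f t))"
  have m: "m < \<infinity>" and meas: "case_prod f \<in> borel_measurable (?J \<Otimes>\<^sub>M lborel)"
    using f by (auto simp: Linf_Lp_def m_def)
  obtain c where c: "m = ennreal c" "c \<ge> 0" using m by (cases m) auto
  have ft: "f t \<in> borel_measurable borel" if "t \<in> I" for t
  proof -
    have "(\<lambda>x. case_prod f (t, x)) \<in> borel_measurable lborel"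
      by (rule measurable_compose[OF _ meas]) (use that in \<open>auto simp: space_restrict_space intro!: measurable_Pair1'\<close>)
    then show ?thesis by simp
  qed
  have "AE t in ?J. Lp_norm 2 (f t) \<le> ennreal c" using esssup_AE[of "\<lambda>t. Lp_norm 2 (f t)" ?J] by (simp add: c m_def[symmetric])
  then have "AE t in lborel. t \<in> I \<longrightarrow> Lp_norm 2 (f t) \<le> ennreal c" using I by (subst (asm) AE_restrict_space_iff) auto
  then have "AE t in lborel. t \<in> I \<longrightarrow> f t \<in> Lp 2 \<and> enn2real (N2 (f t)) \<le> c\<^sup>2"
  proof eventually_elim
    case (elim t)
    show ?case
    proof
      assume t: "t \<in> I"
      then have "N2 (f t) \<le> ennreal (c\<^sup>2)" using elim c by (intro ennpow_half_le) (auto simp: Lp_norm_2)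
      moreover from this have "N2 (f t) < \<infinity>" by (rule le_less_trans) simp
      ultimately show "f t \<in> Lp 2 \<and> enn2real (N2 (f t)) \<le> c\<^sup>2" using ft[OF t] by (auto simp: Lp_2_iff intro!: enn2real_leI)
    qed
  qed
  then show ?thesis by (rule that[of "c\<^sup>2", rotated]) simp
qed

lemma sets_positive_part [simp]: "sets (positive_part \<sigma>) = sets borel"
  and space_positive_part [simp]: "space (positive_part \<sigma>) = UNIV"
proof -
  have "sigma_sets UNIV (sets borel) = sets (borel :: 'a measure)" using sets.sigma_sets_eq[of "borel :: 'a measure"] by simp
  then show "sets (positive_part \<sigma>) = sets borel" "space (positive_part \<sigma>) = UNIV"
    by (simp_all add: positive_part_def space_measure_of_conv)
qed

lemma positive_part_le_total_variation:
  "emeasure (positive_part (\<lambda>A. Re (\<nu> A))) A \<le> total_variation \<nu> A"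
proof (cases "A \<in> sets borel")
  case True
  have "(SUP B \<in> {B \<in> sets borel. B \<subseteq> A}. ennreal (Re (\<nu> B))) \<le> total_variation \<nu> A"
  proof (rule SUP_least)
    fix B assume B: "B \<in> {B \<in> sets borel. B \<subseteq> A}"
    have "ennreal (Re (\<nu> B)) \<le> (\<Sum>B\<in>{B}. ennreal (norm (\<nu> B)))" by (simp add: complex_Re_le_cmod ennreal_leI)
    also have "\<dots> \<le> total_variation \<nu> A"
      unfolding total_variation_def by (rule SUP_upper) (use B in \<open>auto simp: disjoint_def\<close>)
    finally show "ennreal (Re (\<nu> B)) \<le> total_variation \<nu> A" .
  qed
  then show ?thesis by (simp add: positive_part_def emeasure_measure_of_conv)
qed (simp add: emeasure_notin_sets)

text \<open>Only the upper bound for the real part of the pairing matters, so the negative part can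
  be dropped. The positive part is dominated by the total variation, hence finite and carried by the
  null set.\<close>

lemma singular_measure_majorant:
  fixes \<nu> :: "'a::euclidean_space set \<Rightarrow> complex"
  assumes "complex_radon_measure \<nu>" "lebesgue_singular \<nu>"
  obtains m N where "sets m = sets borel" "finite_measure m" "N \<in> null_sets lborel" "emeasure m (- N) = 0"
    "\<And>\<phi>. (\<And>x. 0 \<le> \<phi> x) \<Longrightarrow> Re (measure_pairing \<nu> \<phi>) \<le> (LINT x|m. \<phi> x)"
proof -
  define m where "m = positive_part (\<lambda>A. Re (\<nu> A))"
  obtain N where N: "N \<in> null_sets lborel" "total_variation \<nu> (- N) = 0" using assms(2) by (auto simp: lebesgue_singular_def)
  have "emeasure m UNIV \<le> total_variation \<nu> UNIV" unfolding m_def by (rule positive_part_le_total_variation)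
  also have "\<dots> < \<infinity>" using assms(1) by (simp add: complex_radon_measure_def)
  finally have "finite_measure m" by (intro finite_measureI) (simp add: m_def less_top)
  moreover have "emeasure m (- N) = 0" using positive_part_le_total_variation[of \<nu> "- N"] N(2) by (simp add: m_def)
  \<comment> \<open>The negative part contributes with a minus sign to the integral of a nonnegative
    function.\<close>
  moreover have "Re (measure_pairing \<nu> \<phi>) \<le> (LINT x|m. \<phi> x)" if "\<And>x. 0 \<le> \<phi> x" for \<phi>
  proof -
    have "0 \<le> (LINT x|positive_part (\<lambda>A. - Re (\<nu> A)). \<phi> x)" using that by (intro Bochner_Integration.integral_nonneg)
    then show ?thesis by (simp add: measure_pairing_def real_measure_integral_def m_def)
  qed
  ultimately show ?thesis using N by (intro that[of m N]) (auto simp: m_def)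
qed

text \<open>Up to a null set, a measurable set is a countable union of compact sets.\<close>

lemma null_if_compacts_null:
  fixes A :: "'a::euclidean_space set"
  assumes A: "A \<in> sets borel" and K: "\<And>K. compact K \<Longrightarrow> K \<subseteq> A \<Longrightarrow> emeasure lborel K = 0"
  shows "A \<in> null_sets lborel"
proof -
  have "A \<in> sets lebesgue" using A by (metis sets_completionI_sets sets_lborel)
  then obtain C T where CT: "fsigma C" "T \<in> null_sets lebesgue" "C \<union> T = A" by (rule lebesgue_set_almost_fsigma)
  then obtain F :: "nat \<Rightarrow> 'a set" where F: "range F \<subseteq> Collect compact" "C = \<Union>(F ` UNIV)" by (auto simp: fsigma_Union_compact)
  have "F n \<in> null_sets lborel" for n
    using K[of "F n"] F CT by (auto simp: null_sets_def compact_imp_closed borel_closed subset_eq)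
  then have "(\<Union>n. F n) \<in> null_sets lborel" by (rule null_sets_UN)
  then have "C \<in> null_sets lebesgue" unfolding F(2) by (rule null_sets_completionI)
  then have "A \<in> null_sets lebesgue" using CT by (metis null_sets.Un)
  then show ?thesis using A by (subst (asm) null_sets_completion_iff) auto
qed

text \<open>On each set where \<open>Re (c k) > 0\<close> the integral over a compact subset could
  vanish only if the subset is null. The four directions \<open>c = 1, -1, \<i>, -\<i>\<close>
  together cover \<open>k \<noteq> 0\<close>.\<close>

lemma AE_zero_if_compact_integrals_zero:
  fixes k :: "'a::euclidean_space \<Rightarrow> complex"
  assumes k: "integrable lborel k" and N: "N \<in> null_sets lborel"
    and K: "\<And>K. compact K \<Longrightarrow> K \<inter> N = {} \<Longrightarrow> (LINT x|lborel. indicator K x *\<^sub>R k x) = 0"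
  shows "AE x in lborel. k x = 0"
proof -
  have km: "k \<in> borel_measurable borel" using k by auto
  have *: "AE x in lborel. \<not> Re (c * k x) > 0" for c
  proof -
    let ?A = "{x. Re (c * k x) > 0} - N"
    have m: "{x. Re (c * k x) > 0} \<in> sets borel" using km by measurable
    have "?A \<in> null_sets lborel"
    proof (rule null_if_compacts_null)
      show "?A \<in> sets borel" using N m by (auto simp: null_sets_def)
      fix K assume K1: "compact K" "K \<subseteq> ?A"
      have Kb[measurable]: "K \<in> sets borel" using K1 by (simp add: compact_imp_closed borel_closed)
      have int: "integrable lborel (\<lambda>x. indicator K x *\<^sub>R k x)" by (rule integrable_mult_indicator[OF _ k]) simp
      have "(LINT x|lborel. Re (c * (indicator K x *\<^sub>R k x))) = Re (c * (LINT x|lborel. indicator K x *\<^sub>R k x))"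
        unfolding integral_mult_right_zero[symmetric] by (rule Bochner_Integration.integral_Re[OF integrable_mult_right[OF int]])
      also have "\<dots> = 0"
      proof -
        have "K \<inter> N = {}" using K1(2) by blast
        from K[OF K1(1) this] show ?thesis by simp
      qed
      finally have "(LINT x|lborel. Re (c * (indicator K x *\<^sub>R k x))) = 0" .
      moreover have "integrable lborel (\<lambda>x. Re (c * (indicator K x *\<^sub>R k x)))" using int by (intro Bochner_Integration.integrable_Re integrable_mult_right)
      moreover have nn: "0 \<le> Re (c * (indicator K x *\<^sub>R k x))" for x
        using K1(2) by (cases "x \<in> K") (auto intro: less_imp_le)
      ultimately have "AE x in lborel. Re (c * (indicator K x *\<^sub>R k x)) = 0"
        by (subst (asm) integral_nonneg_eq_0_iff_AE) auto
      then have "AE x in lborel. x \<notin> K" by eventually_elim (use K1(2) in \<open>force simp: indicator_def\<close>)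
      then show "emeasure lborel K = 0" using AE_iff_measurable[of K lborel "\<lambda>x. x \<notin> K"] by simp
    qed
    then have "AE x in lborel. x \<notin> ?A" by (rule AE_not_in)
    with AE_not_in[OF N] show ?thesis by eventually_elim auto
  qed
  show ?thesis using *[of 1] *[of "-1"] *[of \<i>] *[of "-\<i>"]
    by eventually_elim (simp add: complex_eq_iff)
qed

section \<open>Perturbation of the nonlinearity\<close>

lemma N2_as_integral: "f \<in> Lp 2 \<Longrightarrow> enn2real (N2 f) = (LINT x|lborel. (norm (f x))\<^sup>2)"
  by (simp add: N2_eq_integral)

text \<open>Replace \<open>u\<close> by the profile \<open>P\<close> and \<open>F\<close> by its
  profile \<open>D\<close> in the nonlinearity. Since \<open>||u| u - |P| P| \<le> (|u| + |P|) |u -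
  P|\<close> and \<open>u - P\<close> is \<open>l\<close> plus a small remainder, every error is a
  product of an \<open>L\<^sup>2\<close>-bounded factor with one of \<open>V\<close>,
  \<open>l\<close> and the remainder. Young's inequality splits it so that the first factor carries
  the small \<open>\<delta>\<close> and \<open>|V|\<^sup>2 + |l|\<^sup>2\<close> the large
  \<open>1/\<delta>\<close>.\<close>

lemma forcing_error_pointwise:
  fixes V u l P F D \<mu> :: complex and s k \<omega> \<delta> :: real
  assumes \<delta>: "\<delta> > 0" and s: "s \<ge> 0" and k: "s * norm F \<le> k" and \<omega>: "s * norm (F - D) \<le> \<omega>"
  shows "norm (of_real s * (V * u * cnj F + \<mu> * of_real (norm u) * u * cnj F - \<mu> * of_real (norm P) * P * cnj D))
    \<le> ((1 + 2 * norm \<mu>) * \<delta> * ((norm u)\<^sup>2 + (norm P)\<^sup>2) + (1 + norm \<mu>) / (2 * \<delta>) * ((norm V)\<^sup>2 + (norm l)\<^sup>2)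
        + norm \<mu> / (2 * \<delta>) * (norm (u - l - P))\<^sup>2) * k + norm \<mu> * \<omega> * (norm P)\<^sup>2"
proof -
  define E where "E = u - l - P"
  have k0: "k \<ge> 0" using k s by (meson mult_nonneg_nonneg norm_ge_zero order_trans)
  define X where "X = V * u + \<mu> * (of_real (norm u) * u - of_real (norm P) * P)"
  have dec: "of_real s * (V * u * cnj F + \<mu> * of_real (norm u) * u * cnj F - \<mu> * of_real (norm P) * P * cnj D)
    = X * (of_real s * cnj F) + \<mu> * of_real (norm P) * P * (of_real s * cnj (F - D))"
    by (simp add: X_def algebra_simps)
  have nF: "norm (of_real s * cnj F) \<le> k" "norm (of_real s * cnj (F - D)) \<le> \<omega>"
    using k \<omega> s by (simp_all only: norm_mult norm_of_real complex_mod_cnj abs_of_nonneg)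
  have "norm (of_real (norm u) * u - of_real (norm P) * P) = norm (of_real (norm u) * (u - P) + of_real (norm u - norm P) * P)"
    by (simp add: algebra_simps)
  also have "\<dots> \<le> norm u * norm (u - P) + \<bar>norm u - norm P\<bar> * norm P"
    by (rule order_trans[OF norm_triangle_ineq]) (simp add: norm_mult flip: of_real_diff)
  also have "\<dots> \<le> norm u * norm (u - P) + norm (u - P) * norm P"
    by (intro add_left_mono mult_right_mono norm_triangle_ineq3) auto
  also have "\<dots> = (norm u + norm P) * norm (l + E)" by (simp add: algebra_simps E_def)
  also have "\<dots> \<le> (norm u + norm P) * (norm l + norm E)" by (intro mult_left_mono norm_triangle_ineq) auto
  also have "\<dots> = (norm u + norm P) * norm l + (norm u + norm P) * norm E" by (simp add: distrib_left)
  also have "\<dots> \<le> (\<delta> * (norm u + norm P)\<^sup>2 + (norm l)\<^sup>2 / \<delta>) / 2 + (\<delta> * (norm u + norm P)\<^sup>2 + (norm E)\<^sup>2 / \<delta>) / 2"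
    by (intro add_mono young_ineq \<delta>)
  also have "\<dots> = \<delta> * (norm u + norm P)\<^sup>2 + ((norm l)\<^sup>2 + (norm E)\<^sup>2) / (2 * \<delta>)" using \<delta> by (simp add: field_simps)
  also have "\<dots> \<le> \<delta> * (2 * ((norm u)\<^sup>2 + (norm P)\<^sup>2)) + ((norm l)\<^sup>2 + (norm E)\<^sup>2) / (2 * \<delta>)"
    using norm_add_sq_le[of "norm u" "norm P"] \<delta> by (intro add_right_mono mult_left_mono) auto
  finally have 1: "norm (of_real (norm u) * u - of_real (norm P) * P) \<le> \<delta> * (2 * ((norm u)\<^sup>2 + (norm P)\<^sup>2)) + ((norm l)\<^sup>2 + (norm E)\<^sup>2) / (2 * \<delta>)" .
  have 2: "norm (V * u) \<le> (\<delta> * (norm u)\<^sup>2 + (norm V)\<^sup>2 / \<delta>) / 2"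
    using young_ineq[OF \<delta>, of "norm u" "norm V"] by (simp add: norm_mult mult.commute)
  have "norm X \<le> (\<delta> * (norm u)\<^sup>2 + (norm V)\<^sup>2 / \<delta>) / 2 + norm \<mu> * (\<delta> * (2 * ((norm u)\<^sup>2 + (norm P)\<^sup>2)) + ((norm l)\<^sup>2 + (norm E)\<^sup>2) / (2 * \<delta>))"
    unfolding X_def by (rule order_trans[OF norm_triangle_ineq add_mono[OF 2]]) (simp only: norm_mult, intro mult_left_mono 1 norm_ge_zero)
  also have "\<dots> = (1 / 2) * (\<delta> * (norm u)\<^sup>2) + 2 * norm \<mu> * (\<delta> * ((norm u)\<^sup>2 + (norm P)\<^sup>2)) + ((norm V)\<^sup>2 / (2 * \<delta>) + norm \<mu> * ((norm l)\<^sup>2 / (2 * \<delta>))) + norm \<mu> / (2 * \<delta>) * (norm E)\<^sup>2"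
    using \<delta> by (simp add: field_simps)
  also have "\<dots> \<le> 1 * (\<delta> * ((norm u)\<^sup>2 + (norm P)\<^sup>2)) + 2 * norm \<mu> * (\<delta> * ((norm u)\<^sup>2 + (norm P)\<^sup>2)) + ((1 + norm \<mu>) * ((norm V)\<^sup>2 / (2 * \<delta>)) + (1 + norm \<mu>) * ((norm l)\<^sup>2 / (2 * \<delta>))) + norm \<mu> / (2 * \<delta>) * (norm E)\<^sup>2"
  proof (intro add_mono order_refl)
    show "(1 / 2) * (\<delta> * (norm u)\<^sup>2) \<le> 1 * (\<delta> * ((norm u)\<^sup>2 + (norm P)\<^sup>2))" using \<delta> by (intro mult_mono) auto
    have "1 * ((norm V)\<^sup>2 / (2 * \<delta>)) \<le> (1 + norm \<mu>) * ((norm V)\<^sup>2 / (2 * \<delta>))" using \<delta> by (intro mult_right_mono) auto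
    then show "(norm V)\<^sup>2 / (2 * \<delta>) \<le> (1 + norm \<mu>) * ((norm V)\<^sup>2 / (2 * \<delta>))" by simp
    show "norm \<mu> * ((norm l)\<^sup>2 / (2 * \<delta>)) \<le> (1 + norm \<mu>) * ((norm l)\<^sup>2 / (2 * \<delta>))" using \<delta> by (intro mult_right_mono) auto
  qed
  also have "\<dots> = (1 + 2 * norm \<mu>) * \<delta> * ((norm u)\<^sup>2 + (norm P)\<^sup>2) + (1 + norm \<mu>) / (2 * \<delta>) * ((norm V)\<^sup>2 + (norm l)\<^sup>2) + norm \<mu> / (2 * \<delta>) * (norm E)\<^sup>2"
    (is "_ = ?Y") by (simp add: distrib_left distrib_right add_divide_distrib)
  finally have X: "norm X \<le> ?Y" .
  have "norm (X * (of_real s * cnj F)) \<le> ?Y * k"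
    unfolding norm_mult[of X] using X nF(1) k0 by (intro mult_mono) (auto intro: order_trans[OF norm_ge_zero])
  moreover have "norm (\<mu> * of_real (norm P) * P * (of_real s * cnj (F - D))) \<le> norm \<mu> * norm P * norm P * \<omega>"
    unfolding norm_mult[of "\<mu> * of_real (norm P) * P"] using nF(2) by (intro mult_mono) (auto simp: norm_mult)
  moreover have "norm \<mu> * norm P * norm P * \<omega> = norm \<mu> * \<omega> * (norm P)\<^sup>2" by (simp add: power2_eq_square)
  ultimately show ?thesis unfolding dec E_def[symmetric] by (smt (verit) norm_triangle_ineq)
qed

text \<open>The integrated form. The weight \<open>\<psi>\<close> is kept only in the term with
  \<open>|V|\<^sup>2 + |l|\<^sup>2\<close>: this is the mass that the singular measure controls.
  Elsewhere \<open>\<psi>\<close> is estimated by its supremum.\<close>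

lemma forcing_error_bound:
  fixes V u l P F D :: "'a::euclidean_space \<Rightarrow> complex" and s \<omega> \<delta> B :: real
  assumes L: "V \<in> Lp 2" "u \<in> Lp 2" "l \<in> Lp 2" "P \<in> Lp 2"
    and F: "F \<in> borel_measurable borel" "bounded (range F)" and D: "D \<in> borel_measurable borel" "bounded (range D)"
    and \<delta>: "\<delta> > 0" and s: "s \<ge> 0" and \<omega>0: "\<omega> \<ge> 0"
    and \<psi>[measurable]: "\<psi> \<in> borel_measurable borel" and \<psi>b: "\<And>x. 0 \<le> \<psi> x" "\<And>x. \<psi> x \<le> B"
    and k: "\<And>x. s * norm (F x) \<le> \<psi> x + \<omega>" and \<omega>: "\<And>x. s * norm (F x - D x) \<le> \<omega>"
  shows "norm (of_real s * (L2_pairing (\<lambda>x. V x * u x) F + L2_pairing (\<lambda>x. \<mu> * of_real (norm (u x)) * u x) F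
       - L2_pairing (\<lambda>x. \<mu> * of_real (norm (P x)) * P x) D))
    \<le> (1 + 2 * norm \<mu>) * \<delta> * ((enn2real (N2 u) + enn2real (N2 P)) * (B + \<omega>))
      + (1 + norm \<mu>) / (2 * \<delta>) * ((LINT x|lborel. ((norm (V x))\<^sup>2 + (norm (l x))\<^sup>2) * \<psi> x) + (enn2real (N2 V) + enn2real (N2 l)) * \<omega>)
      + norm \<mu> / (2 * \<delta>) * (enn2real (N2 (\<lambda>x. u x - l x - P x)) * (B + \<omega>))
      + norm \<mu> * \<omega> * enn2real (N2 P)"
proof -
  note I = forcing_integrable[OF L(1,2)] forcing_integrable(2)[OF L(4,4)]
  note J = integrable_mult_bounded[OF I(1) F] integrable_mult_bounded[OF I(2) F] integrable_mult_bounded[OF I(3) D]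
  let ?G = "\<lambda>x. V x * u x * cnj (F x) + \<mu> * of_real (norm (u x)) * u x * cnj (F x) - \<mu> * of_real (norm (P x)) * P x * cnj (D x)"
  have eL: "(\<lambda>x. u x - l x - P x) \<in> Lp 2" by (intro Lp_2_diff L)
  note [measurable] = Lp_2_measurable[OF L(1)] Lp_2_measurable[OF L(2)] Lp_2_measurable[OF L(3)] Lp_2_measurable[OF L(4)]
  have eq: "of_real s * (L2_pairing (\<lambda>x. V x * u x) F + L2_pairing (\<lambda>x. \<mu> * of_real (norm (u x)) * u x) F
       - L2_pairing (\<lambda>x. \<mu> * of_real (norm (P x)) * P x) D) = (LINT x|lborel. of_real s * ?G x)"
    unfolding L2_pairing_def integral_mult_right_zero
    by (subst Bochner_Integration.integral_diff[OF Bochner_Integration.integrable_add[OF J(1,2)] J(3)])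
       (subst Bochner_Integration.integral_add[OF J(1,2)], rule refl)
  let ?A = "\<lambda>x. (norm (u x))\<^sup>2 + (norm (P x))\<^sup>2" and ?B = "\<lambda>x. (norm (V x))\<^sup>2 + (norm (l x))\<^sup>2" and ?E = "\<lambda>x. (norm (u x - l x - P x))\<^sup>2"
  have iA: "integrable lborel ?A" and iB: "integrable lborel ?B" and iE: "integrable lborel ?E"
    and iP: "integrable lborel (\<lambda>x. (norm (P x))\<^sup>2)"
    using N2_integrable[OF L(1)] N2_integrable[OF L(2)] N2_integrable[OF L(3)] N2_integrable[OF L(4)] N2_integrable[OF eL] by auto
  have iB\<psi>: "integrable lborel (\<lambda>x. ?B x * \<psi> x)"
  proof (rule Bochner_Integration.integrable_bound[OF integrable_mult_right[OF iB, of B]])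
    show "(\<lambda>x. ?B x * \<psi> x) \<in> borel_measurable lborel" by measurable
    have "?B x * \<psi> x \<le> B * ?B x" for x using mult_left_mono[OF \<psi>b(2)[of x], of "?B x"] by (simp add: mult.commute)
    then show "AE x in lborel. norm (?B x * \<psi> x) \<le> norm (B * ?B x)"
      using \<psi>b(1) by (intro AE_I2) (simp add: abs_mult, smt (verit) abs_ge_self mult_right_mono zero_le_power2)
  qed
  define C1 C2 C3 where C: "C1 = (1 + 2 * norm \<mu>) * \<delta>" "C2 = (1 + norm \<mu>) / (2 * \<delta>)" "C3 = norm \<mu> / (2 * \<delta>)"
  have C0: "C1 \<ge> 0" "C3 \<ge> 0" using \<delta> by (auto simp: C)
  let ?R = "\<lambda>x. (C1 * (B + \<omega>)) * ?A x + (C2 * (?B x * \<psi> x) + (C2 * \<omega>) * ?B x) + (C3 * (B + \<omega>)) * ?E x + (norm \<mu> * \<omega>) * (norm (P x))\<^sup>2"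
  have iR: "integrable lborel ?R"
    by (intro Bochner_Integration.integrable_add integrable_mult_right iA iB iB\<psi> iE iP)
  have pt: "norm (of_real s * ?G x) \<le> ?R x" for x
  proof -
    have "norm (of_real s * ?G x) \<le> (C1 * ?A x + C2 * ?B x + C3 * ?E x) * (\<psi> x + \<omega>) + norm \<mu> * \<omega> * (norm (P x))\<^sup>2"
      unfolding C by (rule forcing_error_pointwise[OF \<delta> s k \<omega>])
    also have "\<dots> = C1 * ?A x * (\<psi> x + \<omega>) + (C2 * (?B x * \<psi> x) + (C2 * \<omega>) * ?B x) + C3 * ?E x * (\<psi> x + \<omega>) + norm \<mu> * \<omega> * (norm (P x))\<^sup>2"
      by (simp add: algebra_simps)
    also have "\<dots> \<le> C1 * ?A x * (B + \<omega>) + (C2 * (?B x * \<psi> x) + (C2 * \<omega>) * ?B x) + C3 * ?E x * (B + \<omega>) + norm \<mu> * \<omega> * (norm (P x))\<^sup>2"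
      using C0 \<psi>b(2)[of x] by (intro add_mono mult_left_mono order_refl) auto
    also have "\<dots> = ?R x" by (simp only: mult_ac)
    finally show ?thesis .
  qed
  have iG: "integrable lborel (\<lambda>x. of_real s * ?G x)"
    by (intro integrable_mult_right Bochner_Integration.integrable_diff Bochner_Integration.integrable_add J)
  have 1: "norm (LINT x|lborel. of_real s * ?G x) \<le> (LINT x|lborel. ?R x)"
    by (rule order_trans[OF integral_norm_bound integral_mono[OF integrable_norm[OF iG] iR pt]])
  have 2: "(LINT x|lborel. ?R x) = (C1 * (B + \<omega>)) * (LINT x|lborel. ?A x) + (C2 * (LINT x|lborel. ?B x * \<psi> x) + (C2 * \<omega>) * (LINT x|lborel. ?B x))
     + (C3 * (B + \<omega>)) * (LINT x|lborel. ?E x) + (norm \<mu> * \<omega>) * (LINT x|lborel. (norm (P x))\<^sup>2)"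
    by (simp only: integral_mult_right_zero Bochner_Integration.integral_add Bochner_Integration.integrable_add integrable_mult_right iA iB iB\<psi> iE iP)
  have 3: "(LINT x|lborel. ?A x) = enn2real (N2 u) + enn2real (N2 P)" "(LINT x|lborel. ?B x) = enn2real (N2 V) + enn2real (N2 l)"
    using N2_integrable[OF L(1)] N2_integrable[OF L(2)] N2_integrable[OF L(3)] N2_integrable[OF L(4)] by (simp_all add: N2_as_integral L)
  have 4: "(LINT x|lborel. ?E x) = enn2real (N2 (\<lambda>x. u x - l x - P x))" "(LINT x|lborel. (norm (P x))\<^sup>2) = enn2real (N2 P)"
    by (simp_all add: N2_as_integral L eL)
  have 5: "(c1 * (b + w)) * a + (c2 * k + (c2 * w) * v) + (c3 * (b + w)) * e + (m * w) * p
    = c1 * (a * (b + w)) + c2 * (k + v * w) + c3 * (e * (b + w)) + m * w * p" for a b c1 c2 c3 w k v e m p :: real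
    by (simp add: algebra_simps)
  show ?thesis using 1 unfolding 2 unfolding 3 4 unfolding 5 unfolding eq C .
qed

section \<open>Boundedness against logarithmic growth\<close>

text \<open>A property that holds at almost every late time holds at arbitrarily late times.\<close>

lemma AE_obtain_ge:
  assumes "AE t in lborel. t \<ge> (T::real) \<longrightarrow> P t"
  obtains t where "t \<ge> c" "t \<ge> T" "P t"
proof -
  obtain N where N: "{t \<in> space lborel. \<not> (t \<ge> T \<longrightarrow> P t)} \<subseteq> N" "emeasure lborel N = 0" "N \<in> sets lborel"
    using AE_E[OF assms] by blast
  have "\<not> {max c T..max c T + 1} \<subseteq> N"
  proof
    assume "{max c T..max c T + 1} \<subseteq> N"
    then have "emeasure lborel {max c T..max c T + 1} \<le> emeasure lborel N" by (rule emeasure_mono) (rule N)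
    then show False using N(2) by simp
  qed
  then show ?thesis using N(1) that by force
qed

lemma LINT_inverse_ge:
  fixes q :: "real \<Rightarrow> real"
  assumes s: "0 < s" "s \<le> b" and q: "set_integrable lborel {s..b} q" and le: "AE t in lborel. t \<in> {s..b} \<longrightarrow> c / t \<le> q t"
  shows "c * (ln b - ln s) \<le> (LINT t:{s..b}|lborel. q t)"
proof -
  have "has_bochner_integral lborel (\<lambda>t. indicator {s..b} t *\<^sub>R (c / t)) (c * ln b - c * ln s)"
  proof (rule has_bochner_integral_FTC_Icc[OF s(2)])
    fix t assume "s \<le> t" "t \<le> b"
    then show "((\<lambda>t. c * ln t) has_vector_derivative c / t) (at t within {s..b})"
      using s unfolding has_real_derivative_iff_has_vector_derivative[symmetric] by (auto intro!: derivative_eq_intros)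
  next
    show "continuous_on {s..b} (\<lambda>t. c / t)" using s by (intro continuous_intros) auto
  qed
  then have "integrable lborel (\<lambda>t. indicator {s..b} t *\<^sub>R (c / t))" "(LINT t|lborel. indicator {s..b} t *\<^sub>R (c / t)) = c * (ln b - ln s)"
    by (auto simp: has_bochner_integral_iff algebra_simps)
  moreover have "(LINT t|lborel. indicator {s..b} t *\<^sub>R (c / t)) \<le> (LINT t|lborel. indicator {s..b} t *\<^sub>R q t)"
    using calculation(1) q unfolding set_integrable_def
    by (rule integral_mono_AE) (use le in eventually_elim, simp add: indicator_def)
  ultimately show ?thesis by (simp add: set_lebesgue_integral_def)
qed

text \<open>If \<open>t\<^sup>d\<^sup>/\<^sup>2\<close> times the forcing were eventually within
  \<open>\<theta>\<close> of a constant \<open>c\<close> with \<open>|c| > \<theta>\<close>, then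
  after rotation by the phase of \<open>c\<close> its real part would be at least \<open>\<eta>
  t\<^sup>-\<^sup>d\<^sup>/\<^sup>2 \<ge> \<eta> / t\<close>, and Duhamel's identity would make the
  bounded quantity \<open>\<langle>u(t), F(t)\<rangle>\<close> grow like \<open>ln
  t\<close>.\<close>

lemma forcing_limit_le:
  fixes f :: "'a::euclidean_space \<Rightarrow> complex" and u V :: "real \<Rightarrow> 'a \<Rightarrow> complex"
  assumes ev: "gauss_evolution f F" and sol: "forward_global_solution \<mu> V u"
    and V: "AE t in lborel. t > 0 \<longrightarrow> V t \<in> Lp 2 \<and> enn2real (N2 (V t)) \<le> M"
    and d: "DIM('a) \<in> {1, 2}" and T: "T \<ge> 1"
    and bd: "AE t in lborel. t \<ge> T \<longrightarrow> enn2real (N2 (u t)) \<le> MU"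
    and close: "AE t in lborel. t \<ge> T \<longrightarrow> norm (of_real (sqrt t ^ DIM('a)) * forcing_pairing \<mu> V u (F t) t - c) \<le> \<theta>"
  shows "norm c \<le> \<theta>"
proof (rule ccontr)
  assume "\<not> norm c \<le> \<theta>"
  define \<eta> where "\<eta> = norm c - \<theta>"
  have \<eta>: "\<eta> > 0" using \<open>\<not> norm c \<le> \<theta>\<close> by (simp add: \<eta>_def)
  obtain t1 where "t1 \<ge> T" "norm (of_real (sqrt t1 ^ DIM('a)) * forcing_pairing \<mu> V u (F t1) t1 - c) \<le> \<theta>" using AE_obtain_ge[OF close, of T] by blast
  then have "\<theta> \<ge> 0" using norm_ge_zero order_trans by blast
  then have c0: "c \<noteq> 0" using \<open>\<not> norm c \<le> \<theta>\<close> by auto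
  define \<kappa> where "\<kappa> = cnj c / of_real (norm c)"
  have \<kappa>1: "norm \<kappa> = 1" using c0 by (simp add: \<kappa>_def norm_divide)
  have "cnj c * c = of_real (norm c) * of_real (norm c)"
    using complex_norm_square[of c] by (simp add: power2_eq_square mult.commute)
  then have "\<kappa> * c = of_real (norm c)" using c0 by (simp add: \<kappa>_def)
  then have \<kappa>c: "Re (\<kappa> * c) = norm c" by simp
  have uL: "u t \<in> Lp 2" if "t \<ge> 0" for t using sol that unfolding forward_global_solution_def continuous_in_L2_def by auto
  note R = gauss_evolution_regular[OF ev]
  define C where "C = (MU + enn2real (N2 f)) / 2"
  have pb: "norm (L2_pairing (u t) (F t)) \<le> C" if "t \<ge> 1" "enn2real (N2 (u t)) \<le> MU" for t
  proof -
    have "norm (L2_pairing (u t) (F t)) \<le> (1 * enn2real (N2 (u t)) + enn2real (N2 (F t)) / 1) / 2"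
      using that by (intro L2_pairing_bound uL R) auto
    also have "\<dots> \<le> C" using that by (simp add: C_def N2_gauss_evolution[OF ev])
    finally show ?thesis .
  qed
  obtain s where s: "s \<ge> T" "enn2real (N2 (u s)) \<le> MU" using AE_obtain_ge[OF bd, of T] by blast
  obtain b where b: "b \<ge> exp (ln s + (2 * C + 1) / \<eta>)" "b \<ge> T" "enn2real (N2 (u b)) \<le> MU" using AE_obtain_ge[OF bd] by blast
  have s1: "s \<ge> 1" using s T by simp
  have C0: "C \<ge> 0" using pb[OF s1 s(2)] norm_ge_zero order_trans by blast
  have bpos: "b > 0" using b T by simp
  have lnb: "ln s + (2 * C + 1) / \<eta> \<le> ln b" using ln_mono[OF b(1)] by simp
  have sb: "s \<le> b"
  proof -
    have "ln s \<le> ln b" using lnb C0 \<eta> by (smt (verit) divide_nonneg_pos)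
    then show ?thesis using s1 bpos by simp
  qed
  obtain Q where Q: "set_integrable lborel {s..b} Q" "AE t in lborel. t \<in> {s..b} \<longrightarrow> Q t = forcing_pairing \<mu> V u (F t) t"
    "\<i> * L2_pairing (u b) (F b) - \<i> * L2_pairing (u s) (F s) = (LINT t:{s..b}|lborel. Q t)"
    using duhamel[OF ev sol V _ sb] s1 by auto
  have \<kappa>Q: "set_integrable lborel {s..b} (\<lambda>t. \<kappa> * Q t)" using Q(1) by simp
  have int: "set_integrable lborel {s..b} (\<lambda>t. Re (\<kappa> * Q t))"
    unfolding set_integrable_def
    using integrable_Re[OF \<kappa>Q[unfolded set_integrable_def]] by (simp only: scaleR_complex.simps real_scaleR_def)
  have "(LINT t:{s..b}|lborel. Re (\<kappa> * Q t)) = Re (LINT t:{s..b}|lborel. \<kappa> * Q t)"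
    unfolding set_lebesgue_integral_def
    using integral_Re[OF \<kappa>Q[unfolded set_integrable_def]] by (simp only: scaleR_complex.simps real_scaleR_def)
  also have "\<dots> \<le> norm (LINT t:{s..b}|lborel. \<kappa> * Q t)" by (rule complex_Re_le_cmod)
  also have "\<dots> = norm (\<i> * L2_pairing (u b) (F b) - \<i> * L2_pairing (u s) (F s))" by (simp add: norm_mult \<kappa>1 Q(3))
  also have "\<dots> \<le> norm (\<i> * L2_pairing (u b) (F b)) + norm (\<i> * L2_pairing (u s) (F s))" by (rule norm_triangle_ineq4)
  also have "\<dots> \<le> C + C" using pb[of b] pb[of s] b s s1 T by (intro add_mono) (auto simp: norm_mult)
  finally have up: "(LINT t:{s..b}|lborel. Re (\<kappa> * Q t)) \<le> 2 * C" by simp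
  have "\<eta> * (ln b - ln s) \<le> (LINT t:{s..b}|lborel. Re (\<kappa> * Q t))"
  proof (rule LINT_inverse_ge[OF _ sb int])
    show "AE t in lborel. t \<in> {s..b} \<longrightarrow> \<eta> / t \<le> Re (\<kappa> * Q t)"
      using Q(2) close
    proof eventually_elim
      case (elim t)
      show ?case
      proof
        assume t: "t \<in> {s..b}"
        let ?p = "sqrt t ^ DIM('a)"
        have t1: "t \<ge> 1" using t s1 by simp
        \<comment> \<open>Here the dimension enters: for \<open>d \<le> 2\<close> the decay rate
          \<open>t\<^sup>-\<^sup>d\<^sup>/\<^sup>2\<close> is at least \<open>1 / t\<close>, which
          is not integrable at infinity.\<close>
        have p: "0 < ?p" "?p \<le> t"
        proof -
          show "0 < ?p" using t1 by simp
          have "sqrt t \<le> t" using real_sqrt_le_mono[of t "t * t"] t1 mult_left_mono[OF t1, of t] by simp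
          then show "?p \<le> t" using d t1 by (auto simp: power2_eq_square)
        qed
        have "norm (\<kappa> * (of_real ?p * Q t - c)) \<le> \<theta>" using elim t s by (simp add: norm_mult \<kappa>1)
        then have "\<bar>Re (\<kappa> * (of_real ?p * Q t - c))\<bar> \<le> \<theta>" using abs_Re_le_cmod order_trans by blast
        moreover have "Re (\<kappa> * (of_real ?p * Q t - c)) = ?p * Re (\<kappa> * Q t) - norm c"
        proof -
          have "\<kappa> * (of_real p * Q t - c) = of_real p * (\<kappa> * Q t) - \<kappa> * c" for p by (simp add: algebra_simps)
          moreover have "Re (of_real p * (\<kappa> * Q t) - \<kappa> * c) = p * Re (\<kappa> * Q t) - norm c" for p
            unfolding minus_complex.simps \<kappa>c by (simp only: Re_complex_of_real times_complex.simps(1)[of "of_real p"] Im_complex_of_real mult_zero_left diff_zero)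
          ultimately show ?thesis by (simp only:)
        qed
        ultimately have "\<eta> \<le> ?p * Re (\<kappa> * Q t)" by (simp add: \<eta>_def)
        then have "\<eta> / ?p \<le> Re (\<kappa> * Q t)" using p by (simp add: field_simps)
        moreover have "\<eta> / t \<le> \<eta> / ?p" using p \<eta> t1 by (intro divide_left_mono) auto
        ultimately show "\<eta> / t \<le> Re (\<kappa> * Q t)" by simp
      qed
    qed
  qed (use s1 in simp)
  moreover have "2 * C + 1 \<le> \<eta> * (ln b - ln s)" using lnb \<eta> by (simp add: field_simps)
  ultimately show False using up by simp
qed

section \<open>Rescaling\<close>

text \<open>The substitution \<open>x = t y\<close> brings the hypothesis on \<open>V\<close> and
  \<open>l\<close> to the original variable.\<close>

lemma rescaled_mass_bound:
  fixes a b :: "real \<Rightarrow> 'a::euclidean_space \<Rightarrow> complex" and \<phi> :: "'a \<Rightarrow> real"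
  assumes lim: "Limsup at_top (\<lambda>t. enn2ereal (\<integral>\<^sup>+x. ennreal (t ^ DIM('a) *
               ((norm (a t (t *\<^sub>R x)))\<^sup>2 + (norm (b t (t *\<^sub>R x)))\<^sup>2) * \<phi> x) \<partial>lborel)) \<le> ereal R"
    and \<phi>[measurable]: "\<phi> \<in> borel_measurable borel" and \<phi>0: "\<And>x. 0 \<le> \<phi> x" and \<phi>B: "\<And>x. \<phi> x \<le> B" and e: "e > 0"
  shows "\<forall>\<^sub>F t in at_top. a t \<in> Lp 2 \<longrightarrow> b t \<in> Lp 2 \<longrightarrow>
    (LINT x|lborel. ((norm (a t x))\<^sup>2 + (norm (b t x))\<^sup>2) * \<phi> ((1 / t) *\<^sub>R x)) \<le> R + e"
proof -
  have "\<forall>\<^sub>F t in at_top. enn2ereal (\<integral>\<^sup>+x. ennreal (t ^ DIM('a) *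
               ((norm (a t (t *\<^sub>R x)))\<^sup>2 + (norm (b t (t *\<^sub>R x)))\<^sup>2) * \<phi> x) \<partial>lborel) < ereal (R + e)"
    by (rule Limsup_lessD[OF le_less_trans[OF lim]]) (use e in simp)
  then show ?thesis using eventually_gt_at_top[of 0]
  proof eventually_elim
    case (elim t)
    show ?case
    proof (intro impI)
      assume L: "a t \<in> Lp 2" "b t \<in> Lp 2"
      note [measurable] = Lp_2_measurable[OF L(1)] Lp_2_measurable[OF L(2)]
      let ?g = "\<lambda>x. ((norm (a t x))\<^sup>2 + (norm (b t x))\<^sup>2) * \<phi> ((1 / t) *\<^sub>R x)"
      have m1[measurable]: "(\<lambda>x. \<phi> ((1 / t) *\<^sub>R x)) \<in> borel_measurable borel" by measurable
      have iab: "integrable lborel (\<lambda>x. (norm (a t x))\<^sup>2 + (norm (b t x))\<^sup>2)"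
        by (intro Bochner_Integration.integrable_add N2_integrable L)
      have int: "integrable lborel ?g"
      proof (rule Bochner_Integration.integrable_bound[OF integrable_mult_right[OF iab, of B]])
        show "?g \<in> borel_measurable lborel" by measurable
        show "AE x in lborel. norm (?g x) \<le> norm (B * ((norm (a t x))\<^sup>2 + (norm (b t x))\<^sup>2))"
        proof (rule AE_I2)
          fix x
          have "?g x \<le> ((norm (a t x))\<^sup>2 + (norm (b t x))\<^sup>2) * B" by (intro mult_left_mono \<phi>B) auto
          moreover have "0 \<le> ?g x" using \<phi>0 by simp
          ultimately show "norm (?g x) \<le> norm (B * ((norm (a t x))\<^sup>2 + (norm (b t x))\<^sup>2))" by (simp only: mult.commute real_norm_def abs_of_nonneg order_trans)
        qed
      qed
      let ?G = "\<lambda>y. ennreal (((norm (a t (t *\<^sub>R y)))\<^sup>2 + (norm (b t (t *\<^sub>R y)))\<^sup>2) * \<phi> y)"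
      have Gm[measurable]: "?G \<in> borel_measurable borel" by measurable
      have "ennreal (LINT x|lborel. ?g x) = (\<integral>\<^sup>+x. ennreal (?g x) \<partial>lborel)"
        using \<phi>0 by (intro nn_integral_eq_integral[OF int, symmetric]) simp
      also have "\<dots> = (\<integral>\<^sup>+x. ?G ((1 / t) *\<^sub>R x) \<partial>lborel)" using elim(2) by simp
      also have "\<dots> = ennreal (t ^ DIM('a)) * (\<integral>\<^sup>+x. ?G x \<partial>lborel)" by (rule nn_integral_lborel_scale[OF elim(2) Gm])
      also have "\<dots> = (\<integral>\<^sup>+x. ennreal (t ^ DIM('a)) * ?G x \<partial>lborel)" by (rule nn_integral_cmult[symmetric]) simp
      also have "\<dots> = (\<integral>\<^sup>+x. ennreal (t ^ DIM('a) * ((norm (a t (t *\<^sub>R x)))\<^sup>2 + (norm (b t (t *\<^sub>R x)))\<^sup>2) * \<phi> x) \<partial>lborel)"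
        using elim(2) \<phi>0 by (intro nn_integral_cong) (simp add: ennreal_mult'[symmetric] mult.assoc)
      finally have "enn2ereal (ennreal (LINT x|lborel. ?g x)) < ereal (R + e)" using elim(1) by simp
      moreover have "0 \<le> (LINT x|lborel. ?g x)" using \<phi>0 by (intro Bochner_Integration.integral_nonneg) simp
      ultimately show "(LINT x|lborel. ?g x) \<le> R + e" by (simp add: enn2ereal_ennreal)
    qed
  qed
qed

text \<open>The common phase cancels and each of the three factors contributes
  \<open>(2t)\<^sup>-\<^sup>d\<^sup>/\<^sup>2\<close>, against the Jacobian
  \<open>(2t)\<^sup>d\<close>; this is the resonant term.\<close>

lemma dollard_pairing:
  fixes h f :: "'a::euclidean_space \<Rightarrow> complex"
  assumes t: "t > 0" and [measurable]: "h \<in> borel_measurable borel" "f \<in> borel_measurable borel"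
  shows "of_real (sqrt t ^ DIM('a)) * L2_pairing (\<lambda>x. \<mu> * of_real (norm (dollard t h x)) * dollard t h x) (dollard t f)
    = of_real ((1 / sqrt 2) ^ DIM('a)) * \<mu> * L2_pairing (\<lambda>x. of_real (norm (h x)) * h x) f"
proof -
  define q where "q = (1 / sqrt (2 * t)) ^ DIM('a)"
  define k where "k x = dollard t (\<lambda>_. 1) x" for x :: 'a
  have kn: "norm (k x) = q" for x using norm_dollard[OF t, of "\<lambda>_. 1" x] by (simp add: k_def q_def)
  have dk: "dollard t g x = k x * g ((1 / (2 * t)) *\<^sub>R x)" for g x by (simp add: k_def dollard_def)
  have kk: "k x * cnj (k x) = of_real (q\<^sup>2)" for x using complex_norm_square[of "k x"] by (simp add: kn)
  define G where "G \<xi> = of_real (q ^ 3) * \<mu> * (of_real (norm (h \<xi>)) * h \<xi> * cnj (f \<xi>))" for \<xi>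
  have Gm: "G \<in> borel_measurable borel" unfolding G_def[abs_def] by measurable
  have q0: "q \<ge> 0" using t by (simp add: q_def)
  have "\<mu> * of_real (norm (dollard t h x)) * dollard t h x * cnj (dollard t f x) = G ((1 / (2 * t)) *\<^sub>R x)" for x
  proof -
    let ?\<xi> = "(1 / (2 * t)) *\<^sub>R x"
    have "\<mu> * of_real (norm (dollard t h x)) * dollard t h x * cnj (dollard t f x)
      = \<mu> * (of_real q * of_real (norm (h ?\<xi>))) * (k x * cnj (k x)) * h ?\<xi> * cnj (f ?\<xi>)"
      by (simp add: dk norm_mult kn mult_ac)
    also have "\<dots> = G ?\<xi>" unfolding kk by (simp add: G_def power2_eq_square power3_eq_cube mult_ac)
    finally show ?thesis .
  qed
  then have "L2_pairing (\<lambda>x. \<mu> * of_real (norm (dollard t h x)) * dollard t h x) (dollard t f) = (LINT x|lborel. G ((1 / (2 * t)) *\<^sub>R x))"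
    unfolding L2_pairing_def by simp
  also have "\<dots> = of_real ((2 * t) ^ DIM('a)) * (LINT x|lborel. G x)" by (rule integral_lborel_scale[OF _ Gm]) (use t in simp)
  also have "(LINT x|lborel. G x) = of_real (q ^ 3) * \<mu> * L2_pairing (\<lambda>x. of_real (norm (h x)) * h x) f"
    by (simp add: G_def L2_pairing_def)
  finally have 1: "L2_pairing (\<lambda>x. \<mu> * of_real (norm (dollard t h x)) * dollard t h x) (dollard t f)
    = of_real ((2 * t) ^ DIM('a)) * (of_real (q ^ 3) * \<mu> * L2_pairing (\<lambda>x. of_real (norm (h x)) * h x) f)" .
  have "sqrt t * (2 * t) * (1 / sqrt (2 * t)) ^ 3 = 1 / sqrt 2"
  proof -
    have "sqrt t > 0" "sqrt 2 > (0::real)" using t by auto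
    moreover have "t = sqrt t * sqrt t" "(2::real) = sqrt 2 * sqrt 2" using t by auto
    moreover have "(a * ((b * b) * (a * a))) * (1 / (b * a)) ^ 3 = 1 / b" if "a > 0" "b > 0" for a b :: real
      using that by (simp add: power3_eq_cube)
    ultimately show ?thesis by (metis real_sqrt_mult)
  qed
  moreover have "q ^ 3 = ((1 / sqrt (2 * t)) ^ 3) ^ DIM('a)"
    unfolding q_def power_mult[symmetric] by (rule arg_cong[OF mult.commute])
  moreover have "(sqrt t * (2 * t) * (1 / sqrt (2 * t)) ^ 3) ^ DIM('a) = sqrt t ^ DIM('a) * (2 * t) ^ DIM('a) * ((1 / sqrt (2 * t)) ^ 3) ^ DIM('a)"
    by (simp only: power_mult_distrib)
  ultimately have 2: "sqrt t ^ DIM('a) * (2 * t) ^ DIM('a) * q ^ 3 = (1 / sqrt 2) ^ DIM('a)" by (simp only:)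
  have 3: "of_real a * (of_real b * (of_real c * x * y)) = of_real (a * b * c) * x * y" for a b c and x y :: complex
    by (simp add: mult_ac)
  show ?thesis unfolding 1 3 2 by (rule refl)
qed

text \<open>The remainder \<open>r\<close> and the error of the free asymptotics together; the bound
  \<open>e\<close> is defined for all times although the decomposition holds for almost every time
  only.\<close>

lemma solution_minus_profile:
  fixes v :: "'a::euclidean_space \<Rightarrow> complex" and u l r :: "real \<Rightarrow> 'a \<Rightarrow> complex"
  assumes v: "v \<in> Lp 2"
    and dec: "AE t in lborel. t > 0 \<longrightarrow> (AE x in lborel. u t x = l t x + free_schroedinger t v x + r t x)"
    and r: "\<forall>t>0. r t \<in> Lp 2" "((\<lambda>t. Lp_norm 2 (r t)) \<longlongrightarrow> 0) at_top"
  obtains e :: "real \<Rightarrow> ennreal" where "(e \<longlongrightarrow> 0) at_top"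
    "AE t in lborel. t > 0 \<longrightarrow> N2 (\<lambda>x. u t x - l t x - dollard t (fourier_L2 v) x) \<le> e t"
proof -
  define h where "h = fourier_L2 v"
  have hm[measurable]: "h \<in> borel_measurable borel" using fourier_L2_props(1)[OF v] by (auto simp: h_def)
  define e where "e t = 2 * N2 (\<lambda>x. free_schroedinger t v x - dollard t h x) + 2 * N2 (r t)" for t
  have "((\<lambda>t. N2 (r t)) \<longlongrightarrow> 0) at_top" using r(2) by (simp add: Lp_norm_2_tendsto_0_iff)
  then have "(e \<longlongrightarrow> 2 * 0 + 2 * 0) at_top"
    unfolding e_def h_def by (intro tendsto_add ennreal_tendsto_cmult free_schroedinger_profile v) auto
  then have "(e \<longlongrightarrow> 0) at_top" by simp
  moreover have "AE t in lborel. t > 0 \<longrightarrow> N2 (\<lambda>x. u t x - l t x - dollard t h x) \<le> e t"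
    using dec
  proof eventually_elim
    case (elim t)
    show ?case
    proof
      assume t: "t > 0"
      have [measurable]: "free_schroedinger t v \<in> borel_measurable borel" "r t \<in> borel_measurable borel"
        using free_schroedinger_props(1)[OF v] r(1) t by auto
      have "AE x in lborel. u t x - l t x - dollard t h x = (free_schroedinger t v x - dollard t h x) + r t x"
        using elim t by (auto elim!: eventually_mono)
      then have "N2 (\<lambda>x. u t x - l t x - dollard t h x) = N2 (\<lambda>x. (free_schroedinger t v x - dollard t h x) + r t x)"
        by (rule N2_cong_AE)
      also have "\<dots> \<le> e t" unfolding e_def by (intro N2_add) measurable
      finally show "N2 (\<lambda>x. u t x - l t x - dollard t h x) \<le> e t" .
    qed
  qed
  ultimately show ?thesis using that by (simp add: h_def)
qed

lemma N2_triangle3: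
  fixes u l P :: "'a::euclidean_space \<Rightarrow> complex"
  assumes L: "u \<in> Lp 2" "l \<in> Lp 2" "P \<in> Lp 2"
  shows "enn2real (N2 u) \<le> 2 * enn2real (N2 (\<lambda>x. u x - l x - P x)) + 4 * enn2real (N2 l) + 4 * enn2real (N2 P)"
proof -
  have E: "(\<lambda>x. u x - l x - P x) \<in> Lp 2" by (intro Lp_2_diff L)
  have pt: "(norm (u x))\<^sup>2 \<le> 2 * (norm (u x - l x - P x))\<^sup>2 + (4 * (norm (l x))\<^sup>2 + 4 * (norm (P x))\<^sup>2)" for x
    using norm_add_sq_le[of "u x - l x - P x" "l x + P x"] norm_add_sq_le[of "l x" "P x"] by simp
  note I = N2_integrable[OF E] N2_integrable[OF L(2)] N2_integrable[OF L(3)]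
  have "(LINT x|lborel. (norm (u x))\<^sup>2) \<le> (LINT x|lborel. 2 * (norm (u x - l x - P x))\<^sup>2 + (4 * (norm (l x))\<^sup>2 + 4 * (norm (P x))\<^sup>2))"
    by (intro integral_mono N2_integrable L Bochner_Integration.integrable_add integrable_mult_right I pt)
  also have "\<dots> = 2 * (LINT x|lborel. (norm (u x - l x - P x))\<^sup>2) + (4 * (LINT x|lborel. (norm (l x))\<^sup>2) + 4 * (LINT x|lborel. (norm (P x))\<^sup>2))"
    by (simp only: Bochner_Integration.integral_add Bochner_Integration.integrable_add integrable_mult_right I integral_mult_right_zero)
  finally show ?thesis by (simp only: N2_as_integral L E add.assoc)
qed

section \<open>The limiting inequality\<close>

text \<open>Combine the expansion of the forcing with boundedness: the resonant term is the
  candidate limit \<open>c\<close>, and the error terms that survive as \<open>t \<rightarrow>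
  \<infinity>\<close> form \<open>\<theta>\<close>. In the hypothesis on \<open>V\<close> and
  \<open>l\<close> the profile appears as \<open>|f(y/2)|\<close>, because the waves live at
  \<open>\<xi> = x / 2t\<close> and the rescaling is \<open>y = x / t\<close>.\<close>

lemma main_estimate:
  fixes f :: "'a::euclidean_space \<Rightarrow> complex" and u V l r :: "real \<Rightarrow> 'a \<Rightarrow> complex" and v :: "'a \<Rightarrow> complex"
  assumes ev: "gauss_evolution f F" and sol: "forward_global_solution \<mu> V u" and d: "DIM('a) \<in> {1, 2}"
    and V: "AE t in lborel. t > 0 \<longrightarrow> V t \<in> Lp 2 \<and> enn2real (N2 (V t)) \<le> MV"
    and l: "AE t in lborel. t > 0 \<longrightarrow> l t \<in> Lp 2 \<and> enn2real (N2 (l t)) \<le> Ml"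
    and v: "v \<in> Lp 2"
    and e: "(e \<longlongrightarrow> (0::ennreal)) at_top"
      "AE t in lborel. t > 0 \<longrightarrow> N2 (\<lambda>x. u t x - l t x - dollard t (fourier_L2 v) x) \<le> e t"
    and lim: "Limsup at_top (\<lambda>t. enn2ereal (\<integral>\<^sup>+x. ennreal (t ^ DIM('a) *
               ((norm (l t (t *\<^sub>R x)))\<^sup>2 + (norm (V t (t *\<^sub>R x)))\<^sup>2) * norm (f ((1 / 2) *\<^sub>R x))) \<partial>lborel)) \<le> ereal R"
    and B: "\<And>x. norm (f x) \<le> B" and \<delta>: "\<delta> > 0"
  shows "norm (of_real ((1 / sqrt 2) ^ DIM('a)) * \<mu> * L2_pairing (\<lambda>x. of_real (norm (fourier_L2 v x)) * fourier_L2 v x) f)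
    \<le> (1 + 2 * norm \<mu>) * \<delta> * ((2 + 4 * Ml + 5 * enn2real (N2 (fourier_L2 v))) * B) + (1 + norm \<mu>) / (2 * \<delta>) * R"
proof (rule field_le_epsilon)
  fix \<eta> :: real assume \<eta>: "\<eta> > 0"
  define h where "h = fourier_L2 v"
  define nh where "nh = enn2real (N2 h)"
  define MU where "MU = 2 + 4 * Ml + 4 * nh"
  define K where "K = (1 + norm \<mu>) / (2 * \<delta>)"
  define c where "c = of_real ((1 / sqrt 2) ^ DIM('a)) * \<mu> * L2_pairing (\<lambda>x. of_real (norm (h x)) * h x) f"
  have K: "K > 0" using \<delta> by (auto simp: K_def intro!: divide_pos_pos add_pos_nonneg)
  \<comment> \<open>Half of the tolerance \<open>\<eta>\<close> absorbs the excess over the limit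
    superior of the mass, the other half the vanishing terms.\<close>
  define \<eta>1 where "\<eta>1 = \<eta> / (2 * K)"
  have \<eta>1: "\<eta>1 > 0" using \<eta> K by (simp add: \<eta>1_def)
  have hL: "h \<in> Lp 2" using fourier_L2_props(1)[OF v] by (simp add: h_def)
  note R' = gauss_evolution_regular[OF ev]
  note [measurable] = gauss_evolution_measurable[OF ev] Lp_2_measurable[OF hL]
  have uL: "u t \<in> Lp 2" if "t \<ge> 0" for t using sol that unfolding forward_global_solution_def continuous_in_L2_def by auto
  have B0: "B \<ge> 0" using norm_ge_zero B by (rule order_trans)
  obtain \<omega> where \<omega>: "(\<omega> \<longlongrightarrow> 0) at_top" "\<And>t. \<omega> t \<ge> 0"
    "\<forall>\<^sub>F t in at_top. \<forall>x. norm (F t x - dollard t f x) \<le> (1 / sqrt t) ^ DIM('a) * \<omega> t"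
    using gauss_evolution_profile_sup[OF ev] by blast
  have e': "((\<lambda>t. enn2real (e t)) \<longlongrightarrow> 0) at_top" by (rule enn2real_tendsto_0[OF e(1)])
  have e1: "\<forall>\<^sub>F t in at_top. e t < 1" by (rule order_tendstoD(2)[OF e(1)]) simp
  define err where "err t = (1 + 2 * norm \<mu>) * \<delta> * ((MU + nh) * (B + \<omega> t)) + K * ((R + \<eta>1) + (MV + Ml) * \<omega> t)
      + norm \<mu> / (2 * \<delta>) * (enn2real (e t) * (B + \<omega> t)) + norm \<mu> * \<omega> t * nh" for t
  define L where "L = (1 + 2 * norm \<mu>) * \<delta> * ((MU + nh) * B) + K * R"
  have "(err \<longlongrightarrow> (1 + 2 * norm \<mu>) * \<delta> * ((MU + nh) * (B + 0)) + K * ((R + \<eta>1) + (MV + Ml) * 0)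
      + norm \<mu> / (2 * \<delta>) * (0 * (B + 0)) + norm \<mu> * 0 * nh) at_top"
    unfolding err_def by (intro tendsto_intros \<omega>(1) e')
  moreover have "K * \<eta>1 = \<eta> / 2" using K by (simp add: \<eta>1_def)
  ultimately have "(err \<longlongrightarrow> L + \<eta> / 2) at_top" by (simp add: L_def distrib_left add.assoc)
  then have err: "\<forall>\<^sub>F t in at_top. err t < L + \<eta>" by (rule order_tendstoD) (use \<eta> in simp)
  have mass: "\<forall>\<^sub>F t in at_top. l t \<in> Lp 2 \<longrightarrow> V t \<in> Lp 2 \<longrightarrow>
    (LINT x|lborel. ((norm (l t x))\<^sup>2 + (norm (V t x))\<^sup>2) * norm (f ((1 / 2) *\<^sub>R ((1 / t) *\<^sub>R x)))) \<le> R + \<eta>1"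
    by (rule rescaled_mass_bound[OF lim _ _ B \<eta>1]) measurable
  have "\<forall>\<^sub>F t in at_top. t \<ge> 1 \<and> err t < L + \<eta> \<and> e t < 1
      \<and> (\<forall>x. norm (F t x - dollard t f x) \<le> (1 / sqrt t) ^ DIM('a) * \<omega> t)
      \<and> (l t \<in> Lp 2 \<longrightarrow> V t \<in> Lp 2 \<longrightarrow> (LINT x|lborel. ((norm (l t x))\<^sup>2 + (norm (V t x))\<^sup>2) * norm (f ((1 / 2) *\<^sub>R ((1 / t) *\<^sub>R x)))) \<le> R + \<eta>1)"
    using err e1 \<omega>(3) mass eventually_ge_at_top[of 1] by eventually_elim blast
  then obtain T0 where T0: "\<And>t. t \<ge> T0 \<Longrightarrow> t \<ge> 1 \<and> err t < L + \<eta> \<and> e t < 1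
      \<and> (\<forall>x. norm (F t x - dollard t f x) \<le> (1 / sqrt t) ^ DIM('a) * \<omega> t)
      \<and> (l t \<in> Lp 2 \<longrightarrow> V t \<in> Lp 2 \<longrightarrow> (LINT x|lborel. ((norm (l t x))\<^sup>2 + (norm (V t x))\<^sup>2) * norm (f ((1 / 2) *\<^sub>R ((1 / t) *\<^sub>R x)))) \<le> R + \<eta>1)"
    unfolding eventually_at_top_linorder by blast
  define T where "T = max 1 T0"
  have both: "AE t in lborel. t \<ge> T \<longrightarrow> enn2real (N2 (u t)) \<le> MU \<and>
      norm (of_real (sqrt t ^ DIM('a)) * forcing_pairing \<mu> V u (F t) t - c) \<le> L + \<eta>"
    using V l e(2)
  proof eventually_elim
    case (elim t)
    show ?case
    proof
      assume "t \<ge> T"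
      then have t: "t \<ge> 1" "t > 0" and tT: "t \<ge> T0" by (auto simp: T_def)
      note t0 = T0[OF tT]
      have VL: "V t \<in> Lp 2" "enn2real (N2 (V t)) \<le> MV" and lL: "l t \<in> Lp 2" "enn2real (N2 (l t)) \<le> Ml"
        and eb: "N2 (\<lambda>x. u t x - l t x - dollard t h x) \<le> e t" using elim t by (auto simp: h_def)
      have ut: "u t \<in> Lp 2" using uL t by simp
      have PN: "N2 (dollard t h) = N2 h" by (rule N2_dollard[OF t(2)]) measurable
      have PL: "dollard t h \<in> Lp 2" using hL PN by (auto simp: Lp_2_iff)
      have e_fin: "e t < top" using t0 by (auto intro: less_trans[of _ 1])
      have eb': "enn2real (N2 (\<lambda>x. u t x - l t x - dollard t h x)) \<le> enn2real (e t)" by (rule enn2real_mono[OF eb e_fin])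
      have "enn2real (e t) \<le> 1" using t0 by (intro enn2real_leI) (auto intro: less_imp_le)
      then have bU: "enn2real (N2 (u t)) \<le> MU"
        using N2_triangle3[OF ut lL(1) PL] eb' lL(2) unfolding PN nh_def[symmetric] MU_def by simp
      let ?s = "sqrt t ^ DIM('a)" and ?\<psi> = "\<lambda>x. norm (f ((1 / (2 * t)) *\<^sub>R x))"
      have s0: "?s \<ge> 0" using t by simp
      have sD: "?s * norm (dollard t f x) \<le> ?\<psi> x" for x
      proof -
        have "?s * (1 / sqrt (2 * t)) ^ DIM('a) = (1 / sqrt 2) ^ DIM('a)"
          using t by (simp add: real_sqrt_mult power_divide power_mult_distrib)
        also have "\<dots> \<le> 1" by (intro power_le_one) (auto simp: real_le_rsqrt)
        finally have "?s * (1 / sqrt (2 * t)) ^ DIM('a) * ?\<psi> x \<le> 1 * ?\<psi> x" by (intro mult_right_mono) auto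
        then show ?thesis by (simp add: norm_dollard[OF t(2)] mult.assoc)
      qed
      have sFD: "?s * norm (F t x - dollard t f x) \<le> \<omega> t" for x
      proof -
        have "?s * norm (F t x - dollard t f x) \<le> ?s * ((1 / sqrt t) ^ DIM('a) * \<omega> t)" using t0 s0 by (intro mult_left_mono) auto
        also have "\<dots> = \<omega> t" using t by (simp add: power_divide)
        finally show ?thesis .
      qed
      have sF: "?s * norm (F t x) \<le> ?\<psi> x + \<omega> t" for x
      proof -
        have "norm (F t x) \<le> norm (dollard t f x) + norm (F t x - dollard t f x)" by (metis add.commute diff_add_cancel norm_triangle_ineq)
        then have "?s * norm (F t x) \<le> ?s * (norm (dollard t f x) + norm (F t x - dollard t f x))" using s0 by (rule mult_left_mono)
        then show ?thesis using sD[of x] sFD[of x] by (simp only: distrib_left)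
      qed
      have Db: "bounded (range (dollard t f))"
      proof -
        have "norm (dollard t f x) \<le> (1 / sqrt (2 * t)) ^ DIM('a) * B" for x
          unfolding norm_dollard[OF t(2)] using t by (intro mult_left_mono B) auto
        then show ?thesis by (auto simp: bounded_iff)
      qed
      have \<psi>m: "?\<psi> \<in> borel_measurable borel" by (intro borel_measurable_norm borel_measurable_scaled) measurable
      have mb: "(LINT x|lborel. ((norm (V t x))\<^sup>2 + (norm (l t x))\<^sup>2) * ?\<psi> x) \<le> R + \<eta>1"
        using t0 lL(1) VL(1) by (simp add: add.commute[of "(norm (V t _))\<^sup>2"])
      have "of_real ?s * forcing_pairing \<mu> V u (F t) t - c
        = of_real ?s * (L2_pairing (\<lambda>x. V t x * u t x) (F t) + L2_pairing (\<lambda>x. \<mu> * of_real (norm (u t x)) * u t x) (F t)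
            - L2_pairing (\<lambda>x. \<mu> * of_real (norm (dollard t h x)) * dollard t h x) (dollard t f))"
        unfolding forcing_pairing_def right_diff_distrib[of "of_real ?s"] dollard_pairing[OF t(2) Lp_2_measurable[OF hL] gauss_evolution_measurable(1)[OF ev]] c_def ..
      then have "norm (of_real ?s * forcing_pairing \<mu> V u (F t) t - c)
        \<le> (1 + 2 * norm \<mu>) * \<delta> * ((enn2real (N2 (u t)) + enn2real (N2 (dollard t h))) * (B + \<omega> t))
      + (1 + norm \<mu>) / (2 * \<delta>) * ((LINT x|lborel. ((norm (V t x))\<^sup>2 + (norm (l t x))\<^sup>2) * ?\<psi> x) + (enn2real (N2 (V t)) + enn2real (N2 (l t))) * \<omega> t)
      + norm \<mu> / (2 * \<delta>) * (enn2real (N2 (\<lambda>x. u t x - l t x - dollard t h x)) * (B + \<omega> t))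
      + norm \<mu> * \<omega> t * enn2real (N2 (dollard t h))"
        using forcing_error_bound[OF VL(1) ut lL(1) PL gauss_evolution_measurable(2)[OF ev] R'(6) _ Db \<delta> s0 \<omega>(2) \<psi>m norm_ge_zero B sF sFD]
        by simp
      also have "\<dots> \<le> err t"
        unfolding err_def PN nh_def[symmetric] K_def[symmetric]
        using bU VL(2) lL(2) mb eb' \<omega>(2)[of t] B0 K \<delta> by (intro add_mono mult_left_mono mult_right_mono order_refl) (auto simp: nh_def)
      also have "\<dots> \<le> L + \<eta>" using t0 by simp
      finally show "enn2real (N2 (u t)) \<le> MU \<and> norm (of_real ?s * forcing_pairing \<mu> V u (F t) t - c) \<le> L + \<eta>" using bU by simp
    qed
  qed
  have "norm c \<le> L + \<eta>"
    by (rule forcing_limit_le[OF ev sol V d, of T MU]) (use both in \<open>auto simp: T_def elim!: eventually_mono\<close>)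
  moreover have "MU + nh = 2 + 4 * Ml + 5 * nh" by (simp add: MU_def)
  ultimately show "norm (of_real ((1 / sqrt 2) ^ DIM('a)) * \<mu> * L2_pairing (\<lambda>x. of_real (norm (fourier_L2 v x)) * fourier_L2 v x) f)
    \<le> (1 + 2 * norm \<mu>) * \<delta> * ((2 + 4 * Ml + 5 * enn2real (N2 (fourier_L2 v))) * B) + (1 + norm \<mu>) / (2 * \<delta>) * R + \<eta>"
    unfolding L_def c_def K_def h_def nh_def by simp
qed

section \<open>Localization to the null set\<close>

text \<open>Both sides are continuous in the uniform norm, so the estimate passes from Gaussians to
  \<open>C\<^sub>0\<close>.\<close>

lemma pairing_bound_extend:
  fixes k :: "'a::euclidean_space \<Rightarrow> complex" and \<phi> :: "'a \<Rightarrow> real"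
  assumes k: "integrable lborel k" and m: "finite_measure m" "sets m = sets borel"
    and A: "A \<ge> 0" and K: "K \<ge> 0"
    and bound: "\<And>g B. gauss_span g \<Longrightarrow> (\<And>x. \<bar>g x\<bar> \<le> B) \<Longrightarrow>
      norm (LINT x|lborel. k x * of_real (g x)) \<le> A * B + K * (LINT y|m. \<bar>g ((1 / 2) *\<^sub>R y)\<bar>)"
    and \<phi>: "continuous_on UNIV \<phi>" "(\<phi> \<longlongrightarrow> 0) at_infinity" "\<And>x. 0 \<le> \<phi> x" "\<And>x. \<phi> x \<le> 1"
  shows "norm (LINT x|lborel. k x * of_real (\<phi> x)) \<le> A + K * (LINT y|m. \<phi> ((1 / 2) *\<^sub>R y))"
proof (rule field_le_epsilon)
  fix e :: real assume e: "e > 0"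
  interpret finite_measure m by (rule m)
  have spm: "space m = UNIV" using m(2) by (metis sets_eq_imp_space_eq space_borel)
  define Z where "Z = (LINT x|lborel. norm (k x)) + A + K * measure m UNIV"
  have Z: "Z \<ge> 0" using A K by (auto simp: Z_def intro!: add_nonneg_nonneg Bochner_Integration.integral_nonneg)
  define \<epsilon> where "\<epsilon> = e / (Z + 1)"
  have \<epsilon>: "\<epsilon> > 0" using e Z by (simp add: \<epsilon>_def)
  have \<epsilon>Z: "\<epsilon> * Z \<le> e" using e Z by (simp add: \<epsilon>_def field_simps)
  obtain g where g: "gauss_span g" "\<And>x. \<bar>\<phi> x - g x\<bar> < \<epsilon>" by (rule gauss_span_dense_C0[OF \<phi>(1,2) \<epsilon>]) blast
  have km: "k \<in> borel_measurable borel" using k by auto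
  have \<phi>m: "\<phi> \<in> borel_measurable borel" by (rule borel_measurable_continuous_onI[OF \<phi>(1)])
  have gm: "g \<in> borel_measurable borel" by (rule borel_measurable_continuous_onI[OF gauss_span_continuous[OF g(1)]])
  have gB: "\<bar>g x\<bar> \<le> 1 + \<epsilon>" for x using g(2)[of x] \<phi>(3)[of x] \<phi>(4)[of x] by linarith
  have ib: "integrable lborel (\<lambda>x. k x * of_real (q x))" if "q \<in> borel_measurable borel" "\<And>x. \<bar>q x\<bar> \<le> C" for q :: "'a \<Rightarrow> real" and C
    using integrable_mult_bounded[OF k, of "\<lambda>x. of_real (q x)"] that by (simp add: bounded_iff) blast
  have mb: "integrable m (\<lambda>y. q ((1 / 2) *\<^sub>R y))" if "q \<in> borel_measurable borel" "\<And>x. \<bar>q x\<bar> \<le> C" for q :: "'a \<Rightarrow> real" and C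
  proof (rule integrable_const_bound[of _ C])
    have "(\<lambda>y. q ((1 / 2) *\<^sub>R y)) \<in> borel_measurable borel" by (rule borel_measurable_scaled[OF that(1)])
    then show "(\<lambda>y. q ((1 / 2) *\<^sub>R y)) \<in> borel_measurable m" by (simp add: measurable_cong_sets[OF m(2) refl])
  qed (use that(2) in simp)
  have i\<phi>: "integrable lborel (\<lambda>x. k x * of_real (\<phi> x))" using \<phi> by (intro ib[of _ 1] \<phi>m) simp
  have ig: "integrable lborel (\<lambda>x. k x * of_real (g x))" by (rule ib[OF gm gB])
  have "norm ((LINT x|lborel. k x * of_real (\<phi> x)) - (LINT x|lborel. k x * of_real (g x))) = norm (LINT x|lborel. k x * of_real (\<phi> x) - k x * of_real (g x))"
    by (simp only: Bochner_Integration.integral_diff[OF i\<phi> ig])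
  also have "\<dots> \<le> (LINT x|lborel. \<epsilon> * norm (k x))"
  proof (rule order_trans[OF integral_norm_bound integral_mono])
    show "integrable lborel (\<lambda>x. norm (k x * of_real (\<phi> x) - k x * of_real (g x)))" by (intro integrable_norm Bochner_Integration.integrable_diff i\<phi> ig)
    show "integrable lborel (\<lambda>x. \<epsilon> * norm (k x))" by (intro integrable_mult_right integrable_norm k)
    fix x
    have "k x * of_real (\<phi> x) - k x * of_real (g x) = of_real (\<phi> x - g x) * k x" by (simp add: algebra_simps)
    then have "norm (k x * of_real (\<phi> x) - k x * of_real (g x)) = \<bar>\<phi> x - g x\<bar> * norm (k x)" by (simp only: norm_mult norm_of_real)
    also have "\<dots> \<le> \<epsilon> * norm (k x)" using g(2)[of x] by (intro mult_right_mono) auto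
    finally show "norm (k x * of_real (\<phi> x) - k x * of_real (g x)) \<le> \<epsilon> * norm (k x)" .
  qed
  finally have 1: "norm ((LINT x|lborel. k x * of_real (\<phi> x)) - (LINT x|lborel. k x * of_real (g x))) \<le> \<epsilon> * (LINT x|lborel. norm (k x))" by simp
  have "(LINT y|m. \<bar>g ((1 / 2) *\<^sub>R y)\<bar>) \<le> (LINT y|m. \<phi> ((1 / 2) *\<^sub>R y) + \<epsilon>)"
  proof (rule integral_mono)
    show "integrable m (\<lambda>y. \<bar>g ((1 / 2) *\<^sub>R y)\<bar>)" by (intro integrable_abs mb[OF gm gB])
    have "integrable m (\<lambda>y. \<phi> ((1 / 2) *\<^sub>R y))" using \<phi> by (intro mb[of _ 1] \<phi>m) simp
    then show "integrable m (\<lambda>y. \<phi> ((1 / 2) *\<^sub>R y) + \<epsilon>)" by (intro Bochner_Integration.integrable_add integrable_const)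
    show "\<bar>g ((1 / 2) *\<^sub>R y)\<bar> \<le> \<phi> ((1 / 2) *\<^sub>R y) + \<epsilon>" for y using g(2)[of "(1 / 2) *\<^sub>R y"] \<phi>(3)[of "(1 / 2) *\<^sub>R y"] by linarith
  qed
  also have "\<dots> = (LINT y|m. \<phi> ((1 / 2) *\<^sub>R y)) + \<epsilon> * measure m UNIV"
  proof -
    have "integrable m (\<lambda>y. \<phi> ((1 / 2) *\<^sub>R y))" using \<phi> by (intro mb[of _ 1] \<phi>m) simp
    then show ?thesis by (subst Bochner_Integration.integral_add) (auto simp: spm)
  qed
  finally have 2: "(LINT y|m. \<bar>g ((1 / 2) *\<^sub>R y)\<bar>) \<le> (LINT y|m. \<phi> ((1 / 2) *\<^sub>R y)) + \<epsilon> * measure m UNIV" .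
  have "norm (LINT x|lborel. k x * of_real (\<phi> x)) \<le> norm (LINT x|lborel. k x * of_real (g x)) + norm ((LINT x|lborel. k x * of_real (\<phi> x)) - (LINT x|lborel. k x * of_real (g x)))"
    by (rule norm_triangle_sub)
  also have "\<dots> \<le> (A * (1 + \<epsilon>) + K * ((LINT y|m. \<phi> ((1 / 2) *\<^sub>R y)) + \<epsilon> * measure m UNIV)) + \<epsilon> * (LINT x|lborel. norm (k x))"
    using bound[OF g(1) gB] mult_left_mono[OF 2 K] 1 by linarith
  also have "\<dots> = A + K * (LINT y|m. \<phi> ((1 / 2) *\<^sub>R y)) + \<epsilon> * Z" by (simp add: Z_def algebra_simps)
  finally show "norm (LINT x|lborel. k x * of_real (\<phi> x)) \<le> A + K * (LINT y|m. \<phi> ((1 / 2) *\<^sub>R y)) + e" using \<epsilon>Z by linarith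
qed

text \<open>Apply the estimate to cut-offs of \<open>K\<close>, let them decrease to the indicator,
  and only then let \<open>\<delta> \<rightarrow> 0\<close>: the term with \<open>1/\<delta>\<close>
  has disappeared in the first limit.\<close>

lemma integral_zero_on_null_compact:
  fixes k :: "'a::euclidean_space \<Rightarrow> complex"
  assumes k: "integrable lborel k" and m: "finite_measure m" "sets m = sets borel"
    and A: "A \<ge> 0" and C: "C \<ge> 0"
    and bound: "\<And>\<delta> g B. \<delta> > 0 \<Longrightarrow> gauss_span g \<Longrightarrow> (\<And>x. \<bar>g x\<bar> \<le> B) \<Longrightarrow>
      norm (LINT x|lborel. k x * of_real (g x)) \<le> A * \<delta> * B + C / \<delta> * (LINT y|m. \<bar>g ((1 / 2) *\<^sub>R y)\<bar>)"
    and K: "compact K" "emeasure m K = 0"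
  shows "(LINT x|lborel. k x * of_real (indicator K (2 *\<^sub>R x))) = 0"
proof (cases "K = {}")
  case False
  interpret finite_measure m by (rule m)
  have km: "k \<in> borel_measurable borel" using k by auto
  define \<phi> where "\<phi> n x = max 0 (1 - real n * infdist x K)" for n x
  obtain R where \<phi>: "\<And>n. continuous_on UNIV (\<phi> n)" "\<And>n x. norm x > R \<Longrightarrow> n > 0 \<Longrightarrow> \<phi> n x = 0"
    "\<And>n x. 0 \<le> \<phi> n x" "\<And>n x. \<phi> n x \<le> 1" "\<And>x. (\<lambda>n. \<phi> n x) \<longlonglongrightarrow> indicator K x"
    using tent_indicator[OF K(1) False] unfolding \<phi>_def by metis
  have \<phi>m: "\<phi> n \<in> borel_measurable borel" for n by (rule borel_measurable_continuous_onI[OF \<phi>(1)])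
  have Kb: "K \<in> sets borel" using K(1) by (simp add: compact_imp_closed borel_closed)
  let ?I = "LINT x|lborel. k x * of_real (indicator K (2 *\<^sub>R x))"
  have *: "norm ?I \<le> A * \<delta>" if \<delta>: "\<delta> > 0" for \<delta>
  proof -
    \<comment> \<open>The factor 2 in the argument compensates the \<open>1/2\<close> in the bound,
      so that the cut-offs of \<open>K\<close> itself are integrated against
      \<open>m\<close>.\<close>
    have le: "norm (LINT x|lborel. k x * of_real (\<phi> (Suc n) (2 *\<^sub>R x))) \<le> A * \<delta> + C / \<delta> * (LINT y|m. \<phi> (Suc n) y)" for n
    proof -
      have "norm (LINT x|lborel. k x * of_real (\<phi> (Suc n) (2 *\<^sub>R x))) \<le> A * \<delta> + C / \<delta> * (LINT y|m. \<phi> (Suc n) (2 *\<^sub>R ((1 / 2) *\<^sub>R y)))"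
      proof (rule pairing_bound_extend[OF k m])
        show "continuous_on UNIV (\<lambda>x. \<phi> (Suc n) (2 *\<^sub>R x))" by (rule continuous_on_compose2[OF \<phi>(1)]) (auto intro: continuous_intros)
        show "((\<lambda>x. \<phi> (Suc n) (2 *\<^sub>R x)) \<longlongrightarrow> 0) at_infinity"
        proof (rule tendsto_eventually)
          show "\<forall>\<^sub>F x in at_infinity. \<phi> (Suc n) (2 *\<^sub>R x) = 0"
            unfolding eventually_at_infinity by (intro exI[of _ "\<bar>R\<bar> + 1"] allI impI \<phi>(2)) auto
        qed
        show "A * \<delta> \<ge> 0" "C / \<delta> \<ge> 0" using A C \<delta> by simp_all
        show "norm (LINT x|lborel. k x * of_real (g x)) \<le> A * \<delta> * B + C / \<delta> * (LINT y|m. \<bar>g ((1 / 2) *\<^sub>R y)\<bar>)"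
          if "gauss_span g" "\<And>x. \<bar>g x\<bar> \<le> B" for g B by (rule bound[OF \<delta> that])
      qed (rule \<phi>(3), rule \<phi>(4))
      then show ?thesis by simp
    qed
    have 1: "(\<lambda>n. LINT x|lborel. k x * of_real (\<phi> (Suc n) (2 *\<^sub>R x))) \<longlonglongrightarrow> ?I"
    proof (rule integral_dominated_convergence[where w="\<lambda>x. norm (k x)"])
      show "(\<lambda>x. k x * of_real (indicator K (2 *\<^sub>R x))) \<in> borel_measurable lborel"
        using km Kb borel_measurable_scaled[OF borel_measurable_indicator[OF Kb], of 2] by measurable
      show "(\<lambda>x. k x * of_real (\<phi> (Suc n) (2 *\<^sub>R x))) \<in> borel_measurable lborel" for n
      proof -
        have "(\<lambda>x. \<phi> (Suc n) (2 *\<^sub>R x)) \<in> borel_measurable borel" by (rule borel_measurable_scaled[OF \<phi>m])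
        then show ?thesis using km by measurable
      qed
      show "AE x in lborel. (\<lambda>n. k x * of_real (\<phi> (Suc n) (2 *\<^sub>R x))) \<longlonglongrightarrow> k x * of_real (indicator K (2 *\<^sub>R x))"
        by (intro AE_I2 tendsto_intros LIMSEQ_Suc \<phi>(5))
      show "AE x in lborel. norm (k x * of_real (\<phi> (Suc n) (2 *\<^sub>R x))) \<le> norm (k x)" for n
        using \<phi>(3,4) by (intro AE_I2) (simp add: norm_mult mult_left_le)
    qed (use k in auto)
    have 2: "(\<lambda>n. LINT y|m. \<phi> (Suc n) y) \<longlonglongrightarrow> (LINT y|m. indicator K y)"
    proof (rule integral_dominated_convergence[where w="\<lambda>_. 1"])
      show "indicator K \<in> borel_measurable m" using Kb m(2) by (intro borel_measurable_indicator) simp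
      show "\<phi> (Suc n) \<in> borel_measurable m" for n using \<phi>m by (simp add: measurable_cong_sets[OF m(2) refl])
      show "AE x in m. (\<lambda>n. \<phi> (Suc n) x) \<longlonglongrightarrow> indicator K x" by (intro AE_I2 LIMSEQ_Suc \<phi>(5))
      show "AE x in m. norm (\<phi> (Suc n) x) \<le> 1" for n using \<phi>(3,4) by (intro AE_I2) simp
    qed simp
    have "(LINT y|m. indicator K y :: real) = 0" using K(2) Kb m(2) by (simp add: measure_def)
    with 2 have "(\<lambda>n. A * \<delta> + C / \<delta> * (LINT y|m. \<phi> (Suc n) y)) \<longlonglongrightarrow> A * \<delta> + C / \<delta> * 0" by (intro tendsto_intros) simp
    then have "norm ?I \<le> A * \<delta> + C / \<delta> * 0"
      using le by (intro LIMSEQ_le[OF tendsto_norm[OF 1]]) auto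
    then show ?thesis by simp
  qed
  have "norm ?I \<le> 0"
  proof (rule field_le_epsilon)
    fix e :: real assume e: "e > 0"
    have "norm ?I \<le> A * (e / (A + 1))" using A e by (intro *) simp
    also have "\<dots> \<le> 0 + e" using A e by (simp add: field_simps)
    finally show "norm ?I \<le> 0 + e" .
  qed
  then show ?thesis by simp
qed simp

section \<open>Vanishing of the scattering state\<close>

theorem theorem1p2:
  fixes \<mu> :: complex
    and V u l r :: "real \<Rightarrow> 'a::euclidean_space \<Rightarrow> complex"
    and v :: "'a \<Rightarrow> complex"
    and \<nu> :: "'a set \<Rightarrow> complex"
    and \<epsilon>\<^sub>V \<epsilon>\<^sub>l :: real
  assumes "\<mu> \<noteq> 0"
    and "DIM('a) \<in> {1, 2}"
    and "0 < \<epsilon>\<^sub>V" and "\<epsilon>\<^sub>V \<le> 1"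
    and "V \<in> Linf_Lp UNIV 2 \<inter> Linf_Lp UNIV (2 - \<epsilon>\<^sub>V)"
    and "forward_global_solution \<mu> V u"
    and "v \<in> Lp 2"
    and "0 < \<epsilon>\<^sub>l" and "\<epsilon>\<^sub>l \<le> 1"
    and "l \<in> Linf_Lp {0<..} 2 \<inter> Linf_Lp {0<..} (2 - \<epsilon>\<^sub>l)"
    and "AE t in lborel. t > 0 \<longrightarrow>
           (AE x in lborel. u t x = l t x + free_schroedinger t v x + r t x)"
    and "\<forall>t>0. r t \<in> Lp 2"
    and "((\<lambda>t. Lp_norm 2 (r t)) \<longlongrightarrow> 0) at_top"
    and "complex_radon_measure \<nu>"
    and "lebesgue_singular \<nu>"
    and "\<forall>\<phi> :: 'a \<Rightarrow> real. \<phi> \<in> C0 \<and> (\<forall>x. 0 \<le> \<phi> x) \<longrightarrow>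
           measure_pairing \<nu> \<phi> \<in> \<real> \<and>
           Limsup at_top (\<lambda>t. enn2ereal (\<integral>\<^sup>+x. ennreal (t ^ DIM('a) *
               ((norm (l t (t *\<^sub>R x)))\<^sup>2 + (norm (V t (t *\<^sub>R x)))\<^sup>2) * \<phi> x) \<partial>lborel))
             \<le> ereal (Re (measure_pairing \<nu> \<phi>))"
  shows "AE x in lborel. v x = 0"
proof -
  note \<mu> = assms(1) and d = assms(2) and sol = assms(6) and v = assms(7) and lim = assms(16)
  define h where "h = fourier_L2 v"
  have hL: "h \<in> Lp 2" using fourier_L2_props(1)[OF v] by (simp add: h_def)
  have hm: "h \<in> borel_measurable borel" by (rule Lp_2_measurable[OF hL])
  have "V \<in> Linf_Lp UNIV 2" using assms(5) by blast
  then obtain MV where MV: "MV \<ge> 0" "AE t in lborel. t \<in> UNIV \<longrightarrow> V t \<in> Lp 2 \<and> enn2real (N2 (V t)) \<le> MV" by (rule Linf_Lp_2_D) auto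
  from MV(2) have V: "AE t in lborel. t > 0 \<longrightarrow> V t \<in> Lp 2 \<and> enn2real (N2 (V t)) \<le> MV" by (rule eventually_mono) simp
  have "l \<in> Linf_Lp {0<..} 2" using assms(10) by blast
  then obtain Ml where Ml: "Ml \<ge> 0" "AE t in lborel. t \<in> {0<..} \<longrightarrow> l t \<in> Lp 2 \<and> enn2real (N2 (l t)) \<le> Ml" by (rule Linf_Lp_2_D) auto
  from Ml(2) have l: "AE t in lborel. t > 0 \<longrightarrow> l t \<in> Lp 2 \<and> enn2real (N2 (l t)) \<le> Ml" by (rule eventually_mono) simp
  obtain e where e: "(e \<longlongrightarrow> 0) at_top" "AE t in lborel. t > 0 \<longrightarrow> N2 (\<lambda>x. u t x - l t x - dollard t (fourier_L2 v) x) \<le> e t"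
    using solution_minus_profile[OF v assms(11-13)] by blast
  obtain m N where m: "sets m = sets borel" "finite_measure m" and N: "N \<in> null_sets lborel" "emeasure m (- N) = 0"
    and major: "\<And>\<phi>. (\<And>x. 0 \<le> \<phi> x) \<Longrightarrow> Re (measure_pairing \<nu> \<phi>) \<le> (LINT x|m. \<phi> x)"
    using singular_measure_majorant[OF assms(14,15)] by metis
  \<comment> \<open>The resonant density; it vanishes exactly where \<open>h\<close> does.\<close>
  define k where "k x = of_real (norm (h x)) * h x" for x
  have ki: "integrable lborel k" using forcing_integrable(2)[OF hL hL, of 1] by (simp add: k_def[abs_def])
  define c where "c = complex_of_real ((1 / sqrt 2) ^ DIM('a)) * \<mu>"
  have c0: "norm c > 0" using \<mu> by (simp add: c_def)
  define A where "A = (1 + 2 * norm \<mu>) * (2 + 4 * Ml + 5 * enn2real (N2 h)) / norm c"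
  define C where "C = (1 + norm \<mu>) / 2 / norm c"
  have A: "A \<ge> 0" using Ml(1) by (simp add: A_def)
  have C: "C \<ge> 0" by (simp add: C_def)
  have bound: "norm (LINT x|lborel. k x * of_real (g x)) \<le> A * \<delta> * B + C / \<delta> * (LINT y|m. \<bar>g ((1 / 2) *\<^sub>R y)\<bar>)"
    if \<delta>: "\<delta> > 0" and g: "gauss_span g" and B: "\<And>x. \<bar>g x\<bar> \<le> B" for \<delta> B :: real and g
  proof -
    obtain G where ev: "gauss_evolution (\<lambda>x. of_real (g x)) G" using gauss_evolution_of_span[OF g] by blast
    let ?\<phi> = "\<lambda>y. \<bar>g ((1 / 2) *\<^sub>R y)\<bar>"
    have "filterlim (\<lambda>y::'a. (1 / 2) *\<^sub>R y) at_infinity at_infinity"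
      unfolding filterlim_at_infinity_conv_norm_at_top norm_scaleR
      by (intro filterlim_tendsto_pos_mult_at_top[OF tendsto_const] filterlim_norm_at_top) simp
    then have "((\<lambda>y. g ((1 / 2) *\<^sub>R y)) \<longlongrightarrow> 0) at_infinity" by (rule filterlim_compose[OF gauss_span_vanishes[OF g]])
    then have "(?\<phi> \<longlongrightarrow> 0) at_infinity" by (rule tendsto_rabs_zero)
    moreover have "continuous_on UNIV ?\<phi>"
      by (intro continuous_on_rabs continuous_on_compose2[OF gauss_span_continuous[OF g]] continuous_intros) auto
    ultimately have "?\<phi> \<in> C0 \<and> (\<forall>x. 0 \<le> ?\<phi> x)" by (simp add: C0_def)
    with lim have "Limsup at_top (\<lambda>t. enn2ereal (\<integral>\<^sup>+x. ennreal (t ^ DIM('a) *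
               ((norm (l t (t *\<^sub>R x)))\<^sup>2 + (norm (V t (t *\<^sub>R x)))\<^sup>2) * ?\<phi> x) \<partial>lborel)) \<le> ereal (Re (measure_pairing \<nu> ?\<phi>))" by blast
    also have "\<dots> \<le> ereal (LINT y|m. ?\<phi> y)" using major[of ?\<phi>] by simp
    finally have lim': "Limsup at_top (\<lambda>t. enn2ereal (\<integral>\<^sup>+x. ennreal (t ^ DIM('a) *
               ((norm (l t (t *\<^sub>R x)))\<^sup>2 + (norm (V t (t *\<^sub>R x)))\<^sup>2) * norm (complex_of_real (g ((1 / 2) *\<^sub>R x)))) \<partial>lborel)) \<le> ereal (LINT y|m. ?\<phi> y)" by simp
    have "norm (c * L2_pairing k (\<lambda>x. of_real (g x))) \<le> (1 + 2 * norm \<mu>) * \<delta> * ((2 + 4 * Ml + 5 * enn2real (N2 h)) * B) + (1 + norm \<mu>) / (2 * \<delta>) * (LINT y|m. ?\<phi> y)"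
      unfolding c_def k_def[abs_def] h_def by (rule main_estimate[OF ev sol d V l v e lim' _ \<delta>]) (use B in simp)
    also have "\<dots> = norm c * (A * \<delta> * B + C / \<delta> * (LINT y|m. ?\<phi> y))"
      using c0 \<delta> by (simp add: A_def C_def field_simps)
    finally have "norm (L2_pairing k (\<lambda>x. of_real (g x))) \<le> A * \<delta> * B + C / \<delta> * (LINT y|m. ?\<phi> y)"
      unfolding norm_mult using c0 by (simp only: mult_le_cancel_left_pos)
    then show ?thesis by (simp add: L2_pairing_def)
  qed
  \<comment> \<open>Rescaling by two moves \<open>h\<close> to the variable of the measure, where
    the null set \<open>N\<close> lives.\<close>
  define h2 where "h2 y = h ((1 / 2) *\<^sub>R y)" for y
  have h2m: "h2 \<in> borel_measurable borel" unfolding h2_def[abs_def] by (rule borel_measurable_scaled[OF hm])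
  have N2h2: "N2 h2 = ennreal (2 ^ DIM('a)) * N2 h"
    unfolding N2_def h2_def by (rule nn_integral_lborel_scale) (use hm in measurable)
  have h2L: "h2 \<in> Lp 2" using hL h2m by (auto simp: Lp_2_iff N2h2 ennreal_mult_less_top)
  define k2 where "k2 y = k ((1 / 2) *\<^sub>R y)" for y
  have k2: "k2 y = of_real (norm (h2 y)) * h2 y" for y by (simp add: k2_def k_def h2_def)
  have k2i: "integrable lborel k2" using forcing_integrable(2)[OF h2L h2L, of 1] by (simp add: k2[abs_def])
  have "AE y in lborel. k2 y = 0"
  proof (rule AE_zero_if_compact_integrals_zero[OF k2i N(1)])
    fix K assume K: "compact K" "K \<inter> N = {}"
    have Kb: "K \<in> sets borel" using K(1) by (simp add: compact_imp_closed borel_closed)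
    have "emeasure m K \<le> emeasure m (- N)" using K(2) N(1) m(1) by (intro emeasure_mono) (auto simp: null_sets_def)
    then have mK: "emeasure m K = 0" using N(2) by simp
    define q where "q x = k x * of_real (indicator K (2 *\<^sub>R x))" for x
    have qm: "q \<in> borel_measurable borel"
    proof -
      have "k \<in> borel_measurable borel" using ki by auto
      then show ?thesis using borel_measurable_scaled[OF borel_measurable_indicator[OF Kb], of 2] unfolding q_def[abs_def] by measurable
    qed
    have "(LINT y|lborel. indicator K y *\<^sub>R k2 y) = (LINT y|lborel. q ((1 / 2) *\<^sub>R y))"
      by (simp add: q_def k2_def scaleR_conv_of_real mult.commute)
    also have "\<dots> = of_real (2 ^ DIM('a)) * (LINT x|lborel. q x)" by (rule integral_lborel_scale[OF _ qm]) simp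
    also have "(LINT x|lborel. q x) = 0"
      unfolding q_def by (rule integral_zero_on_null_compact[OF ki m(2,1) A C bound K(1) mK])
    finally show "(LINT y|lborel. indicator K y *\<^sub>R k2 y) = 0" by simp
  qed
  then have "AE y in lborel. h2 y = 0" by eventually_elim (simp add: k2)
  then have "N2 h2 = 0" using N2_0_iff[OF h2m] by simp
  then have "N2 h = 0" by (simp add: N2h2)
  then have "AE \<xi> in lborel. h \<xi> = 0" using N2_0_iff[OF hm] by simp
  then show ?thesis unfolding h_def by (rule fourier_L2_eq_0_imp[OF v])
qed

end
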